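(* Let $(\Delta_n)$ be a sequence of positive numbers. (i) Assume that $n^{2s/(d+4s)}\Delta_n\to\infty$. Then for any $\alpha\in(0,1)$, $$\lim_{n\to\infty}{\rm power}\{\Phi^{\rm IND}_{n,\nu_n,\alpha};H_1^{\rm IND}(\Delta_n;s)\}=1,$$ provided that $\nu_n\asymp n^{4/(d+4s)}$. (ii) Conversely, if $\liminf_{n\to\infty}n^{2s/(d+4s)}\Delta_n<\infty$, then there exists some $\alpha\in(0,1)$ such that for any test $\Phi_n$ of level $\alpha$ (asymptotically) based on $X_1,\ldots,X_n\sim p$, $$\liminf_{n\to\infty}{\rm power}\{\Phi_n;H_1^{\rm IND}(\Delta_n;s)\}<1.$$
   Context: For a dimension $d\ge1$ and $f:\mathbb{R}^d\to\mathbb{R}$ let $\mathcal{F}(f)(\omega)=(2\pi)^{-d/2}\int f(x)e^{-ix^\top\omega}dx$ be its Fourier transform, $\|f\|_{L_2}^2=\int f^2$ and, for $s>0$, $\|f\|_{\mathcal{W}^{s,2}}^2=\int(1+\|\omega\|^2)^s|\mathcal{F}(f)(\omega)|^2d\omega$. $\mathcal{W}^{s,2}$ is the set of $f:\mathbb{R}^d\to\mathbb{R}$ that are almost everywhere continuous with $\|f\|_{\mathcal{W}^{s,2}}<\infty$, and $\mathcal{W}^{s,2}(M)=\{f\in\mathcal{W}^{s,2}:\|f\|_{\mathcal{W}^{s,2}}\le M\}$ (the dimension is that of the domain of $f$). The notation $a_n\asymp b_n$ means that $a_n/b_n$ is bounded above and below by positive constants. Fix $k\ge2$, $d=d_1+\cdots+d_k$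 with $d_j\ge1$, $s>0$, $M_1,\dots,M_k>0$, and $M=\prod_{j=1}^kM_j$. Let $X=(X^1,\dots,X^k)\in\mathbb{R}^d$ be a random vector with subvectors $X^j\in\mathbb{R}^{d_j}$, distribution $\mathbb{P}$, joint density $p$, and marginal distributions $\mathbb{P}^{X^j}$ with densities $p_j$. The hypotheses are $$H_0^{\rm IND}:\ p=p_1\otimes\cdots\otimes p_k,\quad p_j\in\mathcal{W}^{s,2}(M_j),\ 1\le j\le k,$$ $$H_1^{\rm IND}(\Delta_n;s):\ p\in\mathcal{W}^{s,2}(M),\ p_j\in\mathcal{W}^{s,2}(M_j),\ 1\le j\le k,\ \text{ and }\|p-p_1\otimes\cdots\otimes p_k\|_{L_2}\ge\Delta_n .$$ $X_1,\dots,X_n$ are i.i.d. copies of $X$. The power ${\rm power}\{\Phi;H_1^{\rm IND}(\Delta_n;s)\}$ of a test $\Phi$ is the infimum of $\mathbb{P}\{\Phi\text{ rejects }H_0^{\rm IND}\}$ over all $p$ satisfying $H_1^{\rm IND}(\Delta_n;s)$ (infimum over an empty set being $1$). A sequence of tests $\Phi_n$ has (asymptotic) level $\alpha$ if, for each $p$ satisfying $H_0^{\rm IND}$, the limsup as $n\to\infty$ of its rejection probability is at most $\alpha$. For $\nu>0$, $G_\nu(x,y)=\exp(-\nu\|x-y\|^2)$ in any Euclidean space. Define $$\widehat{\gamma_\nu^2}=\frac1{n(n-1)}\sum_{i\ne j}G_\nu(X_i,X_j)+\frac{(n-2k)!}{n!}\sum_{|\{i_1,\dots,i_k,j_1,\dots,j_k\}|=2k}G_\nu\big((X^1_{i_1},\dots,X^k_{i_k}),(X^1_{j_1},\dots,X^k_{j_k})\big)-\frac{2(n-k-1)!}{n!}\sum_{|\{i,j_1,\dots,j_k\}|=k+1}G_\nu\big(X_i,(X^1_{j_1},\dots,X^k_{j_k})\big),$$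 with all indices in $\{1,\dots,n\}$ (this is the estimate $\widehat{\gamma_\nu^2}(\mathbb{P},\mathbb{P}^{X^1}\otimes\cdots\otimes\mathbb{P}^{X^k})$). For $1\le l\le k$ put $$A_l=\frac1{n(n-1)}\sum_{i\ne j}G_{2\nu}(X_i^l,X_j^l),\quad B_l=\frac{(n-3)!}{n!}\sum_{|\{i,j_1,j_2\}|=3}G_\nu(X_i^l,X_{j_1}^l)G_\nu(X_i^l,X_{j_2}^l),\quad C_l=\frac{(n-4)!}{n!}\sum_{|\{i_1,i_2,j_1,j_2\}|=4}G_\nu(X_{i_1}^l,X_{j_1}^l)G_\nu(X_{i_2}^l,X_{j_2}^l),$$ and $$\tilde s_{n,\nu}^2=\Big(\prod_lA_l-2\prod_lB_l+\prod_lC_l\Big)-2\sum_{j=1}^k\Big(A_j\prod_{l\ne j}B_l-\prod_lB_l-B_j\prod_{l\ne j}C_l+\prod_lC_l\Big)+\sum_{j=1}^k(A_j-2B_j+C_j)\prod_{l\ne j}C_l+\sum_{j_1\ne j_2}(B_{j_1}-C_{j_1})(B_{j_2}-C_{j_2})\prod_{l\ne j_1,j_2}C_l .$$ (For $k=2$ this equals $\prod_{l=1}^2(A_l-2B_l+C_l)$.) Let $\hat s_{n,\nu}^2=\max\{\tilde s_{n,\nu}^2,1/n^2\}$ and $T_{n,\nu}^{\rm IND}=\frac n{\sqrt2}\,\hat s_{n,\nu}^{-1}\,\widehat{\gamma_\nu^2}$. The test $\Phi^{\rm IND}_{n,\nu,\alpha}$ rejects $H_0^{\rm IND}$ if and only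 if $T_{n,\nu}^{\rm IND}>z_\alpha$, where $\Pr(Z>z_\alpha)=\alpha$ for $Z\sim N(0,1)$. *)

theory Defs
  imports "HOL-Probability.Probability" "HOL-Library.Landau_Symbols"
begin

text \<open>
  The dimensions of the subvectors differ from each other and are quantified inside the formulas,
  so for a finite index set \<open>I\<close> the Euclidean space of dimension \<open>card I\<close> is the space of the product
  measure \<open>leb I\<close>, that is the set of extensional functions \<open>I \<rightarrow> \<real>\<close>. Its Euclidean norm is
  \<open>\<lambda>x. L2_set x I\<close>.
\<close>

definition leb :: "'i set \<Rightarrow> ('i \<Rightarrow> real) measure" where
  "leb I = PiM I (\<lambda>_. lborel)"

definition fourier :: "'i set \<Rightarrow> (('i \<Rightarrow> real) \<Rightarrow> real) \<Rightarrow> ('i \<Rightarrow> real) \<Rightarrow> complex" where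
  "fourier I f \<omega> = complex_of_real ((2 * pi) powr (- real (card I) / 2)) *
     (\<integral>x. complex_of_real (f x) * exp (- \<i> * complex_of_real (\<Sum>i\<in>I. x i * \<omega> i)) \<partial>leb I)"

text \<open>Used only for square integrable functions, see the remark before \<open>H1_IND\<close>.\<close>

definition L2_norm :: "'i set \<Rightarrow> (('i \<Rightarrow> real) \<Rightarrow> real) \<Rightarrow> real" where
  "L2_norm I f = sqrt (\<integral>x. (f x)\<^sup>2 \<partial>leb I)"

definition sobolev_density ::
    "'i set \<Rightarrow> real \<Rightarrow> (('i \<Rightarrow> real) \<Rightarrow> real) \<Rightarrow> ('i \<Rightarrow> real) \<Rightarrow> real" where
  "sobolev_density I s f \<omega> = (1 + (L2_set \<omega> I)\<^sup>2) powr s * (cmod (fourier I f \<omega>))\<^sup>2"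

definition sobolev_norm :: "'i set \<Rightarrow> real \<Rightarrow> (('i \<Rightarrow> real) \<Rightarrow> real) \<Rightarrow> real" where
  "sobolev_norm I s f = sqrt (\<integral>\<omega>. sobolev_density I s f \<omega> \<partial>leb I)"

text \<open>
  Integrability of \<open>f\<close> says that the integral defining the Fourier transform exists (otherwise the
  library integral would be \<open>0\<close>); integrability of the weighted square says that the norm is finite.
  Continuity at \<open>x\<close> is with respect to the product topology on the extensional functions, which on
  this set is the Euclidean topology.
\<close>

definition sobolev :: "('i::countable) set \<Rightarrow> real \<Rightarrow> (('i \<Rightarrow> real) \<Rightarrow> real) set" where
  "sobolev I s = {f. integrable (leb I) f \<and>
     (AE x in leb I. continuous (at x within space (leb I)) f) \<and>
     integrable (leb I) (sobolev_density I s f)}"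

definition sobolev_ball :: "('i::countable) set \<Rightarrow> real \<Rightarrow> real \<Rightarrow> (('i \<Rightarrow> real) \<Rightarrow> real) set" where
  "sobolev_ball I s M = {f \<in> sobolev I s. sobolev_norm I s f \<le> M}"

text \<open>
  For subvectors numbered \<open>j < k\<close>, of dimensions \<open>d j\<close>, the coordinate \<open>c < d j\<close> of subvector \<open>j\<close> has
  index \<open>(j, c)\<close>.
\<close>

definition coords :: "nat \<Rightarrow> (nat \<Rightarrow> nat) \<Rightarrow> (nat \<times> nat) set" where
  "coords k d = Sigma {..<k} (\<lambda>j. {..<d j})"

definition block :: "(nat \<Rightarrow> nat) \<Rightarrow> nat \<Rightarrow> (nat \<times> nat) set" where
  "block d j = {j} \<times> {..<d j}"

definition total_dim :: "nat \<Rightarrow> (nat \<Rightarrow> nat) \<Rightarrow> nat" where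
  "total_dim k d = (\<Sum>j<k. d j)"

definition subvec ::
    "(nat \<Rightarrow> nat) \<Rightarrow> nat \<Rightarrow> (nat \<times> nat \<Rightarrow> real) \<Rightarrow> nat \<times> nat \<Rightarrow> real" where
  "subvec d j x = restrict x (block d j)"

definition law :: "'i set \<Rightarrow> (('i \<Rightarrow> real) \<Rightarrow> real) \<Rightarrow> ('i \<Rightarrow> real) measure" where
  "law I p = density (leb I) (\<lambda>x. ennreal (p x))"

definition prob_density :: "'i set \<Rightarrow> (('i \<Rightarrow> real) \<Rightarrow> real) \<Rightarrow> bool" where
  "prob_density I p \<longleftrightarrow>
     p \<in> borel_measurable (leb I) \<and> (\<forall>x\<in>space (leb I). 0 \<le> p x) \<and> prob_space (law I p)"

definition marginal_densities ::
    "nat \<Rightarrow> (nat \<Rightarrow> nat) \<Rightarrow> ((nat \<times> nat \<Rightarrow> real) \<Rightarrow> real) \<Rightarrow>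
     (nat \<Rightarrow> (nat \<times> nat \<Rightarrow> real) \<Rightarrow> real) \<Rightarrow> bool" where
  "marginal_densities k d p pm \<longleftrightarrow> (\<forall>j<k. prob_density (block d j) (pm j) \<and>
     distributed (law (coords k d) p) (leb (block d j)) (subvec d j) (\<lambda>y. ennreal (pm j y)))"

definition tensor ::
    "nat \<Rightarrow> (nat \<Rightarrow> nat) \<Rightarrow> (nat \<Rightarrow> (nat \<times> nat \<Rightarrow> real) \<Rightarrow> real) \<Rightarrow> (nat \<times> nat \<Rightarrow> real) \<Rightarrow> real" where
  "tensor k d pm x = (\<Prod>j<k. pm j (subvec d j x))"

text \<open>
  Densities are determined only up to null sets, and continuity almost everywhere depends on the
  version, so both hypotheses ask for suitable versions of the marginal densities. In \<open>H1_IND\<close> the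
  difference \<open>p - tensor k d pm\<close> is automatically square integrable, because the members of
  \<open>sobolev I s\<close> with \<open>s > 0\<close> are square integrable by Plancherel's theorem.
\<close>

definition H0_IND ::
    "nat \<Rightarrow> (nat \<Rightarrow> nat) \<Rightarrow> real \<Rightarrow> (nat \<Rightarrow> real) \<Rightarrow> ((nat \<times> nat \<Rightarrow> real) \<Rightarrow> real) set" where
  "H0_IND k d s M = {p. prob_density (coords k d) p \<and>
     (\<exists>pm. marginal_densities k d p pm \<and>
        (\<forall>x\<in>space (leb (coords k d)). p x = tensor k d pm x) \<and>
        (\<forall>j<k. pm j \<in> sobolev_ball (block d j) s (M j)))}"

definition H1_IND ::
    "nat \<Rightarrow> (nat \<Rightarrow> nat) \<Rightarrow> real \<Rightarrow> (nat \<Rightarrow> real) \<Rightarrow> real \<Rightarrow> ((nat \<times> nat \<Rightarrow> real) \<Rightarrow> real) set" where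
  "H1_IND k d s M \<delta> = {p. prob_density (coords k d) p \<and>
     p \<in> sobolev_ball (coords k d) s (\<Prod>j<k. M j) \<and>
     (\<exists>pm. marginal_densities k d p pm \<and>
        (\<forall>j<k. pm j \<in> sobolev_ball (block d j) s (M j)) \<and>
        \<delta> \<le> L2_norm (coords k d) (\<lambda>x. p x - tensor k d pm x))}"

text \<open>
  A sample of size \<open>n\<close> is \<open>X 0, \<dots>, X (n - 1)\<close>. A test is given by the predicate
  ``the hypothesis is rejected'' on samples.
\<close>

type_synonym sample = "nat \<Rightarrow> nat \<times> nat \<Rightarrow> real"

definition is_test :: "nat \<Rightarrow> (nat \<Rightarrow> nat) \<Rightarrow> nat \<Rightarrow> (sample \<Rightarrow> bool) \<Rightarrow> bool" where
  "is_test k d n \<phi> \<longleftrightarrow> Measurable.pred (PiM {..<n} (\<lambda>_. leb (coords k d))) \<phi>"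

definition rejection_prob ::
    "nat \<Rightarrow> (nat \<Rightarrow> nat) \<Rightarrow> nat \<Rightarrow> ((nat \<times> nat \<Rightarrow> real) \<Rightarrow> real) \<Rightarrow> (sample \<Rightarrow> bool) \<Rightarrow> real" where
  "rejection_prob k d n p \<phi> = \<P>(X in PiM {..<n} (\<lambda>_. law (coords k d) p). \<phi> X)"

definition test_power ::
    "nat \<Rightarrow> (nat \<Rightarrow> nat) \<Rightarrow> nat \<Rightarrow> (sample \<Rightarrow> bool) \<Rightarrow> ((nat \<times> nat \<Rightarrow> real) \<Rightarrow> real) set \<Rightarrow> real" where
  "test_power k d n \<phi> H = (if H = {} then 1 else (INF p\<in>H. rejection_prob k d n p \<phi>))"

definition asymp_level ::
    "nat \<Rightarrow> (nat \<Rightarrow> nat) \<Rightarrow> ((nat \<times> nat \<Rightarrow> real) \<Rightarrow> real) set \<Rightarrow> (nat \<Rightarrow> sample \<Rightarrow> bool) \<Rightarrow> real \<Rightarrow> bool" where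
  "asymp_level k d H \<Phi> \<alpha> \<longleftrightarrow>
     (\<forall>p\<in>H. limsup (\<lambda>n. ereal (rejection_prob k d n p (\<Phi> n))) \<le> ereal \<alpha>)"

definition gauss_kernel :: "'i set \<Rightarrow> real \<Rightarrow> ('i \<Rightarrow> real) \<Rightarrow> ('i \<Rightarrow> real) \<Rightarrow> real" where
  "gauss_kernel I \<nu> x y = exp (- \<nu> * (L2_set (\<lambda>i. x i - y i) I)\<^sup>2)"

text \<open>
  The vector whose subvector number \<open>l\<close> is that of the observation number \<open>i l\<close>.
\<close>

definition mix :: "nat \<Rightarrow> (nat \<Rightarrow> nat) \<Rightarrow> sample \<Rightarrow> (nat \<Rightarrow> nat) \<Rightarrow> nat \<times> nat \<Rightarrow> real" where
  "mix k d X i = restrict (\<lambda>(l, c). X (i l) (l, c)) (coords k d)"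

text \<open>
  Where \<open>n\<close> is smaller than the number of distinct indices required, the index set of the sum is
  empty, so truncated subtraction and division by zero do no harm.
\<close>

definition gamma2_hat :: "nat \<Rightarrow> (nat \<Rightarrow> nat) \<Rightarrow> nat \<Rightarrow> real \<Rightarrow> sample \<Rightarrow> real" where
  "gamma2_hat k d n \<nu> X =
     1 / (real n * (real n - 1)) *
       (\<Sum>(i, j)\<in>{(i, j) \<in> {..<n} \<times> {..<n}. i \<noteq> j}. gauss_kernel (coords k d) \<nu> (X i) (X j))
   + fact (n - 2 * k) / fact n *
       (\<Sum>(i, j)\<in>{(i, j) \<in> ({..<k} \<rightarrow>\<^sub>E {..<n}) \<times> ({..<k} \<rightarrow>\<^sub>E {..<n}).
                     card (i ` {..<k} \<union> j ` {..<k}) = 2 * k}.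
          gauss_kernel (coords k d) \<nu> (mix k d X i) (mix k d X j))
   - 2 * fact (n - k - 1) / fact n *
       (\<Sum>(i, j)\<in>{(i, j) \<in> {..<n} \<times> ({..<k} \<rightarrow>\<^sub>E {..<n}). card ({i} \<union> j ` {..<k}) = k + 1}.
          gauss_kernel (coords k d) \<nu> (X i) (mix k d X j))"

definition stat_A :: "(nat \<Rightarrow> nat) \<Rightarrow> nat \<Rightarrow> real \<Rightarrow> sample \<Rightarrow> nat \<Rightarrow> real" where
  "stat_A d n \<nu> X l = 1 / (real n * (real n - 1)) *
     (\<Sum>(i, j)\<in>{(i, j) \<in> {..<n} \<times> {..<n}. i \<noteq> j}.
        gauss_kernel (block d l) (2 * \<nu>) (subvec d l (X i)) (subvec d l (X j)))"

definition stat_B :: "(nat \<Rightarrow> nat) \<Rightarrow> nat \<Rightarrow> real \<Rightarrow> sample \<Rightarrow> nat \<Rightarrow> real" where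
  "stat_B d n \<nu> X l = fact (n - 3) / fact n *
     (\<Sum>(i, j1, j2)\<in>{(i, j1, j2) \<in> {..<n} \<times> {..<n} \<times> {..<n}. card {i, j1, j2} = 3}.
        gauss_kernel (block d l) \<nu> (subvec d l (X i)) (subvec d l (X j1)) *
        gauss_kernel (block d l) \<nu> (subvec d l (X i)) (subvec d l (X j2)))"

definition stat_C :: "(nat \<Rightarrow> nat) \<Rightarrow> nat \<Rightarrow> real \<Rightarrow> sample \<Rightarrow> nat \<Rightarrow> real" where
  "stat_C d n \<nu> X l = fact (n - 4) / fact n *
     (\<Sum>(i1, i2, j1, j2)\<in>{(i1, i2, j1, j2) \<in> {..<n} \<times> {..<n} \<times> {..<n} \<times> {..<n}.
                             card {i1, i2, j1, j2} = 4}.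
        gauss_kernel (block d l) \<nu> (subvec d l (X i1)) (subvec d l (X j1)) *
        gauss_kernel (block d l) \<nu> (subvec d l (X i2)) (subvec d l (X j2)))"

definition s2_tilde :: "nat \<Rightarrow> (nat \<Rightarrow> nat) \<Rightarrow> nat \<Rightarrow> real \<Rightarrow> sample \<Rightarrow> real" where
  "s2_tilde k d n \<nu> X =
     (let A = stat_A d n \<nu> X; B = stat_B d n \<nu> X; C = stat_C d n \<nu> X in
        ((\<Prod>l<k. A l) - 2 * (\<Prod>l<k. B l) + (\<Prod>l<k. C l))
      - 2 * (\<Sum>j<k. A j * (\<Prod>l\<in>{..<k} - {j}. B l) - (\<Prod>l<k. B l)
                   - B j * (\<Prod>l\<in>{..<k} - {j}. C l) + (\<Prod>l<k. C l))
      + (\<Sum>j<k. (A j - 2 * B j + C j) * (\<Prod>l\<in>{..<k} - {j}. C l))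
      + (\<Sum>(j1, j2)\<in>{(j1, j2) \<in> {..<k} \<times> {..<k}. j1 \<noteq> j2}.
           (B j1 - C j1) * (B j2 - C j2) * (\<Prod>l\<in>{..<k} - {j1, j2}. C l)))"

definition s2_hat :: "nat \<Rightarrow> (nat \<Rightarrow> nat) \<Rightarrow> nat \<Rightarrow> real \<Rightarrow> sample \<Rightarrow> real" where
  "s2_hat k d n \<nu> X = max (s2_tilde k d n \<nu> X) (1 / (real n)\<^sup>2)"

definition T_IND :: "nat \<Rightarrow> (nat \<Rightarrow> nat) \<Rightarrow> nat \<Rightarrow> real \<Rightarrow> sample \<Rightarrow> real" where
  "T_IND k d n \<nu> X =
     real n / sqrt 2 * inverse (sqrt (s2_hat k d n \<nu> X)) * gamma2_hat k d n \<nu> X"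

definition z_upper :: "real \<Rightarrow> real" where
  "z_upper \<alpha> = (THE z. measure std_normal_distribution {z<..} = \<alpha>)"

definition Phi_IND :: "nat \<Rightarrow> (nat \<Rightarrow> nat) \<Rightarrow> nat \<Rightarrow> real \<Rightarrow> real \<Rightarrow> sample \<Rightarrow> bool" where
  "Phi_IND k d n \<nu> \<alpha> X \<longleftrightarrow> T_IND k d n \<nu> X > z_upper \<alpha>"

end

theory Submission
  imports Defs "HOL-Computational_Algebra.Polynomial" "HOL-Real_Asymp.Real_Asymp"
begin

text \<open>Write \<open>q\<close> for the tensor product of the marginal densities, \<open>f = p - q\<close>, and let \<open>D\<close> be the total dimension.

Above the critical rate the test is consistent. The statistic \<open>gamma2_hat\<close> estimates the Gaussian energy
\<open>\<integral>\<integral> f(x) G\<^sub>\<nu>(x,y) f(y)\<close> (\<open>genergy\<close>), which on the Fourier side is the integral of \<open>|F f|\<^sup>2\<close> against a Gaussian of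
width \<open>\<surd>\<nu>\<close>. Frequencies above this width carry at most \<open>\<nu>\<^sup>-\<^sup>s\<close> times the squared Sobolev norm, so once \<open>\<nu>\<^sup>-\<^sup>s\<close> is
small compared with \<open>\<Delta>\<^sup>2\<close> the energy is at least a constant times \<open>(\<pi>/\<nu>)\<^bsup>D/2\<^esup> \<Delta>\<^sup>2\<close> (\<open>genergy_lower_bound\<close>). The
noise has two parts. \<open>gamma2_hat\<close> is a combination of three U-statistics (\<open>gamma2_hat_eq_ustat\<close>); in the Hoeffding
decomposition the linear terms combine to an average of projections of \<open>G\<^sub>\<nu> * f\<close>, whose variance is at most a
multiple of the energy, and the degenerate terms have second moment of order \<open>\<nu>\<^bsup>-D/2\<^esup> / n\<^sup>2\<close>
(\<open>gamma2_hat_mean_square_error\<close>). The studentising factor \<open>s2_tilde\<close> is at most of order \<open>\<nu>\<^bsup>-D/2\<^esup>\<close> with high probability, by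
Markov's inequality applied to its building blocks. So signal over noise is of order \<open>n \<nu>\<^bsup>-D/4\<^esup> \<Delta>\<^sup>2\<close> in both
comparisons, and for \<open>\<nu>\<close> of order \<open>n\<^bsup>4/(D+4s)\<^esup>\<close> this tends to infinity exactly when \<open>n\<^bsup>2s/(D+4s)\<^esup> \<Delta>\<close> does; all the
bounds are uniform over the alternative (\<open>rejection_lower_bound\<close>, \<open>power_tendsto_1\<close>).

Below it no test is. Start from a product of very wide centred Gaussians, whose Sobolev norms
are as small as desired, and add \<open>a \<Sum>\<^sub>v \<epsilon>\<^sub>v \<psi>\<^sub>v\<close>, where the \<open>\<psi>\<^sub>v\<close> are copies of a product bump on the \<open>N\<^sup>D\<close> cells
of a grid of the unit cube and the \<open>\<epsilon>\<^sub>v\<close> are signs. The one-dimensional bump has integral zero, so no marginal density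
changes and all these densities share the same null density. Averaging over the signs kills the cross terms of the
squared Sobolev norm, so at least half of the choices of signs are admissible alternatives (\<open>many_signs_in_ball\<close>). The
second moment of the likelihood ratio, averaged over the signs, is a product of hyperbolic cosines and stays bounded when
\<open>n\<^sup>2 a\<^sup>4 N\<^sup>-\<^sup>D\<close> does (\<open>sum_signs_exp_le\<close>, \<open>second_moment_testing_bound\<close>). Hence a test whose level is small enough
has power at most one half along the indices where \<open>n\<^bsup>2s/(D+4s)\<^esup> \<Delta>\<^sub>n\<close> stays bounded, for \<open>a\<close> of order
\<open>n\<^bsup>-2s/(D+4s)\<^esup>\<close> and \<open>N\<close> of order \<open>n\<^bsup>2/(D+4s)\<^esup>\<close> (\<open>critical_scaling\<close>, \<open>liminf_power_less_1\<close>).\<close>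

section \<open>Lebesgue measure and the Gaussian kernel\<close>

interpretation lborel_PiM: product_sigma_finite "\<lambda>_. lborel :: real measure"
  by standard

lemma sigma_finite_leb: "finite I \<Longrightarrow> sigma_finite_measure (leb I)"
  unfolding leb_def by (rule lborel_PiM.sigma_finite)

lemma pair_sigma_finite_leb:
  "finite I \<Longrightarrow> finite J \<Longrightarrow> pair_sigma_finite (leb I) (leb J)"
  by (simp add: pair_sigma_finite_def sigma_finite_leb)

lemma measurable_leb_component [measurable (raw)]:
  "f \<in> measurable N (leb I) \<Longrightarrow> i \<in> I \<Longrightarrow> (\<lambda>x. f x i) \<in> borel_measurable N"
  using measurable_compose[OF _ measurable_component_singleton[of i I "\<lambda>_. lborel"], of f N]
  by (simp add: leb_def)

lemma
  fixes f :: "'i \<Rightarrow> real \<Rightarrow> _::{real_normed_field,banach,second_countable_topology}"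
  assumes "finite I" "\<And>i. i \<in> I \<Longrightarrow> integrable lborel (f i)"
  shows integrable_leb_prod: "integrable (leb I) (\<lambda>x. \<Prod>i\<in>I. f i (x i))"
    and integral_leb_prod: "(\<integral>x. (\<Prod>i\<in>I. f i (x i)) \<partial>leb I) = (\<Prod>i\<in>I. \<integral>t. f i t \<partial>lborel)"
  unfolding leb_def using assms
  by (auto intro!: lborel_PiM.product_integrable_prod lborel_PiM.product_integral_prod)

lemma gauss_kernel_prod:
  "gauss_kernel I \<nu> x y = (\<Prod>i\<in>I. exp (- (\<nu> * (x i - y i)\<^sup>2)))"
proof (cases "finite I")
  case True
  then show ?thesis
  by (simp add: gauss_kernel_def L2_set_def sum_nonneg sum_distrib_left flip: exp_sum)
qed (simp add: gauss_kernel_def)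

lemma gauss_kernel_sum:
  "finite I \<Longrightarrow> gauss_kernel I \<nu> x y = exp (- \<nu> * (\<Sum>i\<in>I. (x i - y i)\<^sup>2))"
  by (simp add: gauss_kernel_def L2_set_def sum_nonneg)

lemma gauss_kernel_commute: "gauss_kernel I \<nu> x y = gauss_kernel I \<nu> y x"
  by (simp add: gauss_kernel_prod power2_commute)

lemma gauss_kernel_nonneg [simp]: "0 \<le> gauss_kernel I \<nu> x y"
  by (simp add: gauss_kernel_def)

lemma gauss_kernel_le_1: "0 < \<nu> \<Longrightarrow> gauss_kernel I \<nu> x y \<le> 1"
  by (simp add: gauss_kernel_def)

lemma gauss_kernel_square: "(gauss_kernel I \<nu> x y)\<^sup>2 = gauss_kernel I (2 * \<nu>) x y"
  by (simp add: gauss_kernel_def flip: exp_double)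

lemma measurable_gauss_kernel [measurable (raw)]:
  assumes "f \<in> measurable N (leb I)" "g \<in> measurable N (leb I)"
  shows "(\<lambda>x. gauss_kernel I \<nu> (f x) (g x)) \<in> borel_measurable N"
  unfolding gauss_kernel_prod
  using assms measurable_leb_component by (intro borel_measurable_prod) (measurable, auto)

lemma has_integral_gauss_1d:
  assumes "0 < (\<nu>::real)"
  shows "integrable lborel (\<lambda>t. exp (- (\<nu> * (m - t)\<^sup>2)))"
    and "(\<integral>t. exp (- (\<nu> * (m - t)\<^sup>2)) \<partial>lborel) = sqrt (pi / \<nu>)"
proof -
  define \<sigma> where "\<sigma> = sqrt (1 / (2 * \<nu>))"
  have "exp (- (\<nu> * (m - t)\<^sup>2)) = sqrt (pi / \<nu>) * normal_density m \<sigma> t" for t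
    using assms by (simp add: normal_density_def \<sigma>_def real_sqrt_divide real_sqrt_mult field_simps power2_commute)
  then show "integrable lborel (\<lambda>t. exp (- (\<nu> * (m - t)\<^sup>2)))"
    "(\<integral>t. exp (- (\<nu> * (m - t)\<^sup>2)) \<partial>lborel) = sqrt (pi / \<nu>)"
    using assms by (auto simp: \<sigma>_def)
qed

lemma
  assumes "finite I" "0 < \<nu>"
  shows integrable_gauss_kernel: "integrable (leb I) (gauss_kernel I \<nu> x)"
    and integral_gauss_kernel: "(\<integral>y. gauss_kernel I \<nu> x y \<partial>leb I) = sqrt (pi / \<nu>) ^ card I"
proof -
  have i: "integrable lborel (\<lambda>t. exp (- (\<nu> * (x i - t)\<^sup>2)))"
    "(\<integral>t. exp (- (\<nu> * (x i - t)\<^sup>2)) \<partial>lborel) = sqrt (pi / \<nu>)" for i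
    using assms by (auto intro!: has_integral_gauss_1d)
  show "integrable (leb I) (gauss_kernel I \<nu> x)"
    using integrable_leb_prod[OF \<open>finite I\<close> i(1)] by (simp add: gauss_kernel_prod[abs_def])
  show "(\<integral>y. gauss_kernel I \<nu> x y \<partial>leb I) = sqrt (pi / \<nu>) ^ card I"
    using integral_leb_prod[OF \<open>finite I\<close> i(1)] by (simp add: gauss_kernel_prod[abs_def] i(2))
qed

text \<open>Completing the square in each coordinate: two Gaussians of parameter \<open>2\<nu>\<close> convolve to one of parameter \<open>\<nu>\<close>.\<close>

lemma integral_gauss_kernel_mult:
  assumes "finite I" "0 < \<nu>"
  shows "(\<integral>z. gauss_kernel I (2 * \<nu>) x z * gauss_kernel I (2 * \<nu>) z y \<partial>leb I) =
    sqrt (pi / (4 * \<nu>)) ^ card I * gauss_kernel I \<nu> x y"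
proof -
  have *: "exp (- (2 * \<nu> * (a - t)\<^sup>2)) * exp (- (2 * \<nu> * (t - b)\<^sup>2)) =
      exp (- (\<nu> * (a - b)\<^sup>2)) * exp (- (4 * \<nu> * ((a + b) / 2 - t)\<^sup>2))" for a b t :: real
  proof -
    have "2 * (a - t)\<^sup>2 + 2 * (t - b)\<^sup>2 = (a-b)\<^sup>2 + 4 * ((a + b) / 2 - t)\<^sup>2"
      by (simp add: power2_eq_square field_simps)
    then have "\<nu> * (2 * (a - t)\<^sup>2 + 2 * (t - b)\<^sup>2) = \<nu> * ((a-b)\<^sup>2 + 4 * ((a + b) / 2 - t)\<^sup>2)"
      by simp
    then show ?thesis unfolding exp_add[symmetric] by (simp add: algebra_simps)
  qed
  have i: "integrable lborel (\<lambda>t. exp (- (\<nu> * (a - b)\<^sup>2)) * exp (- (4 * \<nu> * ((a + b) / 2 - t)\<^sup>2)))"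
     "(\<integral>t. exp (- (\<nu> * (a - b)\<^sup>2)) * exp (- (4 * \<nu> * ((a + b) / 2 - t)\<^sup>2)) \<partial>lborel) =
       exp (- (\<nu> * (a - b)\<^sup>2)) * sqrt (pi / (4 * \<nu>))" for a b :: real
    using assms by (auto intro!: has_integral_gauss_1d(1)[of "4 * \<nu>"] simp: has_integral_gauss_1d(2)[of "4 * \<nu>"])
  have "(\<integral>z. gauss_kernel I (2 * \<nu>) x z * gauss_kernel I (2 * \<nu>) z y \<partial>leb I) =
    (\<integral>z. (\<Prod>j\<in>I. exp (- (\<nu> * (x j - y j)\<^sup>2)) * exp (- (4 * \<nu> * ((x j + y j) / 2 - z j)\<^sup>2))) \<partial>leb I)"
    unfolding gauss_kernel_prod prod.distrib[symmetric] * ..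
  also have "... = (\<Prod>j\<in>I. exp (- (\<nu> * (x j - y j)\<^sup>2)) * sqrt (pi / (4 * \<nu>)))"
    by (subst integral_leb_prod[OF \<open>finite I\<close> i(1)]) (simp only: i(2))
  finally show ?thesis
    by (simp add: prod.distrib gauss_kernel_prod)
qed

lemma measurable_cis [measurable]: "cis \<in> borel_measurable borel"
  by (intro borel_measurable_continuous_onI continuous_intros)

text \<open>The characteristic function of the standard normal distribution, rescaled. It is the one explicit Fourier
transform that is needed, both for the energy and for the Gaussian base density of the lower bound.\<close>

lemma char_gauss_1d:
  assumes "0 < (\<nu>::real)"
  shows "integrable lborel (\<lambda>t. complex_of_real (exp (- (t\<^sup>2 / (4 * \<nu>)))) * cis (t * u))"
   and "(\<integral>t. complex_of_real (exp (- (t\<^sup>2 / (4 * \<nu>)))) * cis (t * u) \<partial>lborel) =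
     complex_of_real (sqrt (4 * pi * \<nu>) * exp (- (\<nu> * u\<^sup>2)))"
proof -
  have "integrable lborel (\<lambda>t. exp (- ((1/(4*\<nu>)) * (0 - t)\<^sup>2)))"
    using assms by (intro has_integral_gauss_1d) auto
  then have "integrable lborel (\<lambda>t. exp (- (t\<^sup>2 / (4 * \<nu>))))"
    by simp
  then show "integrable lborel (\<lambda>t. complex_of_real (exp (- (t\<^sup>2 / (4 * \<nu>)))) * cis (t * u))"
    by (rule Bochner_Integration.integrable_bound) (auto simp: norm_mult)
  define c where "c = sqrt (2 * \<nu>)"
  have c: "c > 0" "c\<^sup>2 = 2 * \<nu>" using assms by (auto simp: c_def)
  have e: "- ((c * x)\<^sup>2 / (4 * \<nu>)) = - x\<^sup>2 / 2" for x
    using assms by (simp add: power_mult_distrib c)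
  have "(\<integral>t. complex_of_real (exp (- (t\<^sup>2 / (4 * \<nu>)))) * cis (t * u) \<partial>lborel) =
    c *\<^sub>R (\<integral>x. complex_of_real (exp (- x\<^sup>2 / 2)) * cis (c * x * u) \<partial>lborel)"
    using c by (subst lborel_integral_real_affine[where c=c and t=0]) (auto simp: e)
  also have "(\<integral>x. complex_of_real (exp (- x\<^sup>2 / 2)) * cis (c * x * u) \<partial>lborel) =
     (\<integral>x. sqrt (2 * pi) *\<^sub>R (std_normal_density x *\<^sub>R iexp (c * u * x)) \<partial>lborel)"
    by (intro Bochner_Integration.integral_cong)
      (auto simp: std_normal_density_def scaleR_conv_of_real cis_conv_exp ac_simps simp flip: of_real_mult of_real_divide)
  also have "... = sqrt (2 * pi) *\<^sub>R char std_normal_distribution (c * u)"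
    unfolding char_def by (subst integral_density) (auto simp del: scaleR_scaleR)
  also have "... = sqrt (2*pi) *\<^sub>R complex_of_real (exp (- (\<nu> * u\<^sup>2)))"
    by (simp add: char_std_normal_distribution power_mult_distrib c)
  also have "c *\<^sub>R ... = complex_of_real (sqrt (4 * pi * \<nu>) * exp (- (\<nu> * u\<^sup>2)))"
    by (simp add: scaleR_conv_of_real c_def flip: of_real_mult real_sqrt_mult)
  finally show "(\<integral>t. complex_of_real (exp (- (t\<^sup>2 / (4 * \<nu>)))) * cis (t * u) \<partial>lborel) =
     complex_of_real (sqrt (4 * pi * \<nu>) * exp (- (\<nu> * u\<^sup>2)))" .
qed

lemma char_gauss_kernel:
  assumes "finite I" "0 < \<nu>"
  shows "(\<integral>\<omega>. complex_of_real (exp (- ((\<Sum>i\<in>I. (\<omega> i)\<^sup>2) / (4 * \<nu>)))) * cis (\<Sum>i\<in>I. \<omega> i * (x i - y i)) \<partial>leb I) =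
    complex_of_real (sqrt (4 * pi * \<nu>) ^ card I * gauss_kernel I \<nu> x y)"
proof -
  have "complex_of_real (exp (- ((\<Sum>i\<in>I. (\<omega> i)\<^sup>2) / (4 * \<nu>)))) * cis (\<Sum>i\<in>I. \<omega> i * (x i - y i)) =
    (\<Prod>i\<in>I. complex_of_real (exp (- ((\<omega> i)\<^sup>2 / (4 * \<nu>)))) * cis (\<omega> i * (x i - y i)))" for \<omega>
    using assms by (simp add: prod.distrib cis_conv_exp exp_sum sum_distrib_left sum_divide_distrib
      sum_negf[symmetric] del: sum_negf)
  then show ?thesis
    using integral_leb_prod[OF \<open>finite I\<close> char_gauss_1d(1)[OF \<open>0 < \<nu>\<close>], of "\<lambda>i. x i - y i"] assms
    by (simp add: char_gauss_1d gauss_kernel_prod prod.distrib del: prod.distrib)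
       (simp add: prod.distrib)
qed

lemma Cauchy_Schwarz_integral:
  fixes f g :: "'a \<Rightarrow> real"
  assumes [measurable]: "f \<in> borel_measurable M" "g \<in> borel_measurable M"
    and f2: "integrable M (\<lambda>x. (f x)\<^sup>2)" and g2: "integrable M (\<lambda>x. (g x)\<^sup>2)"
  shows "integrable M (\<lambda>x. f x * g x)"
    and "(\<integral>x. f x * g x \<partial>M)\<^sup>2 \<le> (\<integral>x. (f x)\<^sup>2 \<partial>M) * (\<integral>x. (g x)\<^sup>2 \<partial>M)"
proof -
  have "\<bar>f x * g x\<bar> \<le> (f x)\<^sup>2 + (g x)\<^sup>2" for x
  proof -
    have "0 \<le> \<bar>f x\<bar> * \<bar>g x\<bar>" by simp
    with sum_squares_bound[of "\<bar>f x\<bar>" "\<bar>g x\<bar>"] show ?thesis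
      unfolding abs_mult power2_abs by linarith
  qed
  then show fg: "integrable M (\<lambda>x. f x * g x)"
    by (intro Bochner_Integration.integrable_bound[OF Bochner_Integration.integrable_add[OF f2 g2]]) auto
  let ?A = "\<integral>x. (f x)\<^sup>2 \<partial>M" and ?B = "\<integral>x. f x * g x \<partial>M" and ?C = "\<integral>x. (g x)\<^sup>2 \<partial>M"
  show "?B\<^sup>2 \<le> ?A * ?C"
  proof (cases "?A = 0")
    case True
    then have "AE x in M. (f x)\<^sup>2 = 0"
      using f2 by (subst (asm) integral_nonneg_eq_0_iff_AE) auto
    then have "?B = (\<integral>x. 0 \<partial>M)" by (intro integral_cong_AE) auto
    then show ?thesis using True by simp
  next
    case False
    moreover have "?A \<ge> 0" by (intro Bochner_Integration.integral_nonneg) auto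
    ultimately have A: "?A > 0" by linarith
    define t where "t = - ?B / ?A"
    have "0 \<le> (\<integral>x. (t * f x + g x)\<^sup>2 \<partial>M)" by (intro Bochner_Integration.integral_nonneg) auto
    also have "(\<integral>x. (t * f x + g x)\<^sup>2 \<partial>M) = (\<integral>x. t\<^sup>2 * (f x)\<^sup>2 + (2 * t) * (f x * g x) + (g x)\<^sup>2 \<partial>M)"
      by (intro Bochner_Integration.integral_cong) (auto simp: power2_eq_square algebra_simps)
    also have "... = t\<^sup>2 * ?A + (2*t) * ?B + ?C"
      using f2 g2 fg by simp
    also have "... = ?C - ?B\<^sup>2 / ?A"
      using A by (simp add: t_def power2_eq_square field_simps)
    finally show ?thesis using A by (simp add: field_simps)
  qed
qed

section \<open>Gaussian convolution and energy\<close>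

lemma integrable_pair_mult:
  fixes f :: "'a \<Rightarrow> real" and g :: "'b \<Rightarrow> real"
  assumes "sigma_finite_measure M" "sigma_finite_measure N"
    and f: "integrable M f" and g: "integrable N g"
  shows "integrable (M \<Otimes>\<^sub>M N) (\<lambda>(x, y). f x * g y)"
proof -
  interpret pair_sigma_finite M N using assms by (simp add: pair_sigma_finite_def)
  have [measurable]: "f \<in> borel_measurable M" "g \<in> borel_measurable N" using f g by auto
  show ?thesis
    using f g by (intro Fubini_integrable) (auto simp: abs_mult)
qed

lemma leb_Fubini_dominated:
  fixes H :: "('i \<Rightarrow> real) \<Rightarrow> ('i \<Rightarrow> real) \<Rightarrow> 'b::{banach, second_countable_topology}"
  assumes I: "finite I" and H: "case_prod H \<in> borel_measurable (leb I \<Otimes>\<^sub>M leb I)"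
    and ab: "integrable (leb I) a" "integrable (leb I) b" and le: "\<And>x y. norm (H x y) \<le> a x * b y"
  shows "(\<integral>x. (\<integral>y. H x y \<partial>leb I) \<partial>leb I) = (\<integral>y. (\<integral>x. H x y \<partial>leb I) \<partial>leb I)"
proof -
  interpret pair_sigma_finite "leb I" "leb I" using I by (rule pair_sigma_finite_leb) fact
  have "integrable (leb I \<Otimes>\<^sub>M leb I) (case_prod H)"
  proof (rule Bochner_Integration.integrable_bound[OF integrable_pair_mult[OF _ _ ab]])
    show "AE z in leb I \<Otimes>\<^sub>M leb I. norm (case_prod H z) \<le> norm (case z of (x, y) \<Rightarrow> a x * b y)"
    proof (rule AE_I2)
      fix z
      have "norm (H (fst z) (snd z)) \<le> \<bar>a (fst z) * b (snd z)\<bar>"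
        using le[of "fst z" "snd z"] by linarith
      then show "norm (case_prod H z) \<le> norm (case z of (x, y) \<Rightarrow> a x * b y)"
        by (simp add: split_beta)
    qed
  qed (use I H sigma_finite_leb in auto)
  then show ?thesis by (rule Fubini_integral[symmetric])
qed

text \<open>Convolution with the unnormalised kernel; the corresponding energy is the squared kernel mean discrepancy when \<open>f\<close> is a
difference of two densities.\<close>

definition gconv :: "'i set \<Rightarrow> real \<Rightarrow> (('i \<Rightarrow> real) \<Rightarrow> real) \<Rightarrow> ('i \<Rightarrow> real) \<Rightarrow> real" where
  "gconv I \<nu> f x = (\<integral>y. gauss_kernel I \<nu> x y * f y \<partial>leb I)"

definition genergy :: "'i set \<Rightarrow> real \<Rightarrow> (('i \<Rightarrow> real) \<Rightarrow> real) \<Rightarrow> real" where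
  "genergy I \<nu> f = (\<integral>x. f x * gconv I \<nu> f x \<partial>leb I)"

lemma measurable_gconv [measurable]:
  assumes "finite I" and [measurable]: "f \<in> borel_measurable (leb I)"
  shows "gconv I \<nu> f \<in> borel_measurable (leb I)"
proof -
  interpret sigma_finite_measure "leb I" using assms by (simp add: sigma_finite_leb)
  show ?thesis unfolding gconv_def[abs_def] by measurable
qed

lemma integrable_gauss_mult:
  assumes "0 < \<nu>" "x \<in> space (leb I)" and f: "integrable (leb I) f"
  shows "integrable (leb I) (\<lambda>y. gauss_kernel I \<nu> x y * f y)"
proof (rule Bochner_Integration.integrable_bound[OF f])
  have [measurable]: "f \<in> borel_measurable (leb I)" using f by auto
  show "(\<lambda>y. gauss_kernel I \<nu> x y * f y) \<in> borel_measurable (leb I)"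
    using assms by measurable
  show "AE y in leb I. norm (gauss_kernel I \<nu> x y * f y) \<le> norm (f y)"
    using gauss_kernel_le_1[OF \<open>0 < \<nu>\<close>, of I x]
    by (intro AE_I2) (simp add: abs_mult mult_left_le_one_le)
qed

lemma abs_gconv_le:
  assumes "0 < \<nu>" "x \<in> space (leb I)" and f: "integrable (leb I) f"
  shows "\<bar>gconv I \<nu> f x\<bar> \<le> (\<integral>y. \<bar>f y\<bar> \<partial>leb I)"
proof -
  have "\<bar>gconv I \<nu> f x\<bar> \<le> (\<integral>y. \<bar>gauss_kernel I \<nu> x y * f y\<bar> \<partial>leb I)"
    unfolding gconv_def by (rule integral_abs_bound)
  also have "... \<le> (\<integral>y. \<bar>f y\<bar> \<partial>leb I)"
    using integrable_gauss_mult[OF assms] f gauss_kernel_le_1[OF \<open>0 < \<nu>\<close>, of I x]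
    by (intro integral_mono integrable_abs) (simp_all add: abs_mult mult_left_le_one_le)
  finally show ?thesis .
qed

lemma integrable_gauss_pair:
  assumes "finite I" "0 < \<nu>" and f: "integrable (leb I) f"
  shows "integrable (leb I \<Otimes>\<^sub>M leb I) (\<lambda>(y, x). gauss_kernel I \<nu> x y * f y)"
proof -
  interpret pair_sigma_finite "leb I" "leb I" using assms by (simp add: pair_sigma_finite_leb)
  have [measurable]: "f \<in> borel_measurable (leb I)" using f by auto
  have *: "integrable (leb I) (\<lambda>x. gauss_kernel I \<nu> x y)" "(\<integral>x. gauss_kernel I \<nu> x y \<partial>leb I) = sqrt (pi / \<nu>) ^ card I" for y
    using integrable_gauss_kernel[OF assms(1,2)] integral_gauss_kernel[OF assms(1,2)]
    by (simp_all add: gauss_kernel_commute[of I \<nu> _ y])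
  show ?thesis
    by (intro Fubini_integrable) (use f in \<open>auto simp: abs_mult *\<close>)
qed

lemma
  assumes I: "finite I" "0 < \<nu>" and f: "integrable (leb I) f"
  shows integrable_gconv: "integrable (leb I) (gconv I \<nu> f)"
    and integral_gconv: "(\<integral>x. gconv I \<nu> f x \<partial>leb I) = sqrt (pi / \<nu>) ^ card I * (\<integral>x. f x \<partial>leb I)"
proof -
  interpret pair_sigma_finite "leb I" "leb I" using I by (simp add: pair_sigma_finite_leb)
  note int = integrable_gauss_pair[OF assms]
  show "integrable (leb I) (gconv I \<nu> f)"
    using integrable_snd[OF int] by (simp add: gconv_def[abs_def])
  have "(\<integral>x. gauss_kernel I \<nu> x y \<partial>leb I) = sqrt (pi / \<nu>) ^ card I" for y
    using integral_gauss_kernel[OF I] by (simp add: gauss_kernel_commute[of I \<nu> _ y])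
  then show "(\<integral>x. gconv I \<nu> f x \<partial>leb I) = sqrt (pi / \<nu>) ^ card I * (\<integral>x. f x \<partial>leb I)"
    using Fubini_integral[OF int] by (simp add: gconv_def)
qed

lemma integral_gconv_commute:
  assumes I: "finite I" "0 < \<nu>" and f: "integrable (leb I) f" and g: "integrable (leb I) g"
  shows "(\<integral>x. f x * gconv I \<nu> g x \<partial>leb I) = (\<integral>x. g x * gconv I \<nu> f x \<partial>leb I)"
proof -
  have [measurable]: "f \<in> borel_measurable (leb I)" "g \<in> borel_measurable (leb I)" using f g by auto
  have "(\<integral>x. (\<integral>y. f x * (gauss_kernel I \<nu> x y * g y) \<partial>leb I) \<partial>leb I) =
        (\<integral>y. (\<integral>x. f x * (gauss_kernel I \<nu> x y * g y) \<partial>leb I) \<partial>leb I)"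
    by (rule leb_Fubini_dominated[where a="\<lambda>x. \<bar>f x\<bar>" and b="\<lambda>x. \<bar>g x\<bar>"])
       (use I f g gauss_kernel_le_1[OF \<open>0 < \<nu>\<close>] in
        \<open>auto simp: abs_mult intro!: mult_left_mono mult_left_le_one_le\<close>)
  also have "... = (\<integral>y. (\<integral>x. g y * (gauss_kernel I \<nu> y x * f x) \<partial>leb I) \<partial>leb I)"
    by (intro Bochner_Integration.integral_cong refl) (simp add: gauss_kernel_commute mult_ac)
  finally show ?thesis by (simp add: gconv_def)
qed

lemma gconv_diff:
  assumes "0 < \<nu>" "x \<in> space (leb I)" "integrable (leb I) f" "integrable (leb I) g"
  shows "gconv I \<nu> (\<lambda>x. f x - g x) x = gconv I \<nu> f x - gconv I \<nu> g x"
  unfolding gconv_def right_diff_distrib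
  using assms by (intro Bochner_Integration.integral_diff integrable_gauss_mult)

text \<open>The heat semigroup. It splits the kernel into two equal halves, which makes the energy a square
(\<open>genergy_eq_square\<close>).\<close>

lemma gconv_semigroup:
  assumes I: "finite I" "0 < \<nu>" and x: "x \<in> space (leb I)" and f: "integrable (leb I) f"
  shows "gconv I \<nu> f x = sqrt (4 * \<nu> / pi) ^ card I * gconv I (2 * \<nu>) (gconv I (2 * \<nu>) f) x"
proof -
  have [measurable]: "f \<in> borel_measurable (leb I)" using f by auto
  have "gconv I (2 * \<nu>) (gconv I (2 * \<nu>) f) x =
    (\<integral>z. (\<integral>y. gauss_kernel I (2*\<nu>) x z * (gauss_kernel I (2*\<nu>) z y * f y) \<partial>leb I) \<partial>leb I)"
    by (simp add: gconv_def)
  also have "... = (\<integral>y. (\<integral>z. gauss_kernel I (2*\<nu>) x z * (gauss_kernel I (2*\<nu>) z y * f y) \<partial>leb I) \<partial>leb I)"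
    by (rule leb_Fubini_dominated[where a="gauss_kernel I (2*\<nu>) x" and b="\<lambda>x. \<bar>f x\<bar>"])
       (use I x f gauss_kernel_le_1[of "2*\<nu>"] integrable_gauss_kernel[of I "2*\<nu>"] in
        \<open>auto simp: abs_mult intro!: mult_left_mono mult_left_le_one_le\<close>)
  also have "... = (\<integral>y. sqrt (pi / (4 * \<nu>)) ^ card I * (gauss_kernel I \<nu> x y * f y) \<partial>leb I)"
    using integral_gauss_kernel_mult[OF I, of x] by (simp add: mult.assoc[symmetric])
  also have "... = sqrt (pi / (4 * \<nu>)) ^ card I * gconv I \<nu> f x"
    by (simp add: gconv_def)
  also have "sqrt (4 * \<nu> / pi) ^ card I * ... = gconv I \<nu> f x"
    using I by (simp flip: power_mult_distrib real_sqrt_mult mult.assoc)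
  finally show ?thesis by simp
qed

lemma integrable_gconv_square:
  assumes I: "finite I" "0 < \<nu>" and f: "integrable (leb I) f"
  shows "integrable (leb I) (\<lambda>x. (gconv I \<nu> f x)\<^sup>2)"
proof -
  have [measurable]: "f \<in> borel_measurable (leb I)" using f by auto
  have "integrable (leb I) (\<lambda>x. (\<integral>y. \<bar>f y\<bar> \<partial>leb I) * gconv I \<nu> f x)"
    using integrable_gconv[OF assms] by simp
  then show ?thesis
  proof (rule Bochner_Integration.integrable_bound)
    show "AE x in leb I. norm ((gconv I \<nu> f x)\<^sup>2) \<le> norm ((\<integral>y. \<bar>f y\<bar> \<partial>leb I) * gconv I \<nu> f x)"
    proof (rule AE_I2)
      fix x assume "x \<in> space (leb I)"
      then have "\<bar>gconv I \<nu> f x\<bar> * \<bar>gconv I \<nu> f x\<bar> \<le> \<bar>\<integral>y. \<bar>f y\<bar> \<partial>leb I\<bar> * \<bar>gconv I \<nu> f x\<bar>"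
        using abs_gconv_le[OF I(2) _ f, of x] by (intro mult_right_mono) auto
      then show "norm ((gconv I \<nu> f x)\<^sup>2) \<le> norm ((\<integral>y. \<bar>f y\<bar> \<partial>leb I) * gconv I \<nu> f x)"
        by (simp add: power2_eq_square abs_mult)
    qed
  qed (use I in measurable)
qed

lemma genergy_eq_square:
  assumes I: "finite I" "0 < \<nu>" and f: "integrable (leb I) f"
  shows "genergy I \<nu> f = sqrt (4 * \<nu> / pi) ^ card I * (\<integral>x. (gconv I (2 * \<nu>) f x)\<^sup>2 \<partial>leb I)"
proof -
  let ?u = "gconv I (2 * \<nu>) f"
  have "genergy I \<nu> f = (\<integral>x. sqrt (4 * \<nu> / pi) ^ card I * (f x * gconv I (2 * \<nu>) ?u x) \<partial>leb I)"
    unfolding genergy_def by (intro Bochner_Integration.integral_cong refl)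
      (simp add: gconv_semigroup[OF I _ f])
  also have "... = sqrt (4 * \<nu> / pi) ^ card I * (\<integral>x. f x * gconv I (2 * \<nu>) ?u x \<partial>leb I)"
    by simp
  also have "(\<integral>x. f x * gconv I (2 * \<nu>) ?u x \<partial>leb I) = (\<integral>x. ?u x * ?u x \<partial>leb I)"
    using I f by (intro integral_gconv_commute integrable_gconv) auto
  finally show ?thesis by (simp add: power2_eq_square)
qed

lemma genergy_nonneg:
  assumes I: "finite I" "0 < \<nu>" and f: "integrable (leb I) f"
  shows "0 \<le> genergy I \<nu> f"
  unfolding genergy_eq_square[OF assms] using I
  by (intro mult_nonneg_nonneg Bochner_Integration.integral_nonneg) auto

text \<open>Jensen's inequality for the kernel, after normalising its mass \<open>(\<pi>/\<nu>)\<^bsup>d/2\<^esup>\<close>.\<close>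

lemma gconv_square_le_gconv:
  assumes I: "finite I" "0 < \<nu>" and x: "x \<in> space (leb I)"
    and [measurable]: "u \<in> borel_measurable (leb I)" and u2: "integrable (leb I) (\<lambda>y. (u y)\<^sup>2)"
  shows "(gconv I \<nu> u x)\<^sup>2 \<le> sqrt (pi / \<nu>) ^ card I * gconv I \<nu> (\<lambda>y. (u y)\<^sup>2) x"
proof -
  let ?g = "\<lambda>y. sqrt (gauss_kernel I \<nu> x y)"
  have gx [measurable]: "(\<lambda>y. gauss_kernel I \<nu> x y) \<in> borel_measurable (leb I)"
    using x by measurable
  have "(\<integral>y. ?g y * (?g y * u y) \<partial>leb I)\<^sup>2 \<le> (\<integral>y. (?g y)\<^sup>2 \<partial>leb I) * (\<integral>y. (?g y * u y)\<^sup>2 \<partial>leb I)"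
    by (rule Cauchy_Schwarz_integral)
       (use I x u2 integrable_gauss_kernel[of I \<nu>] integrable_gauss_mult[of \<nu> x I "\<lambda>y. (u y)\<^sup>2"] in
        \<open>auto simp: power_mult_distrib\<close>)
  then show ?thesis
    using integral_gauss_kernel[OF I]
    by (simp add: gconv_def power_mult_distrib mult.assoc[symmetric])
qed

text \<open>In the reproducing kernel Hilbert space of the kernel, \<open>gconv I \<nu> f\<close> is the embedding of \<open>f\<close>, its squared norm is
the energy, and point evaluations have norm one because the kernel is one on the diagonal. The proof replaces the Hilbert
space by the semigroup property and the Cauchy-Schwarz inequality.\<close>

lemma gconv_square_le_genergy:
  assumes I: "finite I" "0 < \<nu>" and x: "x \<in> space (leb I)" and f: "integrable (leb I) f"
  shows "(gconv I \<nu> f x)\<^sup>2 \<le> genergy I \<nu> f"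
proof -
  let ?u = "gconv I (2 * \<nu>) f" and ?c = "sqrt (4 * \<nu> / pi) ^ card I"
  have [measurable]: "f \<in> borel_measurable (leb I)" using f by auto
  have u: "integrable (leb I) (\<lambda>x. (?u x)\<^sup>2)" "integrable (leb I) ?u"
    using I f by (auto intro!: integrable_gconv_square integrable_gconv)
  have G: "(gauss_kernel I (2 * \<nu>) x y)\<^sup>2 = gauss_kernel I (4*\<nu>) x y" for y
    by (simp add: gauss_kernel_square)
  have gx [measurable]: "(\<lambda>y. gauss_kernel I (2*\<nu>) x y) \<in> borel_measurable (leb I)"
    using x by measurable
  have "(gconv I (2 * \<nu>) ?u x)\<^sup>2 \<le> (\<integral>y. (gauss_kernel I (2*\<nu>) x y)\<^sup>2 \<partial>leb I) * (\<integral>y. (?u y)\<^sup>2 \<partial>leb I)"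
    unfolding gconv_def[of I "2*\<nu>" ?u]
    by (rule Cauchy_Schwarz_integral)
       (use I u integrable_gauss_kernel[of I "4*\<nu>"] in \<open>auto simp: G\<close>)
  also have "(\<integral>y. (gauss_kernel I (2*\<nu>) x y)\<^sup>2 \<partial>leb I) = sqrt (pi / (4 * \<nu>)) ^ card I"
    using integral_gauss_kernel[of I "4*\<nu>"] I by (simp add: G)
  finally have *: "(gconv I (2 * \<nu>) ?u x)\<^sup>2 \<le> sqrt (pi / (4 * \<nu>)) ^ card I * (\<integral>y. (?u y)\<^sup>2 \<partial>leb I)" .
  have c: "?c * sqrt (pi / (4 * \<nu>)) ^ card I = 1"
    using I by (simp flip: power_mult_distrib real_sqrt_mult)
  have "(gconv I \<nu> f x)\<^sup>2 = ?c\<^sup>2 * (gconv I (2 * \<nu>) ?u x)\<^sup>2"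
    by (simp add: gconv_semigroup[OF I x f] power_mult_distrib)
  also have "... \<le> ?c\<^sup>2 * (sqrt (pi / (4 * \<nu>)) ^ card I * (\<integral>y. (?u y)\<^sup>2 \<partial>leb I))"
    by (intro mult_left_mono *) auto
  also have "... = ?c * (?c * sqrt (pi / (4 * \<nu>)) ^ card I) * (\<integral>y. (?u y)\<^sup>2 \<partial>leb I)"
    by (simp add: power2_eq_square mult_ac)
  also have "... = genergy I \<nu> f"
    unfolding c genergy_eq_square[OF I f] by simp
  finally show ?thesis .
qed

lemma integral_gconv_square_le:
  assumes I: "finite I" "0 < \<nu>"
    and [measurable]: "u \<in> borel_measurable (leb I)" and u2: "integrable (leb I) (\<lambda>y. (u y)\<^sup>2)"
    and u: "integrable (leb I) u"
  shows "(\<integral>x. (gconv I \<nu> u x)\<^sup>2 \<partial>leb I) \<le> (sqrt (pi / \<nu>) ^ card I)\<^sup>2 * (\<integral>x. (u x)\<^sup>2 \<partial>leb I)"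
proof -
  have "(\<integral>x. (gconv I \<nu> u x)\<^sup>2 \<partial>leb I) \<le> (\<integral>x. sqrt (pi / \<nu>) ^ card I * gconv I \<nu> (\<lambda>y. (u y)\<^sup>2) x \<partial>leb I)"
    using I u2 u by (intro integral_mono gconv_square_le_gconv integrable_gconv_square
      integrable_mult_right integrable_gconv) auto
  also have "... = (sqrt (pi / \<nu>) ^ card I)\<^sup>2 * (\<integral>x. (u x)\<^sup>2 \<partial>leb I)"
    using integral_gconv[OF I u2] by (simp add: power2_eq_square)
  finally show ?thesis .
qed

text \<open>Convolution is a multiplier by a function bounded by \<open>(\<pi>/\<nu>)\<^bsup>d/2\<^esup>\<close>, and the energy contains this multiplier once
while the left-hand side contains it twice. Together with \<open>gconv_square_le_genergy\<close> this controls the variance of the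
linear part of the statistic by the energy.\<close>

lemma integral_gconv_square_le_genergy:
  assumes I: "finite I" "0 < \<nu>" and f: "integrable (leb I) f"
  shows "(\<integral>x. (gconv I \<nu> f x)\<^sup>2 \<partial>leb I) \<le> sqrt (pi / \<nu>) ^ card I * genergy I \<nu> f"
proof -
  let ?u = "gconv I (2 * \<nu>) f" and ?c = "sqrt (4 * \<nu> / pi) ^ card I" and ?K = "sqrt (pi / (2 * \<nu>)) ^ card I"
  have [measurable]: "f \<in> borel_measurable (leb I)" using f by auto
  have u: "integrable (leb I) (\<lambda>x. (?u x)\<^sup>2)" "integrable (leb I) ?u"
    using I f by (auto intro!: integrable_gconv_square integrable_gconv)
  have "(\<integral>x. (gconv I \<nu> f x)\<^sup>2 \<partial>leb I) = (\<integral>x. ?c\<^sup>2 * (gconv I (2 * \<nu>) ?u x)\<^sup>2 \<partial>leb I)"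
    by (intro Bochner_Integration.integral_cong refl)
       (simp add: gconv_semigroup[OF I _ f] power_mult_distrib)
  also have "... = ?c\<^sup>2 * (\<integral>x. (gconv I (2 * \<nu>) ?u x)\<^sup>2 \<partial>leb I)" by simp
  also have "... \<le> ?c\<^sup>2 * (?K\<^sup>2 * (\<integral>x. (?u x)\<^sup>2 \<partial>leb I))"
    using I u by (intro mult_left_mono integral_gconv_square_le) auto
  also have "... = (?c * ?K\<^sup>2) * genergy I \<nu> f"
    unfolding genergy_eq_square[OF I f] by (simp add: power2_eq_square)
  also have "?c * ?K\<^sup>2 = sqrt (pi / \<nu>) ^ card I"
  proof -
    have "sqrt (4 * \<nu> / pi) * (sqrt (pi / (2 * \<nu>)) * sqrt (pi / (2 * \<nu>))) = sqrt (pi / \<nu>)"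
      using I by (simp flip: real_sqrt_mult add: field_simps del: real_sqrt_mult_self)
    then show ?thesis
      by (simp add: power2_eq_square flip: power_mult_distrib)
  qed
  finally show ?thesis .
qed

lemma integral_mult_gconv_le:
  assumes I: "finite I" "0 < \<nu>" and p: "integrable (leb I) p" and q: "integrable (leb I) q"
    and p2: "integrable (leb I) (\<lambda>x. (p x)\<^sup>2)" and q2: "integrable (leb I) (\<lambda>x. (q x)\<^sup>2)"
  shows "(\<integral>x. p x * gconv I \<nu> q x \<partial>leb I) \<le>
    sqrt (pi / \<nu>) ^ card I * sqrt ((\<integral>x. (p x)\<^sup>2 \<partial>leb I) * (\<integral>x. (q x)\<^sup>2 \<partial>leb I))"
proof -
  have [measurable]: "p \<in> borel_measurable (leb I)" "q \<in> borel_measurable (leb I)" using p q by auto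
  have "(\<integral>x. p x * gconv I \<nu> q x \<partial>leb I)\<^sup>2 \<le> (\<integral>x. (p x)\<^sup>2 \<partial>leb I) * (\<integral>x. (gconv I \<nu> q x)\<^sup>2 \<partial>leb I)"
    using I p2 q by (intro Cauchy_Schwarz_integral integrable_gconv_square) auto
  also have "... \<le> (\<integral>x. (p x)\<^sup>2 \<partial>leb I) * ((sqrt (pi / \<nu>) ^ card I)\<^sup>2 * (\<integral>x. (q x)\<^sup>2 \<partial>leb I))"
    using I q2 q by (intro mult_left_mono integral_gconv_square_le) auto
  finally have "(\<integral>x. p x * gconv I \<nu> q x \<partial>leb I) \<le>
     sqrt ((sqrt (pi / \<nu>) ^ card I)\<^sup>2 * ((\<integral>x. (p x)\<^sup>2 \<partial>leb I) * (\<integral>x. (q x)\<^sup>2 \<partial>leb I)))"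
    by (intro real_le_rsqrt) (simp add: mult_ac)
  then show ?thesis using I by (simp only: real_sqrt_mult) simp
qed

section \<open>The energy in frequency space\<close>

lemma measurable_cnj [measurable]: "cnj \<in> borel_measurable borel"
  by (intro borel_measurable_continuous_onI continuous_intros)

lemma fourier_eq_cis:
  "fourier I f \<omega> = complex_of_real ((2 * pi) powr (- real (card I) / 2)) *
     (\<integral>x. complex_of_real (f x) * cis (- (\<Sum>i\<in>I. x i * \<omega> i)) \<partial>leb I)"
  by (simp add: fourier_def cis_conv_exp)

lemma measurable_fourier [measurable]:
  assumes "finite I" and [measurable]: "f \<in> borel_measurable (leb I)"
  shows "fourier I f \<in> borel_measurable (leb I)"
proof -
  interpret sigma_finite_measure "leb I" using assms by (simp add: sigma_finite_leb)
  show ?thesis unfolding fourier_eq_cis[abs_def] by measurable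
qed

text \<open>Parseval's identity with a Gaussian weight. The weight makes every integral absolutely convergent, so Fubini's theorem
suffices for integrable \<open>f\<close>, and Plancherel's theorem for \<open>f\<close> itself follows by letting the weight widen.\<close>

lemma fourier_gauss_energy:
  assumes I: "finite I" "0 < \<nu>" and f: "integrable (leb I) f"
  shows "integrable (leb I) (\<lambda>\<omega>. exp (- ((\<Sum>i\<in>I. (\<omega> i)\<^sup>2) / (4 * \<nu>))) * (cmod (fourier I f \<omega>))\<^sup>2)"
    and "(\<integral>\<omega>. exp (- ((\<Sum>i\<in>I. (\<omega> i)\<^sup>2) / (4 * \<nu>))) * (cmod (fourier I f \<omega>))\<^sup>2 \<partial>leb I) =
      sqrt (\<nu> / pi) ^ card I * genergy I \<nu> f"
proof -
  define e :: "('a \<Rightarrow> real) \<Rightarrow> real" where "e \<omega> = exp (- ((\<Sum>i\<in>I. (\<omega> i)\<^sup>2) / (4 * \<nu>)))" for \<omega>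
  define F where "F \<omega> = (\<integral>x. complex_of_real (f x) * cis (- (\<Sum>i\<in>I. x i * \<omega> i)) \<partial>leb I)" for \<omega>
  define B where "B = (\<integral>x. \<bar>f x\<bar> \<partial>leb I)"
  have [measurable]: "f \<in> borel_measurable (leb I)" using f by auto
  interpret sigma_finite_measure "leb I" using I by (simp add: sigma_finite_leb)
  have F [measurable]: "F \<in> borel_measurable (leb I)"
    unfolding F_def[abs_def] by measurable
  have FB: "cmod (F \<omega>) \<le> B" for \<omega>
    unfolding F_def B_def by (rule order_trans[OF integral_norm_bound]) (simp add: norm_mult)
  have B0: "0 \<le> B" unfolding B_def by simp
  have e_eq: "e = gauss_kernel I (1 / (4 * \<nu>)) (\<lambda>_. 0)"
    using I by (auto simp: e_def gauss_kernel_sum)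
  have e_int: "integrable (leb I) e"
    unfolding e_eq using I by (intro integrable_gauss_kernel) auto
  have [measurable]: "e \<in> borel_measurable (leb I)" using e_int by auto
  have e0: "0 \<le> e \<omega>" for \<omega> by (simp add: e_def)
  have cnjF: "cnj (F \<omega>) = (\<integral>y. complex_of_real (f y) * cis (\<Sum>i\<in>I. y i * \<omega> i) \<partial>leb I)" for \<omega>
    unfolding F_def Bochner_Integration.integral_cnj[symmetric] by (simp add: cis_cnj)
  have fourier: "(cmod (fourier I f \<omega>))\<^sup>2 = ((2 * pi) powr (- real (card I) / 2))\<^sup>2 * (cmod (F \<omega>))\<^sup>2" for \<omega>
    by (simp add: fourier_eq_cis F_def norm_mult power_mult_distrib)
  have int: "integrable (leb I) (\<lambda>\<omega>. e \<omega> * (cmod (F \<omega>))\<^sup>2)"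
  proof (rule Bochner_Integration.integrable_bound)
    show "integrable (leb I) (\<lambda>\<omega>. e \<omega> * B\<^sup>2)" using e_int by simp
    show "AE \<omega> in leb I. norm (e \<omega> * (cmod (F \<omega>))\<^sup>2) \<le> norm (e \<omega> * B\<^sup>2)"
      using FB by (intro AE_I2) (auto simp: abs_mult e0 intro!: mult_left_mono power_mono)
  qed measurable
  have inner: "(\<integral>\<omega>. complex_of_real (e \<omega>) * (complex_of_real (f x) * cis (- (\<Sum>i\<in>I. x i * \<omega> i))) * cnj (F \<omega>) \<partial>leb I) =
      complex_of_real (f x * (sqrt (4 * pi * \<nu>) ^ card I * gconv I \<nu> f x))" if x: "x \<in> space (leb I)" for x
  proof -
    have [measurable]: "(\<lambda>\<omega>. \<Sum>i\<in>I. x i * \<omega> i) \<in> borel_measurable (leb I)" by measurable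
    have "(\<integral>\<omega>. complex_of_real (e \<omega>) * cis (- (\<Sum>i\<in>I. x i * \<omega> i)) * cnj (F \<omega>) \<partial>leb I) =
      (\<integral>\<omega>. (\<integral>y. complex_of_real (e \<omega>) * cis (- (\<Sum>i\<in>I. x i * \<omega> i)) * (complex_of_real (f y) * cis (\<Sum>i\<in>I. y i * \<omega> i)) \<partial>leb I) \<partial>leb I)"
      unfolding cnjF by simp
    also have "... = (\<integral>y. (\<integral>\<omega>. complex_of_real (e \<omega>) * cis (- (\<Sum>i\<in>I. x i * \<omega> i)) * (complex_of_real (f y) * cis (\<Sum>i\<in>I. y i * \<omega> i)) \<partial>leb I) \<partial>leb I)"
      by (rule leb_Fubini_dominated[where a=e and b="\<lambda>y. \<bar>f y\<bar>"])
         (use I e_int f in \<open>auto simp: norm_mult e0\<close>)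
    also have "... = (\<integral>y. complex_of_real (f y) * (\<integral>\<omega>. complex_of_real (e \<omega>) * cis (\<Sum>i\<in>I. \<omega> i * (y i - x i)) \<partial>leb I) \<partial>leb I)"
    proof (intro Bochner_Integration.integral_cong refl)
      fix y
      have eq: "complex_of_real (e \<omega>) * cis (- (\<Sum>i\<in>I. x i * \<omega> i)) * (complex_of_real (f y) * cis (\<Sum>i\<in>I. y i * \<omega> i)) =
         complex_of_real (f y) * (complex_of_real (e \<omega>) * cis (\<Sum>i\<in>I. \<omega> i * (y i - x i)))" for \<omega>
      proof -
        have "(\<Sum>i\<in>I. \<omega> i * (y i - x i)) = - (\<Sum>i\<in>I. x i * \<omega> i) + (\<Sum>i\<in>I. y i * \<omega> i)"
          by (simp add: right_diff_distrib sum_subtractf mult.commute)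
        then show ?thesis unfolding \<open>(\<Sum>i\<in>I. \<omega> i * (y i - x i)) = _\<close> cis_mult[symmetric] by (simp only: mult_ac)
      qed
      then show "(\<integral>\<omega>. complex_of_real (e \<omega>) * cis (- (\<Sum>i\<in>I. x i * \<omega> i)) * (complex_of_real (f y) * cis (\<Sum>i\<in>I. y i * \<omega> i)) \<partial>leb I) =
         complex_of_real (f y) * (\<integral>\<omega>. complex_of_real (e \<omega>) * cis (\<Sum>i\<in>I. \<omega> i * (y i - x i)) \<partial>leb I)"
        by (simp only: eq integral_mult_right_zero)
    qed
    also have "... = (\<integral>y. complex_of_real (sqrt (4 * pi * \<nu>) ^ card I * (gauss_kernel I \<nu> x y * f y)) \<partial>leb I)"
      unfolding e_def char_gauss_kernel[OF I] by (simp add: gauss_kernel_commute[of I \<nu> x] mult_ac)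
    also have "... = complex_of_real (sqrt (4 * pi * \<nu>) ^ card I * gconv I \<nu> f x)"
      unfolding integral_complex_of_real gconv_def by simp
    finally have *: "(\<integral>\<omega>. complex_of_real (e \<omega>) * cis (- (\<Sum>i\<in>I. x i * \<omega> i)) * cnj (F \<omega>) \<partial>leb I) =
      complex_of_real (sqrt (4 * pi * \<nu>) ^ card I * gconv I \<nu> f x)" .
    have "(\<integral>\<omega>. complex_of_real (e \<omega>) * (complex_of_real (f x) * cis (- (\<Sum>i\<in>I. x i * \<omega> i))) * cnj (F \<omega>) \<partial>leb I) =
      (\<integral>\<omega>. complex_of_real (f x) * (complex_of_real (e \<omega>) * cis (- (\<Sum>i\<in>I. x i * \<omega> i)) * cnj (F \<omega>)) \<partial>leb I)"
      by (simp only: mult_ac)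
    also have "... = complex_of_real (f x) * (\<integral>\<omega>. complex_of_real (e \<omega>) * cis (- (\<Sum>i\<in>I. x i * \<omega> i)) * cnj (F \<omega>) \<partial>leb I)"
      by simp
    finally show ?thesis unfolding * by simp
  qed
  have "complex_of_real (\<integral>\<omega>. e \<omega> * (cmod (F \<omega>))\<^sup>2 \<partial>leb I) =
    (\<integral>\<omega>. complex_of_real (e \<omega>) * F \<omega> * cnj (F \<omega>) \<partial>leb I)"
    unfolding integral_complex_of_real[symmetric]
    by (simp add: mult.assoc complex_norm_square[symmetric])
  also have "... = (\<integral>\<omega>. (\<integral>x. complex_of_real (e \<omega>) * (complex_of_real (f x) * cis (- (\<Sum>i\<in>I. x i * \<omega> i))) * cnj (F \<omega>) \<partial>leb I) \<partial>leb I)"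
    by (simp add: F_def)
  also have "... = (\<integral>x. (\<integral>\<omega>. complex_of_real (e \<omega>) * (complex_of_real (f x) * cis (- (\<Sum>i\<in>I. x i * \<omega> i))) * cnj (F \<omega>) \<partial>leb I) \<partial>leb I)"
  proof (rule leb_Fubini_dominated[where a="\<lambda>\<omega>. B * e \<omega>" and b="\<lambda>x. \<bar>f x\<bar>"])
    fix \<omega> x
    have "e \<omega> * \<bar>f x\<bar> * cmod (F \<omega>) \<le> e \<omega> * \<bar>f x\<bar> * B"
      using FB e0 by (intro mult_left_mono) auto
    then show "norm (complex_of_real (e \<omega>) * (complex_of_real (f x) * cis (- (\<Sum>i\<in>I. x i * \<omega> i))) * cnj (F \<omega>)) \<le> B * e \<omega> * \<bar>f x\<bar>"
      by (simp add: norm_mult e0 mult_ac)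
  qed (use I e_int f in auto)
  also have "... = (\<integral>x. complex_of_real (sqrt (4 * pi * \<nu>) ^ card I * (f x * gconv I \<nu> f x)) \<partial>leb I)"
    by (intro Bochner_Integration.integral_cong refl, subst inner) (simp_all add: mult_ac)
  also have "... = complex_of_real (sqrt (4 * pi * \<nu>) ^ card I * genergy I \<nu> f)"
    unfolding integral_complex_of_real genergy_def by simp
  finally have eF: "(\<integral>\<omega>. e \<omega> * (cmod (F \<omega>))\<^sup>2 \<partial>leb I) = sqrt (4 * pi * \<nu>) ^ card I * genergy I \<nu> f"
    using of_real_eq_iff by blast
  have const: "((2 * pi) powr (- real (card I) / 2))\<^sup>2 * sqrt (4 * pi * \<nu>) ^ card I = sqrt (\<nu> / pi) ^ card I"
  proof -
    have "((2 * pi) powr (- real (card I) / 2))\<^sup>2 = (2*pi) powr (- real (card I))"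
      by (simp add: power2_eq_square flip: powr_add)
    also have "... = (1 / (2*pi)) ^ card I"
      by (subst powr_minus, subst powr_realpow) (auto simp: power_one_over inverse_eq_divide)
    finally have "((2 * pi) powr (- real (card I) / 2))\<^sup>2 * sqrt (4 * pi * \<nu>) ^ card I = (1 / (2*pi) * sqrt (4 * pi * \<nu>)) ^ card I"
      by (simp only: power_mult_distrib)
    also have "1 / (2*pi) * sqrt (4 * pi * \<nu>) = sqrt (\<nu> / pi)"
    proof -
      have "sqrt (4 * pi * \<nu>) = sqrt ((2*pi)\<^sup>2 * (\<nu> / pi))" by (simp add: power2_eq_square)
      also have "... = 2 * pi * sqrt (\<nu> / pi)" by (simp only: real_sqrt_mult[of "(2*pi)\<^sup>2"] real_sqrt_abs) simp
      finally show ?thesis by simp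
    qed
    finally show ?thesis .
  qed
  show "integrable (leb I) (\<lambda>\<omega>. exp (- ((\<Sum>i\<in>I. (\<omega> i)\<^sup>2) / (4 * \<nu>))) * (cmod (fourier I f \<omega>))\<^sup>2)"
    using int integrable_mult_right[OF int, of "((2 * pi) powr (- real (card I) / 2))\<^sup>2"]
    unfolding fourier e_def by (simp add: mult_ac)
  have "(\<integral>\<omega>. exp (- ((\<Sum>i\<in>I. (\<omega> i)\<^sup>2) / (4 * \<nu>))) * (cmod (fourier I f \<omega>))\<^sup>2 \<partial>leb I) =
    (\<integral>\<omega>. ((2 * pi) powr (- real (card I) / 2))\<^sup>2 * (e \<omega> * (cmod (F \<omega>))\<^sup>2) \<partial>leb I)"
    unfolding fourier e_def by (simp only: mult_ac)
  also have "... = ((2 * pi) powr (- real (card I) / 2))\<^sup>2 * (sqrt (4 * pi * \<nu>) ^ card I * genergy I \<nu> f)"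
    by (simp add: eF)
  finally show "(\<integral>\<omega>. exp (- ((\<Sum>i\<in>I. (\<omega> i)\<^sup>2) / (4 * \<nu>))) * (cmod (fourier I f \<omega>))\<^sup>2 \<partial>leb I) =
      sqrt (\<nu> / pi) ^ card I * genergy I \<nu> f"
    unfolding const[symmetric] by simp
qed

lemma continuous_within_leb_eps:
  fixes f :: "('i::countable \<Rightarrow> real) \<Rightarrow> real"
  assumes I: "finite I" and x: "x \<in> space (leb I)"
    and cont: "continuous (at x within space (leb I)) f" and e: "0 < e"
  obtains \<delta> where "0 < \<delta>" "\<And>y. y \<in> space (leb I) \<Longrightarrow> (\<Sum>i\<in>I. (x i - y i)\<^sup>2) < \<delta> \<Longrightarrow> \<bar>f y - f x\<bar> < e"
proof (rule ccontr)
  assume "\<not> thesis"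
  then have "\<forall>n. \<exists>y. y \<in> space (leb I) \<and> (\<Sum>i\<in>I. (x i - y i)\<^sup>2) < 1 / real (Suc n) \<and> \<not> \<bar>f y - f x\<bar> < e"
    using that by (metis divide_pos_pos of_nat_0_less_iff zero_less_Suc zero_less_one)
  then obtain Y where Y: "\<And>n. Y n \<in> space (leb I)" "\<And>n. (\<Sum>i\<in>I. (x i - Y n i)\<^sup>2) < 1 / real (Suc n)"
    "\<And>n. \<not> \<bar>f (Y n) - f x\<bar> < e" by metis
  have comp: "(\<lambda>n. Y n i) \<longlonglongrightarrow> x i" for i
  proof (cases "i \<in> I")
    case True
    have "(x i - Y n i)\<^sup>2 \<le> 1 / real (Suc n)" for n
    proof -
      have "(x i - Y n i)\<^sup>2 \<le> (\<Sum>i\<in>I. (x i - Y n i)\<^sup>2)"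
        using I True by (intro member_le_sum) auto
      with Y(2)[of n] show ?thesis by linarith
    qed
    then have "(\<lambda>n. (x i - Y n i)\<^sup>2) \<longlonglongrightarrow> 0"
      by (intro tendsto_sandwich[OF _ _ tendsto_const lim_1_over_n[THEN LIMSEQ_Suc]]) (auto intro!: always_eventually)
    then have "(\<lambda>n. sqrt ((x i - Y n i)\<^sup>2)) \<longlonglongrightarrow> sqrt 0" by (intro tendsto_intros)
    then have "(\<lambda>n. \<bar>Y n i - x i\<bar>) \<longlonglongrightarrow> 0" by (simp add: abs_minus_commute)
    then show ?thesis using LIM_zero_cancel tendsto_rabs_zero_iff by blast
  next
    case False
    then have "Y n i = x i" for n
      using Y(1)[of n] x by (auto simp: leb_def space_PiM PiE_def extensional_def)
    then show ?thesis by simp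
  qed
  have "Y \<longlonglongrightarrow> x"
    using comp limitin_componentwise[of "\<lambda>_::'i. euclidean :: real topology" UNIV Y x sequentially]
    by (simp add: euclidean_product_topology)
  then have "(\<lambda>n. f (Y n)) \<longlonglongrightarrow> f x"
    using cont Y(1) by (intro continuous_within_tendsto_compose[OF cont]) auto
  then have "eventually (\<lambda>n. dist (f (Y n)) (f x) < e) sequentially"
    using e tendstoD by blast
  then show False using Y(3) by (auto simp: dist_real_def)
qed

text \<open>The mass of the normalised kernel concentrates at \<open>x\<close>. Only continuity at this one point is available, and \<open>f\<close> need
not be bounded, so the tail of \<open>f\<close> and the tail of the constant \<open>f x\<close> are estimated separately.\<close>

lemma gauss_approx_identity:
  fixes f :: "('i::countable \<Rightarrow> real) \<Rightarrow> real"
  assumes I: "finite I" and x: "x \<in> space (leb I)" and f: "integrable (leb I) f"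
    and cont: "continuous (at x within space (leb I)) f"
  shows "((\<lambda>\<nu>. sqrt (\<nu> / pi) ^ card I * gconv I \<nu> f x) \<longlongrightarrow> f x) at_top"
proof -
  define L where "L = (\<integral>y. \<bar>f y\<bar> \<partial>leb I)"
  let ?d = "card I"
  have L0: "0 \<le> L" unfolding L_def by simp
  have key: "\<bar>sqrt (\<nu> / pi) ^ ?d * gconv I \<nu> f x - f x\<bar> \<le>
       e + sqrt (\<nu> / pi) ^ ?d * exp (- (\<nu> * \<delta>)) * L + \<bar>f x\<bar> * exp (- (\<nu> * \<delta> / 2)) * sqrt 2 ^ ?d"
    if \<nu>: "0 < \<nu>" and e: "0 < e" and \<delta>: "0 < \<delta>"
      and near: "\<And>y. y \<in> space (leb I) \<Longrightarrow> (\<Sum>i\<in>I. (x i - y i)\<^sup>2) < \<delta> \<Longrightarrow> \<bar>f y - f x\<bar> < e" for \<nu> e \<delta>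
  proof -
    (* Away from x the kernel is bounded by exp (- nu delta), which is used against the integrable f, and by
       exp (- nu delta / 2) times the wider kernel ?H, which is used against the constant f x. *)
    let ?G = "gauss_kernel I \<nu> x" and ?H = "gauss_kernel I (\<nu> / 2) x"
    have iG: "integrable (leb I) ?G" "integrable (leb I) ?H" "integrable (leb I) (\<lambda>y. ?G y * f y)"
      using I x f \<nu> by (auto intro!: integrable_gauss_kernel integrable_gauss_mult)
    have K: "sqrt (\<nu> / pi) ^ ?d * sqrt (pi / \<nu>) ^ ?d = 1"
      "sqrt (\<nu> / pi) ^ ?d * sqrt (pi / (\<nu> / 2)) ^ ?d = sqrt 2 ^ ?d"
      using \<nu> by (simp_all flip: power_mult_distrib real_sqrt_mult)
    have iGG: "(\<integral>y. ?G y \<partial>leb I) = sqrt (pi / \<nu>) ^ ?d" "(\<integral>y. ?H y \<partial>leb I) = sqrt (pi / (\<nu> / 2)) ^ ?d"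
      using I \<nu> integral_gauss_kernel by (auto simp: integral_gauss_kernel simp del: divide_divide_eq_right)
    have "gconv I \<nu> f x - sqrt (pi / \<nu>) ^ ?d * f x = (\<integral>y. ?G y * f y - f x * ?G y \<partial>leb I)"
      using iG by (simp add: gconv_def iGG mult.commute)
    then have "\<bar>gconv I \<nu> f x - sqrt (pi / \<nu>) ^ ?d * f x\<bar> \<le> (\<integral>y. \<bar>?G y * f y - f x * ?G y\<bar> \<partial>leb I)"
      using integral_abs_bound by metis
    also have "... \<le> (\<integral>y. e * ?G y + exp (- (\<nu> * \<delta>)) * \<bar>f y\<bar> + \<bar>f x\<bar> * exp (- (\<nu> * \<delta> / 2)) * ?H y \<partial>leb I)"
    proof (intro integral_mono integrable_abs)
      fix y assume y: "y \<in> space (leb I)"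
      have [simp]: "0 \<le> ?G y" "0 \<le> ?H y" by auto
      show "\<bar>?G y * f y - f x * ?G y\<bar> \<le> e * ?G y + exp (- (\<nu> * \<delta>)) * \<bar>f y\<bar> + \<bar>f x\<bar> * exp (- (\<nu> * \<delta> / 2)) * ?H y"
      proof (cases "(\<Sum>i\<in>I. (x i - y i)\<^sup>2) < \<delta>")
        case True
        have "\<bar>?G y * f y - f x * ?G y\<bar> = ?G y * \<bar>f y - f x\<bar>"
        proof -
          have "?G y * f y - f x * ?G y = ?G y * (f y - f x)" by (simp add: algebra_simps)
          then show ?thesis by (simp add: abs_mult)
        qed
        also have "... \<le> ?G y * e" using near[OF y True] by (intro mult_left_mono) auto
        finally show ?thesis by (simp add: mult.commute add_increasing2)
      next
        case False
        let ?S = "\<Sum>i\<in>I. (x i - y i)\<^sup>2"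
        have G: "?G y = exp (- (\<nu> * ?S))" "?H y = exp (- (\<nu> / 2 * ?S))"
          using I by (simp_all add: gauss_kernel_sum)
        have "\<nu> * \<delta> \<le> \<nu> * ?S" using False \<nu> by (intro mult_left_mono) auto
        then have 1: "?G y \<le> exp (- (\<nu> * \<delta>))" "?G y \<le> exp (- (\<nu> * \<delta> / 2)) * ?H y"
          unfolding G exp_add[symmetric] by auto
        have "\<bar>?G y * f y - f x * ?G y\<bar> \<le> ?G y * \<bar>f y\<bar> + \<bar>f x\<bar> * ?G y"
          by (rule order_trans[OF abs_triangle_ineq4]) (simp add: abs_mult)
        also have "... \<le> exp (- (\<nu> * \<delta>)) * \<bar>f y\<bar> + \<bar>f x\<bar> * (exp (- (\<nu> * \<delta> / 2)) * ?H y)"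
          by (intro add_mono mult_left_mono mult_right_mono 1) auto
        moreover have "0 \<le> e * ?G y" using e by simp
        ultimately show ?thesis unfolding mult.assoc by linarith
      qed
    qed (use iG f in auto)
    also have "... = e * sqrt (pi / \<nu>) ^ ?d + exp (- (\<nu> * \<delta>)) * L + \<bar>f x\<bar> * exp (- (\<nu> * \<delta> / 2)) * sqrt (pi / (\<nu> / 2)) ^ ?d"
      using iG f by (simp add: iGG L_def)
    finally have "sqrt (\<nu> / pi) ^ ?d * \<bar>gconv I \<nu> f x - sqrt (pi / \<nu>) ^ ?d * f x\<bar> \<le>
      sqrt (\<nu> / pi) ^ ?d * (e * sqrt (pi / \<nu>) ^ ?d + exp (- (\<nu> * \<delta>)) * L + \<bar>f x\<bar> * exp (- (\<nu> * \<delta> / 2)) * sqrt (pi / (\<nu> / 2)) ^ ?d)"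
      using \<nu> by (intro mult_left_mono) auto
    also have "... = e * (sqrt (\<nu> / pi) ^ ?d * sqrt (pi / \<nu>) ^ ?d) + sqrt (\<nu> / pi) ^ ?d * exp (- (\<nu> * \<delta>)) * L +
        \<bar>f x\<bar> * exp (- (\<nu> * \<delta> / 2)) * (sqrt (\<nu> / pi) ^ ?d * sqrt (pi / (\<nu> / 2)) ^ ?d)"
      by (simp only: distrib_left mult_ac)
    finally have A: "sqrt (\<nu> / pi) ^ ?d * \<bar>gconv I \<nu> f x - sqrt (pi / \<nu>) ^ ?d * f x\<bar> \<le>
      e + sqrt (\<nu> / pi) ^ ?d * exp (- (\<nu> * \<delta>)) * L + \<bar>f x\<bar> * exp (- (\<nu> * \<delta> / 2)) * sqrt 2 ^ ?d"
      unfolding K by simp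
    have "sqrt (\<nu> / pi) ^ ?d * \<bar>gconv I \<nu> f x - sqrt (pi / \<nu>) ^ ?d * f x\<bar> =
      \<bar>sqrt (\<nu> / pi) ^ ?d * (gconv I \<nu> f x - sqrt (pi / \<nu>) ^ ?d * f x)\<bar>"
      using \<nu> by (simp add: abs_mult)
    also have "sqrt (\<nu> / pi) ^ ?d * (gconv I \<nu> f x - sqrt (pi / \<nu>) ^ ?d * f x) =
       sqrt (\<nu> / pi) ^ ?d * gconv I \<nu> f x - (sqrt (\<nu> / pi) ^ ?d * sqrt (pi / \<nu>) ^ ?d) * f x"
      by (simp only: right_diff_distrib mult.assoc)
    finally show ?thesis using A unfolding K by simp
  qed
  have lim: "((\<lambda>\<nu>. sqrt (\<nu> / pi) ^ ?d * exp (- (\<nu> * \<delta>)) * L + \<bar>f x\<bar> * exp (- (\<nu> * \<delta> / 2)) * sqrt 2 ^ ?d) \<longlongrightarrow> 0) at_top"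
    if \<delta>: "0 < \<delta>" for \<delta>
  proof -
    have t: "filterlim (\<lambda>\<nu>. \<nu> * \<delta>) at_top at_top"
      using \<delta> by (intro filterlim_at_top_mult_tendsto_pos[OF tendsto_const _ filterlim_ident])
    have t2: "filterlim (\<lambda>\<nu>. \<nu> * (\<delta> / 2)) at_top at_top"
      using \<delta> by (intro filterlim_at_top_mult_tendsto_pos[OF tendsto_const _ filterlim_ident]) auto
    have "((\<lambda>\<nu>. (\<nu> * \<delta>) ^ ?d / exp (\<nu> * \<delta>)) \<longlongrightarrow> 0) at_top"
      by (rule filterlim_compose[OF tendsto_power_div_exp_0 t])
    then have 1: "((\<lambda>\<nu>. (1 / \<delta>) ^ ?d * ((\<nu> * \<delta>) ^ ?d / exp (\<nu> * \<delta>))) \<longlongrightarrow> (1 / \<delta>) ^ ?d * 0) at_top"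
      by (intro tendsto_intros)
    have 2: "((\<lambda>\<nu>. sqrt (\<nu> / pi) ^ ?d * exp (- (\<nu> * \<delta>))) \<longlongrightarrow> 0) at_top"
    proof (rule tendsto_sandwich[OF _ _ tendsto_const])
      show "((\<lambda>\<nu>. (1 / \<delta>) ^ ?d * ((\<nu> * \<delta>) ^ ?d / exp (\<nu> * \<delta>))) \<longlongrightarrow> 0) at_top" using 1 by simp
      show "\<forall>\<^sub>F \<nu> in at_top. sqrt (\<nu> / pi) ^ ?d * exp (- (\<nu> * \<delta>)) \<le> (1 / \<delta>) ^ ?d * ((\<nu> * \<delta>) ^ ?d / exp (\<nu> * \<delta>))"
        using eventually_ge_at_top[of 1]
      proof eventually_elim
        case (elim \<nu>)
        have "sqrt (\<nu> / pi) \<le> \<nu>"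
        proof (rule real_le_lsqrt)
          have "\<nu> / pi \<le> \<nu> * 1" using elim pi_ge_two by (simp add: divide_simps mult_le_cancel_left1)
          also have "... \<le> \<nu> * \<nu>" using elim by (intro mult_left_mono) auto
          finally show "\<nu> / pi \<le> \<nu>\<^sup>2" by (simp add: power2_eq_square)
        qed (use elim in auto)
        then have "sqrt (\<nu> / pi) ^ ?d \<le> \<nu> ^ ?d" using elim by (intro power_mono) auto
        then have "sqrt (\<nu> / pi) ^ ?d * exp (- (\<nu> * \<delta>)) \<le> \<nu> ^ ?d * exp (- (\<nu> * \<delta>))" by (intro mult_right_mono) auto
        then show ?case using \<delta> by (simp add: power_mult_distrib power_divide exp_minus field_simps)
      qed
      show "\<forall>\<^sub>F \<nu> in at_top. 0 \<le> sqrt (\<nu> / pi) ^ ?d * exp (- (\<nu> * \<delta>))"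
        using eventually_ge_at_top[of 0] by eventually_elim auto
    qed
    have 3: "((\<lambda>\<nu>. exp (- (\<nu> * (\<delta> / 2)))) \<longlongrightarrow> 0) at_top"
      by (intro filterlim_compose[OF exp_at_bot] filterlim_compose[OF filterlim_uminus_at_bot_at_top] t2)
    show ?thesis
      using tendsto_add[OF tendsto_mult_right[OF 2, of L] tendsto_mult_right[OF tendsto_mult_left[OF 3, of "\<bar>f x\<bar>"], of "sqrt 2 ^ ?d"]]
      by simp
  qed
  show ?thesis
  proof (rule tendstoI)
    fix e :: real assume e: "0 < e"
    obtain \<delta> where \<delta>: "0 < \<delta>" "\<And>y. y \<in> space (leb I) \<Longrightarrow> (\<Sum>i\<in>I. (x i - y i)\<^sup>2) < \<delta> \<Longrightarrow> \<bar>f y - f x\<bar> < e / 2"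
      using continuous_within_leb_eps[OF I x cont, of "e/2"] e by auto
    have "\<forall>\<^sub>F \<nu> in at_top. sqrt (\<nu> / pi) ^ ?d * exp (- (\<nu> * \<delta>)) * L + \<bar>f x\<bar> * exp (- (\<nu> * \<delta> / 2)) * sqrt 2 ^ ?d < e / 2"
      using e by (intro order_tendstoD(2)[OF lim[OF \<delta>(1)]]) auto
    then show "\<forall>\<^sub>F \<nu> in at_top. dist (sqrt (\<nu> / pi) ^ ?d * gconv I \<nu> f x) (f x) < e"
      using eventually_gt_at_top[of 0]
    proof eventually_elim
      case (elim \<nu>)
      have "0 < e / 2" using e by simp
      from key[OF elim(2) this \<delta>] elim(1) show ?case
        unfolding dist_real_def by linarith
    qed
  qed
qed

text \<open>The inequality of Plancherel's theorem that is needed. Almost everywhere, \<open>f\<close> is the limit of its Gaussian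
regularisations by continuity; their squared norms are weighted Parseval integrals, hence bounded by the unweighted one,
and Fatou's lemma passes to the limit.\<close>

lemma Plancherel_le:
  fixes f :: "('i::countable \<Rightarrow> real) \<Rightarrow> real"
  assumes I: "finite I" and f: "integrable (leb I) f"
    and cont: "AE x in leb I. continuous (at x within space (leb I)) f"
    and F2: "integrable (leb I) (\<lambda>\<omega>. (cmod (fourier I f \<omega>))\<^sup>2)"
  shows "integrable (leb I) (\<lambda>x. (f x)\<^sup>2)"
    and "(\<integral>x. (f x)\<^sup>2 \<partial>leb I) \<le> (\<integral>\<omega>. (cmod (fourier I f \<omega>))\<^sup>2 \<partial>leb I)"
proof -
  have [measurable]: "f \<in> borel_measurable (leb I)" using f by auto
  let ?P = "\<integral>\<omega>. (cmod (fourier I f \<omega>))\<^sup>2 \<partial>leb I"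
  define g where "g n x = sqrt (2 * real (Suc n) / pi) ^ card I * gconv I (2 * real (Suc n)) f x" for n x
  have g2: "(\<integral>\<^sup>+x. ennreal ((g n x)\<^sup>2) \<partial>leb I) \<le> ennreal ?P" for n
  proof -
    define \<nu> where "\<nu> = real (Suc n)"
    have \<nu>: "0 < \<nu>" by (simp add: \<nu>_def)
    let ?c = "sqrt (2 * \<nu> / pi) ^ card I"
    have int: "integrable (leb I) (\<lambda>x. ?c\<^sup>2 * (gconv I (2 * \<nu>) f x)\<^sup>2)"
      using I f \<nu> by (intro integrable_mult_right integrable_gconv_square) auto
    have "(\<integral>\<^sup>+x. ennreal ((g n x)\<^sup>2) \<partial>leb I) = (\<integral>\<^sup>+x. ennreal (?c\<^sup>2 * (gconv I (2 * \<nu>) f x)\<^sup>2) \<partial>leb I)"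
      by (simp add: g_def \<nu>_def power_mult_distrib)
    also have "... = ennreal (\<integral>x. ?c\<^sup>2 * (gconv I (2 * \<nu>) f x)\<^sup>2 \<partial>leb I)"
      by (rule nn_integral_eq_integral[OF int]) auto
    also have "(\<integral>x. ?c\<^sup>2 * (gconv I (2 * \<nu>) f x)\<^sup>2 \<partial>leb I) = ?c\<^sup>2 * (\<integral>x. (gconv I (2 * \<nu>) f x)\<^sup>2 \<partial>leb I)"
      by simp
    also have "?c\<^sup>2 = sqrt (\<nu> / pi) ^ card I * sqrt (4 * \<nu> / pi) ^ card I"
    proof -
      have "sqrt (2 * \<nu> / pi) * sqrt (2 * \<nu> / pi) = sqrt (\<nu> / pi) * sqrt (4 * \<nu> / pi)"
        unfolding real_sqrt_mult[symmetric] by (rule arg_cong[where f=sqrt]) (simp add: field_simps)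
      then show ?thesis by (simp only: power2_eq_square flip: power_mult_distrib)
    qed
    also have "sqrt (\<nu> / pi) ^ card I * sqrt (4 * \<nu> / pi) ^ card I * (\<integral>x. (gconv I (2 * \<nu>) f x)\<^sup>2 \<partial>leb I) =
       sqrt (\<nu> / pi) ^ card I * genergy I \<nu> f"
      using genergy_eq_square[OF I \<nu> f] by simp
    also have "... = (\<integral>\<omega>. exp (- ((\<Sum>i\<in>I. (\<omega> i)\<^sup>2) / (4 * \<nu>))) * (cmod (fourier I f \<omega>))\<^sup>2 \<partial>leb I)"
      using fourier_gauss_energy(2)[OF I \<nu> f] by simp
    also have "... \<le> ?P"
      using \<nu> by (intro integral_mono fourier_gauss_energy(1)[OF I \<nu> f] F2)
        (auto intro!: mult_left_le_one_le divide_nonneg_nonneg sum_nonneg)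
    finally show ?thesis by (simp add: ennreal_leI)
  qed
  have lim: "AE x in leb I. (f x)\<^sup>2 = liminf (\<lambda>n. ennreal ((g n x)\<^sup>2))"
    using cont AE_space
  proof eventually_elim
    case (elim x)
    have "filterlim (\<lambda>n. 2 * real (Suc n)) at_top sequentially"
      by (intro filterlim_tendsto_pos_mult_at_top[OF tendsto_const] filterlim_compose[OF filterlim_real_sequentially] filterlim_Suc) auto
    then have "(\<lambda>n. g n x) \<longlonglongrightarrow> f x"
      unfolding g_def by (rule filterlim_compose[OF gauss_approx_identity[OF I elim(2) f elim(1)]])
    then have "(\<lambda>n. ennreal ((g n x)\<^sup>2)) \<longlonglongrightarrow> ennreal ((f x)\<^sup>2)"
      by (intro tendsto_ennrealI tendsto_intros)
    from lim_imp_Liminf[OF _ this] show ?case by simp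
  qed
  have [measurable]: "g n \<in> borel_measurable (leb I)" for n
    unfolding g_def[abs_def] using I by measurable
  have "(\<integral>\<^sup>+x. ennreal ((f x)\<^sup>2) \<partial>leb I) = (\<integral>\<^sup>+x. liminf (\<lambda>n. ennreal ((g n x)\<^sup>2)) \<partial>leb I)"
    using lim by (intro nn_integral_cong_AE) auto
  also have "... \<le> liminf (\<lambda>n. \<integral>\<^sup>+x. ennreal ((g n x)\<^sup>2) \<partial>leb I)"
    by (rule nn_integral_liminf) measurable
  also have "... \<le> ennreal ?P"
    using g2 by (intro order_trans[OF Liminf_mono Liminf_const[THEN eq_refl]]) (auto simp: always_eventually)
  finally have le: "(\<integral>\<^sup>+x. ennreal ((f x)\<^sup>2) \<partial>leb I) \<le> ennreal ?P" .
  then show int: "integrable (leb I) (\<lambda>x. (f x)\<^sup>2)"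
    by (intro integrableI_nonneg) (auto simp: le_less_trans[OF _ ennreal_less_top])
  have "ennreal (\<integral>x. (f x)\<^sup>2 \<partial>leb I) \<le> ennreal ?P"
    using le nn_integral_eq_integral[OF int] by simp
  moreover have "0 \<le> ?P" by (intro Bochner_Integration.integral_nonneg) auto
  ultimately show "(\<integral>x. (f x)\<^sup>2 \<partial>leb I) \<le> ?P"
    by (simp add: ennreal_le_iff)
qed

text \<open>The bias of the kernel. Frequencies \<open>|\<omega>|\<^sup>2 \<le> \<nu>\<close> lose at most a factor \<open>exp (- 1 / 4)\<close> in the Gaussian weight; on the
others the Sobolev weight exceeds \<open>\<nu>\<^sup>s\<close>, so subtracting \<open>\<nu>\<^sup>-\<^sup>s\<close> times the squared Sobolev norm makes the integrand
on the left nonpositive there.\<close>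

lemma genergy_lower_bound:
  fixes f :: "('i::countable \<Rightarrow> real) \<Rightarrow> real"
  assumes I: "finite I" and \<nu>: "0 < \<nu>" and s: "0 < s" and f: "f \<in> sobolev I s"
  shows "integrable (leb I) (\<lambda>x. (f x)\<^sup>2)"
    and "(\<integral>x. (f x)\<^sup>2 \<partial>leb I) \<le> (sobolev_norm I s f)\<^sup>2"
    and "sqrt (pi / \<nu>) ^ card I * exp (- 1 / 4) * ((\<integral>x. (f x)\<^sup>2 \<partial>leb I) - \<nu> powr (- s) * (sobolev_norm I s f)\<^sup>2)
      \<le> genergy I \<nu> f"
proof -
  have fi: "integrable (leb I) f" and cont: "AE x in leb I. continuous (at x within space (leb I)) f"
    and S: "integrable (leb I) (sobolev_density I s f)"
    using f by (auto simp: sobolev_def)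
  have [measurable]: "f \<in> borel_measurable (leb I)" using fi by auto
  have S0: "0 \<le> sobolev_density I s f \<omega>" for \<omega> by (simp add: sobolev_density_def)
  have N: "(sobolev_norm I s f)\<^sup>2 = (\<integral>\<omega>. sobolev_density I s f \<omega> \<partial>leb I)"
    unfolding sobolev_norm_def using S0 by (subst real_sqrt_pow2) (auto intro!: Bochner_Integration.integral_nonneg)
  have w: "1 \<le> (1 + (L2_set \<omega> I)\<^sup>2) powr s" for \<omega> :: "'i \<Rightarrow> real"
    using s by (intro ge_one_powr_ge_zero) auto
  have le: "(cmod (fourier I f \<omega>))\<^sup>2 \<le> sobolev_density I s f \<omega>" for \<omega>
    using mult_right_mono[OF w[of \<omega>], of "(cmod (fourier I f \<omega>))\<^sup>2"] by (simp add: sobolev_density_def)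
  have F2: "integrable (leb I) (\<lambda>\<omega>. (cmod (fourier I f \<omega>))\<^sup>2)"
    using I le by (intro Bochner_Integration.integrable_bound[OF S]) (auto simp: S0)
  note P = Plancherel_le[OF I fi cont F2]
  show "integrable (leb I) (\<lambda>x. (f x)\<^sup>2)" by (rule P)
  have "(\<integral>\<omega>. (cmod (fourier I f \<omega>))\<^sup>2 \<partial>leb I) \<le> (sobolev_norm I s f)\<^sup>2"
    unfolding N using F2 S le by (intro integral_mono) auto
  with P(2) show "(\<integral>x. (f x)\<^sup>2 \<partial>leb I) \<le> (sobolev_norm I s f)\<^sup>2" by linarith
  have pt: "exp (- 1 / 4) * (F - \<nu> powr (- s) * ((1 + r) powr s * F)) \<le> exp (- (r / (4 * \<nu>))) * F"
    if "0 \<le> r" "0 \<le> F" for r F :: real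
  proof -
    have "exp (- 1 / 4) * (1 - \<nu> powr (- s) * (1 + r) powr s) \<le> exp (- (r / (4 * \<nu>)))"
    proof (cases "r \<le> \<nu>")
      case True
      then have "exp (- 1 / 4) \<le> exp (- (r / (4 * \<nu>)))" using \<nu> by (simp add: field_simps)
      moreover have "exp (- 1 / 4) * (1 - \<nu> powr (- s) * (1 + r) powr s) \<le> exp (- 1/4) * (1::real)"
        by (intro mult_left_mono) auto
      ultimately show ?thesis by linarith
    next
      case False
      then have "1 = \<nu> powr (- s) * \<nu> powr s" using \<nu> by (simp flip: powr_add)
      also have "... \<le> \<nu> powr (- s) * (1 + r) powr s"
        using False \<nu> s by (intro mult_left_mono powr_mono2) auto
      finally have "exp (- 1 / 4) * (1 - \<nu> powr (- s) * (1 + r) powr s) \<le> (0::real)"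
        by (intro mult_nonneg_nonpos) auto
      then show ?thesis by (rule order_trans) simp
    qed
    from mult_right_mono[OF this \<open>0 \<le> F\<close>] show ?thesis by (simp add: algebra_simps)
  qed
  have "exp (- 1 / 4) * ((\<integral>\<omega>. (cmod (fourier I f \<omega>))\<^sup>2 \<partial>leb I) - \<nu> powr (- s) * (sobolev_norm I s f)\<^sup>2) =
    (\<integral>\<omega>. exp (- 1 / 4) * ((cmod (fourier I f \<omega>))\<^sup>2 - \<nu> powr (- s) * sobolev_density I s f \<omega>) \<partial>leb I)"
    unfolding N using F2 S by simp
  also have "... \<le> (\<integral>\<omega>. exp (- ((\<Sum>i\<in>I. (\<omega> i)\<^sup>2) / (4 * \<nu>))) * (cmod (fourier I f \<omega>))\<^sup>2 \<partial>leb I)"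
  proof (rule integral_mono)
    fix \<omega>
    show "exp (- 1 / 4) * ((cmod (fourier I f \<omega>))\<^sup>2 - \<nu> powr (- s) * sobolev_density I s f \<omega>) \<le>
      exp (- ((\<Sum>i\<in>I. (\<omega> i)\<^sup>2) / (4 * \<nu>))) * (cmod (fourier I f \<omega>))\<^sup>2"
      using pt[of "\<Sum>i\<in>I. (\<omega> i)\<^sup>2" "(cmod (fourier I f \<omega>))\<^sup>2"]
      by (simp add: sobolev_density_def L2_set_def sum_nonneg)
  next
    show "integrable (leb I) (\<lambda>\<omega>. exp (- 1 / 4) * ((cmod (fourier I f \<omega>))\<^sup>2 - \<nu> powr (- s) * sobolev_density I s f \<omega>))"
      using F2 S by (intro integrable_mult_right Bochner_Integration.integrable_diff)
  qed (rule fourier_gauss_energy(1)[OF I \<nu> fi])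
  also have "... = sqrt (\<nu> / pi) ^ card I * genergy I \<nu> f"
    by (rule fourier_gauss_energy(2)[OF I \<nu> fi])
  finally have main: "exp (- 1 / 4) * ((\<integral>\<omega>. (cmod (fourier I f \<omega>))\<^sup>2 \<partial>leb I) - \<nu> powr (- s) * (sobolev_norm I s f)\<^sup>2) \<le>
     sqrt (\<nu> / pi) ^ card I * genergy I \<nu> f" .
  have K: "sqrt (pi / \<nu>) ^ card I * sqrt (\<nu> / pi) ^ card I = 1"
    using \<nu> by (simp flip: power_mult_distrib real_sqrt_mult)
  have "sqrt (pi / \<nu>) ^ card I * (exp (- 1 / 4) * ((\<integral>x. (f x)\<^sup>2 \<partial>leb I) - \<nu> powr (- s) * (sobolev_norm I s f)\<^sup>2)) \<le>
    sqrt (pi / \<nu>) ^ card I * (sqrt (\<nu> / pi) ^ card I * genergy I \<nu> f)"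
    using \<nu> P(2) by (intro mult_left_mono order_trans[OF _ main] diff_right_mono) auto
  then show "sqrt (pi / \<nu>) ^ card I * exp (- 1 / 4) * ((\<integral>x. (f x)\<^sup>2 \<partial>leb I) - \<nu> powr (- s) * (sobolev_norm I s f)\<^sup>2)
      \<le> genergy I \<nu> f"
    unfolding mult.assoc[symmetric] K by simp
qed

section \<open>U-statistics and their Hoeffding decomposition\<close>

text \<open>A U-statistic averages a kernel \<open>h\<close> over all ways of filling its argument slots, indexed by \<open>J\<close>, with distinct
observations. Arbitrary finite index sets allow kernels whose slots have a structure of their own; \<open>hproj\<close> is the first
Hoeffding projection onto one slot.\<close>

definition inj_tuples :: "'j set \<Rightarrow> nat \<Rightarrow> ('j \<Rightarrow> nat) set" where
  "inj_tuples J n = {\<sigma> \<in> J \<rightarrow>\<^sub>E {..<n}. inj_on \<sigma> J}"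

definition pull :: "'j set \<Rightarrow> ('j \<Rightarrow> 'l) \<Rightarrow> ('l \<Rightarrow> 'a) \<Rightarrow> 'j \<Rightarrow> 'a" where
  "pull J \<sigma> X = (\<lambda>j\<in>J. X (\<sigma> j))"

definition ustat :: "'j set \<Rightarrow> nat \<Rightarrow> (('j \<Rightarrow> 'a) \<Rightarrow> real) \<Rightarrow> (nat \<Rightarrow> 'a) \<Rightarrow> real" where
  "ustat J n h X = (\<Sum>\<sigma>\<in>inj_tuples J n. h (pull J \<sigma> X)) / card (inj_tuples J n)"

definition hproj :: "'a measure \<Rightarrow> 'j set \<Rightarrow> (('j \<Rightarrow> 'a) \<Rightarrow> real) \<Rightarrow> 'j \<Rightarrow> 'a \<Rightarrow> real" where
  "hproj M J h a x = (\<integral>y. h (y(a := x)) \<partial>PiM (J - {a}) (\<lambda>_. M))"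

lemma finite_inj_tuples: "finite J \<Longrightarrow> finite (inj_tuples J n)"
  unfolding inj_tuples_def by (rule finite_subset[of _ "J \<rightarrow>\<^sub>E {..<n}"]) (auto intro: finite_PiE)

lemma card_inj_tuples: "finite J \<Longrightarrow> card (inj_tuples J n) = (\<Prod>i<card J. n - i)"
  unfolding inj_tuples_def using card_inj_on_subset_funcset[of J "{..<n}" J]
  by (simp add: atLeast0LessThan)

lemma card_inj_tuples_ge:
  assumes "finite J" "2 * card J \<le> n"
  shows "(real n / 2) ^ card J \<le> real (card (inj_tuples J n))"
proof -
  have "(real n / 2) ^ card J = (\<Prod>i<card J. real n / 2)" by simp
  also have "... \<le> (\<Prod>i<card J. real (n - i))"
  proof (rule prod_mono, intro conjI)
    fix i assume "i \<in> {..<card J}"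
    then have "2 * i \<le> n" using assms by simp
    then show "real n / 2 \<le> real (n - i)" by (simp add: of_nat_diff)
  qed simp
  finally show ?thesis unfolding card_inj_tuples[OF assms(1)] of_nat_prod .
qed

text \<open>By symmetry each observation is equally often in the slot \<open>a\<close>. The symmetry is realised by the cyclic shifts of the
observations.\<close>

lemma sum_inj_tuples_component:
  assumes J: "finite J" "a \<in> J"
  shows "real n * (\<Sum>\<sigma>\<in>inj_tuples J n. \<phi> (\<sigma> a)) = real (card (inj_tuples J n)) * (\<Sum>i<n. \<phi> i :: real)"
proof -
  let ?sh = "\<lambda>t \<sigma>. \<lambda>j\<in>J. (\<sigma> j + t) mod n"
  have inj_mod: "i = j" if "(i + t) mod n = (j + t) mod n" "i < n" "j < n" for i j t
  proof -
    obtain q r where "i + t + n * q = j + t + n * r" using \<open>(i + t) mod n = (j + t) mod n\<close> by (auto simp: nat_mod_eq_iff)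
    then have "i mod n = j mod n" unfolding nat_mod_eq_iff by (intro exI[of _ q] exI[of _ r]) simp
    then show ?thesis using \<open>i < n\<close> \<open>j < n\<close> by simp
  qed
  have shift: "bij_betw (\<lambda>i. (i + t) mod n) {..<n} {..<n}" for t
  proof -
    have i: "inj_on (\<lambda>i. (i + t) mod n) {..<n}"
    proof (rule inj_onI)
      fix i j assume ij: "i \<in> {..<n}" "j \<in> {..<n}" "(i + t) mod n = (j + t) mod n"
      show "i = j" by (rule inj_mod[OF ij(3)]) (use ij(1,2) in \<open>simp_all only: lessThan_iff\<close>)
    qed
    moreover have "(\<lambda>i. (i + t) mod n) ` {..<n} = {..<n}"
    proof (rule endo_inj_surj[OF _ _ i])
      show "(\<lambda>i. (i + t) mod n) ` {..<n} \<subseteq> {..<n}"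
      proof clarify
        fix i assume "i < n"
        then show "(i + t) mod n < n" by (intro mod_less_divisor) linarith
      qed
    qed simp
    ultimately show ?thesis by (simp add: bij_betw_def)
  qed
  have bij: "bij_betw (?sh t) (inj_tuples J n) (inj_tuples J n)" for t
  proof -
    have i: "inj_on (?sh t) (inj_tuples J n)"
    proof (rule inj_onI)
      fix \<sigma> \<tau> assume st: "\<sigma> \<in> inj_tuples J n" "\<tau> \<in> inj_tuples J n" "?sh t \<sigma> = ?sh t \<tau>"
      show "\<sigma> = \<tau>"
      proof (rule PiE_ext)
        show "\<sigma> \<in> J \<rightarrow>\<^sub>E {..<n}" "\<tau> \<in> J \<rightarrow>\<^sub>E {..<n}" using st by (auto simp: inj_tuples_def)
        fix j assume j: "j \<in> J"
        then have "(\<sigma> j + t) mod n = (\<tau> j + t) mod n" using fun_cong[OF st(3), of j] by simp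
        moreover have "\<sigma> j < n" "\<tau> j < n" using st(1,2) j by (auto simp: inj_tuples_def PiE_iff)
        ultimately show "\<sigma> j = \<tau> j" by (rule inj_mod)
      qed
    qed
    moreover have "?sh t ` inj_tuples J n \<subseteq> inj_tuples J n"
    proof (clarify)
      fix \<sigma> assume s: "\<sigma> \<in> inj_tuples J n"
      have "inj_on (?sh t \<sigma>) J"
      proof (rule inj_onI)
        fix i j assume ij: "i \<in> J" "j \<in> J" "?sh t \<sigma> i = ?sh t \<sigma> j"
        then have "(\<sigma> i + t) mod n = (\<sigma> j + t) mod n" by simp
        moreover have "\<sigma> i < n" "\<sigma> j < n" using s ij(1,2) by (auto simp: inj_tuples_def PiE_iff)
        ultimately have "\<sigma> i = \<sigma> j" by (rule inj_mod)
        then show "i = j" using s ij by (auto simp: inj_tuples_def inj_on_def)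
      qed
      moreover have "(\<sigma> j + t) mod n < n" if "j \<in> J" for j
      proof -
        have "\<sigma> j < n" using s that by (auto simp: inj_tuples_def PiE_iff)
        then show ?thesis by (intro mod_less_divisor) linarith
      qed
      ultimately show "?sh t \<sigma> \<in> inj_tuples J n" by (auto simp: inj_tuples_def)
    qed
    ultimately show ?thesis
      using endo_inj_surj[OF finite_inj_tuples[OF J(1)]] by (auto simp: bij_betw_def)
  qed
  have "(\<Sum>\<sigma>\<in>inj_tuples J n. \<phi> (\<sigma> a)) = (\<Sum>\<sigma>\<in>inj_tuples J n. \<phi> ((\<sigma> a + t) mod n))" for t
    using sum.reindex_bij_betw[OF bij[of t], of "\<lambda>\<sigma>. \<phi> (\<sigma> a)"] J(2) by simp
  note shifted = this
  have "real n * (\<Sum>\<sigma>\<in>inj_tuples J n. \<phi> (\<sigma> a)) = (\<Sum>t<n. \<Sum>\<sigma>\<in>inj_tuples J n. \<phi> (\<sigma> a))" by simp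
  also have "... = (\<Sum>t<n. \<Sum>\<sigma>\<in>inj_tuples J n. \<phi> ((\<sigma> a + t) mod n))"
    by (rule sum.cong[OF refl], rule shifted)
  also have "... = (\<Sum>\<sigma>\<in>inj_tuples J n. \<Sum>t<n. \<phi> ((t + \<sigma> a) mod n))"
    by (subst sum.swap) (simp add: add.commute)
  also have "... = (\<Sum>\<sigma>\<in>inj_tuples J n. \<Sum>i<n. \<phi> i)"
    by (intro sum.cong refl sum.reindex_bij_betw shift)
  finally show ?thesis by simp
qed

text \<open>Sharing two observations fixes two slots of \<open>\<tau>\<close>: there are at most \<open>(card J)\<^sup>4\<close> ways to choose the slots and their
values, and \<open>n\<close> values for each of the remaining slots. Hence a fraction of order \<open>1/n\<^sup>2\<close> of the pairs of tuples.\<close>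

lemma card_overlapping_inj_tuples:
  assumes J: "finite J" and n: "2 * card J \<le> n" "0 < n" and \<sigma>: "\<sigma> \<in> inj_tuples J n"
  shows "real (card {\<tau> \<in> inj_tuples J n. 1 < card (\<sigma> ` J \<inter> \<tau> ` J)}) \<le>
    real (card J) ^ 4 * 2 ^ card J / (real n)\<^sup>2 * real (card (inj_tuples J n))"
proof -
  let ?m = "card J"
  define Q where "Q = {(b, b', u, u'). b \<in> J \<and> b' \<in> J \<and> b \<noteq> b' \<and> u \<in> \<sigma> ` J \<and> u' \<in> \<sigma> ` J}"
  define T where "T = (\<lambda>(b, b', u, u'). PiE J (\<lambda>j. if j = b then {u} else if j = b' then {u'} else {..<n}))"
  have Qsub: "Q \<subseteq> J \<times> J \<times> \<sigma> ` J \<times> \<sigma> ` J" by (auto simp: Q_def)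
  have Qfin: "finite Q" by (rule finite_subset[OF Qsub]) (use J in simp)
  have "card Q \<le> ?m * (?m * (card (\<sigma> ` J) * card (\<sigma> ` J)))"
    using card_mono[OF _ Qsub] J by (simp add: card_cartesian_product)
  also have "... \<le> ?m * (?m * (?m * ?m))"
    using card_image_le[OF J, of \<sigma>] by (intro mult_le_mono) auto
  finally have Qcard: "card Q \<le> ?m ^ 4" by (simp add: eval_nat_numeral mult_ac)
  have Tcard: "card (T q) = n ^ (?m - 2)" if q0: "q \<in> Q" for q
  proof -
    obtain b b' u u' where q: "q = (b, b', u, u')" "b \<in> J" "b' \<in> J" "b \<noteq> b'"
      using q0 by (auto simp: Q_def)
    have "card (T q) = (\<Prod>j\<in>J. card (if j = b then {u} else if j = b' then {u'} else {..<n}))"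
      using J by (simp add: T_def q card_PiE)
    also have "... = (\<Prod>j\<in>J - {b, b'}. n)"
      using J q by (intro prod.mono_neutral_cong_right) auto
    also have "... = n ^ (?m - 2)"
      using J q by (simp add: card_Diff_subset numeral_2_eq_2)
    finally show ?thesis .
  qed
  have "{\<tau> \<in> inj_tuples J n. 1 < card (\<sigma> ` J \<inter> \<tau> ` J)} \<subseteq> (\<Union>q\<in>Q. T q)"
  proof
    fix \<tau> assume \<tau>: "\<tau> \<in> {\<tau> \<in> inj_tuples J n. 1 < card (\<sigma> ` J \<inter> \<tau> ` J)}"
    then have "\<not> card (\<sigma> ` J \<inter> \<tau> ` J) \<le> Suc 0" by simp
    moreover have "finite (\<sigma> ` J \<inter> \<tau> ` J)" using J by simp
    ultimately obtain u u' where u: "u \<in> \<sigma> ` J \<inter> \<tau> ` J" "u' \<in> \<sigma> ` J \<inter> \<tau> ` J" "u \<noteq> u'"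
      using card_le_Suc0_iff_eq by blast
    then obtain b b' where b: "b \<in> J" "b' \<in> J" "u = \<tau> b" "u' = \<tau> b'" by auto
    with u \<tau> have "(b, b', u, u') \<in> Q" "\<tau> \<in> T (b, b', u, u')"
      by (auto simp: Q_def T_def inj_tuples_def PiE_iff)
    then show "\<tau> \<in> (\<Union>q\<in>Q. T q)" by blast
  qed
  then have "card {\<tau> \<in> inj_tuples J n. 1 < card (\<sigma> ` J \<inter> \<tau> ` J)} \<le> card (\<Union>q\<in>Q. T q)"
    using Qfin J by (intro card_mono) (auto simp: T_def intro!: finite_PiE)
  also have "... \<le> (\<Sum>q\<in>Q. card (T q))" by (rule card_UN_le[OF Qfin])
  also have "... = card Q * n ^ (?m - 2)" using Tcard by simp
  finally have A: "card {\<tau> \<in> inj_tuples J n. 1 < card (\<sigma> ` J \<inter> \<tau> ` J)} \<le> card Q * n ^ (?m - 2)" .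
  show ?thesis
  proof (cases "?m < 2")
    case True
    then have "Q = {}" using card_le_Suc0_iff_eq[OF J] by (auto simp: Q_def)
    then show ?thesis using A by simp
  next
    case False
    have "real (card {\<tau> \<in> inj_tuples J n. 1 < card (\<sigma> ` J \<inter> \<tau> ` J)}) \<le> real (card Q * n ^ (?m - 2))"
      using A by (rule of_nat_mono)
    also have "... \<le> real ?m ^ 4 * real n ^ (?m - 2)"
      using Qcard by (simp add: mult_right_mono flip: of_nat_power)
    also have "real n ^ (?m - 2) = (2 ^ ?m / (real n)\<^sup>2) * (real n / 2) ^ ?m"
    proof -
      have "?m = (?m - 2) + 2" using False by simp
      then have "real n ^ ?m = real n ^ (?m - 2) * (real n)\<^sup>2" by (metis power_add)
      then show ?thesis using n by (simp add: power_divide)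
    qed
    also have "real ?m ^ 4 * ((2 ^ ?m / (real n)\<^sup>2) * (real n / 2) ^ ?m) \<le>
      real ?m ^ 4 * ((2 ^ ?m / (real n)\<^sup>2) * real (card (inj_tuples J n)))"
      by (intro mult_left_mono card_inj_tuples_ge J n) auto
    finally show ?thesis by (simp add: mult_ac)
  qed
qed

lemma abs_square_le: "\<bar>r\<bar> \<le> c \<Longrightarrow> \<bar>r\<^sup>2\<bar> \<le> (c::real)\<^sup>2"
  using power_mono[of "\<bar>r\<bar>" c 2] by simp

context prob_space begin

lemma bounded_integrable:
  "f \<in> borel_measurable M \<Longrightarrow> (\<And>x. x \<in> space M \<Longrightarrow> \<bar>f x\<bar> \<le> b) \<Longrightarrow> integrable M (f :: 'a \<Rightarrow> real)"
  by (rule integrable_const_bound[where B=b]) auto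

lemma square_expectation_le:
  assumes f: "f \<in> borel_measurable M" "\<And>x. x \<in> space M \<Longrightarrow> \<bar>f x\<bar> \<le> (b :: real)"
  shows "(expectation f)\<^sup>2 \<le> expectation (\<lambda>x. (f x)\<^sup>2)"
proof -
  have [measurable]: "f \<in> borel_measurable M" by fact
  have "integrable M (\<lambda>x. (f x)\<^sup>2)"
    using f by (intro bounded_integrable[where b="b\<^sup>2"] abs_square_le) auto
  then show ?thesis using Cauchy_Schwarz_integral(2)[of f M "\<lambda>_. 1"] f(1) by (simp add: prob_space)
qed

lemma prob_space_PiM_const: "prob_space (PiM J (\<lambda>_. M))"
  by (intro prob_space_PiM prob_space_axioms)

lemma product_prob_space_const: "product_prob_space (\<lambda>_. M)"
  by standard

lemma measurable_pull:
  assumes "\<sigma> \<in> J \<rightarrow> N" shows "pull J \<sigma> \<in> measurable (PiM N (\<lambda>_. M)) (PiM J (\<lambda>_. M))"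
  unfolding pull_def by (rule measurable_restrict, rule measurable_component_singleton) (use assms in auto)

lemma distr_pull:
  assumes "inj_on \<sigma> J" "\<sigma> \<in> J \<rightarrow> N"
  shows "distr (PiM N (\<lambda>_. M)) (PiM J (\<lambda>_. M)) (pull J \<sigma>) = PiM J (\<lambda>_. M)"
  using distr_PiM_reindex[of N "\<lambda>_. M" \<sigma> J] assms prob_space_axioms by (simp add: pull_def[abs_def])

lemma integral_pull:
  fixes h :: "_ \<Rightarrow> real"
  assumes "inj_on \<sigma> J" "\<sigma> \<in> J \<rightarrow> N" and h: "h \<in> borel_measurable (PiM J (\<lambda>_. M))"
  shows "(\<integral>X. h (pull J \<sigma> X) \<partial>PiM N (\<lambda>_. M)) = (\<integral>y. h y \<partial>PiM J (\<lambda>_. M))"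
  by (subst distr_pull[OF assms(1,2), symmetric], subst integral_distr[OF measurable_pull[OF assms(2)] h]) simp

lemma integral_component:
  fixes h :: "_ \<Rightarrow> real"
  assumes "i \<in> J" and h: "h \<in> borel_measurable M"
  shows "(\<integral>X. h (X i) \<partial>PiM J (\<lambda>_. M)) = (\<integral>y. h y \<partial>M)"
  using distr_PiM_component[of J "\<lambda>_. M" i] assms prob_space_axioms
    integral_distr[of "\<lambda>X. X i" "PiM J (\<lambda>_. M)" M h] by simp

lemma measurable_upd_pair:
  assumes "a \<in> J"
  shows "(\<lambda>(x, y). y(a := x)) \<in> measurable (M \<Otimes>\<^sub>M PiM (J - {a}) (\<lambda>_. M)) (PiM J (\<lambda>_. M))"
  unfolding split_beta by (rule measurable_fun_upd[where J="J - {a}"]) (use assms in auto)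

lemma measurable_hproj:
  assumes "a \<in> J" and h: "h \<in> borel_measurable (PiM J (\<lambda>_. M))"
  shows "hproj M J h a \<in> borel_measurable M"
proof -
  interpret P: prob_space "PiM (J - {a}) (\<lambda>_. M)" by (rule prob_space_PiM_const)
  have "(\<lambda>(x, y). h (y(a := x))) \<in> borel_measurable (M \<Otimes>\<^sub>M PiM (J - {a}) (\<lambda>_. M))"
    using measurable_compose[OF measurable_upd_pair[OF assms(1)] h] by (simp add: split_beta)
  then show ?thesis unfolding hproj_def[abs_def] by (rule P.borel_measurable_lebesgue_integral)
qed

lemma upd_in_space_PiM:
  "x \<in> space M \<Longrightarrow> y \<in> space (PiM (J - {a}) (\<lambda>_. M)) \<Longrightarrow> a \<in> J \<Longrightarrow> y(a := x) \<in> space (PiM J (\<lambda>_. M))"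
  by (auto simp: space_PiM PiE_iff extensional_def)

lemma measurable_upd_slice:
  assumes "a \<in> J" "x \<in> space M" and h: "h \<in> borel_measurable (PiM J (\<lambda>_. M))"
  shows "(\<lambda>y. h (y(a := x))) \<in> borel_measurable (PiM (J - {a}) (\<lambda>_. M))"
proof -
  have "(\<lambda>y. y(a := x)) \<in> measurable (PiM (J - {a}) (\<lambda>_. M)) (PiM J (\<lambda>_. M))"
    by (rule measurable_fun_upd[where J="J - {a}"]) (use assms in auto)
  then show ?thesis using h by (rule measurable_compose)
qed

lemma abs_hproj_le:
  assumes "a \<in> J" "x \<in> space M" and h: "h \<in> borel_measurable (PiM J (\<lambda>_. M))"
    and b: "\<And>y. y \<in> space (PiM J (\<lambda>_. M)) \<Longrightarrow> \<bar>h y\<bar> \<le> b"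
  shows "\<bar>hproj M J h a x\<bar> \<le> b"
proof -
  interpret P: prob_space "PiM (J - {a}) (\<lambda>_. M)" by (rule prob_space_PiM_const)
  have le: "\<bar>h (y(a := x))\<bar> \<le> b" if "y \<in> space (PiM (J - {a}) (\<lambda>_. M))" for y
    using b[OF upd_in_space_PiM[OF assms(2) that assms(1)]] .
  have int: "integrable (PiM (J - {a}) (\<lambda>_. M)) (\<lambda>y. h (y(a := x)))"
    by (rule P.bounded_integrable[OF measurable_upd_slice[OF assms(1-3)] le])
  have "\<bar>hproj M J h a x\<bar> \<le> (\<integral>y. \<bar>h (y(a := x))\<bar> \<partial>PiM (J - {a}) (\<lambda>_. M))"
    unfolding hproj_def by (rule integral_abs_bound)
  also have "... \<le> (\<integral>y. b \<partial>PiM (J - {a}) (\<lambda>_. M))"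
    using int le by (intro integral_mono) auto
  finally show ?thesis by (simp add: P.prob_space)
qed

lemma integral_hproj:
  assumes "a \<in> J" and h: "h \<in> borel_measurable (PiM J (\<lambda>_. M))"
    and b: "\<And>y. y \<in> space (PiM J (\<lambda>_. M)) \<Longrightarrow> \<bar>h y\<bar> \<le> b"
  shows "(\<integral>x. hproj M J h a x \<partial>M) = (\<integral>y. h y \<partial>PiM J (\<lambda>_. M))"
proof -
  let ?P = "PiM (J - {a}) (\<lambda>_. M)"
  interpret P: prob_space ?P by (rule prob_space_PiM_const)
  interpret MP: pair_prob_space M ?P ..
  have J: "insert a (J - {a}) = J" using assms(1) by auto
  have meas: "(\<lambda>(x, y). h (y(a := x))) \<in> borel_measurable (M \<Otimes>\<^sub>M ?P)"
    using measurable_compose[OF measurable_upd_pair[OF assms(1)] h] by (simp add: split_beta)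
  have int: "integrable (M \<Otimes>\<^sub>M ?P) (\<lambda>(x, y). h (y(a := x)))"
    by (rule MP.P.bounded_integrable[OF meas, where b=b])
      (auto simp: space_pair_measure intro!: b upd_in_space_PiM assms(1))
  have "(\<integral>y. h y \<partial>PiM J (\<lambda>_. M)) = (\<integral>y. h y \<partial>distr (M \<Otimes>\<^sub>M ?P) (PiM J (\<lambda>_. M)) (\<lambda>(x, y). y(a := x)))"
    using distr_pair_PiM_eq_PiM[of "J - {a}" "\<lambda>_. M" a] prob_space_axioms J by simp
  also have "... = (\<integral>z. h ((\<lambda>(x, y). y(a := x)) z) \<partial>(M \<Otimes>\<^sub>M ?P))"
    by (rule integral_distr[OF measurable_upd_pair[OF assms(1)] h])
  also have "... = (\<integral>x. hproj M J h a x \<partial>M)"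
    unfolding hproj_def using MP.integral_fst'[OF int] by (simp add: case_prod_unfold)
  finally show ?thesis by simp
qed

lemma integral_hproj_square_le:
  assumes "a \<in> J" and h: "h \<in> borel_measurable (PiM J (\<lambda>_. M))"
    and b: "\<And>y. y \<in> space (PiM J (\<lambda>_. M)) \<Longrightarrow> \<bar>h y\<bar> \<le> b"
  shows "(\<integral>x. (hproj M J h a x)\<^sup>2 \<partial>M) \<le> (\<integral>y. (h y)\<^sup>2 \<partial>PiM J (\<lambda>_. M))"
proof -
  interpret P: prob_space "PiM (J - {a}) (\<lambda>_. M)" by (rule prob_space_PiM_const)
  have [measurable]: "h \<in> borel_measurable (PiM J (\<lambda>_. M))" by fact
  have h2: "(\<lambda>y. (h y)\<^sup>2) \<in> borel_measurable (PiM J (\<lambda>_. M))" by measurable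
  have b2: "\<bar>(h y)\<^sup>2\<bar> \<le> b\<^sup>2" if "y \<in> space (PiM J (\<lambda>_. M))" for y
    by (rule abs_square_le[OF b[OF that]])
  have "(\<integral>x. (hproj M J h a x)\<^sup>2 \<partial>M) \<le> (\<integral>x. hproj M J (\<lambda>y. (h y)\<^sup>2) a x \<partial>M)"
  proof (rule integral_mono)
    show "integrable M (\<lambda>x. (hproj M J h a x)\<^sup>2)"
      using measurable_hproj[OF assms(1) h] abs_hproj_le[OF assms(1) _ h b]
      by (intro bounded_integrable[where b="b\<^sup>2"] abs_square_le) auto
    show "integrable M (hproj M J (\<lambda>y. (h y)\<^sup>2) a)"
      using measurable_hproj[OF assms(1) h2] abs_hproj_le[OF assms(1) _ h2 b2]
      by (intro bounded_integrable[where b="b\<^sup>2"]) auto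
    show "(hproj M J h a x)\<^sup>2 \<le> hproj M J (\<lambda>y. (h y)\<^sup>2) a x" if "x \<in> space M" for x
      unfolding hproj_def using that assms(1)
      by (intro P.square_expectation_le[where b=b] measurable_upd_slice h b upd_in_space_PiM) auto
  qed
  also have "... = (\<integral>y. (h y)\<^sup>2 \<partial>PiM J (\<lambda>_. M))"
    by (rule integral_hproj[OF assms(1) h2 b2])
  finally show ?thesis .
qed

text \<open>If the tuples share at most one observation, all slots of \<open>\<sigma>\<close> except one are filled independently of \<open>\<tau>\<close>.
Integrating over these first produces a projection of \<open>g\<close>, which vanishes.\<close>

lemma degenerate_orthogonal:
  fixes g :: "('j \<Rightarrow> 'a) \<Rightarrow> real"
  assumes J: "finite J" "J \<noteq> {}" and g: "g \<in> borel_measurable (PiM J (\<lambda>_. M))"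
    and b: "\<And>y. y \<in> space (PiM J (\<lambda>_. M)) \<Longrightarrow> \<bar>g y\<bar> \<le> b"
    and deg: "\<And>a x. a \<in> J \<Longrightarrow> x \<in> space M \<Longrightarrow> hproj M J g a x = 0"
    and \<sigma>: "\<sigma> \<in> inj_tuples J n" and \<tau>: "\<tau> \<in> inj_tuples J n" and ov: "card (\<sigma> ` J \<inter> \<tau> ` J) \<le> 1"
  shows "(\<integral>X. g (pull J \<sigma> X) * g (pull J \<tau> X) \<partial>PiM {..<n} (\<lambda>_. M)) = 0"
proof -
  have "\<exists>a\<in>J. \<sigma> ` J \<inter> \<tau> ` J \<subseteq> {\<sigma> a}"
  proof (cases "\<sigma> ` J \<inter> \<tau> ` J = {}")
    case False
    then obtain u where u: "u \<in> \<sigma> ` J" "u \<in> \<tau> ` J" by (metis IntE all_not_in_conv)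
    from u(1) obtain a where a: "a \<in> J" "u = \<sigma> a" by (rule imageE)
    from u have u': "u \<in> \<sigma> ` J \<inter> \<tau> ` J" by (rule IntI)
    have fin: "finite (\<sigma> ` J \<inter> \<tau> ` J)" using J by simp
    from ov have "card (\<sigma> ` J \<inter> \<tau> ` J) \<le> Suc 0" by simp
    then have "\<forall>u\<in>\<sigma> ` J \<inter> \<tau> ` J. \<forall>v\<in>\<sigma> ` J \<inter> \<tau> ` J. u = v"
      unfolding card_le_Suc0_iff_eq[OF fin] .
    then have "\<sigma> ` J \<inter> \<tau> ` J \<subseteq> {u}" using u' by blast
    with a show ?thesis by (intro bexI[of _ a]) simp_all
  next
    case True
    from J(2) obtain a where "a \<in> J" by (metis all_not_in_conv)
    then show ?thesis unfolding True by (intro bexI[of _ a] empty_subsetI)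
  qed
  then obtain a where a: "a \<in> J" "\<sigma> ` J \<inter> \<tau> ` J \<subseteq> {\<sigma> a}" by (rule bexE)
  (* The coordinates in K are used by sigma only; those in L contain all observations of tau and the possibly
     shared observation of the slot a. *)
  define K where "K = \<sigma> ` (J - {a})"
  define L where "L = {..<n} - K"
  have inj: "inj_on \<sigma> J" and range: "\<sigma> \<in> J \<rightarrow> {..<n}" "\<tau> \<in> J \<rightarrow> {..<n}"
    using \<sigma> \<tau> by (auto simp: inj_tuples_def)
  have K: "K \<subseteq> {..<n}" using range by (auto simp: K_def)
  have LK: "L \<inter> K = {}" "finite L" "finite K" "L \<union> K = {..<n}"
    using K J by (auto simp: L_def K_def)
  have \<sigma>a: "\<sigma> a \<in> L" using inj a range by (auto simp: L_def K_def inj_on_def)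
  have \<tau>L: "\<tau> j \<in> L" if "j \<in> J" for j
  proof -
    have "\<tau> j \<notin> K"
    proof
      assume "\<tau> j \<in> K"
      then obtain i where i: "i \<in> J" "i \<noteq> a" "\<tau> j = \<sigma> i" by (auto simp: K_def)
      then have "\<sigma> i \<in> \<sigma> ` J \<inter> \<tau> ` J" using that by (metis IntI imageI)
      then have "\<sigma> i = \<sigma> a" using a by auto
      then show False using inj i a by (auto simp: inj_on_def)
    qed
    then show ?thesis using range that by (auto simp: L_def)
  qed
  interpret PP: product_prob_space "\<lambda>_::nat. M" by (rule product_prob_space_const)
  interpret P: prob_space "PiM {..<n} (\<lambda>_. M)" by (rule prob_space_PiM_const)
  let ?f = "\<lambda>X. g (pull J \<sigma> X) * g (pull J \<tau> X)"
  have pull_space: "pull J \<rho> X \<in> space (PiM J (\<lambda>_. M))" if "X \<in> space (PiM {..<n} (\<lambda>_. M))" "\<rho> \<in> J \<rightarrow> {..<n}" for \<rho> X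
    using measurable_space[OF measurable_pull[OF that(2)] that(1)] .
  have [measurable]: "(\<lambda>X. g (pull J \<sigma> X)) \<in> borel_measurable (PiM {..<n} (\<lambda>_. M))"
    "(\<lambda>X. g (pull J \<tau> X)) \<in> borel_measurable (PiM {..<n} (\<lambda>_. M))"
    by (rule measurable_compose[OF measurable_pull[OF range(1)] g] measurable_compose[OF measurable_pull[OF range(2)] g])+
  have int: "integrable (PiM (L \<union> K) (\<lambda>_. M)) ?f"
    unfolding LK
    by (rule P.bounded_integrable[where b="b * b"])
      (auto simp: abs_mult intro!: mult_mono b pull_space range intro: order_trans[OF abs_ge_zero b[OF pull_space[OF _ range(1)]]])
  have "(\<integral>X. ?f X \<partial>PiM (L \<union> K) (\<lambda>_. M)) =
    (\<integral>x. (\<integral>y. ?f (merge L K (x, y)) \<partial>PiM K (\<lambda>_. M)) \<partial>PiM L (\<lambda>_. M))"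
    by (rule PP.product_integral_fold[OF LK(1-3) int])
  also have "... = (\<integral>x. 0 \<partial>PiM L (\<lambda>_. M))"
  proof (rule Bochner_Integration.integral_cong[OF refl])
    fix x assume x: "x \<in> space (PiM L (\<lambda>_. M))"
    have e1: "pull J \<sigma> (merge L K (x, y)) = (pull (J - {a}) \<sigma> y)(a := x (\<sigma> a))" for y
    proof
      fix j
      have "\<sigma> j \<in> K" "\<sigma> j \<notin> L" if "j \<in> J" "j \<noteq> a" using that LK by (auto simp: K_def)
      then show "pull J \<sigma> (merge L K (x, y)) j = ((pull (J - {a}) \<sigma> y)(a := x (\<sigma> a))) j"
        using a(1) \<sigma>a by (auto simp: pull_def merge_def)
    qed
    have e2: "pull J \<tau> (merge L K (x, y)) = pull J \<tau> x" for y
      using \<tau>L by (auto simp: pull_def merge_def fun_eq_iff)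
    have xa: "x (\<sigma> a) \<in> space M" using x \<sigma>a by (auto simp: space_PiM)
    have "(\<integral>y. ?f (merge L K (x, y)) \<partial>PiM K (\<lambda>_. M)) =
      (\<integral>y. g ((pull (J - {a}) \<sigma> y)(a := x (\<sigma> a))) \<partial>PiM K (\<lambda>_. M)) * g (pull J \<tau> x)"
      unfolding e1 e2 by simp
    also have "(\<integral>y. g ((pull (J - {a}) \<sigma> y)(a := x (\<sigma> a))) \<partial>PiM K (\<lambda>_. M)) = hproj M J g a (x (\<sigma> a))"
      unfolding hproj_def
      by (rule integral_pull[OF _ _ measurable_upd_slice[OF a(1) xa g]])
        (use inj in \<open>auto simp: K_def inj_on_def\<close>)
    finally show "(\<integral>y. ?f (merge L K (x, y)) \<partial>PiM K (\<lambda>_. M)) = 0"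
      using deg[OF a(1) xa] by simp
  qed
  finally show ?thesis unfolding LK by simp
qed

text \<open>Only pairs of tuples with at least two common observations contribute to the second moment.\<close>

lemma degenerate_ustat_second_moment:
  fixes g :: "('j \<Rightarrow> 'a) \<Rightarrow> real"
  assumes J: "finite J" "J \<noteq> {}" and n: "2 * card J \<le> n"
    and g: "g \<in> borel_measurable (PiM J (\<lambda>_. M))"
    and b: "\<And>y. y \<in> space (PiM J (\<lambda>_. M)) \<Longrightarrow> \<bar>g y\<bar> \<le> b"
    and deg: "\<And>a x. a \<in> J \<Longrightarrow> x \<in> space M \<Longrightarrow> hproj M J g a x = 0"
  shows "(\<integral>X. (ustat J n g X)\<^sup>2 \<partial>PiM {..<n} (\<lambda>_. M)) \<le>
    real (card J) ^ 4 * 2 ^ card J / (real n)\<^sup>2 * (\<integral>y. (g y)\<^sup>2 \<partial>PiM J (\<lambda>_. M))"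
proof -
  let ?P = "PiM {..<n} (\<lambda>_. M)" and ?I = "inj_tuples J n" and ?G = "\<integral>y. (g y)\<^sup>2 \<partial>PiM J (\<lambda>_. M)"
  let ?C = "real (card J) ^ 4 * 2 ^ card J / (real n)\<^sup>2"
  define v where "v \<sigma> X = g (pull J \<sigma> X)" for \<sigma> and X :: "nat \<Rightarrow> 'a"
  interpret P: prob_space ?P by (rule prob_space_PiM_const)
  have n0: "0 < n" using J n by (cases "card J") auto
  have G0: "0 \<le> ?G" by simp
  have "0 < (real n / 2) ^ card J" using n0 by simp
  with card_inj_tuples_ge[OF J(1) n] have "0 < real (card ?I)" by linarith
  with finite_inj_tuples[OF J(1)] have I: "finite ?I" "0 < card ?I" by auto
  have rng: "\<sigma> \<in> J \<rightarrow> {..<n}" "inj_on \<sigma> J" if "\<sigma> \<in> ?I" for \<sigma> using that by (auto simp: inj_tuples_def)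
  have v [measurable]: "v \<sigma> \<in> borel_measurable ?P" if "\<sigma> \<in> ?I" for \<sigma>
    unfolding v_def[abs_def] using measurable_compose[OF measurable_pull[OF rng(1)[OF that]] g] .
  have vb: "\<bar>v \<sigma> X\<bar> \<le> b" if "\<sigma> \<in> ?I" "X \<in> space ?P" for \<sigma> X
    unfolding v_def by (rule b[OF measurable_space[OF measurable_pull[OF rng(1)[OF that(1)]] that(2)]])
  have vv: "integrable ?P (\<lambda>X. v \<sigma> X * v \<tau> X)" if "\<sigma> \<in> ?I" "\<tau> \<in> ?I" for \<sigma> \<tau>
    using that by (intro P.bounded_integrable[where b="b * b"])
      (auto simp: abs_mult intro!: mult_mono vb intro: order_trans[OF abs_ge_zero vb])
  have v2: "(\<integral>X. (v \<sigma> X)\<^sup>2 \<partial>?P) = ?G" if "\<sigma> \<in> ?I" for \<sigma>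
    unfolding v_def by (rule integral_pull[OF rng(2)[OF that] rng(1)[OF that], where h="\<lambda>y. (g y)\<^sup>2"]) (use g in measurable)
  have cov: "(\<integral>X. v \<sigma> X * v \<tau> X \<partial>?P) \<le> (if 1 < card (\<sigma> ` J \<inter> \<tau> ` J) then ?G else 0)" if "\<sigma> \<in> ?I" "\<tau> \<in> ?I" for \<sigma> \<tau>
  proof (cases "1 < card (\<sigma> ` J \<inter> \<tau> ` J)")
    case True
    have "(\<integral>X. v \<sigma> X * v \<tau> X \<partial>?P) \<le> (\<integral>X. ((v \<sigma> X)\<^sup>2 + (v \<tau> X)\<^sup>2) / 2 \<partial>?P)"
    proof (rule integral_mono)
      show "v \<sigma> X * v \<tau> X \<le> ((v \<sigma> X)\<^sup>2 + (v \<tau> X)\<^sup>2) / 2" for X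
        using sum_squares_bound[of "v \<sigma> X" "v \<tau> X"] by simp
    qed (use that vv[of \<sigma> \<sigma>] vv[of \<tau> \<tau>] vv[of \<sigma> \<tau>] in \<open>auto simp: power2_eq_square\<close>)
    also have "... = ?G"
      using that vv[of \<sigma> \<sigma>] vv[of \<tau> \<tau>] v2[of \<sigma>] v2[of \<tau>] by (simp add: power2_eq_square)
    finally show ?thesis using True by simp
  next
    case False
    then have "(\<integral>X. v \<sigma> X * v \<tau> X \<partial>?P) = 0"
      unfolding v_def using that by (intro degenerate_orthogonal[OF J g b deg]) auto
    then show ?thesis using False by simp
  qed
  have "(\<integral>X. (ustat J n g X)\<^sup>2 \<partial>?P) = (\<integral>X. (\<Sum>\<sigma>\<in>?I. \<Sum>\<tau>\<in>?I. v \<sigma> X * v \<tau> X) / (real (card ?I))\<^sup>2 \<partial>?P)"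
    by (simp add: ustat_def v_def power_divide power2_eq_square sum_product)
  also have "... = (\<Sum>\<sigma>\<in>?I. \<Sum>\<tau>\<in>?I. (\<integral>X. v \<sigma> X * v \<tau> X \<partial>?P)) / (real (card ?I))\<^sup>2"
    using vv by (simp add: Bochner_Integration.integral_sum)
  also have "... \<le> (\<Sum>\<sigma>\<in>?I. ?C * real (card ?I) * ?G) / (real (card ?I))\<^sup>2"
  proof (intro divide_right_mono sum_mono)
    fix \<sigma> assume \<sigma>: "\<sigma> \<in> ?I"
    have "(\<Sum>\<tau>\<in>?I. (\<integral>X. v \<sigma> X * v \<tau> X \<partial>?P)) \<le> (\<Sum>\<tau>\<in>?I. if 1 < card (\<sigma> ` J \<inter> \<tau> ` J) then ?G else 0)"
      using \<sigma> cov by (intro sum_mono) auto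
    also have "... = real (card {\<tau> \<in> ?I. 1 < card (\<sigma> ` J \<inter> \<tau> ` J)}) * ?G"
      using I by (simp add: sum.If_cases Int_def)
    also have "... \<le> (?C * real (card ?I)) * ?G"
      by (intro mult_right_mono card_overlapping_inj_tuples J n n0 \<sigma> G0)
    finally show "(\<Sum>\<tau>\<in>?I. (\<integral>X. v \<sigma> X * v \<tau> X \<partial>?P)) \<le> ?C * real (card ?I) * ?G" .
  qed auto
  also have "... = ?C * ?G" using I(2) by (simp add: power2_eq_square card_gt_0_iff)
  finally show ?thesis .
qed

text \<open>The remainder after removing constant and linear terms of the Hoeffding decomposition; the constant \<open>card J - 1\<close> is
what remains because each linear term is subtracted without being centred.\<close>

definition degenerate_part :: "'j set \<Rightarrow> (('j \<Rightarrow> 'a) \<Rightarrow> real) \<Rightarrow> ('j \<Rightarrow> 'a) \<Rightarrow> real" where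
  "degenerate_part J h y = h y - (\<Sum>a\<in>J. hproj M J h a (y a)) + (real (card J) - 1) * (\<integral>y. h y \<partial>PiM J (\<lambda>_. M))"

lemma
  fixes h :: "('j \<Rightarrow> 'a) \<Rightarrow> real"
  assumes J: "finite J" "J \<noteq> {}" and h: "h \<in> borel_measurable (PiM J (\<lambda>_. M))"
    and b: "\<And>y. y \<in> space (PiM J (\<lambda>_. M)) \<Longrightarrow> \<bar>h y\<bar> \<le> b"
  shows measurable_degenerate_part: "degenerate_part J h \<in> borel_measurable (PiM J (\<lambda>_. M))"
    and abs_degenerate_part_le: "\<And>y. y \<in> space (PiM J (\<lambda>_. M)) \<Longrightarrow> \<bar>degenerate_part J h y\<bar> \<le> 3 * real (card J) * b"
    and hproj_degenerate_part: "\<And>a x. a \<in> J \<Longrightarrow> x \<in> space M \<Longrightarrow> hproj M J (degenerate_part J h) a x = 0"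
    and degenerate_part_second_moment: "(\<integral>y. (degenerate_part J h y)\<^sup>2 \<partial>PiM J (\<lambda>_. M)) \<le> 9 * (real (card J))\<^sup>2 * (\<integral>y. (h y)\<^sup>2 \<partial>PiM J (\<lambda>_. M))"
proof -
  let ?PJ = "PiM J (\<lambda>_. M)"
  define \<theta> where "\<theta> = (\<integral>y. h y \<partial>?PJ)"
  define m where "m = real (card J)"
  interpret PJ: prob_space ?PJ by (rule prob_space_PiM_const)
  have m: "1 \<le> m" using J by (simp add: m_def Suc_leI card_gt_0_iff)
  have mh: "hproj M J h a \<in> borel_measurable M" if "a \<in> J" for a using measurable_hproj[OF that h] .
  have hb: "\<bar>hproj M J h a x\<bar> \<le> b" if "a \<in> J" "x \<in> space M" for a x using abs_hproj_le[OF that h b] .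
  have mhc: "(\<lambda>y. hproj M J h a (y a)) \<in> borel_measurable (PiM K (\<lambda>_. M))" if "a \<in> J" "a \<in> K" for a K
    using measurable_compose[OF measurable_component_singleton[of a K "\<lambda>_. M"] mh[of a]] that by simp
  have dp: "degenerate_part J h = (\<lambda>y. h y - (\<Sum>a\<in>J. hproj M J h a (y a)) + (m - 1) * \<theta>)"
    by (simp add: degenerate_part_def[abs_def] m_def \<theta>_def)
  show meas: "degenerate_part J h \<in> borel_measurable ?PJ"
    unfolding dp using h mhc by (intro borel_measurable_add borel_measurable_diff borel_measurable_sum) auto
  obtain y0 where y0: "y0 \<in> space ?PJ" using PJ.not_empty by blast
  have b0: "0 \<le> b" using order_trans[OF abs_ge_zero b[OF y0]] .
  have hint: "integrable ?PJ h" using PJ.bounded_integrable[OF h b] .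
  have "\<bar>\<theta>\<bar> \<le> (\<integral>y. \<bar>h y\<bar> \<partial>?PJ)" unfolding \<theta>_def by (rule integral_abs_bound)
  also have "... \<le> (\<integral>y. b \<partial>?PJ)" using hint b by (intro integral_mono) auto
  finally have \<theta>b: "\<bar>\<theta>\<bar> \<le> b" by (simp add: PJ.prob_space)
  show "\<bar>degenerate_part J h y\<bar> \<le> 3 * real (card J) * b" if y: "y \<in> space ?PJ" for y
  proof -
    have ya: "y a \<in> space M" if "a \<in> J" for a using y that by (auto simp: space_PiM)
    have "\<bar>\<Sum>a\<in>J. hproj M J h a (y a)\<bar> \<le> (\<Sum>a\<in>J. \<bar>hproj M J h a (y a)\<bar>)" by (rule sum_abs)
    also have "... \<le> (\<Sum>a\<in>J. b)" by (intro sum_mono hb ya)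
    finally have S: "\<bar>\<Sum>a\<in>J. hproj M J h a (y a)\<bar> \<le> m * b" by (simp add: m_def)
    have T: "\<bar>(m - 1) * \<theta>\<bar> \<le> m * b"
      using m \<theta>b b0 by (auto simp: abs_mult intro!: mult_mono)
    have "b \<le> m * b" using m b0 by (simp add: mult_le_cancel_right1)
    with S T b[OF y] have "\<bar>degenerate_part J h y\<bar> \<le> 3 * (m * b)" unfolding dp by linarith
    then show ?thesis by (simp add: m_def)
  qed
  show "hproj M J (degenerate_part J h) a x = 0" if a: "a \<in> J" and x: "x \<in> space M" for a x
  proof -
    let ?P = "PiM (J - {a}) (\<lambda>_. M)"
    interpret P: prob_space ?P by (rule prob_space_PiM_const)
    have i1: "integrable ?P (\<lambda>y. h (y(a := x)))"
      by (rule P.bounded_integrable[OF measurable_upd_slice[OF a x h], where b=b])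
         (auto intro!: b upd_in_space_PiM a x)
    have i2: "integrable ?P (\<lambda>y. hproj M J h c (y c))" if "c \<in> J - {a}" for c
      using that by (intro P.bounded_integrable[where b=b] mhc hb) (auto simp: space_PiM)
    have e: "(\<integral>y. hproj M J h c (y c) \<partial>?P) = \<theta>" if "c \<in> J - {a}" for c
      using that integral_component[of c "J - {a}" "hproj M J h c"] mh[of c] integral_hproj[OF _ h b, of c]
      by (simp add: \<theta>_def)
    have sum: "(\<Sum>c\<in>J. hproj M J h c ((y(a := x)) c)) = hproj M J h a x + (\<Sum>c\<in>J - {a}. hproj M J h c (y c))" for y
      using J a by (subst sum.remove[OF J(1) a]) (auto intro!: sum.cong)
    have "hproj M J (degenerate_part J h) a x =
      (\<integral>y. h (y(a := x)) - (hproj M J h a x + (\<Sum>c\<in>J - {a}. hproj M J h c (y c))) + (m - 1) * \<theta> \<partial>?P)"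
      unfolding dp hproj_def[of M J "\<lambda>y. h y - (\<Sum>a\<in>J. hproj M J h a (y a)) + (m - 1) * \<theta>"] sum ..
    also have "... = hproj M J h a x - (hproj M J h a x + (\<Sum>c\<in>J - {a}. \<theta>)) + (m - 1) * \<theta>"
    proof -
      define S where "S y = (\<Sum>c\<in>J - {a}. hproj M J h c (y c))" for y
      have S: "integrable ?P S" unfolding S_def[abs_def] by (rule Bochner_Integration.integrable_sum[OF i2])
      have "(\<integral>y. S y \<partial>?P) = (\<Sum>c\<in>J - {a}. \<integral>y. hproj M J h c (y c) \<partial>?P)"
        unfolding S_def by (rule Bochner_Integration.integral_sum[OF i2])
      also have "... = (\<Sum>c\<in>J - {a}. \<theta>)" by (rule sum.cong[OF refl e])
      finally have S': "(\<integral>y. S y \<partial>?P) = (\<Sum>c\<in>J - {a}. \<theta>)" .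
      have "(\<integral>y. h (y(a := x)) - (hproj M J h a x + S y) + (m - 1) * \<theta> \<partial>?P) =
        (\<integral>y. h (y(a := x)) \<partial>?P) - (hproj M J h a x + (\<integral>y. S y \<partial>?P)) + (m - 1) * \<theta>"
        using i1 S by (simp add: P.prob_space)
      then show ?thesis unfolding S' hproj_def[of M J h a x, symmetric] by (simp only: S_def)
    qed
    also have "... = 0"
      using J a m by (simp add: m_def of_nat_diff Suc_leI card_gt_0_iff)
    finally show ?thesis .
  qed
  have [measurable]: "h \<in> borel_measurable ?PJ" by fact
  have ih2: "integrable ?PJ (\<lambda>y. (h y)\<^sup>2)"
    using b by (intro PJ.bounded_integrable[where b="b\<^sup>2"] abs_square_le) auto
  have ihp: "integrable ?PJ (\<lambda>y. (hproj M J h a (y a))\<^sup>2)" if "a \<in> J" for a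
    using that mhc[OF that that] by (intro PJ.bounded_integrable[where b="b\<^sup>2"] abs_square_le hb) (auto simp: space_PiM)
  define H2 where "H2 = (\<integral>y. (h y)\<^sup>2 \<partial>?PJ)"
  have hp2: "(\<integral>y. (hproj M J h a (y a))\<^sup>2 \<partial>?PJ) \<le> H2" if "a \<in> J" for a
    using integral_component[OF that, of "\<lambda>x. (hproj M J h a x)\<^sup>2"] integral_hproj_square_le[OF that h b] mh[OF that]
    by (simp add: H2_def)
  have \<theta>2: "\<theta>\<^sup>2 \<le> H2" unfolding \<theta>_def H2_def by (rule PJ.square_expectation_le[OF h b])
  have pt: "(degenerate_part J h y)\<^sup>2 \<le> 3 * ((h y)\<^sup>2 + m * (\<Sum>a\<in>J. (hproj M J h a (y a))\<^sup>2) + m\<^sup>2 * \<theta>\<^sup>2)" for y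
  proof -
    define S where "S = (\<Sum>a\<in>J. hproj M J h a (y a))"
    have S2: "S\<^sup>2 \<le> m * (\<Sum>a\<in>J. (hproj M J h a (y a))\<^sup>2)"
      using Cauchy_Schwarz_ineq_sum[of "\<lambda>_. 1" "\<lambda>a. hproj M J h a (y a)" J] by (simp add: S_def m_def)
    have m2: "(m - 1)\<^sup>2 * \<theta>\<^sup>2 \<le> m\<^sup>2 * \<theta>\<^sup>2" using m by (intro mult_right_mono power_mono) auto
    have d2: "(degenerate_part J h y)\<^sup>2 \<le> 3 * ((h y)\<^sup>2 + S\<^sup>2 + (m - 1)\<^sup>2 * \<theta>\<^sup>2)"
    proof -
      have "(p - q + r)\<^sup>2 \<le> 3 * (p\<^sup>2 + q\<^sup>2 + r\<^sup>2)" for p q r :: real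
      proof -
        have "3 * (p\<^sup>2 + q\<^sup>2 + r\<^sup>2) - (p - q + r)\<^sup>2 = (p + q)\<^sup>2 + (p - r)\<^sup>2 + (q + r)\<^sup>2"
          by (simp add: power2_eq_square algebra_simps)
        moreover have "0 \<le> (p + q)\<^sup>2 + (p - r)\<^sup>2 + (q + r)\<^sup>2" by simp
        ultimately show ?thesis by linarith
      qed
      from this[of "h y" S "(m - 1) * \<theta>"] show ?thesis by (simp add: dp S_def power_mult_distrib)
    qed
    show ?thesis by (rule order_trans[OF d2], intro mult_left_mono add_mono order_refl S2 m2) simp
  qed
  have "(\<integral>y. (degenerate_part J h y)\<^sup>2 \<partial>?PJ) \<le>
    (\<integral>y. 3 * ((h y)\<^sup>2 + m * (\<Sum>a\<in>J. (hproj M J h a (y a))\<^sup>2) + m\<^sup>2 * \<theta>\<^sup>2) \<partial>?PJ)"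
  proof (rule integral_mono)
    show int: "integrable ?PJ (\<lambda>y. 3 * ((h y)\<^sup>2 + m * (\<Sum>a\<in>J. (hproj M J h a (y a))\<^sup>2) + m\<^sup>2 * \<theta>\<^sup>2))"
      using ih2 ihp by (intro integrable_mult_right Bochner_Integration.integrable_add Bochner_Integration.integrable_sum) auto
    have "AE y in ?PJ. norm ((degenerate_part J h y)\<^sup>2) \<le> norm (3 * ((h y)\<^sup>2 + m * (\<Sum>a\<in>J. (hproj M J h a (y a))\<^sup>2) + m\<^sup>2 * \<theta>\<^sup>2))"
      using pt by (intro AE_I2) (simp only: real_norm_def abs_power2, rule order_trans[OF _ abs_ge_self])
    then show "integrable ?PJ (\<lambda>y. (degenerate_part J h y)\<^sup>2)"
      using meas by (intro Bochner_Integration.integrable_bound[OF int]) auto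
  qed (rule pt)
  also have "... = 3 * (H2 + m * (\<Sum>a\<in>J. (\<integral>y. (hproj M J h a (y a))\<^sup>2 \<partial>?PJ)) + m\<^sup>2 * \<theta>\<^sup>2)"
    using ih2 ihp by (simp add: Bochner_Integration.integral_sum H2_def PJ.prob_space)
  also have "... \<le> 3 * (m\<^sup>2 * H2 + m * (m * H2) + m\<^sup>2 * H2)"
  proof -
    have "(\<Sum>a\<in>J. (\<integral>y. (hproj M J h a (y a))\<^sup>2 \<partial>?PJ)) \<le> m * H2"
      using sum_mono[OF hp2] by (simp add: m_def)
    moreover have "1 * H2 \<le> m\<^sup>2 * H2" using m by (intro mult_right_mono) (auto simp: H2_def one_le_power)
    then have "H2 \<le> m\<^sup>2 * H2" by simp
    ultimately show ?thesis using m \<theta>2 by (intro mult_left_mono add_mono) auto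
  qed
  also have "... = 9 * (real (card J))\<^sup>2 * H2" by (simp add: m_def power2_eq_square)
  finally show "(\<integral>y. (degenerate_part J h y)\<^sup>2 \<partial>?PJ) \<le> 9 * (real (card J))\<^sup>2 * (\<integral>y. (h y)\<^sup>2 \<partial>?PJ)"
    by (simp add: H2_def)
qed

lemma ustat_decomposition:
  fixes h :: "('j \<Rightarrow> 'a) \<Rightarrow> real"
  assumes J: "finite J" "J \<noteq> {}" and n: "2 * card J \<le> n"
  shows "ustat J n h X = (\<Sum>i<n. \<Sum>a\<in>J. hproj M J h a (X i)) / n
    - (real (card J) - 1) * (\<integral>y. h y \<partial>PiM J (\<lambda>_. M)) + ustat J n (degenerate_part J h) X"
proof -
  let ?I = "inj_tuples J n" and ?\<theta> = "\<integral>y. h y \<partial>PiM J (\<lambda>_. M)"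
  have n0: "0 < n" using J n by (cases "card J") auto
  have "0 < (real n / 2) ^ card J" using n0 by simp
  with card_inj_tuples_ge[OF J(1) n] have I: "0 < real (card ?I)" by linarith
  have "(\<Sum>\<sigma>\<in>?I. \<Sum>a\<in>J. hproj M J h a (pull J \<sigma> X a)) = (\<Sum>a\<in>J. \<Sum>\<sigma>\<in>?I. hproj M J h a (X (\<sigma> a)))"
    by (subst sum.swap) (simp add: pull_def)
  also have "... = (\<Sum>a\<in>J. real (card ?I) * (\<Sum>i<n. hproj M J h a (X i)) / n)"
  proof (rule sum.cong[OF refl])
    fix a assume "a \<in> J"
    from sum_inj_tuples_component[OF J(1) this, of n "\<lambda>i. hproj M J h a (X i)"] n0
    show "(\<Sum>\<sigma>\<in>?I. hproj M J h a (X (\<sigma> a))) = real (card ?I) * (\<Sum>i<n. hproj M J h a (X i)) / n"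
      by (simp add: field_simps)
  qed
  also have "... = real (card ?I) * ((\<Sum>i<n. \<Sum>a\<in>J. hproj M J h a (X i)) / n)"
    by (subst sum.swap) (simp add: sum_distrib_left sum_divide_distrib)
  finally have "(\<Sum>\<sigma>\<in>?I. degenerate_part J h (pull J \<sigma> X)) =
    (\<Sum>\<sigma>\<in>?I. h (pull J \<sigma> X)) - real (card ?I) * ((\<Sum>i<n. \<Sum>a\<in>J. hproj M J h a (X i)) / n)
      + real (card ?I) * ((real (card J) - 1) * ?\<theta>)"
    by (simp add: degenerate_part_def sum.distrib sum_subtractf)
  then have "ustat J n (degenerate_part J h) X = ustat J n h X - (\<Sum>i<n. \<Sum>a\<in>J. hproj M J h a (X i)) / n + (real (card J) - 1) * ?\<theta>"
    unfolding ustat_def using I by (simp only: add_divide_distrib diff_divide_distrib) simp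
  then show ?thesis by simp
qed

text \<open>The law of large numbers in mean square, with the second moment in place of the variance.\<close>

lemma centered_mean_second_moment:
  fixes \<phi> :: "'a \<Rightarrow> real" and n :: nat
  assumes \<phi>: "\<phi> \<in> borel_measurable M" and b: "\<And>x. x \<in> space M \<Longrightarrow> \<bar>\<phi> x\<bar> \<le> b" and n: "0 < n"
  shows "(\<integral>X. ((\<Sum>i<n. \<phi> (X i)) / n - expectation \<phi>)\<^sup>2 \<partial>PiM {..<n} (\<lambda>_. M)) \<le> expectation (\<lambda>x. (\<phi> x)\<^sup>2) / n"
proof -
  let ?P = "PiM {..<n} (\<lambda>_. M)"
  interpret PP: product_prob_space "\<lambda>_::nat. M" by (rule product_prob_space_const)
  interpret P: prob_space ?P by (rule prob_space_PiM_const)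
  have [measurable]: "\<phi> \<in> borel_measurable M" by fact
  have int: "integrable M \<phi>" using bounded_integrable[OF \<phi> b] .
  define \<psi> where "\<psi> x = \<phi> x - expectation \<phi>" for x
  have m\<psi> [measurable]: "\<psi> \<in> borel_measurable M" unfolding \<psi>_def[abs_def] by measurable
  have \<psi>0: "integrable M \<psi>" "expectation \<psi> = 0" using int by (simp_all add: \<psi>_def[abs_def] prob_space)
  have i2: "integrable M (\<lambda>x. (\<phi> x)\<^sup>2)"
    using b by (intro bounded_integrable[where b="b\<^sup>2"] abs_square_le) auto
  have \<psi>2: "integrable M (\<lambda>x. (\<psi> x)\<^sup>2)" "expectation (\<lambda>x. (\<psi> x)\<^sup>2) \<le> expectation (\<lambda>x. (\<phi> x)\<^sup>2)"
    using i2 int variance_eq[OF int i2] unfolding \<psi>_def by (auto simp: power2_diff)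
  have pair: "(\<lambda>X. \<psi> (X i) * \<psi> (X j)) = (\<lambda>X. \<Prod>l\<in>{..<n}. (if l = i \<or> l = j then \<psi> else (\<lambda>_. 1)) (X l))"
    if "i < n" "j < n" "i \<noteq> j" for i j
  proof
    fix X
    have "(\<Prod>l\<in>{..<n}. (if l = i \<or> l = j then \<psi> else (\<lambda>_. 1)) (X l)) = (\<Prod>l\<in>{i, j}. \<psi> (X l))"
      using that by (intro prod.mono_neutral_cong_right) auto
    then show "\<psi> (X i) * \<psi> (X j) = (\<Prod>l\<in>{..<n}. (if l = i \<or> l = j then \<psi> else (\<lambda>_. 1)) (X l))"
      using that by simp
  qed
  have off: "integrable ?P (\<lambda>X. \<psi> (X i) * \<psi> (X j))" "(\<integral>X. \<psi> (X i) * \<psi> (X j) \<partial>?P) = 0"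
    if "i < n" "j < n" "i \<noteq> j" for i j
  proof -
    have 1: "integrable M (if l = i \<or> l = j then \<psi> else (\<lambda>_. 1))" for l using \<psi>0 by auto
    show "integrable ?P (\<lambda>X. \<psi> (X i) * \<psi> (X j))"
      unfolding pair[OF that] by (rule PP.product_integrable_prod) (use 1 in auto)
    show "(\<integral>X. \<psi> (X i) * \<psi> (X j) \<partial>?P) = 0"
      unfolding pair[OF that] using that \<psi>0
      by (subst PP.product_integral_prod[OF _ 1]) (auto intro!: prod_zero bexI[of _ i])
  qed
  have diag: "integrable ?P (\<lambda>X. \<psi> (X i) * \<psi> (X i))" "(\<integral>X. \<psi> (X i) * \<psi> (X i) \<partial>?P) = expectation (\<lambda>x. (\<psi> x)\<^sup>2)" if "i < n" for i
  proof -
    have "distr ?P M (\<lambda>X. X i) = M" using distr_PiM_component[of "{..<n}" "\<lambda>_. M" i] prob_space_axioms that by simp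
    then have "integrable (distr ?P M (\<lambda>X. X i)) (\<lambda>x. (\<psi> x)\<^sup>2)" using \<psi>2 by simp
    then show "integrable ?P (\<lambda>X. \<psi> (X i) * \<psi> (X i))"
      using that by (subst (asm) integrable_distr_eq) (auto simp: power2_eq_square)
    show "(\<integral>X. \<psi> (X i) * \<psi> (X i) \<partial>?P) = expectation (\<lambda>x. (\<psi> x)\<^sup>2)"
      using integral_component[of i "{..<n}" "\<lambda>x. (\<psi> x)\<^sup>2"] that by (simp add: power2_eq_square)
  qed
  have all: "integrable ?P (\<lambda>X. \<psi> (X i) * \<psi> (X j))"
    "(\<integral>X. \<psi> (X i) * \<psi> (X j) \<partial>?P) = (if j = i then expectation (\<lambda>x. (\<psi> x)\<^sup>2) else 0)" if "i < n" "j < n" for i j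
    using diag[of i] off[of i j] that by (cases "i = j"; auto)+
  have "((\<Sum>i<n. \<phi> (X i)) / n - expectation \<phi>)\<^sup>2 = (\<Sum>i<n. \<Sum>j<n. \<psi> (X i) * \<psi> (X j)) / (real n)\<^sup>2" for X
  proof -
    have "(\<Sum>i<n. \<phi> (X i)) / n - expectation \<phi> = (\<Sum>i<n. \<psi> (X i)) / n"
      using n by (simp add: \<psi>_def sum_subtractf field_simps)
    then show ?thesis by (simp add: power2_eq_square sum_product)
  qed
  then have "(\<integral>X. ((\<Sum>i<n. \<phi> (X i)) / n - expectation \<phi>)\<^sup>2 \<partial>?P) =
    (\<integral>X. (\<Sum>i<n. \<Sum>j<n. \<psi> (X i) * \<psi> (X j)) \<partial>?P) / (real n)\<^sup>2"
    by simp
  also have "(\<integral>X. (\<Sum>i<n. \<Sum>j<n. \<psi> (X i) * \<psi> (X j)) \<partial>?P) = (\<Sum>i<n. \<integral>X. (\<Sum>j<n. \<psi> (X i) * \<psi> (X j)) \<partial>?P)"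
    by (intro Bochner_Integration.integral_sum Bochner_Integration.integrable_sum all(1)) auto
  also have "... = (\<Sum>i<n. \<Sum>j<n. \<integral>X. \<psi> (X i) * \<psi> (X j) \<partial>?P)"
    by (intro sum.cong refl Bochner_Integration.integral_sum all(1)) auto
  also have "... = (\<Sum>i<n. \<Sum>j<n. if j = i then expectation (\<lambda>x. (\<psi> x)\<^sup>2) else 0)"
    by (intro sum.cong refl all(2)) auto
  also have "(\<Sum>i<n. \<Sum>j<n. if j = i then expectation (\<lambda>x. (\<psi> x)\<^sup>2) else 0) / (real n)\<^sup>2 = expectation (\<lambda>x. (\<psi> x)\<^sup>2) / n"
    using n by (simp add: power2_eq_square)
  also have "... \<le> expectation (\<lambda>x. (\<phi> x)\<^sup>2) / n" using \<psi>2 by (intro divide_right_mono) auto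
  finally show ?thesis .
qed

end

section \<open>Blocks of coordinates and marginal densities\<close>

lemma finite_block [simp]: "finite (block d j)"
  by (simp add: block_def)

lemma finite_coords [simp]: "finite (coords k d)"
  by (simp add: coords_def)

lemma block_subset_coords: "j < k \<Longrightarrow> block d j \<subseteq> coords k d"
  by (auto simp: block_def coords_def)

lemma coords_Suc: "coords (Suc k) d = coords k d \<union> block d k"
  by (auto simp: block_def coords_def less_Suc_eq)

lemma coords_block_disjoint: "coords k d \<inter> block d k = {}"
  by (auto simp: block_def coords_def)

lemma card_coords: "card (coords k d) = total_dim k d"
  by (simp add: coords_def total_dim_def)

lemma in_coords_iff: "(j, c) \<in> coords k d \<longleftrightarrow> j < k \<and> (j, c) \<in> block d j"
  by (auto simp: block_def coords_def)

lemma measurable_subvec [measurable]: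
  "j < k \<Longrightarrow> subvec d j \<in> measurable (leb (coords k d)) (leb (block d j))"
  unfolding leb_def subvec_def[abs_def] by (intro measurable_restrict_subset block_subset_coords)

lemma subvec_merge:
  assumes "y \<in> space (leb (block d k))"
  shows "j < k \<Longrightarrow> subvec d j (merge (coords k d) (block d k) (x, y)) = subvec d j x"
    and "subvec d k (merge (coords k d) (block d k) (x, y)) = y"
proof -
  show "subvec d j (merge (coords k d) (block d k) (x, y)) = subvec d j x" if "j < k"
    using block_subset_coords[OF that, of d] by (auto simp: subvec_def restrict_def merge_def fun_eq_iff)
  show "subvec d k (merge (coords k d) (block d k) (x, y)) = y"
    using assms coords_block_disjoint[of k d]
    by (auto simp: subvec_def restrict_def merge_def fun_eq_iff leb_def space_PiM PiE_def extensional_def)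
qed

lemma nn_integral_blocks:
  assumes "\<And>j. j < k \<Longrightarrow> g j \<in> borel_measurable (leb (block d j))"
  shows "(\<integral>\<^sup>+x. (\<Prod>j<k. g j (subvec d j x)) \<partial>leb (coords k d)) = (\<Prod>j<k. \<integral>\<^sup>+y. g j y \<partial>leb (block d j))"
  using assms
proof (induction k)
  case 0
  show ?case by (simp add: coords_def leb_def space_PiM lborel_PiM.nn_integral_empty)
next
  case (Suc k)
  have m [measurable]: "g j \<in> borel_measurable (leb (block d j))" if "j < Suc k" for j using Suc.prems that .
  have meas: "(\<lambda>x. \<Prod>j<Suc k. g j (subvec d j x)) \<in> borel_measurable (leb (coords (Suc k) d))"
    by (intro borel_measurable_prod_ennreal) (auto intro!: measurable_compose[OF measurable_subvec m])
  have "(\<integral>\<^sup>+x. (\<Prod>j<Suc k. g j (subvec d j x)) \<partial>leb (coords (Suc k) d)) =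
    (\<integral>\<^sup>+x. (\<integral>\<^sup>+y. (\<Prod>j<Suc k. g j (subvec d j (merge (coords k d) (block d k) (x, y)))) \<partial>leb (block d k)) \<partial>leb (coords k d))"
    using meas unfolding leb_def coords_Suc
    by (intro lborel_PiM.product_nn_integral_fold coords_block_disjoint) auto
  also have "... = (\<integral>\<^sup>+x. (\<integral>\<^sup>+y. (\<Prod>j<k. g j (subvec d j x)) * g k y \<partial>leb (block d k)) \<partial>leb (coords k d))"
    by (intro nn_integral_cong) (simp add: subvec_merge)
  also have "... = (\<integral>\<^sup>+x. (\<Prod>j<k. g j (subvec d j x)) * (\<integral>\<^sup>+y. g k y \<partial>leb (block d k)) \<partial>leb (coords k d))"
    using m[of k] by (intro nn_integral_cong nn_integral_cmult) auto
  also have "... = (\<integral>\<^sup>+x. (\<Prod>j<k. g j (subvec d j x)) \<partial>leb (coords k d)) * (\<integral>\<^sup>+y. g k y \<partial>leb (block d k))"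
    by (intro nn_integral_multc borel_measurable_prod_ennreal) (auto intro!: measurable_compose[OF measurable_subvec m])
  finally show ?case using Suc by simp
qed

lemma
  fixes g :: "nat \<Rightarrow> (nat \<times> nat \<Rightarrow> real) \<Rightarrow> 'b::{real_normed_field,banach,second_countable_topology}"
  assumes "\<And>j. j < k \<Longrightarrow> integrable (leb (block d j)) (g j)"
  shows integrable_blocks: "integrable (leb (coords k d)) (\<lambda>x. \<Prod>j<k. g j (subvec d j x))"
    and integral_blocks: "(\<integral>x. (\<Prod>j<k. g j (subvec d j x)) \<partial>leb (coords k d)) = (\<Prod>j<k. \<integral>y. g j y \<partial>leb (block d j))"
proof -
  have int: "integrable (leb (coords k d)) (\<lambda>x. \<Prod>j<k. g j (subvec d j x))" if "\<And>j. j < k \<Longrightarrow> integrable (leb (block d j)) (g j)" for k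
    unfolding integrable_iff_bounded
  proof
    have m [measurable]: "g j \<in> borel_measurable (leb (block d j))" if "j < k" for j
      using \<open>\<And>j. j < k \<Longrightarrow> integrable (leb (block d j)) (g j)\<close>[OF that] by auto
    show "(\<lambda>x. \<Prod>j<k. g j (subvec d j x)) \<in> borel_measurable (leb (coords k d))"
      by (intro borel_measurable_prod) (auto intro!: measurable_compose[OF measurable_subvec m])
    have "(\<integral>\<^sup>+x. ennreal (norm (\<Prod>j<k. g j (subvec d j x))) \<partial>leb (coords k d)) =
      (\<integral>\<^sup>+x. (\<Prod>j<k. (\<lambda>y. ennreal (norm (g j y))) (subvec d j x)) \<partial>leb (coords k d))"
      by (simp add: prod_norm[symmetric] prod_ennreal)
    also have "... = (\<Prod>j<k. \<integral>\<^sup>+y. ennreal (norm (g j y)) \<partial>leb (block d j))"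
      by (rule nn_integral_blocks) (use m in measurable)
    also have "... < \<infinity>"
      using that by (simp add: less_top[symmetric] ennreal_prod_eq_top integrable_iff_bounded)
    finally show "(\<integral>\<^sup>+x. ennreal (norm (\<Prod>j<k. g j (subvec d j x))) \<partial>leb (coords k d)) < \<infinity>" .
  qed
  show "integrable (leb (coords k d)) (\<lambda>x. \<Prod>j<k. g j (subvec d j x))" using int assms .
  show "(\<integral>x. (\<Prod>j<k. g j (subvec d j x)) \<partial>leb (coords k d)) = (\<Prod>j<k. \<integral>y. g j y \<partial>leb (block d j))"
    using assms
  proof (induction k)
    case 0
    have "emeasure (leb (coords 0 d)) (space (leb (coords 0 d))) = 1"
      by (simp add: coords_def leb_def space_PiM)
    then show ?case by (simp add: measure_def)
  next
    case (Suc k)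
    have "(\<integral>x. (\<Prod>j<Suc k. g j (subvec d j x)) \<partial>leb (coords (Suc k) d)) =
      (\<integral>x. (\<integral>y. (\<Prod>j<Suc k. g j (subvec d j (merge (coords k d) (block d k) (x, y)))) \<partial>leb (block d k)) \<partial>leb (coords k d))"
      using int[of "Suc k", OF Suc.prems] unfolding leb_def coords_Suc
      by (rule lborel_PiM.product_integral_fold[OF coords_block_disjoint finite_coords finite_block])
    also have "... = (\<integral>x. (\<integral>y. (\<Prod>j<k. g j (subvec d j x)) * g k y \<partial>leb (block d k)) \<partial>leb (coords k d))"
      by (intro Bochner_Integration.integral_cong refl) (simp add: subvec_merge)
    also have "... = (\<integral>x. (\<Prod>j<k. g j (subvec d j x)) \<partial>leb (coords k d)) * (\<integral>y. g k y \<partial>leb (block d k))"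
      by simp
    finally show ?case using Suc by simp
  qed
qed

lemma AE_subvec:
  assumes j: "j < k" and P: "AE y in leb (block d j). P y"
  shows "AE x in leb (coords k d). P (subvec d j x)"
proof -
  from P obtain N where N: "{y \<in> space (leb (block d j)). \<not> P y} \<subseteq> N" "emeasure (leb (block d j)) N = 0"
    and [measurable]: "N \<in> sets (leb (block d j))"
    by (rule AE_E)
  let ?S = "{x \<in> space (leb (coords k d)). subvec d j x \<in> N}"
  have S: "?S = subvec d j -` N \<inter> space (leb (coords k d))" by auto
  have Sm: "?S \<in> sets (leb (coords k d))" unfolding S using measurable_subvec[OF j] by (rule measurable_sets) measurable
  have "emeasure (leb (coords k d)) ?S = (\<integral>\<^sup>+x. indicator ?S x \<partial>leb (coords k d))" using Sm by simp
  also have "... = (\<integral>\<^sup>+x. (\<Prod>l<k. (if l = j then indicator N else (\<lambda>_. 1)) (subvec d l x)) \<partial>leb (coords k d))"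
  proof (rule nn_integral_cong)
    fix x assume "x \<in> space (leb (coords k d))"
    have "(\<Prod>l<k. (if l = j then indicator N else (\<lambda>_. 1)) (subvec d l x)) = (\<Prod>l\<in>{j}. indicator N (subvec d l x) :: ennreal)"
      using j by (intro prod.mono_neutral_cong_right) auto
    then show "indicator ?S x = (\<Prod>l<k. (if l = j then indicator N else (\<lambda>_. 1)) (subvec d l x) :: ennreal)"
      using \<open>x \<in> _\<close> by (auto simp: indicator_def)
  qed
  also have "... = (\<Prod>l<k. \<integral>\<^sup>+y. (if l = j then indicator N else (\<lambda>_. 1)) y \<partial>leb (block d l))"
    by (rule nn_integral_blocks) auto
  also have "... = 0" using j N by (intro prod_zero) (auto intro!: bexI[of _ j])
  finally have "emeasure (leb (coords k d)) ?S = 0" .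
  then show ?thesis
    by (rule AE_I[rotated]) (use Sm N measurable_space[OF measurable_subvec[OF j]] in auto)
qed

lemma sets_law [measurable_cong, simp]: "sets (law I p) = sets (leb I)"
  and space_law [simp]: "space (law I p) = space (leb I)"
  by (simp_all add: law_def)

lemma prob_densityD:
  assumes "prob_density I p"
  shows "p \<in> borel_measurable (leb I)" "\<And>x. x \<in> space (leb I) \<Longrightarrow> 0 \<le> p x" "prob_space (law I p)"
    "integrable (leb I) p" "(\<integral>x. p x \<partial>leb I) = 1" "(\<integral>\<^sup>+x. ennreal (p x) \<partial>leb I) = 1"
proof -
  show m [measurable]: "p \<in> borel_measurable (leb I)" and nn: "\<And>x. x \<in> space (leb I) \<Longrightarrow> 0 \<le> p x"
    and ps: "prob_space (law I p)"
    using assms by (auto simp: prob_density_def)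
  have "emeasure (law I p) (space (leb I)) = 1" using prob_space.emeasure_space_1[OF ps] by simp
  then show one: "(\<integral>\<^sup>+x. ennreal (p x) \<partial>leb I) = 1"
    by (simp add: law_def emeasure_density cong: nn_integral_cong)
  show "integrable (leb I) p"
    by (rule integrableI_nonneg) (use nn one in auto)
  show "(\<integral>x. p x \<partial>leb I) = 1"
    using nn one by (subst integral_eq_nn_integral) auto
qed

lemma prob_densityI:
  assumes [measurable]: "p \<in> borel_measurable (leb I)" and nn: "\<And>x. x \<in> space (leb I) \<Longrightarrow> 0 \<le> p x"
    and one: "(\<integral>\<^sup>+x. ennreal (p x) \<partial>leb I) = 1"
  shows "prob_density I p"
proof -
  have "emeasure (law I p) (space (law I p)) = 1"
    using one by (simp add: law_def emeasure_density cong: nn_integral_cong)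
  then show ?thesis using assms by (auto simp: prob_density_def intro: prob_spaceI)
qed

lemma integral_law:
  fixes g :: "_ \<Rightarrow> real"
  assumes "prob_density I p" and g: "g \<in> borel_measurable (leb I)"
  shows "(\<integral>x. g x \<partial>law I p) = (\<integral>x. p x * g x \<partial>leb I)"
  unfolding law_def using prob_densityD(1,2)[OF assms(1)] g by (subst integral_density) auto

lemma tensor_prob_density:
  assumes pm: "\<And>j. j < k \<Longrightarrow> prob_density (block d j) (pm j)"
  shows "prob_density (coords k d) (tensor k d pm)"
proof (rule prob_densityI)
  note D = prob_densityD[OF pm]
  show "tensor k d pm \<in> borel_measurable (leb (coords k d))"
    unfolding tensor_def[abs_def] by (intro borel_measurable_prod) (auto intro!: measurable_compose[OF measurable_subvec D(1)])
  have nn: "0 \<le> pm j (subvec d j x)" if "x \<in> space (leb (coords k d))" "j < k" for x j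
    using D(2)[OF that(2)] measurable_space[OF measurable_subvec[OF that(2)] that(1)] by auto
  then show "0 \<le> tensor k d pm x" if "x \<in> space (leb (coords k d))" for x
    unfolding tensor_def using that by (intro prod_nonneg) auto
  have "(\<integral>\<^sup>+x. ennreal (tensor k d pm x) \<partial>leb (coords k d)) =
    (\<integral>\<^sup>+x. (\<Prod>j<k. (\<lambda>y. ennreal (pm j y)) (subvec d j x)) \<partial>leb (coords k d))"
    unfolding tensor_def using nn by (intro nn_integral_cong, subst prod_ennreal) auto
  also have "... = (\<Prod>j<k. \<integral>\<^sup>+y. ennreal (pm j y) \<partial>leb (block d j))"
    by (rule nn_integral_blocks) (use D(1) in auto)
  also have "... = 1" using D(6) by simp
  finally show "(\<integral>\<^sup>+x. ennreal (tensor k d pm x) \<partial>leb (coords k d)) = 1" .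
qed

lemma measurable_mix:
  assumes "i \<in> {..<k} \<rightarrow> N" and M: "sets M = sets (leb (coords k d))"
  shows "(\<lambda>X. mix k d X i) \<in> measurable (PiM N (\<lambda>_. M)) (leb (coords k d))"
proof -
  have "(\<lambda>X. X (i l) (l, c)) \<in> borel_measurable (PiM N (\<lambda>_. M))" if "(l, c) \<in> coords k d" for l c
  proof -
    have l: "i l \<in> N" using assms(1) that by (auto simp: in_coords_iff)
    have "(\<lambda>X. X (i l)) \<in> measurable (PiM N (\<lambda>_. M)) (leb (coords k d))"
      using measurable_component_singleton[OF l, of "\<lambda>_. M"] M by (simp add: measurable_cong_sets[OF refl M])
    then show ?thesis using that by (rule measurable_leb_component)
  qed
  then show ?thesis unfolding mix_def[abs_def] leb_def
    by (intro measurable_restrict) (auto simp: split_beta)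
qed

lemma mix_const: "x i \<in> space (leb (coords k d)) \<Longrightarrow> mix k d x (\<lambda>_. i) = x i"
  by (auto simp: mix_def restrict_def fun_eq_iff leb_def space_PiM PiE_def extensional_def)

text \<open>Taking each subvector from a different observation makes the subvectors independent, while each keeps its marginal
law. It is enough to compare the two measures on boxes.\<close>

lemma mix_id_law:
  assumes p: "prob_density (coords k d) p" and m: "marginal_densities k d p pm"
  shows "distr (PiM {..<k} (\<lambda>_. law (coords k d) p)) (leb (coords k d)) (\<lambda>Y. mix k d Y id) =
    law (coords k d) (tensor k d pm)"
proof -
  let ?C = "coords k d" and ?P = "law (coords k d) p"
  let ?PP = "PiM {..<k} (\<lambda>_. ?P)" and ?Q = "law (coords k d) (tensor k d pm)"
  interpret P: prob_space ?P using prob_densityD(3)[OF p] .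
  interpret PP: product_prob_space "\<lambda>_::nat. ?P" ..
  interpret PPk: prob_space ?PP by (rule P.prob_space_PiM_const)
  have pm: "prob_density (block d j) (pm j)"
    and dist: "distributed ?P (leb (block d j)) (subvec d j) (\<lambda>y. ennreal (pm j y))" if "j < k" for j
    using m that by (auto simp: marginal_densities_def)
  note D = prob_densityD[OF pm]
  note Qd = prob_densityD[OF tensor_prob_density[OF pm]]
  have mm: "(\<lambda>Y. mix k d Y id) \<in> measurable ?PP (leb ?C)" by (rule measurable_mix) auto
  show ?thesis
  proof (rule measure_eqI_PiM_finite[of ?C _ "\<lambda>_. lborel" _ "\<lambda>_. space (PiM ?C (\<lambda>_. lborel))"])
    show "sets (distr ?PP (leb ?C) (\<lambda>Y. mix k d Y id)) = sets (PiM ?C (\<lambda>_. lborel))" by (simp add: leb_def)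
    show "sets ?Q = sets (PiM ?C (\<lambda>_. lborel))" by (simp add: leb_def)
    show "range (\<lambda>_. space (PiM ?C (\<lambda>_. lborel))) \<subseteq> prod_algebra ?C (\<lambda>_. lborel)"
      by (auto simp: space_PiM intro!: prod_algebraI_finite)
    show "emeasure (distr ?PP (leb ?C) (\<lambda>Y. mix k d Y id)) (space (PiM ?C (\<lambda>_. lborel))) \<noteq> \<infinity>"
      using prob_space.emeasure_space_1[OF PPk.prob_space_distr[OF mm]] by (simp add: leb_def)
  next
    fix A :: "nat \<times> nat \<Rightarrow> real set" assume A: "\<And>i. i \<in> ?C \<Longrightarrow> A i \<in> sets lborel"
    let ?B = "\<lambda>l. PiE (block d l) A"
    have B [measurable]: "?B l \<in> sets (leb (block d l))" if "l < k" for l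
      unfolding leb_def using A block_subset_coords[OF that, of d] by (intro sets_PiM_I_finite) auto
    have CA: "PiE ?C A \<in> sets (leb ?C)" unfolding leb_def using A by (intro sets_PiM_I_finite) auto
    define E where "E l = subvec d l -` ?B l \<inter> space (leb ?C)" for l
    have Em: "E l \<in> sets ?P" if "l < k" for l
      unfolding E_def sets_law using measurable_sets[OF measurable_subvec[OF that] B[OF that]] .
    have "emeasure (distr ?PP (leb ?C) (\<lambda>Y. mix k d Y id)) (PiE ?C A) =
      emeasure ?PP ((\<lambda>Y. mix k d Y id) -` PiE ?C A \<inter> space ?PP)"
      by (rule emeasure_distr[OF mm CA])
    also have "(\<lambda>Y. mix k d Y id) -` PiE ?C A \<inter> space ?PP = PiE {..<k} E"
    proof (rule set_eqI)
      fix Y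
      have "mix k d Y id \<in> PiE ?C A \<longleftrightarrow> (\<forall>l<k. \<forall>i\<in>block d l. Y l i \<in> A i)"
        by (auto simp: mix_def PiE_iff coords_def block_def)
      moreover have "subvec d l (Y l) \<in> ?B l \<longleftrightarrow> (\<forall>i\<in>block d l. Y l i \<in> A i)" for l
        by (auto simp: subvec_def PiE_iff)
      ultimately show "Y \<in> (\<lambda>Y. mix k d Y id) -` PiE ?C A \<inter> space ?PP \<longleftrightarrow> Y \<in> PiE {..<k} E"
        by (auto simp: E_def space_PiM PiE_iff)
    qed
    also have "emeasure ?PP (PiE {..<k} E) = (\<Prod>l<k. emeasure ?P (E l))"
      using Em by (intro PP.emeasure_PiM) auto
    also have "... = (\<Prod>l<k. \<integral>\<^sup>+y. ennreal (pm l y) * indicator (?B l) y \<partial>leb (block d l))"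
    proof (rule prod.cong[OF refl])
      fix l assume "l \<in> {..<k}"
      then have l: "l < k" by simp
      have sm: "subvec d l \<in> measurable ?P (leb (block d l))"
        unfolding measurable_cong_sets[OF sets_law refl] by (rule measurable_subvec[OF l])
      have "emeasure ?P (E l) = emeasure (distr ?P (leb (block d l)) (subvec d l)) (?B l)"
        unfolding E_def using emeasure_distr[OF sm B[OF l]] by simp
      also have "... = (\<integral>\<^sup>+y. ennreal (pm l y) * indicator (?B l) y \<partial>leb (block d l))"
        unfolding distributed_distr_eq_density[OF dist[OF l]]
        by (rule emeasure_density) (use D(1)[OF l] B[OF l] in auto)
      finally show "emeasure ?P (E l) = (\<integral>\<^sup>+y. ennreal (pm l y) * indicator (?B l) y \<partial>leb (block d l))" .
    qed
    also have "... = (\<integral>\<^sup>+x. (\<Prod>l<k. ennreal (pm l (subvec d l x)) * indicator (?B l) (subvec d l x)) \<partial>leb ?C)"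
      using B D(1) by (subst nn_integral_blocks) auto
    also have "... = (\<integral>\<^sup>+x. ennreal (tensor k d pm x) * indicator (PiE ?C A) x \<partial>leb ?C)"
    proof (rule nn_integral_cong)
      fix x assume x: "x \<in> space (leb ?C)"
      have nn: "0 \<le> pm l (subvec d l x)" if "l < k" for l
        using D(2)[OF that] measurable_space[OF measurable_subvec[OF that] x] by auto
      have "x \<in> PiE ?C A \<longleftrightarrow> (\<forall>l<k. subvec d l x \<in> ?B l)"
        using x by (auto simp: subvec_def PiE_iff coords_def block_def leb_def space_PiM)
      then have "indicator (PiE ?C A) x = (\<Prod>l<k. indicator (?B l) (subvec d l x) :: ennreal)"
        by (auto simp: indicator_def)
      moreover have "ennreal (tensor k d pm x) = (\<Prod>l<k. ennreal (pm l (subvec d l x)))"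
        unfolding tensor_def using nn by (subst prod_ennreal) auto
      ultimately show "(\<Prod>l<k. ennreal (pm l (subvec d l x)) * indicator (?B l) (subvec d l x)) =
         ennreal (tensor k d pm x) * indicator (PiE ?C A) x"
        by (simp add: prod.distrib)
    qed
    also have "... = emeasure ?Q (PiE ?C A)"
      unfolding law_def using Qd(1) CA by (simp add: emeasure_density)
    finally show "emeasure (distr ?PP (leb ?C) (\<lambda>Y. mix k d Y id)) (PiE ?C A) = emeasure ?Q (PiE ?C A)" .
  qed (auto simp: leb_def)
qed

section \<open>The estimator as a combination of U-statistics\<close>

lemma mix_cong:
  assumes "\<And>l. l < k \<Longrightarrow> X (i l) = Y (j l)" shows "mix k d X i = mix k d Y j"
  using assms by (auto simp: mix_def restrict_def fun_eq_iff in_coords_iff)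

text \<open>Each of the three sums of the estimator compares two vectors, and each of these is either one observation or a mixture
of \<open>k\<close> observations. The flag \<open>u\<close> tells which: an observation uses the single slot \<open>0\<close>, a mixture the slots below \<open>k\<close>.
A slot of the kernel is then a pair \<open>(t, i)\<close>, where \<open>t\<close> says to which of the two compared vectors the slot \<open>i\<close> belongs,
and \<open>v t\<close> is the flag of that vector. So one kernel treats all three sums.\<close>

definition sel :: "bool \<Rightarrow> nat \<Rightarrow> nat" where
  "sel u = (if u then id else (\<lambda>_. 0))"

definition roles :: "nat \<Rightarrow> bool \<Rightarrow> nat set" where
  "roles k u = (if u then {..<k} else {0})"

definition pair_roles :: "nat \<Rightarrow> (bool \<Rightarrow> bool) \<Rightarrow> (bool \<times> nat) set" where
  "pair_roles k v = Sigma UNIV (\<lambda>t. roles k (v t))"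

definition slot_mix :: "nat \<Rightarrow> (nat \<Rightarrow> nat) \<Rightarrow> bool \<Rightarrow> bool \<Rightarrow> (bool \<times> nat \<Rightarrow> nat \<times> nat \<Rightarrow> real) \<Rightarrow> nat \<times> nat \<Rightarrow> real" where
  "slot_mix k d u t y = mix k d (\<lambda>i. y (t, i)) (sel u)"

definition pair_kernel :: "nat \<Rightarrow> (nat \<Rightarrow> nat) \<Rightarrow> real \<Rightarrow> (bool \<Rightarrow> bool) \<Rightarrow> (bool \<times> nat \<Rightarrow> nat \<times> nat \<Rightarrow> real) \<Rightarrow> real" where
  "pair_kernel k d \<nu> v y = gauss_kernel (coords k d) \<nu> (slot_mix k d (v False) False y) (slot_mix k d (v True) True y)"

lemma finite_roles [simp]: "finite (roles k u)"
  by (simp add: roles_def)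

lemma card_roles: "card (roles k u) = (if u then k else 1)"
  by (simp add: roles_def)

lemma sel_in_roles: "l < k \<Longrightarrow> sel u l \<in> roles k u"
  by (simp add: roles_def sel_def)

lemma finite_pair_roles [simp]: "finite (pair_roles k v)"
  by (simp add: pair_roles_def)

lemma sum_bool: "(\<Sum>t\<in>UNIV. f t) = f False + f (True :: bool)"
  by (simp add: UNIV_bool add.commute)

lemma card_pair_roles: "card (pair_roles k v) = card (roles k (v False)) + card (roles k (v True))"
  by (simp add: pair_roles_def sum_bool)

lemma card_pair_roles_le: "0 < k \<Longrightarrow> card (pair_roles k v) \<le> 2 * k"
  by (auto simp: card_pair_roles card_roles)

lemma pair_roles_nonempty: "0 < k \<Longrightarrow> pair_roles k v \<noteq> {}"
proof -
  assume "0 < k"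
  then have "(False, 0) \<in> pair_roles k v" by (auto simp: pair_roles_def roles_def)
  then show ?thesis by blast
qed

lemma pair_kernel_sym:
  "pair_kernel k d \<nu> v y = gauss_kernel (coords k d) \<nu> (slot_mix k d (v t) t y) (slot_mix k d (v (\<not> t)) (\<not> t) y)"
  by (cases t) (simp_all add: pair_kernel_def gauss_kernel_commute)

lemma pair_kernel_square: "(pair_kernel k d \<nu> v y)\<^sup>2 = pair_kernel k d (2 * \<nu>) v y"
  by (simp add: pair_kernel_def gauss_kernel_square)

lemma slot_mix_pull:
  assumes "v t = u"
  shows "slot_mix k d u t (pull (pair_roles k v) \<sigma> X) = mix k d X (\<lambda>l. \<sigma> (t, sel u l))"
  unfolding slot_mix_def using assms by (intro mix_cong) (auto simp: pull_def pair_roles_def sel_in_roles)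

text \<open>An injective filling of all slots is the same as two tuples whose combined range has the largest possible size, which is
how the estimator expresses that all indices are distinct.\<close>

lemma sum_inj_pair_roles:
  fixes F :: "(nat \<Rightarrow> nat) \<Rightarrow> (nat \<Rightarrow> nat) \<Rightarrow> real" and v :: "bool \<Rightarrow> bool" and k n :: nat
  defines "A \<equiv> roles k (v False)" and "B \<equiv> roles k (v True)"
  shows "(\<Sum>\<sigma>\<in>inj_tuples (pair_roles k v) n. F (\<lambda>c\<in>A. \<sigma> (False, c)) (\<lambda>c\<in>B. \<sigma> (True, c))) =
    (\<Sum>(a, b)\<in>{(a, b) \<in> (A \<rightarrow>\<^sub>E {..<n}) \<times> (B \<rightarrow>\<^sub>E {..<n}). card (a ` A \<union> b ` B) = card A + card B}. F a b)"
proof -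
  have J: "(False, c) \<in> pair_roles k v \<longleftrightarrow> c \<in> A" "(True, c) \<in> pair_roles k v \<longleftrightarrow> c \<in> B" for c
    by (auto simp: pair_roles_def A_def B_def)
  have Jeq: "pair_roles k v = Pair False ` A \<union> Pair True ` B"
  proof (rule set_eqI)
    fix x :: "bool \<times> nat"
    obtain t c where x: "x = (t, c)" by (cases x)
    show "x \<in> pair_roles k v \<longleftrightarrow> x \<in> Pair False ` A \<union> Pair True ` B"
      unfolding x by (cases t) (simp_all add: J image_iff)
  qed
  have card: "card (pair_roles k v) = card A + card B"
    by (simp add: card_pair_roles A_def B_def)
  show ?thesis
  proof (rule sum.reindex_bij_witness[where
      i="\<lambda>(a, b). \<lambda>(t, c)\<in>pair_roles k v. if t then b c else a c" and
      j="\<lambda>\<sigma>. ((\<lambda>c\<in>A. \<sigma> (False, c)), (\<lambda>c\<in>B. \<sigma> (True, c)))"])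
    have inj: "inj_on \<sigma> (pair_roles k v) \<longleftrightarrow> card ((\<lambda>c. \<sigma> (False, c)) ` A \<union> (\<lambda>c. \<sigma> (True, c)) ` B) = card A + card B" for \<sigma> :: "bool \<times> nat \<Rightarrow> nat"
    proof -
      have "\<sigma> ` pair_roles k v = (\<lambda>c. \<sigma> (False, c)) ` A \<union> (\<lambda>c. \<sigma> (True, c)) ` B"
        unfolding Jeq by (simp add: image_Un image_image)
      then show ?thesis using inj_on_iff_eq_card[OF finite_pair_roles, of \<sigma> k v] card by simp
    qed
    fix \<sigma> assume \<sigma>: "\<sigma> \<in> inj_tuples (pair_roles k v) n"
    then have ext: "\<sigma> x = undefined" if "x \<notin> pair_roles k v" for x
      using \<sigma> that by (cases x) (auto simp: inj_tuples_def PiE_def extensional_def)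
    show "(case ((\<lambda>c\<in>A. \<sigma> (False, c)), (\<lambda>c\<in>B. \<sigma> (True, c))) of (a, b) \<Rightarrow> \<lambda>(t, c)\<in>pair_roles k v. if t then b c else a c) = \<sigma>"
      using ext by (auto simp: fun_eq_iff restrict_def J)
    show "((\<lambda>c\<in>A. \<sigma> (False, c)), (\<lambda>c\<in>B. \<sigma> (True, c))) \<in> {(a, b) \<in> (A \<rightarrow>\<^sub>E {..<n}) \<times> (B \<rightarrow>\<^sub>E {..<n}). card (a ` A \<union> b ` B) = card A + card B}"
      using \<sigma> inj[of \<sigma>] by (auto simp: inj_tuples_def PiE_iff J)
  next
    fix ab assume ab: "ab \<in> {(a, b) \<in> (A \<rightarrow>\<^sub>E {..<n}) \<times> (B \<rightarrow>\<^sub>E {..<n}). card (a ` A \<union> b ` B) = card A + card B}"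
    obtain a b where [simp]: "ab = (a, b)" by (cases ab)
    have a: "a \<in> A \<rightarrow>\<^sub>E {..<n}" and b: "b \<in> B \<rightarrow>\<^sub>E {..<n}" and c: "card (a ` A \<union> b ` B) = card A + card B"
      using ab by auto
    have ab': "\<And>c. c \<in> A \<Longrightarrow> a c < n" "\<And>c. c \<in> B \<Longrightarrow> b c < n" using a b by (auto simp: PiE_iff)
    let ?s = "\<lambda>(t, c)\<in>pair_roles k v. if t then b c else a c"
    have 1: "(\<lambda>c\<in>A. ?s (False, c)) = a" "(\<lambda>c\<in>B. ?s (True, c)) = b"
      using a b by (auto simp: fun_eq_iff restrict_def J PiE_def extensional_def)
    then show "((\<lambda>c\<in>A. (case ab of (a, b) \<Rightarrow> \<lambda>(t, c)\<in>pair_roles k v. if t then b c else a c) (False, c)),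
        (\<lambda>c\<in>B. (case ab of (a, b) \<Rightarrow> \<lambda>(t, c)\<in>pair_roles k v. if t then b c else a c) (True, c))) = ab"
      by simp
    have "?s ` pair_roles k v = a ` A \<union> b ` B"
      unfolding Jeq by (auto simp: image_Un image_image image_iff)
    then have "inj_on ?s (pair_roles k v)"
      using inj_on_iff_eq_card[OF finite_pair_roles, of ?s k v] card c by simp
    then show "(case ab of (a, b) \<Rightarrow> \<lambda>(t, c)\<in>pair_roles k v. if t then b c else a c) \<in> inj_tuples (pair_roles k v) n"
      using ab' by (auto simp: inj_tuples_def J split: if_splits)
  qed simp_all
qed

lemma card_inj_tuples_fact:
  assumes "finite J" "card J \<le> n"
  shows "real (card (inj_tuples J n)) = fact n / fact (n - card J)"
proof -
  have "fact (n - m) * (\<Prod>i<m. n - i) = (fact n :: nat)" if "m \<le> n" for m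
    using that
  proof (induction m)
    case (Suc m)
    then have "n - m = Suc (n - Suc m)" by simp
    then have "fact (n - m) = (n - m) * (fact (n - Suc m) :: nat)" by (metis fact_Suc of_nat_id)
    then show ?case using Suc by (simp add: mult_ac)
  qed simp
  from this[OF assms(2)] have "fact (n - card J) * real (card (inj_tuples J n)) = fact n"
    unfolding card_inj_tuples[OF assms(1)] by (metis of_nat_fact of_nat_mult)
  then show ?thesis by (simp add: field_simps)
qed

lemma gamma2_hat_eq_ustat:
  assumes k: "2 \<le> k" and n: "2 * k \<le> n" and X: "\<And>i. i < n \<Longrightarrow> X i \<in> space (leb (coords k d))"
  shows "gamma2_hat k d n \<nu> X =
    ustat (pair_roles k (\<lambda>_. False)) n (pair_kernel k d \<nu> (\<lambda>_. False)) X
    + ustat (pair_roles k (\<lambda>_. True)) n (pair_kernel k d \<nu> (\<lambda>_. True)) X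
    - 2 * ustat (pair_roles k id) n (pair_kernel k d \<nu> id) X"
proof -
  let ?G = "gauss_kernel (coords k d) \<nu>"
  have k0: "0 < k" using k by simp
  have U: "ustat (pair_roles k v) n (pair_kernel k d \<nu> v) X =
     (\<Sum>(a, b)\<in>{(a, b) \<in> (roles k (v False) \<rightarrow>\<^sub>E {..<n}) \<times> (roles k (v True) \<rightarrow>\<^sub>E {..<n}).
        card (a ` roles k (v False) \<union> b ` roles k (v True)) = card (roles k (v False)) + card (roles k (v True))}.
        ?G (mix k d X (\<lambda>l. a (sel (v False) l))) (mix k d X (\<lambda>l. b (sel (v True) l)))) *
      (fact (n - card (pair_roles k v)) / fact n)" for v
  proof -
    have c: "card (pair_roles k v) \<le> n" using card_pair_roles_le[OF k0, of v] n by linarith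
    have "(\<Sum>\<sigma>\<in>inj_tuples (pair_roles k v) n. pair_kernel k d \<nu> v (pull (pair_roles k v) \<sigma> X)) =
      (\<Sum>\<sigma>\<in>inj_tuples (pair_roles k v) n.
        ?G (mix k d X (\<lambda>l. (\<lambda>c\<in>roles k (v False). \<sigma> (False, c)) (sel (v False) l)))
           (mix k d X (\<lambda>l. (\<lambda>c\<in>roles k (v True). \<sigma> (True, c)) (sel (v True) l))))"
      unfolding pair_kernel_def
      by (intro sum.cong refl arg_cong2[where f="?G"]) (auto simp: slot_mix_pull sel_in_roles intro!: mix_cong)
    also have "... = (\<Sum>(a, b)\<in>{(a, b) \<in> (roles k (v False) \<rightarrow>\<^sub>E {..<n}) \<times> (roles k (v True) \<rightarrow>\<^sub>E {..<n}).
        card (a ` roles k (v False) \<union> b ` roles k (v True)) = card (roles k (v False)) + card (roles k (v True))}.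
        ?G (mix k d X (\<lambda>l. a (sel (v False) l))) (mix k d X (\<lambda>l. b (sel (v True) l))))"
      by (rule sum_inj_pair_roles)
    finally show ?thesis
      unfolding ustat_def card_inj_tuples_fact[OF finite_pair_roles c] by simp
  qed
  have Xc: "mix k d X (\<lambda>l. i) = X i" if "i < n" for i
    using mix_const[of X i, OF X[OF that]] .
  have fin: "finite ({..<k} \<rightarrow>\<^sub>E {..<n})" "finite ({0::nat} \<rightarrow>\<^sub>E {..<n})" by (auto intro!: finite_PiE)
  have U1: "ustat (pair_roles k (\<lambda>_. False)) n (pair_kernel k d \<nu> (\<lambda>_. False)) X =
     1 / (real n * (real n - 1)) * (\<Sum>(i, j)\<in>{(i, j) \<in> {..<n} \<times> {..<n}. i \<noteq> j}. ?G (X i) (X j))"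
  proof -
    define S where "S = (\<Sum>(a, b)\<in>{(a, b) \<in> ({0::nat} \<rightarrow>\<^sub>E {..<n}) \<times> ({0::nat} \<rightarrow>\<^sub>E {..<n}). card (a ` {0} \<union> b ` {0}) = 2}.
        ?G (mix k d X (\<lambda>l. a 0)) (mix k d X (\<lambda>l. b 0)))"
    have two: "card {0 :: nat} + card {0 :: nat} = 2" by simp
    have u: "ustat (pair_roles k (\<lambda>_. False)) n (pair_kernel k d \<nu> (\<lambda>_. False)) X = S * (fact (n - 2) / fact n)"
      unfolding U card_pair_roles roles_def sel_def if_False two S_def ..
    have S: "S = (\<Sum>(i, j)\<in>{(i, j) \<in> {..<n} \<times> {..<n}. i \<noteq> j}. ?G (X i) (X j))"
      unfolding S_def
      by (rule sum.reindex_bij_witness[where i="\<lambda>(i, j). ((\<lambda>c\<in>{0}. i), (\<lambda>c\<in>{0}. j))" and j="\<lambda>(a, b). (a 0, b 0)"])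
        (auto simp: Xc fun_eq_iff PiE_iff extensional_def restrict_def card_insert_if)
    have ff: "fact (n - 2) / fact n = 1 / (real n * (real n - 1))"
    proof -
      have "n = Suc (Suc (n - 2))" using n k by linarith
      then obtain m where m: "n = Suc (Suc m)" by blast
      have f: "fact n = real n * (real n - 1) * fact (n - 2)" by (simp add: m)
      show ?thesis unfolding f by simp
    qed
    show ?thesis unfolding u S ff by (rule mult.commute)
  qed
  have U2: "ustat (pair_roles k (\<lambda>_. True)) n (pair_kernel k d \<nu> (\<lambda>_. True)) X =
      fact (n - 2 * k) / fact n *
       (\<Sum>(i, j)\<in>{(i, j) \<in> ({..<k} \<rightarrow>\<^sub>E {..<n}) \<times> ({..<k} \<rightarrow>\<^sub>E {..<n}). card (i ` {..<k} \<union> j ` {..<k}) = 2 * k}.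
          ?G (mix k d X i) (mix k d X j))"
    unfolding U card_pair_roles roles_def sel_def if_True card_lessThan mult_2 id_apply by (rule mult.commute)
  have U3: "ustat (pair_roles k id) n (pair_kernel k d \<nu> id) X =
      fact (n - k - 1) / fact n *
       (\<Sum>(i, j)\<in>{(i, j) \<in> {..<n} \<times> ({..<k} \<rightarrow>\<^sub>E {..<n}). card ({i} \<union> j ` {..<k}) = k + 1}.
          ?G (X i) (mix k d X j))"
  proof -
    define S where "S = (\<Sum>(a, b)\<in>{(a, b) \<in> ({0::nat} \<rightarrow>\<^sub>E {..<n}) \<times> ({..<k} \<rightarrow>\<^sub>E {..<n}). card (a ` {0} \<union> b ` {..<k}) = 1 + k}.
        ?G (mix k d X (\<lambda>l. a 0)) (mix k d X b))"
    have one: "card {0 :: nat} = 1" by simp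
    have u: "ustat (pair_roles k id) n (pair_kernel k d \<nu> id) X = S * (fact (n - (1 + k)) / fact n)"
      unfolding U card_pair_roles roles_def sel_def id_apply if_True if_False card_lessThan one S_def ..
    have S: "S = (\<Sum>(i, j)\<in>{(i, j) \<in> {..<n} \<times> ({..<k} \<rightarrow>\<^sub>E {..<n}). card ({i} \<union> j ` {..<k}) = k + 1}. ?G (X i) (mix k d X j))"
      unfolding S_def
      by (rule sum.reindex_bij_witness[where i="\<lambda>(i, b). ((\<lambda>c\<in>{0}. i), b)" and j="\<lambda>(a, b). (a 0, b)"])
        (auto simp: Xc fun_eq_iff PiE_iff extensional_def restrict_def)
    have "n - (1 + k) = n - k - 1" by simp
    then show ?thesis unfolding u S by (simp only: mult.commute)
  qed
  show ?thesis unfolding gamma2_hat_def U1 U2 U3 by simp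
qed

section \<open>The mean square error of the estimator\<close>

text \<open>The squared \<open>L\<^sub>2\<close>-norm of the joint density and of the product of its marginals is bounded by \<open>B\<close>; this is the only
consequence of smoothness that the variance needs.\<close>

locale density_with_marginals =
  fixes k :: nat and d :: "nat \<Rightarrow> nat" and p :: "(nat \<times> nat \<Rightarrow> real) \<Rightarrow> real"
    and pm :: "nat \<Rightarrow> (nat \<times> nat \<Rightarrow> real) \<Rightarrow> real" and B :: real
  assumes k: "2 \<le> k" and density: "prob_density (coords k d) p" and marginals: "marginal_densities k d p pm"
    and p_square: "integrable (leb (coords k d)) (\<lambda>x. (p x)\<^sup>2)" "(\<integral>x. (p x)\<^sup>2 \<partial>leb (coords k d)) \<le> B"
    and q_square: "integrable (leb (coords k d)) (\<lambda>x. (tensor k d pm x)\<^sup>2)"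
      "(\<integral>x. (tensor k d pm x)\<^sup>2 \<partial>leb (coords k d)) \<le> B"
begin

abbreviation "C \<equiv> coords k d"
abbreviation "P \<equiv> law C p"
text \<open>With the flags as above, \<open>dens u\<close> is the density of the vector with flag \<open>u\<close>, and \<open>K \<nu>\<close> is the mass of the kernel.\<close>

definition "q = tensor k d pm"
definition "dens u = (if u then q else p)"
definition "gap x = p x - q x"
definition "K \<nu> = sqrt (pi / \<nu>) ^ card C"

lemma k0: "0 < k" using k by simp

lemma q_density: "prob_density C q"
  unfolding q_def using marginals by (intro tensor_prob_density) (auto simp: marginal_densities_def)

lemma dens_density: "prob_density C (dens u)"
  using density q_density by (simp add: dens_def)

lemmas dens = prob_densityD[OF dens_density]

lemma dens_square: "integrable (leb C) (\<lambda>x. (dens u x)\<^sup>2)" "(\<integral>x. (dens u x)\<^sup>2 \<partial>leb C) \<le> B"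
  using p_square q_square by (auto simp: dens_def q_def)

lemma gap_eq: "gap x = dens False x - dens True x"
  by (simp add: gap_def dens_def)

lemma integrable_gap: "integrable (leb C) gap"
  unfolding gap_def[abs_def] using dens(4)[of False] dens(4)[of True] by (simp add: dens_def)

lemma B_nonneg: "0 \<le> B"
  by (rule order_trans[OF _ p_square(2)]) simp

lemma K_pos: "0 < \<nu> \<Longrightarrow> 0 < K \<nu>"
  by (simp add: K_def)

lemma K_double_le: "0 < \<nu> \<Longrightarrow> K (2 * \<nu>) \<le> K \<nu>"
  unfolding K_def by (intro power_mono real_sqrt_le_mono divide_left_mono) auto

sublocale P: prob_space P
  using density by (rule prob_densityD)

lemma measurable_mix_sel: "(\<lambda>Y. mix k d Y (sel u)) \<in> measurable (PiM (roles k u) (\<lambda>_. P)) (leb C)"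
  by (rule measurable_mix) (auto simp: sel_in_roles)

lemma mix_sel_law:
  "distr (PiM (roles k u) (\<lambda>_. P)) (leb C) (\<lambda>Y. mix k d Y (sel u)) = law C (dens u)"
proof (cases u)
  case True
  then show ?thesis using mix_id_law[OF density marginals] by (simp add: roles_def sel_def dens_def q_def)
next
  case False
  have "distr (PiM {0} (\<lambda>_::nat. P)) (leb C) (\<lambda>Y. mix k d Y (\<lambda>_. 0)) = distr (PiM {0} (\<lambda>_::nat. P)) P (\<lambda>Y. Y 0)"
    by (rule distr_cong) (auto intro!: mix_const simp: space_PiM)
  also have "... = P" using distr_PiM_component[of "{0::nat}" "\<lambda>_. P" 0] P.prob_space_axioms by simp
  finally show ?thesis using False by (simp add: roles_def sel_def dens_def)
qed

lemma integral_mix_sel: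
  fixes g :: "_ \<Rightarrow> real"
  assumes "g \<in> borel_measurable (leb C)"
  shows "(\<integral>Y. g (mix k d Y (sel u)) \<partial>PiM (roles k u) (\<lambda>_. P)) = (\<integral>x. dens u x * g x \<partial>leb C)"
  using integral_distr[OF measurable_mix_sel assms, of u] integral_law[OF dens_density assms, of u]
  by (simp add: mix_sel_law)

lemma slot_mix_eq_pull:
  "slot_mix k d (v t) t y = mix k d (pull (roles k (v t)) (Pair t) y) (sel (v t))"
  unfolding slot_mix_def by (intro mix_cong) (simp add: pull_def sel_in_roles)

lemma measurable_slot_mix: "slot_mix k d (v t) t \<in> measurable (PiM (pair_roles k v) (\<lambda>_. P)) (leb C)"
  unfolding slot_mix_eq_pull[abs_def]
  by (rule measurable_compose[OF P.measurable_pull measurable_mix_sel]) (auto simp: pair_roles_def)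

lemma measurable_pair_kernel: "pair_kernel k d \<nu> v \<in> borel_measurable (PiM (pair_roles k v) (\<lambda>_. P))"
  unfolding pair_kernel_def[abs_def]
  using measurable_slot_mix[of v False] measurable_slot_mix[of v True] by measurable

lemma abs_pair_kernel_le: "0 < \<nu> \<Longrightarrow> \<bar>pair_kernel k d \<nu> v y\<bar> \<le> 1"
  by (simp add: pair_kernel_def gauss_kernel_le_1)

lemma measurable_gconv_dens: "gconv C \<nu> (dens u) \<in> borel_measurable (leb C)"
  using dens(1) by (intro measurable_gconv) auto

lemma abs_gconv_dens_le: "0 < \<nu> \<Longrightarrow> x \<in> space (leb C) \<Longrightarrow> \<bar>gconv C \<nu> (dens u) x\<bar> \<le> 1"
proof -
  have "(\<integral>y. \<bar>dens u y\<bar> \<partial>leb C) = (\<integral>y. dens u y \<partial>leb C)"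
    using dens(2) by (intro Bochner_Integration.integral_cong) auto
  then show "0 < \<nu> \<Longrightarrow> x \<in> space (leb C) \<Longrightarrow> \<bar>gconv C \<nu> (dens u) x\<bar> \<le> 1"
    using abs_gconv_le[of \<nu> x C "dens u"] dens(4,5) by simp
qed

lemma mix_sel_space: "Y \<in> space (PiM (roles k u) (\<lambda>_. P)) \<Longrightarrow> mix k d Y (sel u) \<in> space (leb C)"
  using measurable_space[OF measurable_mix_sel] .

text \<open>Fixing one slot leaves the other compared vector untouched; integrating that vector out turns the kernel into a Gaussian
convolution of its density, to be evaluated at the vector that contains the fixed slot.\<close>

lemma hproj_pair_kernel:
  assumes \<nu>: "0 < \<nu>" and c: "c \<in> roles k (v t)" and x: "x \<in> space (leb C)"
  shows "hproj P (pair_roles k v) (pair_kernel k d \<nu> v) (t, c) x =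
    hproj P (roles k (v t)) (\<lambda>Y. gconv C \<nu> (dens (v (\<not> t))) (mix k d Y (sel (v t)))) c x"
proof -
  let ?J = "pair_roles k v" and ?A = "roles k (v t)" and ?B = "roles k (v (\<not> t))"
  define I1 where "I1 = {t} \<times> (?A - {c})"
  define I2 where "I2 = {\<not> t} \<times> ?B"
  have "?J - {(t, c)} = I1 \<union> I2"
  proof (rule set_eqI)
    fix z :: "bool \<times> nat"
    obtain t' b where z: "z = (t', b)" by (cases z)
    show "z \<in> ?J - {(t, c)} \<longleftrightarrow> z \<in> I1 \<union> I2"
    proof (cases "t' = t")
      case True
      then show ?thesis by (simp add: z pair_roles_def I1_def I2_def)
    next
      case False
      then have "t' = (\<not> t)" by simp
      then show ?thesis by (simp add: z pair_roles_def I1_def I2_def)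
    qed
  qed
  then have J: "?J - {(t, c)} = I1 \<union> I2" "I1 \<inter> I2 = {}" "finite I1" "finite I2"
    by (auto simp: I1_def I2_def)
  have tc: "(t, c) \<in> ?J" using c by (auto simp: pair_roles_def)
  interpret PP: product_prob_space "\<lambda>_::bool \<times> nat. P" by (rule P.product_prob_space_const)
  interpret PJ: prob_space "PiM (I1 \<union> I2) (\<lambda>_. P)" by (rule P.prob_space_PiM_const)
  have xP: "x \<in> space P" using x by simp
  have int: "integrable (PiM (I1 \<union> I2) (\<lambda>_. P)) (\<lambda>y. pair_kernel k d \<nu> v (y((t, c) := x)))"
    using P.measurable_upd_slice[OF tc xP measurable_pair_kernel] abs_pair_kernel_le[OF \<nu>]
    unfolding J(1) by (intro PJ.bounded_integrable[where b=1]) auto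
  have "hproj P ?J (pair_kernel k d \<nu> v) (t, c) x =
    (\<integral>y1. (\<integral>y2. pair_kernel k d \<nu> v ((merge I1 I2 (y1, y2))((t, c) := x)) \<partial>PiM I2 (\<lambda>_. P)) \<partial>PiM I1 (\<lambda>_. P))"
    unfolding hproj_def J(1) by (rule PP.product_integral_fold[OF J(2-4) int])
  also have "... = (\<integral>y1. gconv C \<nu> (dens (v (\<not> t))) (mix k d ((pull (?A - {c}) (Pair t) y1)(c := x)) (sel (v t))) \<partial>PiM I1 (\<lambda>_. P))"
  proof (rule Bochner_Integration.integral_cong[OF refl])
    fix y1 assume y1: "y1 \<in> space (PiM I1 (\<lambda>_. P))"
    define z where "z = mix k d ((pull (?A - {c}) (Pair t) y1)(c := x)) (sel (v t))"
    have "pull (?A - {c}) (Pair t) y1 \<in> space (PiM (?A - {c}) (\<lambda>_. P))"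
      by (rule measurable_space[OF P.measurable_pull y1]) (auto simp: I1_def)
    then have z: "z \<in> space (leb C)" unfolding z_def
      by (intro mix_sel_space P.upd_in_space_PiM) (use x c in auto)
    have 1: "slot_mix k d (v t) t ((merge I1 I2 (y1, y2))((t, c) := x)) = z" for y2
      unfolding slot_mix_def z_def by (intro mix_cong) (auto simp: pull_def merge_def I1_def sel_in_roles)
    have 2: "slot_mix k d (v (\<not> t)) (\<not> t) ((merge I1 I2 (y1, y2))((t, c) := x)) =
       mix k d (pull ?B (Pair (\<not> t)) y2) (sel (v (\<not> t)))" for y2
      unfolding slot_mix_def by (intro mix_cong) (auto simp: pull_def merge_def I1_def I2_def sel_in_roles)
    have gz: "gauss_kernel C \<nu> z \<in> borel_measurable (leb C)" using z by measurable
    have "(\<integral>y2. pair_kernel k d \<nu> v ((merge I1 I2 (y1, y2))((t, c) := x)) \<partial>PiM I2 (\<lambda>_. P)) =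
      (\<integral>y2. gauss_kernel C \<nu> z (mix k d (pull ?B (Pair (\<not> t)) y2) (sel (v (\<not> t)))) \<partial>PiM I2 (\<lambda>_. P))"
      unfolding pair_kernel_sym[of k d \<nu> v _ t] 1 2 ..
    also have "... = (\<integral>Y. gauss_kernel C \<nu> z (mix k d Y (sel (v (\<not> t)))) \<partial>PiM ?B (\<lambda>_. P))"
      by (rule P.integral_pull) (auto simp: I2_def inj_on_def intro!: measurable_compose[OF measurable_mix_sel gz])
    also have "... = gconv C \<nu> (dens (v (\<not> t))) z"
      unfolding integral_mix_sel[OF gz] gconv_def by (simp add: mult.commute)
    finally show "(\<integral>y2. pair_kernel k d \<nu> v ((merge I1 I2 (y1, y2))((t, c) := x)) \<partial>PiM I2 (\<lambda>_. P)) =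
      gconv C \<nu> (dens (v (\<not> t))) (mix k d ((pull (?A - {c}) (Pair t) y1)(c := x)) (sel (v t)))"
      unfolding z_def .
  qed
  also have "... = hproj P ?A (\<lambda>Y. gconv C \<nu> (dens (v (\<not> t))) (mix k d Y (sel (v t)))) c x"
    unfolding hproj_def
    by (rule P.integral_pull[where h="\<lambda>y. gconv C \<nu> (dens (v (\<not> t))) (mix k d (y(c := x)) (sel (v t)))"])
       (auto simp: I1_def inj_on_def intro!: P.measurable_upd_slice[OF c xP] measurable_compose[OF measurable_mix_sel measurable_gconv_dens])
  finally show ?thesis .
qed

text \<open>The expectation of the kernel with flags \<open>v\<close>.\<close>

definition "\<theta> \<nu> v = (\<integral>x. dens (v False) x * gconv C \<nu> (dens (v True)) x \<partial>leb C)"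

lemma expectation_pair_kernel:
  assumes \<nu>: "0 < \<nu>"
  shows "(\<integral>y. pair_kernel k d \<nu> v y \<partial>PiM (pair_roles k v) (\<lambda>_. P)) = \<theta> \<nu> v"
proof -
  have c: "(False, 0) \<in> pair_roles k v" "0 \<in> roles k (v False)" using k0 by (auto simp: pair_roles_def roles_def)
  let ?h = "\<lambda>Y. gconv C \<nu> (dens (v True)) (mix k d Y (sel (v False)))"
  have hm: "?h \<in> borel_measurable (PiM (roles k (v False)) (\<lambda>_. P))"
    by (rule measurable_compose[OF measurable_mix_sel measurable_gconv_dens])
  have "(\<integral>y. pair_kernel k d \<nu> v y \<partial>PiM (pair_roles k v) (\<lambda>_. P)) =
    (\<integral>x. hproj P (pair_roles k v) (pair_kernel k d \<nu> v) (False, 0) x \<partial>P)"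
    by (rule P.integral_hproj[OF c(1) measurable_pair_kernel abs_pair_kernel_le[OF \<nu>], symmetric])
  also have "... = (\<integral>x. hproj P (roles k (v False)) ?h 0 x \<partial>P)"
    using hproj_pair_kernel[where t=False and v=v and c=0, OF \<nu> c(2)] by (intro Bochner_Integration.integral_cong refl) simp
  also have "... = (\<integral>Y. ?h Y \<partial>PiM (roles k (v False)) (\<lambda>_. P))"
    by (rule P.integral_hproj[OF c(2) hm, where b=1]) (auto intro!: abs_gconv_dens_le \<nu> mix_sel_space)
  also have "... = \<theta> \<nu> v" unfolding \<theta>_def by (rule integral_mix_sel[OF measurable_gconv_dens])
  finally show ?thesis .
qed

lemma \<theta>_le: "0 < \<nu> \<Longrightarrow> \<theta> \<nu> v \<le> K \<nu> * B"
proof -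
  assume \<nu>: "0 < \<nu>"
  have "\<theta> \<nu> v \<le> K \<nu> * sqrt ((\<integral>x. (dens (v False) x)\<^sup>2 \<partial>leb C) * (\<integral>x. (dens (v True) x)\<^sup>2 \<partial>leb C))"
    unfolding \<theta>_def K_def by (rule integral_mult_gconv_le[OF finite_coords \<nu> dens(4) dens(4) dens_square(1) dens_square(1)])
  also have "... \<le> K \<nu> * sqrt (B * B)"
    using K_pos[OF \<nu>] B_nonneg by (intro mult_left_mono real_sqrt_le_mono mult_mono dens_square) auto
  finally show ?thesis using B_nonneg by simp
qed

text \<open>The square of a Gaussian kernel is a Gaussian kernel of twice the parameter, so its expectation has the same bound.\<close>

lemma pair_kernel_second_moment:
  assumes \<nu>: "0 < \<nu>"
  shows "(\<integral>y. (pair_kernel k d \<nu> v y)\<^sup>2 \<partial>PiM (pair_roles k v) (\<lambda>_. P)) \<le> K \<nu> * B"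
proof -
  have "(\<integral>y. (pair_kernel k d \<nu> v y)\<^sup>2 \<partial>PiM (pair_roles k v) (\<lambda>_. P)) = \<theta> (2 * \<nu>) v"
    unfolding pair_kernel_square using \<nu> by (intro expectation_pair_kernel) simp
  also have "... \<le> K (2 * \<nu>) * B" using \<nu> by (intro \<theta>_le) simp
  also have "... \<le> K \<nu> * B" using K_double_le[OF \<nu>] B_nonneg by (intro mult_right_mono)
  finally show ?thesis .
qed

text \<open>The quantity that is estimated: the squared kernel discrepancy between the joint law and the product of the marginals.\<close>

definition "\<gamma>2 \<nu> = genergy C \<nu> gap"

lemma gconv_gap: "0 < \<nu> \<Longrightarrow> x \<in> space (leb C) \<Longrightarrow> gconv C \<nu> gap x = gconv C \<nu> (dens False) x - gconv C \<nu> (dens True) x"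
  unfolding gap_eq[abs_def] by (rule gconv_diff) (auto simp: dens(4))

lemma \<gamma>2_eq:
  assumes \<nu>: "0 < \<nu>"
  shows "\<gamma>2 \<nu> = \<theta> \<nu> (\<lambda>_. False) + \<theta> \<nu> (\<lambda>_. True) - 2 * \<theta> \<nu> id"
proof -
  have int: "integrable (leb C) (\<lambda>x. dens u x * gconv C \<nu> (dens w) x)" for u w
  proof (rule Bochner_Integration.integrable_bound[OF dens(4)[of u]])
    show "(\<lambda>x. dens u x * gconv C \<nu> (dens w) x) \<in> borel_measurable (leb C)"
      using dens(1)[of u] measurable_gconv_dens[of \<nu> w] by measurable
    show "AE x in leb C. norm (dens u x * gconv C \<nu> (dens w) x) \<le> norm (dens u x)"
      using abs_gconv_dens_le[OF \<nu>] by (intro AE_I2) (auto simp: abs_mult intro!: mult_right_le_one_le)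
  qed
  have com: "(\<integral>x. dens True x * gconv C \<nu> (dens False) x \<partial>leb C) = \<theta> \<nu> id"
    unfolding \<theta>_def using integral_gconv_commute[OF finite_coords \<nu> dens(4)[of True] dens(4)[of False]] by simp
  have "\<gamma>2 \<nu> = (\<integral>x. dens False x * gconv C \<nu> (dens False) x - dens False x * gconv C \<nu> (dens True) x
      - dens True x * gconv C \<nu> (dens False) x + dens True x * gconv C \<nu> (dens True) x \<partial>leb C)"
    unfolding \<gamma>2_def genergy_def
    by (intro Bochner_Integration.integral_cong refl) (simp add: gconv_gap[OF \<nu>] gap_eq algebra_simps)
  also have "... = \<theta> \<nu> (\<lambda>_. False) + \<theta> \<nu> (\<lambda>_. True) - 2 * \<theta> \<nu> id"
    using int com by (simp add: \<theta>_def)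
  finally show ?thesis .
qed

text \<open>The variance of the linear part, bounded by the signal. One factor of the convolution is bounded uniformly by the root
of the energy, the other one is integrated against the density by the Cauchy-Schwarz inequality.\<close>

lemma integral_gconv_gap_square_dens_le:
  assumes \<nu>: "0 < \<nu>"
  shows "(\<integral>x. dens u x * (gconv C \<nu> gap x)\<^sup>2 \<partial>leb C) \<le> sqrt (K \<nu> * B) * \<gamma>2 \<nu>"
proof -
  let ?F = "gconv C \<nu> gap"
  have F2: "(?F x)\<^sup>2 \<le> \<gamma>2 \<nu>" if "x \<in> space (leb C)" for x
    unfolding \<gamma>2_def by (rule gconv_square_le_genergy[OF finite_coords \<nu> that integrable_gap])
  have \<gamma>0: "0 \<le> \<gamma>2 \<nu>" unfolding \<gamma>2_def by (rule genergy_nonneg[OF finite_coords \<nu> integrable_gap])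
  have Fs: "\<bar>?F x\<bar> \<le> sqrt (\<gamma>2 \<nu>)" if "x \<in> space (leb C)" for x
    using F2[OF that] by (simp add: real_le_rsqrt)
  have [measurable]: "?F \<in> borel_measurable (leb C)" "dens u \<in> borel_measurable (leb C)"
    using integrable_gap dens(1) by (auto intro!: measurable_gconv)
  have iF2: "integrable (leb C) (\<lambda>x. (?F x)\<^sup>2)" by (rule integrable_gconv_square[OF finite_coords \<nu> integrable_gap])
  have cs: "integrable (leb C) (\<lambda>x. dens u x * \<bar>?F x\<bar>)"
     "(\<integral>x. dens u x * \<bar>?F x\<bar> \<partial>leb C)\<^sup>2 \<le> (\<integral>x. (dens u x)\<^sup>2 \<partial>leb C) * (\<integral>x. \<bar>?F x\<bar>\<^sup>2 \<partial>leb C)"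
    using Cauchy_Schwarz_integral[of "dens u" "leb C" "\<lambda>x. \<bar>?F x\<bar>"] dens_square(1)[of u] iF2 by simp_all
  note cs(2)
  also have "(\<integral>x. (dens u x)\<^sup>2 \<partial>leb C) * (\<integral>x. \<bar>?F x\<bar>\<^sup>2 \<partial>leb C) \<le> B * (K \<nu> * \<gamma>2 \<nu>)"
    using integral_gconv_square_le_genergy[OF finite_coords \<nu> integrable_gap] dens_square(2)[of u] B_nonneg
    by (intro mult_mono) (auto simp: K_def \<gamma>2_def)
  finally have le: "(\<integral>x. dens u x * \<bar>?F x\<bar> \<partial>leb C) \<le> sqrt (B * (K \<nu> * \<gamma>2 \<nu>))"
    by (rule real_le_rsqrt)
  have "(\<integral>x. dens u x * (?F x)\<^sup>2 \<partial>leb C) \<le> (\<integral>x. sqrt (\<gamma>2 \<nu>) * (dens u x * \<bar>?F x\<bar>) \<partial>leb C)"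
  proof (rule integral_mono')
    show "integrable (leb C) (\<lambda>x. sqrt (\<gamma>2 \<nu>) * (dens u x * \<bar>?F x\<bar>))" using cs(1) by simp
    fix x assume x: "x \<in> space (leb C)"
    have "dens u x * (\<bar>?F x\<bar> * \<bar>?F x\<bar>) \<le> dens u x * (sqrt (\<gamma>2 \<nu>) * \<bar>?F x\<bar>)"
      using Fs[OF x] dens(2)[OF x] by (intro mult_left_mono mult_right_mono) auto
    then show "dens u x * (?F x)\<^sup>2 \<le> sqrt (\<gamma>2 \<nu>) * (dens u x * \<bar>?F x\<bar>)"
      by (simp add: power2_eq_square mult_ac)
    show "0 \<le> sqrt (\<gamma>2 \<nu>) * (dens u x * \<bar>?F x\<bar>)" using \<gamma>0 dens(2)[OF x] by simp
  qed
  also have "... = sqrt (\<gamma>2 \<nu>) * (\<integral>x. dens u x * \<bar>?F x\<bar> \<partial>leb C)" by simp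
  also have "... \<le> sqrt (\<gamma>2 \<nu>) * sqrt (B * (K \<nu> * \<gamma>2 \<nu>))" using le \<gamma>0 by (intro mult_left_mono) auto
  also have "... = sqrt (K \<nu> * B) * (sqrt (\<gamma>2 \<nu>) * sqrt (\<gamma>2 \<nu>))" by (simp add: real_sqrt_mult mult_ac)
  also have "... = sqrt (K \<nu> * B) * \<gamma>2 \<nu>" using \<gamma>0 by simp
  finally show ?thesis .
qed

text \<open>The linear part contributed by one of the two compared vectors when the other one has been integrated out.\<close>

definition "proj_sum u \<phi> x = (\<Sum>c\<in>roles k u. hproj P (roles k u) (\<lambda>Y. \<phi> (mix k d Y (sel u))) c x)"

lemma proj_sum_second_moment:
  assumes [measurable]: "\<phi> \<in> borel_measurable (leb C)" and b: "\<And>x. x \<in> space (leb C) \<Longrightarrow> \<bar>\<phi> x\<bar> \<le> b"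
  shows "proj_sum u \<phi> \<in> borel_measurable (leb C)"
    and "\<And>x. x \<in> space (leb C) \<Longrightarrow> \<bar>proj_sum u \<phi> x\<bar> \<le> real k * b"
    and "(\<integral>x. (proj_sum u \<phi> x)\<^sup>2 \<partial>P) \<le> (real k)\<^sup>2 * (\<integral>x. dens u x * (\<phi> x)\<^sup>2 \<partial>leb C)"
proof -
  let ?A = "roles k u" and ?h = "\<lambda>Y. \<phi> (mix k d Y (sel u))"
  have hm: "?h \<in> borel_measurable (PiM ?A (\<lambda>_. P))" by (rule measurable_compose[OF measurable_mix_sel]) fact
  have hb: "\<bar>?h Y\<bar> \<le> b" if "Y \<in> space (PiM ?A (\<lambda>_. P))" for Y using b[OF mix_sel_space[OF that]] .
  have mP: "hproj P ?A ?h c \<in> borel_measurable P" if "c \<in> ?A" for c by (rule P.measurable_hproj[OF that hm])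
  have bP: "\<bar>hproj P ?A ?h c x\<bar> \<le> b" if "c \<in> ?A" "x \<in> space (leb C)" for c x
    by (rule P.abs_hproj_le[OF that(1) _ hm hb]) (use that in auto)
  have A: "real (card ?A) \<le> real k" "0 < card ?A" using k by (auto simp: card_roles)
  have "proj_sum u \<phi> \<in> borel_measurable P"
    unfolding proj_sum_def[abs_def] using mP by (intro borel_measurable_sum) auto
  then show "proj_sum u \<phi> \<in> borel_measurable (leb C)" by (simp add: measurable_cong_sets[OF sets_law refl])
  obtain x0 where x0: "x0 \<in> space P" using P.not_empty by blast
  have b0: "0 \<le> b" using b[of x0] x0 by (simp add: order_trans[OF abs_ge_zero])
  show "\<bar>proj_sum u \<phi> x\<bar> \<le> real k * b" if x: "x \<in> space (leb C)" for x
  proof -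
    have "\<bar>proj_sum u \<phi> x\<bar> \<le> (\<Sum>c\<in>?A. \<bar>hproj P ?A ?h c x\<bar>)" unfolding proj_sum_def by (rule sum_abs)
    also have "... \<le> (\<Sum>c\<in>?A. b)" using x by (intro sum_mono bP) auto
    also have "... \<le> real k * b" using A b0 by (simp add: mult_right_mono)
    finally show ?thesis .
  qed
  have i2: "integrable P (\<lambda>x. (hproj P ?A ?h c x)\<^sup>2)" if "c \<in> ?A" for c
    using mP[OF that] bP[OF that] by (intro P.bounded_integrable[where b="b\<^sup>2"] abs_square_le) auto
  have "(\<integral>x. (proj_sum u \<phi> x)\<^sup>2 \<partial>P) \<le> (\<integral>x. real (card ?A) * (\<Sum>c\<in>?A. (hproj P ?A ?h c x)\<^sup>2) \<partial>P)"
  proof (rule integral_mono')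
    show "integrable P (\<lambda>x. real (card ?A) * (\<Sum>c\<in>?A. (hproj P ?A ?h c x)\<^sup>2))"
      using i2 by (intro integrable_mult_right Bochner_Integration.integrable_sum)
    show "(proj_sum u \<phi> x)\<^sup>2 \<le> real (card ?A) * (\<Sum>c\<in>?A. (hproj P ?A ?h c x)\<^sup>2)" for x
      using Cauchy_Schwarz_ineq_sum[of "\<lambda>_. 1" "\<lambda>c. hproj P ?A ?h c x" ?A] by (simp add: proj_sum_def)
  qed (auto intro!: mult_nonneg_nonneg sum_nonneg)
  also have "... = real (card ?A) * (\<Sum>c\<in>?A. \<integral>x. (hproj P ?A ?h c x)\<^sup>2 \<partial>P)"
    using i2 by (simp add: Bochner_Integration.integral_sum)
  also have "... \<le> real (card ?A) * (\<Sum>c\<in>?A. \<integral>Y. (?h Y)\<^sup>2 \<partial>PiM ?A (\<lambda>_. P))"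
    by (intro mult_left_mono sum_mono P.integral_hproj_square_le[where b=b] hm hb) auto
  also have "(\<integral>Y. (?h Y)\<^sup>2 \<partial>PiM ?A (\<lambda>_. P)) = (\<integral>x. dens u x * (\<phi> x)\<^sup>2 \<partial>leb C)"
    by (rule integral_mix_sel) measurable
  also have "real (card ?A) * (\<Sum>c\<in>?A. \<integral>x. dens u x * (\<phi> x)\<^sup>2 \<partial>leb C) = (real (card ?A))\<^sup>2 * (\<integral>x. dens u x * (\<phi> x)\<^sup>2 \<partial>leb C)"
    by (simp add: power2_eq_square)
  also have "... \<le> (real k)\<^sup>2 * (\<integral>x. dens u x * (\<phi> x)\<^sup>2 \<partial>leb C)"
    using A dens(2) by (intro mult_right_mono power_mono Bochner_Integration.integral_nonneg) auto
  finally show "(\<integral>x. (proj_sum u \<phi> x)\<^sup>2 \<partial>P) \<le> (real k)\<^sup>2 * (\<integral>x. dens u x * (\<phi> x)\<^sup>2 \<partial>leb C)" .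
qed

lemma proj_sum_diff:
  assumes m: "\<phi> \<in> borel_measurable (leb C)" "\<psi> \<in> borel_measurable (leb C)"
    and b: "\<And>x. x \<in> space (leb C) \<Longrightarrow> \<bar>\<phi> x\<bar> \<le> b" "\<And>x. x \<in> space (leb C) \<Longrightarrow> \<bar>\<psi> x\<bar> \<le> b"
    and x: "x \<in> space (leb C)" and eq: "\<And>x. x \<in> space (leb C) \<Longrightarrow> \<zeta> x = \<phi> x - \<psi> x"
  shows "proj_sum u \<zeta> x = proj_sum u \<phi> x - proj_sum u \<psi> x"
  unfolding proj_sum_def sum_subtractf[symmetric]
proof (rule sum.cong[OF refl])
  let ?A = "roles k u"
  fix c assume c: "c \<in> ?A"
  interpret Q: prob_space "PiM (?A - {c}) (\<lambda>_. P)" by (rule P.prob_space_PiM_const)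
  have sp: "mix k d (Y(c := x)) (sel u) \<in> space (leb C)" if "Y \<in> space (PiM (?A - {c}) (\<lambda>_. P))" for Y
    by (intro mix_sel_space P.upd_in_space_PiM c that) (use x in simp)
  have int: "integrable (PiM (?A - {c}) (\<lambda>_. P)) (\<lambda>Y. \<xi> (mix k d (Y(c := x)) (sel u)))"
    if "\<xi> \<in> borel_measurable (leb C)" "\<And>x. x \<in> space (leb C) \<Longrightarrow> \<bar>\<xi> x\<bar> \<le> b" for \<xi>
    by (rule Q.bounded_integrable[OF P.measurable_upd_slice[OF c _ measurable_compose[OF measurable_mix_sel that(1)]], where b=b])
       (use x that(2) sp in auto)
  have "hproj P ?A (\<lambda>Y. \<zeta> (mix k d Y (sel u))) c x =
    (\<integral>Y. \<phi> (mix k d (Y(c := x)) (sel u)) - \<psi> (mix k d (Y(c := x)) (sel u)) \<partial>PiM (?A - {c}) (\<lambda>_. P))"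
    unfolding hproj_def by (intro Bochner_Integration.integral_cong refl eq sp)
  also have "... = hproj P ?A (\<lambda>Y. \<phi> (mix k d Y (sel u))) c x - hproj P ?A (\<lambda>Y. \<psi> (mix k d Y (sel u))) c x"
    unfolding hproj_def using int[OF m(1) b(1)] int[OF m(2) b(2)] by simp
  finally show "hproj P ?A (\<lambda>Y. \<zeta> (mix k d Y (sel u))) c x =
    hproj P ?A (\<lambda>Y. \<phi> (mix k d Y (sel u))) c x - hproj P ?A (\<lambda>Y. \<psi> (mix k d Y (sel u))) c x" .
qed

lemma sum_hproj_pair_kernel:
  assumes \<nu>: "0 < \<nu>" and x: "x \<in> space (leb C)"
  shows "(\<Sum>a\<in>pair_roles k v. hproj P (pair_roles k v) (pair_kernel k d \<nu> v) a x) =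
    proj_sum (v False) (gconv C \<nu> (dens (v True))) x + proj_sum (v True) (gconv C \<nu> (dens (v False))) x"
proof -
  have "(\<Sum>a\<in>pair_roles k v. hproj P (pair_roles k v) (pair_kernel k d \<nu> v) a x) =
    (\<Sum>t\<in>UNIV. \<Sum>c\<in>roles k (v t). hproj P (pair_roles k v) (pair_kernel k d \<nu> v) (t, c) x)"
    by (simp add: sum.Sigma pair_roles_def)
  also have "... = (\<Sum>t\<in>UNIV. proj_sum (v t) (gconv C \<nu> (dens (v (\<not> t)))) x)"
    unfolding proj_sum_def by (intro sum.cong refl hproj_pair_kernel \<nu> x)
  finally show ?thesis by (simp add: sum_bool)
qed

text \<open>The linear parts of the three U-statistics add up to the linear parts for the convolution of \<open>p - q\<close>, because
\<open>proj_sum\<close> is linear and the coefficients are \<open>1, 1, -2\<close>. This cancellation makes the first error term proportional to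
the signal. The second error term comes from the degenerate parts.\<close>

lemma gamma2_hat_mean_square_error:
  assumes \<nu>: "0 < \<nu>" and n: "4 * k \<le> n"
  shows "gamma2_hat k d n \<nu> \<in> borel_measurable (PiM {..<n} (\<lambda>_. P))"
    and "integrable (PiM {..<n} (\<lambda>_. P)) (\<lambda>X. (gamma2_hat k d n \<nu> X - \<gamma>2 \<nu>)\<^sup>2)"
    and "(\<integral>X. (gamma2_hat k d n \<nu> X - \<gamma>2 \<nu>)\<^sup>2 \<partial>PiM {..<n} (\<lambda>_. P)) \<le>
      324 * (2 * real k) ^ 6 * 4 ^ k * (sqrt (K \<nu> * B) * \<gamma>2 \<nu> / n + K \<nu> * B / (real n)\<^sup>2)"
proof -
  let ?PP = "PiM {..<n} (\<lambda>_. P)"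
  let ?J = "pair_roles k" and ?h = "pair_kernel k d \<nu>"
  interpret PP: prob_space ?PP by (rule P.prob_space_PiM_const)
  have n0: "0 < n" using n k by simp
  have J: "finite (?J v)" "?J v \<noteq> {}" "2 * card (?J v) \<le> n" for v
    using pair_roles_nonempty[OF k0] card_pair_roles_le[OF k0, of v] n by auto
  note J12 = J(1,2)
  have cJ: "1 \<le> real (card (?J v))" "real (card (?J v)) \<le> 2 * real k" for v
    using J[of v] card_pair_roles_le[OF k0, of v] by (auto simp: Suc_leI card_gt_0_iff)
  define g where "g v = P.degenerate_part (?J v) (?h v)" for v
  note hm = measurable_pair_kernel[of \<nu>] and hb = abs_pair_kernel_le[OF \<nu>]
  have gm: "g v \<in> borel_measurable (PiM (?J v) (\<lambda>_. P))" for v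
    unfolding g_def by (rule P.measurable_degenerate_part[OF J12 hm hb])
  have gb: "\<bar>g v y\<bar> \<le> 3 * real (card (?J v)) * 1" if "y \<in> space (PiM (?J v) (\<lambda>_. P))" for v y
    unfolding g_def by (rule P.abs_degenerate_part_le[OF J12 hm hb that])
  define R where "R v = ustat (?J v) n (g v)" for v
  have mp: "pull (?J v) \<sigma> \<in> measurable ?PP (PiM (?J v) (\<lambda>_. P))" if "\<sigma> \<in> inj_tuples (?J v) n" for v \<sigma>
    using that by (intro P.measurable_pull) (auto simp: inj_tuples_def)
  have Um: "ustat (?J v) n f \<in> borel_measurable ?PP" if "f \<in> borel_measurable (PiM (?J v) (\<lambda>_. P))" for v f
    unfolding ustat_def[abs_def]
    by (intro borel_measurable_divide borel_measurable_sum borel_measurable_const measurable_compose[OF mp that])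
  have Ub: "\<bar>ustat (?J v) n f X\<bar> \<le> b" if "X \<in> space ?PP" "\<And>y. y \<in> space (PiM (?J v) (\<lambda>_. P)) \<Longrightarrow> \<bar>f y\<bar> \<le> b" "0 \<le> b" for v f X b
  proof -
    have "\<bar>\<Sum>\<sigma>\<in>inj_tuples (?J v) n. f (pull (?J v) \<sigma> X)\<bar> \<le> (\<Sum>\<sigma>\<in>inj_tuples (?J v) n. b)"
      by (intro order_trans[OF sum_abs] sum_mono that measurable_space[OF mp])
    then show ?thesis using \<open>0 \<le> b\<close>
      by (auto simp: ustat_def abs_divide divide_le_eq mult.commute card_gt_0_iff)
  qed
  have Rm [measurable]: "R v \<in> borel_measurable ?PP" for v unfolding R_def by (rule Um[OF gm])
  have Rb: "\<bar>R v X\<bar> \<le> 3 * real (card (?J v)) * 1" if "X \<in> space ?PP" for v X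
    unfolding R_def by (rule Ub[OF that gb]) auto
  have R2i: "integrable ?PP (\<lambda>X. (R v X)\<^sup>2)" for v
    using Rb by (intro PP.bounded_integrable[OF _ abs_square_le]) auto
  have R2: "(\<integral>X. (R v X)\<^sup>2 \<partial>?PP) \<le> 9 * (2 * real k) ^ 6 * 4 ^ k * (K \<nu> * B) / (real n)\<^sup>2" for v
  proof -
    let ?m = "real (card (?J v))"
    have "(\<integral>X. (R v X)\<^sup>2 \<partial>?PP) \<le> ?m ^ 4 * 2 ^ card (?J v) / (real n)\<^sup>2 * (\<integral>y. (g v y)\<^sup>2 \<partial>PiM (?J v) (\<lambda>_. P))"
      unfolding R_def
      by (rule P.degenerate_ustat_second_moment[OF J gm gb])
         (auto simp: g_def intro!: P.hproj_degenerate_part[OF J12 hm hb])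
    also have "... \<le> ?m ^ 4 * 2 ^ card (?J v) / (real n)\<^sup>2 * (9 * ?m\<^sup>2 * (K \<nu> * B))"
    proof (intro mult_left_mono)
      have "(\<integral>y. (g v y)\<^sup>2 \<partial>PiM (?J v) (\<lambda>_. P)) \<le> 9 * ?m\<^sup>2 * (\<integral>y. (?h v y)\<^sup>2 \<partial>PiM (?J v) (\<lambda>_. P))"
        unfolding g_def by (rule P.degenerate_part_second_moment[OF J12 hm hb])
      also have "... \<le> 9 * ?m\<^sup>2 * (K \<nu> * B)" by (intro mult_left_mono pair_kernel_second_moment \<nu>) auto
      finally show "(\<integral>y. (g v y)\<^sup>2 \<partial>PiM (?J v) (\<lambda>_. P)) \<le> 9 * ?m\<^sup>2 * (K \<nu> * B)" .
    qed auto
    also have "... = 9 * (?m ^ 6 * 2 ^ card (?J v) * (K \<nu> * B) / (real n)\<^sup>2)"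
      by (simp add: eval_nat_numeral)
    also have "... \<le> 9 * ((2 * real k) ^ 6 * 2 ^ (2 * k) * (K \<nu> * B) / (real n)\<^sup>2)"
      using cJ[of v] card_pair_roles_le[OF k0, of v] K_pos[OF \<nu>] B_nonneg
      by (intro mult_left_mono divide_right_mono mult_right_mono mult_mono power_mono power_increasing) auto
    also have "(2::real) ^ (2 * k) = 4 ^ k" by (simp add: power_mult)
    finally show ?thesis by simp
  qed
  let ?v0 = "\<lambda>_::bool. False" and ?v1 = "\<lambda>_::bool. True" and ?v2 = "id :: bool \<Rightarrow> bool"
  let ?F = "gconv C \<nu> gap" and ?D = "\<lambda>u. gconv C \<nu> (dens u)"
  define l where "l x = 2 * proj_sum False ?F x - 2 * proj_sum True ?F x" for x
  have Fm: "?F \<in> borel_measurable (leb C)" using integrable_gap by (intro measurable_gconv) auto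
  have Fb: "\<bar>?F x\<bar> \<le> 2" if "x \<in> space (leb C)" for x
    using abs_gconv_dens_le[OF \<nu> that, of False] abs_gconv_dens_le[OF \<nu> that, of True] gconv_gap[OF \<nu> that] by linarith
  have psF: "proj_sum u ?F x = proj_sum u (?D False) x - proj_sum u (?D True) x" if "x \<in> space (leb C)" for u x
    by (rule proj_sum_diff[OF measurable_gconv_dens measurable_gconv_dens _ _ that gconv_gap[OF \<nu>]])
       (auto intro!: abs_gconv_dens_le \<nu>)
  have l_eq: "(\<Sum>a\<in>?J ?v0. hproj P (?J ?v0) (?h ?v0) a x) + (\<Sum>a\<in>?J ?v1. hproj P (?J ?v1) (?h ?v1) a x)
      - 2 * (\<Sum>a\<in>?J ?v2. hproj P (?J ?v2) (?h ?v2) a x) = l x" if "x \<in> space (leb C)" for x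
    unfolding sum_hproj_pair_kernel[OF \<nu> that] l_def psF[OF that] by simp
  have lm: "l \<in> borel_measurable P"
    unfolding l_def[abs_def] measurable_cong_sets[OF sets_law refl] using proj_sum_second_moment(1)[OF Fm Fb] by measurable
  have pb: "\<bar>proj_sum u ?F x\<bar> \<le> real k * 2" if "x \<in> space (leb C)" for u x
    by (rule proj_sum_second_moment(2)[OF Fm Fb that])
  have lb: "\<bar>l x\<bar> \<le> 8 * real k" if "x \<in> space P" for x
    using pb[of x False] pb[of x True] that unfolding l_def by simp
  have l2: "(\<integral>x. (l x)\<^sup>2 \<partial>P) \<le> 16 * (real k)\<^sup>2 * (sqrt (K \<nu> * B) * \<gamma>2 \<nu>)"
  proof -
    have i: "integrable P (\<lambda>x. (proj_sum u ?F x)\<^sup>2)" for u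
      using pb[of _ u] proj_sum_second_moment(1)[OF Fm Fb, of u]
      by (intro P.bounded_integrable[where b="(real k * 2)\<^sup>2"] abs_square_le) (auto simp: measurable_cong_sets[OF sets_law refl])
    have s: "(\<integral>x. (proj_sum u ?F x)\<^sup>2 \<partial>P) \<le> (real k)\<^sup>2 * (sqrt (K \<nu> * B) * \<gamma>2 \<nu>)" for u
      by (rule order_trans[OF proj_sum_second_moment(3)[OF Fm Fb]])
         (auto intro!: mult_left_mono integral_gconv_gap_square_dens_le \<nu>)
    have "(\<integral>x. (l x)\<^sup>2 \<partial>P) \<le> (\<integral>x. 8 * (proj_sum False ?F x)\<^sup>2 + 8 * (proj_sum True ?F x)\<^sup>2 \<partial>P)"
    proof (rule integral_mono')
      show "integrable P (\<lambda>x. 8 * (proj_sum False ?F x)\<^sup>2 + 8 * (proj_sum True ?F x)\<^sup>2)"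
        using i by (intro Bochner_Integration.integrable_add integrable_mult_right)
      show "(l x)\<^sup>2 \<le> 8 * (proj_sum False ?F x)\<^sup>2 + 8 * (proj_sum True ?F x)\<^sup>2" for x
      proof -
        have "8 * a\<^sup>2 + 8 * b\<^sup>2 - (2 * a - 2 * b)\<^sup>2 = (2 * a + 2 * b)\<^sup>2" for a b :: real
          by (simp add: power2_eq_square algebra_simps)
        from this[of "proj_sum False ?F x" "proj_sum True ?F x"] show ?thesis
          unfolding l_def using zero_le_power2[of "2 * proj_sum False ?F x + 2 * proj_sum True ?F x"] by linarith
      qed
    qed auto
    also have "... = 8 * (\<integral>x. (proj_sum False ?F x)\<^sup>2 \<partial>P) + 8 * (\<integral>x. (proj_sum True ?F x)\<^sup>2 \<partial>P)"
      using i by simp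
    finally show ?thesis using s[of False] s[of True] by simp
  qed
  define L where "L X = (\<Sum>i<n. l (X i)) / n - P.expectation l" for X
  have Lm [measurable]: "L \<in> borel_measurable ?PP"
  proof -
    have "(\<lambda>X. l (X i)) \<in> borel_measurable ?PP" if "i < n" for i
      using measurable_compose[OF measurable_component_singleton[of i "{..<n}" "\<lambda>_. P"] lm] that by simp
    then show ?thesis unfolding L_def[abs_def]
      by (intro borel_measurable_diff borel_measurable_divide borel_measurable_sum borel_measurable_const) auto
  qed
  have L2: "(\<integral>X. (L X)\<^sup>2 \<partial>?PP) \<le> 16 * (real k)\<^sup>2 * (sqrt (K \<nu> * B) * \<gamma>2 \<nu>) / n"
    unfolding L_def by (rule order_trans[OF P.centered_mean_second_moment[OF lm lb n0]])
      (auto intro!: divide_right_mono l2)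
  have Lb: "\<bar>L X\<bar> \<le> 16 * real k" if "X \<in> space ?PP" for X
  proof -
    have "\<bar>\<Sum>i<n. l (X i)\<bar> \<le> (\<Sum>i<n. 8 * real k)"
      using that by (intro order_trans[OF sum_abs] sum_mono lb) (auto simp: space_PiM)
    then have 1: "\<bar>(\<Sum>i<n. l (X i)) / n\<bar> \<le> 8 * real k" using n0 by (simp add: field_simps)
    have "\<bar>P.expectation l\<bar> \<le> (\<integral>x. \<bar>l x\<bar> \<partial>P)" by (rule integral_abs_bound)
    also have "... \<le> (\<integral>x. 8 * real k \<partial>P)" using lb lm by (intro integral_mono integrable_abs P.bounded_integrable[OF lm lb]) auto
    finally have "\<bar>P.expectation l\<bar> \<le> 8 * real k" by (simp add: P.prob_space[simplified])
    with 1 show ?thesis unfolding L_def by linarith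
  qed
  have L2i: "integrable ?PP (\<lambda>X. (L X)\<^sup>2)"
    using Lb by (intro PP.bounded_integrable[OF _ abs_square_le]) auto
  have El: "P.expectation l = real (card (?J ?v0)) * \<theta> \<nu> ?v0 + real (card (?J ?v1)) * \<theta> \<nu> ?v1 - 2 * (real (card (?J ?v2)) * \<theta> \<nu> ?v2)"
  proof -
    have ii: "integrable P (\<lambda>x. \<Sum>a\<in>?J v. hproj P (?J v) (?h v) a x)" "(\<integral>x. (\<Sum>a\<in>?J v. hproj P (?J v) (?h v) a x) \<partial>P) = real (card (?J v)) * \<theta> \<nu> v" for v
    proof -
      have i: "integrable P (hproj P (?J v) (?h v) a)" if "a \<in> ?J v" for a
        by (rule P.bounded_integrable[OF P.measurable_hproj[OF that hm] P.abs_hproj_le[OF that _ hm hb]])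
      then show "integrable P (\<lambda>x. \<Sum>a\<in>?J v. hproj P (?J v) (?h v) a x)" by (intro Bochner_Integration.integrable_sum)
      have "(\<integral>x. (\<Sum>a\<in>?J v. hproj P (?J v) (?h v) a x) \<partial>P) = (\<Sum>a\<in>?J v. \<integral>x. hproj P (?J v) (?h v) a x \<partial>P)"
        using i by (rule Bochner_Integration.integral_sum)
      also have "... = (\<Sum>a\<in>?J v. \<theta> \<nu> v)"
        unfolding expectation_pair_kernel[OF \<nu>, symmetric] by (intro sum.cong refl P.integral_hproj[OF _ hm hb])
      finally show "(\<integral>x. (\<Sum>a\<in>?J v. hproj P (?J v) (?h v) a x) \<partial>P) = real (card (?J v)) * \<theta> \<nu> v" by simp
    qed
    have "P.expectation l = (\<integral>x. (\<Sum>a\<in>?J ?v0. hproj P (?J ?v0) (?h ?v0) a x) + (\<Sum>a\<in>?J ?v1. hproj P (?J ?v1) (?h ?v1) a x)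
      - 2 * (\<Sum>a\<in>?J ?v2. hproj P (?J ?v2) (?h ?v2) a x) \<partial>P)"
      by (intro Bochner_Integration.integral_cong refl l_eq[symmetric]) simp
    then show ?thesis using ii(1)[of ?v0] ii(1)[of ?v1] ii(1)[of ?v2] by (simp add: ii(2))
  qed
  have decomp: "gamma2_hat k d n \<nu> X - \<gamma>2 \<nu> = L X + (R ?v0 X + R ?v1 X - 2 * R ?v2 X)" if X: "X \<in> space ?PP" for X
  proof -
    have Xi: "X i \<in> space (leb C)" if "i < n" for i using X that by (auto simp: space_PiM)
    have U: "ustat (?J v) n (?h v) X = (\<Sum>i<n. \<Sum>a\<in>?J v. hproj P (?J v) (?h v) a (X i)) / n - (real (card (?J v)) - 1) * \<theta> \<nu> v + R v X" for v
      using P.ustat_decomposition[OF J, of v "?h v" X] unfolding R_def g_def expectation_pair_kernel[OF \<nu>] .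
    have S: "(\<Sum>i<n. l (X i)) = (\<Sum>i<n. \<Sum>a\<in>?J ?v0. hproj P (?J ?v0) (?h ?v0) a (X i)) + (\<Sum>i<n. \<Sum>a\<in>?J ?v1. hproj P (?J ?v1) (?h ?v1) a (X i))
       - 2 * (\<Sum>i<n. \<Sum>a\<in>?J ?v2. hproj P (?J ?v2) (?h ?v2) a (X i))"
      unfolding sum_distrib_left sum.distrib[symmetric] sum_subtractf[symmetric]
      by (intro sum.cong refl) (simp add: l_eq[OF Xi, symmetric] sum_distrib_left)
    have 4: "2 * k \<le> n" using n by simp
    have G: "gamma2_hat k d n \<nu> X = ustat (?J ?v0) n (?h ?v0) X + ustat (?J ?v1) n (?h ?v1) X - 2 * ustat (?J ?v2) n (?h ?v2) X"
      by (rule gamma2_hat_eq_ustat[OF k 4]) (rule Xi)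
    show ?thesis
      unfolding G U \<gamma>2_eq[OF \<nu>] L_def S El
      by (simp add: add_divide_distrib diff_divide_distrib algebra_simps)
  qed
  let ?D = "\<lambda>X. L X + (R ?v0 X + R ?v1 X - 2 * R ?v2 X)"
  have "(\<lambda>X. ?D X + \<gamma>2 \<nu>) \<in> borel_measurable ?PP" by measurable
  then show "gamma2_hat k d n \<nu> \<in> borel_measurable ?PP"
    by (rule measurable_cong[THEN iffD1, rotated]) (simp add: decomp[symmetric])
  have dom: "(?D X)\<^sup>2 \<le> 2 * (L X)\<^sup>2 + 6 * (R ?v0 X)\<^sup>2 + 6 * (R ?v1 X)\<^sup>2 + 24 * (R ?v2 X)\<^sup>2" for X
  proof -
    have "2 * L\<^sup>2 + 6 * a\<^sup>2 + 6 * b\<^sup>2 + 24 * c\<^sup>2 - (L + (a + b - 2 * c))\<^sup>2 =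
      (L - (a + b - 2 * c))\<^sup>2 + 2 * (a - b)\<^sup>2 + 2 * (a + 2 * c)\<^sup>2 + 2 * (b + 2 * c)\<^sup>2" for L a b c :: real
      by (simp add: power2_eq_square algebra_simps)
    from this[of "L X" "R ?v0 X" "R ?v1 X" "R ?v2 X"] show ?thesis
      by (smt (verit) zero_le_power2)
  qed
  have domi: "integrable ?PP (\<lambda>X. 2 * (L X)\<^sup>2 + 6 * (R ?v0 X)\<^sup>2 + 6 * (R ?v1 X)\<^sup>2 + 24 * (R ?v2 X)\<^sup>2)"
    using L2i R2i by (intro Bochner_Integration.integrable_add integrable_mult_right)
  have Di: "integrable ?PP (\<lambda>X. (?D X)\<^sup>2)"
    using dom by (intro Bochner_Integration.integrable_bound[OF domi]) (auto intro!: AE_I2 order_trans[OF _ abs_ge_self])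
  then show "integrable ?PP (\<lambda>X. (gamma2_hat k d n \<nu> X - \<gamma>2 \<nu>)\<^sup>2)"
    by (rule Bochner_Integration.integrable_cong[THEN iffD1, rotated 2]) (simp_all add: decomp)
  have "(\<integral>X. (gamma2_hat k d n \<nu> X - \<gamma>2 \<nu>)\<^sup>2 \<partial>?PP) = (\<integral>X. (?D X)\<^sup>2 \<partial>?PP)"
    by (intro Bochner_Integration.integral_cong refl) (simp add: decomp)
  also have "... \<le> (\<integral>X. 2 * (L X)\<^sup>2 + 6 * (R ?v0 X)\<^sup>2 + 6 * (R ?v1 X)\<^sup>2 + 24 * (R ?v2 X)\<^sup>2 \<partial>?PP)"
    by (rule integral_mono[OF Di domi dom])
  also have "... = 2 * (\<integral>X. (L X)\<^sup>2 \<partial>?PP) + 6 * (\<integral>X. (R ?v0 X)\<^sup>2 \<partial>?PP) + 6 * (\<integral>X. (R ?v1 X)\<^sup>2 \<partial>?PP) + 24 * (\<integral>X. (R ?v2 X)\<^sup>2 \<partial>?PP)"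
    using L2i R2i by simp
  also have "... \<le> 2 * (16 * (real k)\<^sup>2 * (sqrt (K \<nu> * B) * \<gamma>2 \<nu>) / n) + 6 * (9 * (2 * real k) ^ 6 * 4 ^ k * (K \<nu> * B) / (real n)\<^sup>2)
      + 6 * (9 * (2 * real k) ^ 6 * 4 ^ k * (K \<nu> * B) / (real n)\<^sup>2) + 24 * (9 * (2 * real k) ^ 6 * 4 ^ k * (K \<nu> * B) / (real n)\<^sup>2)"
    by (intro add_mono mult_left_mono L2 R2) simp_all
  also have "... = 2 * (16 * (real k)\<^sup>2 * (sqrt (K \<nu> * B) * \<gamma>2 \<nu>) / n) + 36 * (9 * (2 * real k) ^ 6 * 4 ^ k * (K \<nu> * B) / (real n)\<^sup>2)"
    by simp
  also have "... \<le> 324 * (2 * real k) ^ 6 * 4 ^ k * (sqrt (K \<nu> * B) * \<gamma>2 \<nu> / n + K \<nu> * B / (real n)\<^sup>2)"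
  proof -
    have \<gamma>0: "0 \<le> \<gamma>2 \<nu>" unfolding \<gamma>2_def by (rule genergy_nonneg[OF finite_coords \<nu> integrable_gap])
    have "(2 * real k)\<^sup>2 \<le> (2 * real k) ^ 6" using k by (intro power_increasing) auto
    moreover have "(1::real) \<le> 4 ^ k" by simp
    ultimately have "(2 * real k)\<^sup>2 * 1 \<le> (2 * real k) ^ 6 * 4 ^ k" by (intro mult_mono) auto
    then have "4 * (real k)\<^sup>2 \<le> (2 * real k) ^ 6 * 4 ^ k" by (simp only: power_mult_distrib) simp
    moreover have "0 \<le> (2 * real k) ^ 6 * 4 ^ k" by simp
    ultimately have "32 * (real k)\<^sup>2 \<le> 324 * ((2 * real k) ^ 6 * 4 ^ k)" by linarith
    then have "32 * (real k)\<^sup>2 * (sqrt (K \<nu> * B) * \<gamma>2 \<nu> / n) \<le> 324 * ((2 * real k) ^ 6 * 4 ^ k) * (sqrt (K \<nu> * B) * \<gamma>2 \<nu> / n)"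
      using \<gamma>0 K_pos[OF \<nu>] B_nonneg by (intro mult_right_mono) auto
    then show ?thesis by (simp add: algebra_simps)
  qed
  finally show "(\<integral>X. (gamma2_hat k d n \<nu> X - \<gamma>2 \<nu>)\<^sup>2 \<partial>?PP) \<le>
      324 * (2 * real k) ^ 6 * 4 ^ k * (sqrt (K \<nu> * B) * \<gamma>2 \<nu> / n + K \<nu> * B / (real n)\<^sup>2)" .
qed

end

section \<open>Smoothness of products of densities and the studentising factor\<close>

lemma sum_coords: "(\<Sum>i\<in>coords k d. f i) = (\<Sum>j<k. \<Sum>i\<in>block d j. f i)"
proof (induction k)
  case (Suc k)
  then show ?case by (simp add: coords_Suc sum.union_disjoint coords_block_disjoint)
qed (simp add: coords_def)

lemma continuous_subvec: "continuous (at x within S) (subvec d j)"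
proof -
  have "continuous_on UNIV (\<lambda>x. subvec d j x i)" for i
    by (cases "i \<in> block d j") (simp_all add: subvec_def)
  then have "continuous_on UNIV (subvec d j)" by (rule continuous_on_coordinatewise_then_product)
  then show ?thesis by (metis UNIV_I continuous_on_eq_continuous_within continuous_within_subset subset_UNIV)
qed

lemma AE_continuous_tensor:
  assumes "\<And>j. j < k \<Longrightarrow> AE y in leb (block d j). continuous (at y within space (leb (block d j))) (pm j)"
  shows "AE x in leb (coords k d). continuous (at x within space (leb (coords k d))) (tensor k d pm)"
proof -
  have "AE x in leb (coords k d). \<forall>j\<in>{..<k}. continuous (at (subvec d j x) within space (leb (block d j))) (pm j)"
    by (rule AE_finite_allI) (auto intro: AE_subvec assms)
  then show ?thesis
  proof (rule AE_mp, intro AE_I2 impI)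
    fix x assume x: "x \<in> space (leb (coords k d))"
      and c: "\<forall>j\<in>{..<k}. continuous (at (subvec d j x) within space (leb (block d j))) (pm j)"
    have "continuous (at x within space (leb (coords k d))) (\<lambda>x. pm j (subvec d j x))" if "j < k" for j
    proof (rule continuous_within_compose2[OF continuous_subvec])
      have "subvec d j ` space (leb (coords k d)) \<subseteq> space (leb (block d j))"
        using measurable_space[OF measurable_subvec[OF that]] by auto
      with c that show "continuous (at (subvec d j x) within subvec d j ` space (leb (coords k d))) (pm j)"
        by (auto intro: continuous_within_subset)
    qed
    then show "continuous (at x within space (leb (coords k d))) (tensor k d pm)"
      unfolding tensor_def[abs_def] by (intro continuous_prod) auto
  qed
qed

lemma fourier_tensor:
  assumes "\<And>j. j < k \<Longrightarrow> integrable (leb (block d j)) (pm j)"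
  shows "fourier (coords k d) (tensor k d pm) \<omega> = (\<Prod>j<k. fourier (block d j) (pm j) (subvec d j \<omega>))"
proof -
  have card: "card (coords k d) = (\<Sum>j<k. card (block d j))"
    by (simp add: card_coords total_dim_def block_def)
  have const: "(2 * pi) powr (- real (card (coords k d)) / 2) = (\<Prod>j<k. (2 * pi) powr (- real (card (block d j)) / 2))"
  proof -
    have "- real (card (coords k d)) / 2 = (\<Sum>j<k. - real (card (block d j)) / 2)"
      by (simp add: card sum_divide_distrib sum_negf)
    then show ?thesis by (simp only:) (rule powr_sum, auto)
  qed
  define g where "g j y = complex_of_real (pm j y) * cis (- (\<Sum>i\<in>block d j. y i * \<omega> i))" for j y
  have gi: "integrable (leb (block d j)) (g j)" if "j < k" for j
  proof (rule Bochner_Integration.integrable_bound[OF assms[OF that]])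
    have [measurable]: "pm j \<in> borel_measurable (leb (block d j))" using assms[OF that] by auto
    show "g j \<in> borel_measurable (leb (block d j))" unfolding g_def[abs_def] by measurable
  qed (auto simp: g_def norm_mult)
  have "complex_of_real (tensor k d pm x) * cis (- (\<Sum>i\<in>coords k d. x i * \<omega> i)) = (\<Prod>j<k. g j (subvec d j x))" for x
  proof -
    have "(\<Sum>i\<in>coords k d. x i * \<omega> i) = (\<Sum>j<k. \<Sum>i\<in>block d j. subvec d j x i * \<omega> i)"
      by (simp add: sum_coords subvec_def)
    then show ?thesis
      by (simp add: g_def tensor_def prod.distrib cis_conv_exp exp_sum sum_distrib_left sum_negf[symmetric] del: sum_negf)
  qed
  then have "(\<integral>x. complex_of_real (tensor k d pm x) * cis (- (\<Sum>i\<in>coords k d. x i * \<omega> i)) \<partial>leb (coords k d)) =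
    (\<Prod>j<k. \<integral>y. g j y \<partial>leb (block d j))"
    using integral_blocks[of k d g, OF gi] by simp
  moreover have "fourier (block d j) (pm j) (subvec d j \<omega>) = complex_of_real ((2 * pi) powr (- real (card (block d j)) / 2)) * (\<integral>y. g j y \<partial>leb (block d j))" for j
    unfolding fourier_eq_cis g_def by (simp add: subvec_def)
  ultimately show ?thesis
    unfolding fourier_eq_cis[of "coords k d"] const by (simp add: prod.distrib)
qed

lemma one_plus_sum_le_prod:
  fixes a :: "'i \<Rightarrow> real"
  assumes "finite A" "\<And>i. i \<in> A \<Longrightarrow> 0 \<le> a i"
  shows "1 + (\<Sum>i\<in>A. a i) \<le> (\<Prod>i\<in>A. 1 + a i)"
  using assms
proof (induction A rule: finite_induct)
  case (insert i A)
  have s: "0 \<le> (\<Sum>i\<in>A. a i)" using insert by (intro sum_nonneg) auto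
  have "1 + (a i + (\<Sum>i\<in>A. a i)) \<le> (1 + a i) * (1 + (\<Sum>i\<in>A. a i))"
    using insert.prems[of i] s by (simp add: algebra_simps)
  also have "... \<le> (1 + a i) * (\<Prod>i\<in>A. 1 + a i)"
    using insert by (intro mult_left_mono) auto
  finally show ?case using insert by simp
qed simp

lemma sobolev_density_nonneg: "0 \<le> sobolev_density I s f \<omega>"
  by (simp add: sobolev_density_def)

lemma sobolev_norm_square: "(sobolev_norm I s f)\<^sup>2 = (\<integral>\<omega>. sobolev_density I s f \<omega> \<partial>leb I)"
  unfolding sobolev_norm_def by (subst real_sqrt_pow2) (auto intro!: Bochner_Integration.integral_nonneg sobolev_density_nonneg)

lemma sobolev_ballD:
  assumes "f \<in> sobolev_ball I s M"
  shows "f \<in> sobolev I s" "(sobolev_norm I s f)\<^sup>2 \<le> M\<^sup>2" "0 \<le> M"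
proof -
  have n: "0 \<le> sobolev_norm I s f" unfolding sobolev_norm_def
    by (auto intro!: Bochner_Integration.integral_nonneg sobolev_density_nonneg)
  show "f \<in> sobolev I s" "(sobolev_norm I s f)\<^sup>2 \<le> M\<^sup>2" "0 \<le> M"
    using assms n by (auto simp: sobolev_ball_def intro: power_mono)
qed

lemma measurable_sobolev_density:
  assumes "finite I" and [measurable]: "f \<in> borel_measurable (leb I)"
  shows "sobolev_density I s f \<in> borel_measurable (leb I)"
  unfolding sobolev_density_def[abs_def] L2_set_def using assms(1) by measurable

text \<open>The Sobolev weight is submultiplicative over the blocks, since \<open>1 + \<Sum> a\<^sub>j \<le> \<Prod> (1 + a\<^sub>j)\<close>, and the Fourier transform
of a tensor product is the product of the transforms.\<close>

lemma tensor_sobolev: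
  assumes s: "0 < s" and pm: "\<And>j. j < k \<Longrightarrow> pm j \<in> sobolev_ball (block d j) s (M j)"
  shows "tensor k d pm \<in> sobolev (coords k d) s"
    and "(sobolev_norm (coords k d) s (tensor k d pm))\<^sup>2 \<le> (\<Prod>j<k. M j)\<^sup>2"
proof -
  let ?C = "coords k d"
  have S: "pm j \<in> sobolev (block d j) s" "(sobolev_norm (block d j) s (pm j))\<^sup>2 \<le> (M j)\<^sup>2" if "j < k" for j
    using sobolev_ballD[OF pm[OF that]] by auto
  have i: "integrable (leb (block d j)) (pm j)" "integrable (leb (block d j)) (sobolev_density (block d j) s (pm j))"
    "AE y in leb (block d j). continuous (at y within space (leb (block d j))) (pm j)" if "j < k" for j
    using S(1)[OF that] by (auto simp: sobolev_def)
  have ti: "integrable (leb ?C) (tensor k d pm)" unfolding tensor_def[abs_def] by (rule integrable_blocks[OF i(1)])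
  have dom: "sobolev_density ?C s (tensor k d pm) \<omega> \<le> (\<Prod>j<k. sobolev_density (block d j) s (pm j) (subvec d j \<omega>))" for \<omega>
  proof -
    let ?r = "\<lambda>j. \<Sum>i\<in>block d j. (\<omega> i)\<^sup>2"
    have r: "(L2_set \<omega> ?C)\<^sup>2 = (\<Sum>j<k. ?r j)" "(L2_set (subvec d j \<omega>) (block d j))\<^sup>2 = ?r j" for j
      by (simp_all add: L2_set_def sum_nonneg sum_coords subvec_def)
    have "(1 + (\<Sum>j<k. ?r j)) powr s \<le> (\<Prod>j<k. 1 + ?r j) powr s"
      using s by (intro powr_mono2 one_plus_sum_le_prod add_nonneg_nonneg) (auto intro!: sum_nonneg)
    also have "... = (\<Prod>j<k. (1 + ?r j) powr s)"
      by (rule prod_powr_distrib)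
    finally have w: "(1 + (\<Sum>j<k. ?r j)) powr s \<le> (\<Prod>j<k. (1 + ?r j) powr s)" .
    have F: "(cmod (fourier ?C (tensor k d pm) \<omega>))\<^sup>2 = (\<Prod>j<k. (cmod (fourier (block d j) (pm j) (subvec d j \<omega>)))\<^sup>2)"
      by (subst fourier_tensor[OF i(1)]) (simp_all add: prod_norm[symmetric] prod_power_distrib)
    show ?thesis unfolding sobolev_density_def r F prod.distrib
      by (rule mult_right_mono[OF w]) (simp add: prod_nonneg)
  qed
  note int = integrable_blocks[OF i(2)]
  have Si: "integrable (leb ?C) (sobolev_density ?C s (tensor k d pm))"
  proof (rule Bochner_Integration.integrable_bound[OF int])
    show "sobolev_density ?C s (tensor k d pm) \<in> borel_measurable (leb ?C)"
      using ti by (intro measurable_sobolev_density) auto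
    show "AE \<omega> in leb ?C. norm (sobolev_density ?C s (tensor k d pm) \<omega>) \<le> norm (\<Prod>j<k. sobolev_density (block d j) s (pm j) (subvec d j \<omega>))"
      using dom by (intro AE_I2) (simp add: sobolev_density_nonneg prod_nonneg)
  qed
  show "tensor k d pm \<in> sobolev ?C s"
    using ti Si AE_continuous_tensor[OF i(3)] by (simp add: sobolev_def)
  have "(sobolev_norm ?C s (tensor k d pm))\<^sup>2 \<le> (\<integral>\<omega>. (\<Prod>j<k. sobolev_density (block d j) s (pm j) (subvec d j \<omega>)) \<partial>leb ?C)"
    unfolding sobolev_norm_square by (rule integral_mono[OF Si int dom])
  also have "... = (\<Prod>j<k. (sobolev_norm (block d j) s (pm j))\<^sup>2)"
    unfolding sobolev_norm_square by (rule integral_blocks) (rule i(2))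
  also have "... \<le> (\<Prod>j<k. (M j)\<^sup>2)" using S(2) by (intro prod_mono) auto
  finally show "(sobolev_norm ?C s (tensor k d pm))\<^sup>2 \<le> (\<Prod>j<k. M j)\<^sup>2" by (simp add: prod_power_distrib)
qed

lemma fourier_diff:
  assumes "finite I" and f: "integrable (leb I) f" and g: "integrable (leb I) g"
  shows "fourier I (\<lambda>x. f x - g x) \<omega> = fourier I f \<omega> - fourier I g \<omega>"
proof -
  have i: "integrable (leb I) (\<lambda>x. complex_of_real (h x) * cis (- (\<Sum>i\<in>I. x i * \<omega> i)))" if "integrable (leb I) h" for h
  proof (rule Bochner_Integration.integrable_bound[OF that])
    have [measurable]: "h \<in> borel_measurable (leb I)" using that by auto
    show "(\<lambda>x. complex_of_real (h x) * cis (- (\<Sum>i\<in>I. x i * \<omega> i))) \<in> borel_measurable (leb I)" by measurable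
  qed (auto simp: norm_mult)
  show ?thesis unfolding fourier_eq_cis using i[OF f] i[OF g] by (simp add: left_diff_distrib right_diff_distrib)
qed

lemma sobolev_diff:
  assumes I: "finite I" and f: "f \<in> sobolev I s" and g: "g \<in> sobolev I s"
  shows "(\<lambda>x. f x - g x) \<in> sobolev I s"
    and "(sobolev_norm I s (\<lambda>x. f x - g x))\<^sup>2 \<le> 2 * (sobolev_norm I s f)\<^sup>2 + 2 * (sobolev_norm I s g)\<^sup>2"
proof -
  have i: "integrable (leb I) f" "integrable (leb I) g"
    "integrable (leb I) (sobolev_density I s f)" "integrable (leb I) (sobolev_density I s g)"
    "AE x in leb I. continuous (at x within space (leb I)) f" "AE x in leb I. continuous (at x within space (leb I)) g"
    using f g by (auto simp: sobolev_def)
  let ?h = "\<lambda>x. f x - g x"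
  have dom: "sobolev_density I s ?h \<omega> \<le> 2 * sobolev_density I s f \<omega> + 2 * sobolev_density I s g \<omega>" for \<omega>
  proof -
    have "(cmod (a - b))\<^sup>2 \<le> 2 * (cmod a)\<^sup>2 + 2 * (cmod b)\<^sup>2" for a b :: complex
    proof -
      have "(cmod (a - b))\<^sup>2 \<le> (cmod a + cmod b)\<^sup>2" by (intro power_mono norm_triangle_ineq4) auto
      also have "... \<le> 2 * (cmod a)\<^sup>2 + 2 * (cmod b)\<^sup>2"
        using sum_squares_bound[of "cmod a" "cmod b"] by (simp add: power2_sum)
      finally show ?thesis .
    qed
    from mult_left_mono[OF this, of "(1 + (L2_set \<omega> I)\<^sup>2) powr s" "fourier I f \<omega>" "fourier I g \<omega>"]
    show ?thesis by (simp add: sobolev_density_def fourier_diff[OF I i(1,2)] algebra_simps)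
  qed
  have int: "integrable (leb I) (\<lambda>\<omega>. 2 * sobolev_density I s f \<omega> + 2 * sobolev_density I s g \<omega>)" using i by simp
  have Si: "integrable (leb I) (sobolev_density I s ?h)"
  proof (rule Bochner_Integration.integrable_bound[OF int])
    show "sobolev_density I s ?h \<in> borel_measurable (leb I)" using i I by (intro measurable_sobolev_density) auto
    show "AE \<omega> in leb I. norm (sobolev_density I s ?h \<omega>) \<le> norm (2 * sobolev_density I s f \<omega> + 2 * sobolev_density I s g \<omega>)"
      using dom by (intro AE_I2) (simp add: sobolev_density_nonneg)
  qed
  have "AE x in leb I. continuous (at x within space (leb I)) ?h"
    using i(5,6) by eventually_elim (rule continuous_diff)
  then show "?h \<in> sobolev I s" using i Si by (simp add: sobolev_def)
  show "(sobolev_norm I s ?h)\<^sup>2 \<le> 2 * (sobolev_norm I s f)\<^sup>2 + 2 * (sobolev_norm I s g)\<^sup>2"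
    unfolding sobolev_norm_square using integral_mono[OF Si int dom] i by simp
qed

text \<open>A crude bound: every product in the formula has one factor for each subvector, a statistic or a difference of
statistics, and the differences cost at most constant factors.\<close>

lemma s2_tilde_le:
  assumes A: "\<And>l. l < k \<Longrightarrow> 0 \<le> stat_A d n \<nu> X l \<and> stat_A d n \<nu> X l \<le> W l"
    and B: "\<And>l. l < k \<Longrightarrow> 0 \<le> stat_B d n \<nu> X l \<and> stat_B d n \<nu> X l \<le> W l"
    and C: "\<And>l. l < k \<Longrightarrow> 0 \<le> stat_C d n \<nu> X l \<and> stat_C d n \<nu> X l \<le> W l"
    and k: "1 \<le> k"
  shows "s2_tilde k d n \<nu> X \<le> 9 * (real k)\<^sup>2 * (\<Prod>l<k. W l)"
proof -
  define a b c where "a = stat_A d n \<nu> X" and "b = stat_B d n \<nu> X" and "c = stat_C d n \<nu> X"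
  let ?W = "\<Prod>l<k. W l"
  have W0: "0 \<le> W l" if "l < k" for l using A[OF that] by linarith
  have P: "0 \<le> (\<Prod>l<k. f l)" "(\<Prod>l<k. f l) \<le> ?W" if "\<And>l. l < k \<Longrightarrow> 0 \<le> f l \<and> f l \<le> W l" for f
    using that by (auto intro!: prod_nonneg prod_mono)
  have one: "\<bar>f j * (\<Prod>l\<in>{..<k} - {j}. g l)\<bar> \<le> ?W"
    if "j < k" "\<bar>f j\<bar> \<le> W j" "\<And>l. l < k \<Longrightarrow> 0 \<le> g l \<and> g l \<le> W l" for f g j
  proof -
    have "0 \<le> (\<Prod>l\<in>{..<k} - {j}. g l)" using that(3) by (intro prod_nonneg) auto
    then have "\<bar>f j * (\<Prod>l\<in>{..<k} - {j}. g l)\<bar> = \<bar>f j\<bar> * (\<Prod>l\<in>{..<k} - {j}. g l)"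
      by (simp add: abs_mult)
    also have "... \<le> W j * (\<Prod>l\<in>{..<k} - {j}. W l)"
      using that W0 by (intro mult_mono prod_mono prod_nonneg) auto
    also have "... = ?W" using that(1) by (subst prod.remove[of "{..<k}" j]) auto
    finally show ?thesis .
  qed
  have two: "\<bar>f i * f j * (\<Prod>l\<in>{..<k} - {i, j}. g l)\<bar> \<le> ?W"
    if "i < k" "j < k" "i \<noteq> j" "\<And>l. l < k \<Longrightarrow> \<bar>f l\<bar> \<le> W l" "\<And>l. l < k \<Longrightarrow> 0 \<le> g l \<and> g l \<le> W l" for f g i j
  proof -
    have "0 \<le> (\<Prod>l\<in>{..<k} - {i, j}. g l)" using that(5) by (intro prod_nonneg) auto
    then have "\<bar>f i * f j * (\<Prod>l\<in>{..<k} - {i, j}. g l)\<bar> = \<bar>f i\<bar> * \<bar>f j\<bar> * (\<Prod>l\<in>{..<k} - {i, j}. g l)"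
      by (simp add: abs_mult)
    also have "... \<le> W i * W j * (\<Prod>l\<in>{..<k} - {i, j}. W l)"
      using that W0 by (intro mult_mono prod_mono prod_nonneg mult_nonneg_nonneg) auto
    also have "... = W i * (W j * (\<Prod>l\<in>{..<k} - {i} - {j}. W l))" by (simp add: Diff_insert2[symmetric] insert_commute mult.assoc)
    also have "... = W i * (\<Prod>l\<in>{..<k} - {i}. W l)" using that by (subst prod.remove[of "{..<k} - {i}" j]) auto
    also have "... = ?W" using that(1) by (subst prod.remove[of "{..<k}" i]) auto
    finally show ?thesis .
  qed
  have abc: "0 \<le> a l \<and> a l \<le> W l" "0 \<le> b l \<and> b l \<le> W l" "0 \<le> c l \<and> c l \<le> W l" if "l < k" for l
    using A[OF that] B[OF that] C[OF that] by (auto simp: a_def b_def c_def)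
  have t1: "(\<Prod>l<k. a l) - 2 * (\<Prod>l<k. b l) + (\<Prod>l<k. c l) \<le> 2 * ?W"
    using P[of a] P[of b] P[of c] abc by fastforce
  have t2: "- 2 * (\<Sum>j<k. a j * (\<Prod>l\<in>{..<k} - {j}. b l) - (\<Prod>l<k. b l) - b j * (\<Prod>l\<in>{..<k} - {j}. c l) + (\<Prod>l<k. c l)) \<le> 4 * real k * ?W"
  proof -
    have "(\<Sum>j<k. - 2 * ?W) \<le> (\<Sum>j<k. a j * (\<Prod>l\<in>{..<k} - {j}. b l) - (\<Prod>l<k. b l) - b j * (\<Prod>l\<in>{..<k} - {j}. c l) + (\<Prod>l<k. c l))"
    proof (rule sum_mono)
      fix j assume "j \<in> {..<k}"
      then have j: "j < k" by simp
      have "0 \<le> a j * (\<Prod>l\<in>{..<k} - {j}. b l)" using j abc by (intro mult_nonneg_nonneg prod_nonneg) auto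
      moreover have "b j * (\<Prod>l\<in>{..<k} - {j}. c l) \<le> ?W" using one[of j b c] j abc by fastforce
      moreover have "(\<Prod>l<k. b l) \<le> ?W" "0 \<le> (\<Prod>l<k. c l)" using P[of b] P[of c] abc by auto
      ultimately show "- 2 * ?W \<le> a j * (\<Prod>l\<in>{..<k} - {j}. b l) - (\<Prod>l<k. b l) - b j * (\<Prod>l\<in>{..<k} - {j}. c l) + (\<Prod>l<k. c l)"
        by linarith
    qed
    then show ?thesis by simp
  qed
  have t3: "(\<Sum>j<k. (a j - 2 * b j + c j) * (\<Prod>l\<in>{..<k} - {j}. c l)) \<le> real k * (2 * ?W)"
  proof -
    have "(\<Sum>j<k. (a j - 2 * b j + c j) * (\<Prod>l\<in>{..<k} - {j}. c l)) \<le> (\<Sum>j<k. 2 * ?W)"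
    proof (rule sum_mono)
      fix j assume "j \<in> {..<k}"
      then have j: "j < k" by simp
      have "a j * (\<Prod>l\<in>{..<k} - {j}. c l) \<le> ?W" "c j * (\<Prod>l\<in>{..<k} - {j}. c l) \<le> ?W"
        using one[of j a c] one[of j c c] j abc by fastforce+
      moreover have "0 \<le> b j * (\<Prod>l\<in>{..<k} - {j}. c l)" using j abc by (intro mult_nonneg_nonneg prod_nonneg) auto
      ultimately show "(a j - 2 * b j + c j) * (\<Prod>l\<in>{..<k} - {j}. c l) \<le> 2 * ?W" by (simp add: algebra_simps)
    qed
    then show ?thesis by simp
  qed
  have t4: "(\<Sum>(j1, j2)\<in>{(j1, j2) \<in> {..<k} \<times> {..<k}. j1 \<noteq> j2}. (b j1 - c j1) * (b j2 - c j2) * (\<Prod>l\<in>{..<k} - {j1, j2}. c l)) \<le> (real k)\<^sup>2 * ?W"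
  proof -
    let ?S = "{(j1, j2) \<in> {..<k} \<times> {..<k}. j1 \<noteq> j2}"
    have sub: "?S \<subseteq> {..<k} \<times> {..<k}" by auto
    have "card ?S \<le> card ({..<k} \<times> {..<k})" by (rule card_mono[OF _ sub]) simp
    then have "card ?S \<le> k * k" by (simp only: card_cartesian_product card_lessThan)
    then have "real (card ?S) \<le> real (k * k)" by (rule of_nat_mono)
    then have cS: "real (card ?S) \<le> (real k)\<^sup>2" by (simp add: power2_eq_square)
    have "(\<Sum>(j1, j2)\<in>?S. (b j1 - c j1) * (b j2 - c j2) * (\<Prod>l\<in>{..<k} - {j1, j2}. c l)) \<le> (\<Sum>q\<in>?S. ?W)"
    proof (rule sum_mono)
      fix q assume "q \<in> ?S"
      then obtain j1 j2 where q: "q = (j1, j2)" and j: "j1 \<in> {..<k}" "j2 \<in> {..<k}" "j1 \<noteq> j2" by auto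
      have "\<bar>(\<lambda>l. b l - c l) j1 * (\<lambda>l. b l - c l) j2 * (\<Prod>l\<in>{..<k} - {j1, j2}. c l)\<bar> \<le> ?W"
      proof (rule two)
        show "\<bar>b l - c l\<bar> \<le> W l" if "l < k" for l using abc(2,3)[OF that] by linarith
      qed (use j abc in auto)
      then show "(case q of (j1, j2) \<Rightarrow> (b j1 - c j1) * (b j2 - c j2) * (\<Prod>l\<in>{..<k} - {j1, j2}. c l)) \<le> ?W"
        unfolding q prod.case by linarith
    qed
    also have "... = real (card ?S) * ?W" by (rule sum_constant)
    also have "... \<le> (real k)\<^sup>2 * ?W" using W0 by (intro mult_right_mono cS prod_nonneg) auto
    finally show ?thesis .
  qed
  have "s2_tilde k d n \<nu> X \<le> 2 * ?W + 4 * real k * ?W + real k * (2 * ?W) + (real k)\<^sup>2 * ?W"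
    unfolding s2_tilde_def Let_def a_def[symmetric] b_def[symmetric] c_def[symmetric]
    using t1 t2 t3 t4 by linarith
  also have "... = (2 + 6 * real k + (real k)\<^sup>2) * ?W" by (simp add: algebra_simps)
  also have "... \<le> 9 * (real k)\<^sup>2 * ?W"
  proof (intro mult_right_mono)
    have "1 \<le> real k" using k by simp
    then have "1 * real k \<le> real k * real k" by (intro mult_right_mono) auto
    with \<open>1 \<le> real k\<close> have "real k \<le> (real k)\<^sup>2" "1 \<le> (real k)\<^sup>2" unfolding power2_eq_square by linarith+
    then show "2 + 6 * real k + (real k)\<^sup>2 \<le> 9 * (real k)\<^sup>2" by linarith
  qed (use W0 in \<open>auto intro: prod_nonneg\<close>)
  finally show ?thesis .
qed

section \<open>A lower bound for the rejection probability\<close>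

lemma falling_factorial_ratio_le:
  assumes "2 * m \<le> n" "0 < n"
  shows "fact (n - m) / fact n * real n ^ m \<le> 2 ^ m"
proof -
  have "(real n / 2) ^ m \<le> fact n / fact (n - m)"
    using card_inj_tuples_ge[of "{..<m}" n] card_inj_tuples_fact[of "{..<m}" n] assms by simp
  then have "real n ^ m * fact (n - m) \<le> 2 ^ m * fact n" by (simp add: power_divide field_simps)
  then show ?thesis by (simp add: field_simps)
qed

lemma (in prob_space) weighted_sum_expectation:
  assumes S: "finite S" and f: "\<And>t. t \<in> S \<Longrightarrow> f t \<in> borel_measurable M"
    and b: "\<And>t x. t \<in> S \<Longrightarrow> 0 \<le> f t x \<and> f t x \<le> (1::real)" and e: "\<And>t. t \<in> S \<Longrightarrow> expectation (f t) \<le> e"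
    and c: "0 \<le> c" "c * real N \<le> 16" "card S \<le> N" and e0: "0 \<le> e"
  shows "(\<lambda>x. c * (\<Sum>t\<in>S. f t x)) \<in> borel_measurable M" "integrable M (\<lambda>x. c * (\<Sum>t\<in>S. f t x))"
    "0 \<le> c * (\<Sum>t\<in>S. f t x)" "expectation (\<lambda>x. c * (\<Sum>t\<in>S. f t x)) \<le> 16 * e"
proof -
  show "(\<lambda>x. c * (\<Sum>t\<in>S. f t x)) \<in> borel_measurable M"
    using f by (intro borel_measurable_times borel_measurable_sum) auto
  have i: "integrable M (f t)" if "t \<in> S" for t
    using b[OF that] by (intro bounded_integrable[where b=1] f[OF that]) auto
  then show "integrable M (\<lambda>x. c * (\<Sum>t\<in>S. f t x))"
    by (intro integrable_mult_right Bochner_Integration.integrable_sum)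
  show "0 \<le> c * (\<Sum>t\<in>S. f t x)" using b c by (intro mult_nonneg_nonneg sum_nonneg) auto
  have "expectation (\<lambda>x. c * (\<Sum>t\<in>S. f t x)) = c * (\<Sum>t\<in>S. expectation (f t))"
    using i by simp
  also have "... \<le> c * (\<Sum>t\<in>S. e)" using c e by (intro mult_left_mono sum_mono) auto
  also have "... = (c * real (card S)) * e" by simp
  also have "... \<le> 16 * e"
  proof (rule mult_right_mono[OF _ e0])
    have "c * real (card S) \<le> c * real N" using c by (intro mult_left_mono) auto
    then show "c * real (card S) \<le> 16" using c by linarith
  qed
  finally show "expectation (\<lambda>x. c * (\<Sum>t\<in>S. f t x)) \<le> 16 * e" .
qed

text \<open>The bounds \<open>m l\<close> for the marginals multiply to the bound for the tensor product, so that products of estimates for the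
subvectors give estimates for the whole vector.\<close>

locale density_with_square_marginals = density_with_marginals +
  fixes m :: "nat \<Rightarrow> real"
  assumes pm_square: "\<And>l. l < k \<Longrightarrow> integrable (leb (block d l)) (\<lambda>x. (pm l x)\<^sup>2)"
      "\<And>l. l < k \<Longrightarrow> (\<integral>x. (pm l x)\<^sup>2 \<partial>leb (block d l)) \<le> m l"
    and m_pos: "\<And>l. l < k \<Longrightarrow> 0 < m l" and m_prod: "(\<Prod>l<k. m l) = B"
begin

text \<open>The mass \<open>K \<nu>\<close> of the kernel and the kernel itself, restricted to the subvector \<open>l\<close>.\<close>

definition "Kl \<nu> l = sqrt (pi / \<nu>) ^ card (block d l)"
definition "bG l \<nu> i j X = gauss_kernel (block d l) \<nu> (subvec d l (X i)) (subvec d l (X j))"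

lemma prod_Kl: "(\<Prod>l<k. Kl \<nu> l) = K \<nu>"
proof -
  have "card C = (\<Sum>l<k. card (block d l))" by (simp add: card_coords total_dim_def block_def)
  then show ?thesis by (simp add: Kl_def K_def power_sum)
qed

lemma Kl_pos: "0 < \<nu> \<Longrightarrow> 0 < Kl \<nu> l"
  by (simp add: Kl_def)

lemma pm_density: "l < k \<Longrightarrow> prob_density (block d l) (pm l)"
  and pm_distributed: "l < k \<Longrightarrow> distributed P (leb (block d l)) (subvec d l) (\<lambda>y. ennreal (pm l y))"
  using marginals by (auto simp: marginal_densities_def)

lemma measurable_subvec_P: "l < k \<Longrightarrow> subvec d l \<in> measurable P (leb (block d l))"
  unfolding measurable_cong_sets[OF sets_law refl] by (rule measurable_subvec)

lemma integral_subvec: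
  fixes g :: "_ \<Rightarrow> real"
  assumes l: "l < k" and g: "g \<in> borel_measurable (leb (block d l))"
  shows "(\<integral>x. g (subvec d l x) \<partial>P) = (\<integral>y. pm l y * g y \<partial>leb (block d l))"
  using distributed_integral[OF pm_distributed[OF l] g] prob_densityD(2)[OF pm_density[OF l]] by simp

lemma measurable_bG:
  assumes "l < k" "i < n" "j < n"
  shows "bG l \<nu> i j \<in> borel_measurable (PiM {..<n} (\<lambda>_. P))"
proof -
  have "(\<lambda>X. subvec d l (X i)) \<in> measurable (PiM {..<n} (\<lambda>_. P)) (leb (block d l))" if "i < n" for i
    using measurable_compose[OF measurable_component_singleton[of i "{..<n}" "\<lambda>_. P"] measurable_subvec_P[OF assms(1)]] that by simp
  from measurable_gauss_kernel[OF this[OF assms(2)] this[OF assms(3)]] show ?thesis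
    by (simp add: bG_def[abs_def])
qed

lemma bG_bounds: "0 < \<nu> \<Longrightarrow> 0 \<le> bG l \<nu> i j X \<and> bG l \<nu> i j X \<le> 1"
  by (simp add: bG_def gauss_kernel_le_1)

lemma bG_nonneg: "0 \<le> bG l \<nu> i j X"
  by (simp add: bG_def)

lemma abs_bG_le: "0 < \<nu> \<Longrightarrow> \<bar>bG l \<nu> i j X\<bar> \<le> 1"
  using bG_bounds[of \<nu> l i j X] by linarith

lemma expectation_bG_le:
  assumes \<nu>: "0 < \<nu>" and l: "l < k" and ij: "i < n" "j < n" "i \<noteq> j"
  shows "(\<integral>X. bG l (2 * \<nu>) i j X \<partial>PiM {..<n} (\<lambda>_. P)) \<le> Kl \<nu> l * m l"
proof -
  let ?I = "block d l" and ?\<nu> = "2 * \<nu>"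
  have \<nu>2: "0 < ?\<nu>" using \<nu> by simp
  note D = prob_densityD[OF pm_density[OF l]]
  have "(\<integral>X. bG l ?\<nu> i j X \<partial>PiM {..<n} (\<lambda>_. P)) = (\<integral>x. hproj P {..<n} (bG l ?\<nu> i j) i x \<partial>P)"
    using ij abs_bG_le[OF \<nu>2] by (intro P.integral_hproj[where b=1, symmetric] measurable_bG l) auto
  also have "... = (\<integral>x. gconv ?I ?\<nu> (pm l) (subvec d l x) \<partial>P)"
  proof (rule Bochner_Integration.integral_cong[OF refl])
    fix x assume "x \<in> space P"
    then have x: "subvec d l x \<in> space (leb ?I)" using measurable_space[OF measurable_subvec_P[OF l]] by auto
    have gx: "gauss_kernel ?I ?\<nu> (subvec d l x) \<in> borel_measurable (leb ?I)" using x by measurable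
    have "hproj P {..<n} (bG l ?\<nu> i j) i x = (\<integral>y. gauss_kernel ?I ?\<nu> (subvec d l x) (subvec d l (y j)) \<partial>PiM ({..<n} - {i}) (\<lambda>_. P))"
      using ij by (simp add: hproj_def bG_def)
    also have "... = (\<integral>z. gauss_kernel ?I ?\<nu> (subvec d l x) (subvec d l z) \<partial>P)"
      using ij by (intro P.integral_component measurable_compose[OF measurable_subvec_P[OF l] gx]) auto
    also have "... = gconv ?I ?\<nu> (pm l) (subvec d l x)"
      unfolding integral_subvec[OF l gx] gconv_def by (simp add: mult.commute)
    finally show "hproj P {..<n} (bG l ?\<nu> i j) i x = gconv ?I ?\<nu> (pm l) (subvec d l x)" .
  qed
  also have "... = (\<integral>y. pm l y * gconv ?I ?\<nu> (pm l) y \<partial>leb ?I)"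
    using D(1) by (intro integral_subvec l measurable_gconv) auto
  also have "... \<le> sqrt (pi / ?\<nu>) ^ card ?I * sqrt ((\<integral>x. (pm l x)\<^sup>2 \<partial>leb ?I) * (\<integral>x. (pm l x)\<^sup>2 \<partial>leb ?I))"
    by (rule integral_mult_gconv_le[OF finite_block \<nu>2 D(4) D(4) pm_square(1)[OF l] pm_square(1)[OF l]])
  also have "... \<le> Kl \<nu> l * m l"
  proof (intro mult_mono)
    show "sqrt (pi / ?\<nu>) ^ card ?I \<le> Kl \<nu> l"
      unfolding Kl_def using \<nu> by (intro power_mono real_sqrt_le_mono divide_left_mono) auto
    show "sqrt ((\<integral>x. (pm l x)\<^sup>2 \<partial>leb ?I) * (\<integral>x. (pm l x)\<^sup>2 \<partial>leb ?I)) \<le> m l"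
      using pm_square(2)[OF l] by simp
  qed (use Kl_pos[OF \<nu>, of l] in auto)
  finally show ?thesis .
qed

definition "stat_ABC n \<nu> l X = stat_A d n \<nu> X l + stat_B d n \<nu> X l + stat_C d n \<nu> X l"

text \<open>Each of \<open>A\<close>, \<open>B\<close> and \<open>C\<close> averages products of at most two kernels; by the inequality of the arithmetic and the
geometric mean these are dominated by kernels of twice the parameter, whose expectation at two independent observations is
bounded by \<open>expectation_bG_le\<close>.\<close>

lemma stat_moments:
  assumes \<nu>: "0 < \<nu>" and l: "l < k" and n: "8 \<le> n"
  defines "PP \<equiv> PiM {..<n} (\<lambda>_. P)" and "e \<equiv> Kl \<nu> l * m l"
  shows "(\<lambda>X. stat_A d n \<nu> X l) \<in> borel_measurable PP" "\<And>X. 0 \<le> stat_A d n \<nu> X l"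
    "(\<lambda>X. stat_B d n \<nu> X l) \<in> borel_measurable PP" "\<And>X. 0 \<le> stat_B d n \<nu> X l"
    "(\<lambda>X. stat_C d n \<nu> X l) \<in> borel_measurable PP" "\<And>X. 0 \<le> stat_C d n \<nu> X l"
    "integrable PP (stat_ABC n \<nu> l)" "(\<integral>X. stat_ABC n \<nu> l X \<partial>PP) \<le> 48 * e"
proof -
  interpret PP: prob_space PP unfolding PP_def by (rule P.prob_space_PiM_const)
  have e0: "0 \<le> e" unfolding e_def using Kl_pos[OF \<nu>, of l] m_pos[OF l] by simp
  have \<nu>2: "0 < 2 * \<nu>" using \<nu> by simp
  have meas: "bG l \<nu>' i j \<in> borel_measurable PP" if "i < n" "j < n" for \<nu>' i j
    unfolding PP_def by (rule measurable_bG[OF l that])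
  have E: "(\<integral>X. bG l (2 * \<nu>) i j X \<partial>PP) \<le> e" if "i < n" "j < n" "i \<noteq> j" for i j
    unfolding PP_def e_def by (rule expectation_bG_le[OF \<nu> l that])
  have int: "integrable PP (bG l \<nu>' i j)" if "i < n" "j < n" "0 < \<nu>'" for \<nu>' i j
    using meas[OF that(1,2)] abs_bG_le[OF that(3)] by (intro PP.bounded_integrable[where b=1]) auto
  have prod_le: "bG l \<nu> i j X * bG l \<nu> i' j' X \<le> (bG l (2 * \<nu>) i j X + bG l (2 * \<nu>) i' j' X) / 2" for i j i' j' X
    using sum_squares_bound[of "bG l \<nu> i j X" "bG l \<nu> i' j' X"] by (simp add: bG_def gauss_kernel_square)
  have E2: "(\<integral>X. bG l \<nu> i j X * bG l \<nu> i' j' X \<partial>PP) \<le> e" if "i < n" "j < n" "i \<noteq> j" "i' < n" "j' < n" "i' \<noteq> j'" for i j i' j'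
  proof -
    have "(\<integral>X. bG l \<nu> i j X * bG l \<nu> i' j' X \<partial>PP) \<le> (\<integral>X. (bG l (2 * \<nu>) i j X + bG l (2 * \<nu>) i' j' X) / 2 \<partial>PP)"
      using that int \<nu>2
      by (intro integral_mono' prod_le) (auto intro!: add_nonneg_nonneg bG_nonneg)
    also have "... = ((\<integral>X. bG l (2 * \<nu>) i j X \<partial>PP) + (\<integral>X. bG l (2 * \<nu>) i' j' X \<partial>PP)) / 2"
      using that int \<nu>2 by simp
    also have "... \<le> e" using E[of i j] E[of i' j'] that by simp
    finally show ?thesis .
  qed
  have bb: "0 \<le> bG l \<nu> i j X * bG l \<nu> i' j' X \<and> bG l \<nu> i j X * bG l \<nu> i' j' X \<le> 1" for i j i' j' X
    using bG_bounds[OF \<nu>, of l i j X] bG_bounds[OF \<nu>, of l i' j' X] by (auto intro: mult_le_one)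
  let ?SA = "{(i, j) \<in> {..<n} \<times> {..<n}. i \<noteq> j}"
  let ?SB = "{(i, j1, j2) \<in> {..<n} \<times> {..<n} \<times> {..<n}. card {i, j1, j2} = 3}"
  let ?SC = "{(i1, i2, j1, j2) \<in> {..<n} \<times> {..<n} \<times> {..<n} \<times> {..<n}. card {i1, i2, j1, j2} = 4}"
  have SA: "finite ?SA" "card ?SA \<le> n ^ 2"
    using card_mono[of "{..<n} \<times> {..<n}" ?SA] by (auto simp: power2_eq_square intro: finite_subset[of _ "{..<n} \<times> {..<n}"])
  have SB: "finite ?SB" "card ?SB \<le> n ^ 3"
    using card_mono[of "{..<n} \<times> {..<n} \<times> {..<n}" ?SB]
    by (auto simp: power3_eq_cube mult.assoc intro: finite_subset[of _ "{..<n} \<times> {..<n} \<times> {..<n}"])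
  have SC: "finite ?SC" "card ?SC \<le> n ^ 4"
    using card_mono[of "{..<n} \<times> {..<n} \<times> {..<n} \<times> {..<n}" ?SC]
    by (auto simp: eval_nat_numeral intro: finite_subset[of _ "{..<n} \<times> {..<n} \<times> {..<n} \<times> {..<n}"])
  have c: "fact (n - 2) / fact n * real (n ^ 2) \<le> 16" "fact (n - 3) / fact n * real (n ^ 3) \<le> 16" "fact (n - 4) / fact n * real (n ^ 4) \<le> 16"
    using falling_factorial_ratio_le[of 2 n] falling_factorial_ratio_le[of 3 n] falling_factorial_ratio_le[of 4 n] n by auto
  have f2: "1 / (real n * (real n - 1)) = fact (n - 2) / fact n"
  proof -
    have "n = Suc (Suc (n - 2))" using n by linarith
    then obtain m where m: "n = Suc (Suc m)" by blast
    have f: "fact n = real n * (real n - 1) * fact (n - 2)" by (simp add: m)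
    show ?thesis unfolding f by simp
  qed
  have three: "i \<noteq> j1" "i \<noteq> j2" if "card {i, j1, j2} = 3" for i j1 j2 :: nat
    using that by (auto simp: card_insert_if split: if_splits)
  have four: "i1 \<noteq> j1" "i2 \<noteq> j2" if "card {i1, i2, j1, j2} = 4" for i1 i2 j1 j2 :: nat
    using that by (auto simp: card_insert_if split: if_splits)
  define fA where "fA = (\<lambda>(i :: nat, j :: nat). bG l (2 * \<nu>) i j)"
  define fB where "fB = (\<lambda>(i :: nat, j1 :: nat, j2 :: nat) X. bG l \<nu> i j1 X * bG l \<nu> i j2 X)"
  define fC where "fC = (\<lambda>(i1 :: nat, i2 :: nat, j1 :: nat, j2 :: nat) X. bG l \<nu> i1 j1 X * bG l \<nu> i2 j2 X)"
  have A: "(\<lambda>X. stat_A d n \<nu> X l) = (\<lambda>X. fact (n - 2) / fact n * (\<Sum>t\<in>?SA. fA t X))"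
    unfolding stat_A_def f2 fA_def bG_def by (simp add: split_beta)
  have B: "(\<lambda>X. stat_B d n \<nu> X l) = (\<lambda>X. fact (n - 3) / fact n * (\<Sum>t\<in>?SB. fB t X))"
    unfolding stat_B_def fB_def bG_def by (simp add: split_beta)
  have C: "(\<lambda>X. stat_C d n \<nu> X l) = (\<lambda>X. fact (n - 4) / fact n * (\<Sum>t\<in>?SC. fC t X))"
    unfolding stat_C_def fC_def bG_def by (simp add: split_beta)
  have WA: "(\<lambda>x. fact (n - 2) / fact n * (\<Sum>t\<in>?SA. fA t x)) \<in> borel_measurable PP"
    "integrable PP (\<lambda>x. fact (n - 2) / fact n * (\<Sum>t\<in>?SA. fA t x))"
    "0 \<le> fact (n - 2) / fact n * (\<Sum>t\<in>?SA. fA t x)"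
    "(\<integral>x. fact (n - 2) / fact n * (\<Sum>t\<in>?SA. fA t x) \<partial>PP) \<le> 16 * e" for x
    by (rule PP.weighted_sum_expectation[OF SA(1) _ _ _ _ c(1) SA(2) e0];
        auto simp: fA_def bG_bounds[OF \<nu>2] intro!: meas E)+
  have WB: "(\<lambda>x. fact (n - 3) / fact n * (\<Sum>t\<in>?SB. fB t x)) \<in> borel_measurable PP"
    "integrable PP (\<lambda>x. fact (n - 3) / fact n * (\<Sum>t\<in>?SB. fB t x))"
    "0 \<le> fact (n - 3) / fact n * (\<Sum>t\<in>?SB. fB t x)"
    "(\<integral>x. fact (n - 3) / fact n * (\<Sum>t\<in>?SB. fB t x) \<partial>PP) \<le> 16 * e" for x
    by (rule PP.weighted_sum_expectation[OF SB(1) _ _ _ _ c(2) SB(2) e0];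
        auto simp: fB_def bb intro!: borel_measurable_times meas E2 dest: three)+
  have WC: "(\<lambda>x. fact (n - 4) / fact n * (\<Sum>t\<in>?SC. fC t x)) \<in> borel_measurable PP"
    "integrable PP (\<lambda>x. fact (n - 4) / fact n * (\<Sum>t\<in>?SC. fC t x))"
    "0 \<le> fact (n - 4) / fact n * (\<Sum>t\<in>?SC. fC t x)"
    "(\<integral>x. fact (n - 4) / fact n * (\<Sum>t\<in>?SC. fC t x) \<partial>PP) \<le> 16 * e" for x
    by (rule PP.weighted_sum_expectation[OF SC(1) _ _ _ _ c(3) SC(2) e0];
        auto simp: fC_def bb intro!: borel_measurable_times meas E2 dest: four)+
  show "(\<lambda>X. stat_A d n \<nu> X l) \<in> borel_measurable PP" "(\<lambda>X. stat_B d n \<nu> X l) \<in> borel_measurable PP"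
    "(\<lambda>X. stat_C d n \<nu> X l) \<in> borel_measurable PP"
    unfolding A B C by (rule WA WB WC)+
  show "0 \<le> stat_A d n \<nu> X l" "0 \<le> stat_B d n \<nu> X l" "0 \<le> stat_C d n \<nu> X l" for X
    using fun_cong[OF A, of X] fun_cong[OF B, of X] fun_cong[OF C, of X] WA(3)[of X] WB(3)[of X] WC(3)[of X] by simp_all
  have ABC: "stat_ABC n \<nu> l = (\<lambda>X. fact (n - 2) / fact n * (\<Sum>t\<in>?SA. fA t X) + fact (n - 3) / fact n * (\<Sum>t\<in>?SB. fB t X)
     + fact (n - 4) / fact n * (\<Sum>t\<in>?SC. fC t X))"
    unfolding stat_ABC_def[abs_def] A[symmetric, unfolded fun_eq_iff, rule_format] B[symmetric, unfolded fun_eq_iff, rule_format] C[symmetric, unfolded fun_eq_iff, rule_format] ..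
  show "integrable PP (stat_ABC n \<nu> l)"
    unfolding ABC using WA(2) WB(2) WC(2) by (intro Bochner_Integration.integrable_add)
  have "(\<integral>X. stat_ABC n \<nu> l X \<partial>PP) = (\<integral>x. fact (n - 2) / fact n * (\<Sum>t\<in>?SA. fA t x) \<partial>PP)
     + (\<integral>x. fact (n - 3) / fact n * (\<Sum>t\<in>?SB. fB t x) \<partial>PP) + (\<integral>x. fact (n - 4) / fact n * (\<Sum>t\<in>?SC. fC t x) \<partial>PP)"
    unfolding ABC
    by (subst Bochner_Integration.integral_add[OF Bochner_Integration.integrable_add[OF WA(2) WB(2)] WC(2)],
        subst Bochner_Integration.integral_add[OF WA(2) WB(2)]) (rule refl)
  then show "(\<integral>X. stat_ABC n \<nu> l X \<partial>PP) \<le> 48 * e" using WA(4) WB(4) WC(4) by linarith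
qed

lemma measurable_s2_tilde:
  assumes \<nu>: "0 < \<nu>" and n: "8 \<le> n"
  shows "s2_tilde k d n \<nu> \<in> borel_measurable (PiM {..<n} (\<lambda>_. P))"
  unfolding s2_tilde_def[abs_def] Let_def split_beta
  by (intro borel_measurable_add borel_measurable_diff borel_measurable_times borel_measurable_sum borel_measurable_prod
      borel_measurable_const stat_moments(1)[OF \<nu> _ n] stat_moments(3)[OF \<nu> _ n] stat_moments(5)[OF \<nu> _ n]) auto

text \<open>Here \<open>\<rho>\<close> is the ratio of noise to signal. Outside two unlikely events the estimator exceeds half of the signal
(Chebyshev's inequality with the mean square error) and, for each subvector, the statistics are at most \<open>t\<close> times the
bound for their mean (Markov's inequality, leaving a failure probability of order \<open>k / t\<close>). There the hypothesis
\<open>small\<close> puts the statistic above the critical value.\<close>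

lemma rejection_lower_bound:
  fixes \<Delta> t \<alpha> :: real
  assumes \<nu>: "0 < \<nu>" and n: "4 * k \<le> n" and t: "0 < t" and \<Delta>: "0 < \<Delta>"
    and signal: "K \<nu> * \<Delta>\<^sup>2 / 4 \<le> \<gamma>2 \<nu>"
  defines "\<rho> \<equiv> 1 / (real n * sqrt (K \<nu>) * \<Delta>\<^sup>2)"
  assumes small: "8 * sqrt 2 * \<bar>z_upper \<alpha>\<bar> * \<rho> * (3 * real k * sqrt (t ^ k) * sqrt B + 1 / (real n * sqrt (K \<nu>))) < 1"
  shows "1 - 4 * (324 * (2 * real k) ^ 6 * 4 ^ k) * (4 * \<rho> * sqrt B + 16 * \<rho>\<^sup>2 * B) - 48 * real k / t
     \<le> rejection_prob k d n p (Phi_IND k d n \<nu> \<alpha>)"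
proof -
  define PP where "PP = PiM {..<n} (\<lambda>_. P)"
  let ?z = "z_upper \<alpha>" and ?\<gamma> = "\<gamma>2 \<nu>" and ?K = "K \<nu>" and ?Ck = "324 * (2 * real k) ^ 6 * 4 ^ k"
  interpret PP: prob_space PP unfolding PP_def by (rule P.prob_space_PiM_const)
  have n8: "8 \<le> n" using n k by linarith
  have n0: "0 < real n" using n8 by simp
  have K0: "0 < ?K" by (rule K_pos[OF \<nu>])
  have \<gamma>0: "0 < ?\<gamma>" using signal K0 \<Delta> by (smt (verit) divide_pos_pos mult_pos_pos zero_less_power)
  have \<rho>0: "0 < \<rho>" unfolding \<rho>_def using n0 K0 \<Delta> by simp
  note mse = gamma2_hat_mean_square_error[OF \<nu> n, folded PP_def]
  note [measurable] = mse(1)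
  have sm [measurable]: "s2_tilde k d n \<nu> \<in> borel_measurable PP"
    unfolding PP_def by (rule measurable_s2_tilde[OF \<nu> n8])
  note st = stat_moments[OF \<nu> _ n8, folded PP_def]
  have wm [measurable]: "stat_ABC n \<nu> l \<in> borel_measurable PP" if "l < k" for l using st(7)[OF that] by auto
  (* Where the estimator deviates from the signal by half of it, and where a studentising statistic is large. *)
  define bad1 where "bad1 = {X \<in> space PP. (gamma2_hat k d n \<nu> X - ?\<gamma>)\<^sup>2 \<ge> (?\<gamma> / 2)\<^sup>2}"
  define bad2 where "bad2 l = {X \<in> space PP. stat_ABC n \<nu> l X \<ge> t * (Kl \<nu> l * m l)}" for l
  have bad1m: "bad1 \<in> sets PP" unfolding bad1_def by measurable
  have bad2m: "bad2 l \<in> sets PP" if "l < k" for l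
    unfolding bad2_def using wm[OF that] by measurable
  have "PP.prob bad1 \<le> (\<integral>X. (gamma2_hat k d n \<nu> X - ?\<gamma>)\<^sup>2 \<partial>PP) / (?\<gamma> / 2)\<^sup>2"
    unfolding bad1_def using \<gamma>0 by (intro integral_Markov_inequality_measure[OF mse(2), where A="{}"]) auto
  also have "... \<le> ?Ck * (sqrt (?K * B) * ?\<gamma> / n + ?K * B / (real n)\<^sup>2) / (?\<gamma> / 2)\<^sup>2"
    by (intro divide_right_mono mse(3)) auto
  also have "... = 4 * ?Ck * ((sqrt ?K / (real n * ?\<gamma>)) * sqrt B + (sqrt ?K / (real n * ?\<gamma>))\<^sup>2 * B)"
  proof -
    have gen: "c * (u * b * g / N + u * u * (b * b) / N\<^sup>2) / (g / 2)\<^sup>2 = 4 * c * ((u / (N * g)) * b + (u / (N * g))\<^sup>2 * (b * b))"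
      if "0 < N" "0 < g" for c u b g N :: real
      using that by (simp add: power2_eq_square field_simps)
    have e: "sqrt (?K * B) = sqrt ?K * sqrt B" "sqrt ?K * sqrt ?K = ?K" "sqrt B * sqrt B = B"
      using K0 B_nonneg by (auto simp: real_sqrt_mult)
    from gen[OF n0 \<gamma>0, of ?Ck "sqrt ?K" "sqrt B"] show ?thesis by (simp only: e)
  qed
  also have "... \<le> 4 * ?Ck * ((4 * \<rho>) * sqrt B + (4 * \<rho>)\<^sup>2 * B)"
  proof -
    have "sqrt ?K / (real n * ?\<gamma>) \<le> sqrt ?K / (real n * (?K * \<Delta>\<^sup>2 / 4))"
      using n0 K0 \<Delta> \<gamma>0 signal by (intro divide_left_mono mult_left_mono mult_pos_pos) auto
    also have "... = 4 * \<rho>"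
    proof -
      have "?K = sqrt ?K * sqrt ?K" using K0 by simp
      then have "sqrt ?K / (real n * (?K * \<Delta>\<^sup>2 / 4)) = sqrt ?K / (real n * (sqrt ?K * sqrt ?K * \<Delta>\<^sup>2 / 4))" by simp
      also have "... = 4 * \<rho>" unfolding \<rho>_def using K0 by (simp del: real_sqrt_mult_self)
      finally show ?thesis .
    qed
    finally have r: "sqrt ?K / (real n * ?\<gamma>) \<le> 4 * \<rho>" .
    have r0: "0 \<le> sqrt ?K / (real n * ?\<gamma>)" using n0 K0 \<gamma>0 by simp
    show ?thesis using B_nonneg
      by (intro mult_left_mono add_mono mult_right_mono power_mono r r0) auto
  qed
  finally have b1: "PP.prob bad1 \<le> 4 * ?Ck * (4 * \<rho> * sqrt B + 16 * \<rho>\<^sup>2 * B)" by (simp add: power_mult_distrib)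
  have b2: "PP.prob (bad2 l) \<le> 48 / t" if l: "l < k" for l
  proof -
    have e0: "0 < Kl \<nu> l * m l" using Kl_pos[OF \<nu>] m_pos[OF l] by simp
    have "PP.prob (bad2 l) \<le> (\<integral>X. stat_ABC n \<nu> l X \<partial>PP) / (t * (Kl \<nu> l * m l))"
      unfolding bad2_def using e0 t st(2,4,6)[OF l]
      by (intro integral_Markov_inequality_measure[OF st(7)[OF l], where A="{}"]) (auto simp: stat_ABC_def intro!: add_nonneg_nonneg)
    also have "... \<le> (48 * (Kl \<nu> l * m l)) / (t * (Kl \<nu> l * m l))"
      using e0 t by (intro divide_right_mono st(8)[OF l]) auto
    also have "... = 48 / t" by (rule mult_divide_mult_cancel_right) (rule less_imp_neq[OF e0, symmetric])
    finally show ?thesis .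
  qed
  define bad where "bad = bad1 \<union> (\<Union>l\<in>{..<k}. bad2 l)"
  have badm: "bad \<in> sets PP" unfolding bad_def using bad1m bad2m by auto
  have "PP.prob bad \<le> PP.prob bad1 + PP.prob (\<Union>l\<in>{..<k}. bad2 l)"
    unfolding bad_def using bad1m bad2m by (intro measure_Un_le) auto
  also have "... \<le> PP.prob bad1 + (\<Sum>l<k. PP.prob (bad2 l))"
    using bad2m by (intro add_left_mono measure_UNION_le) auto
  also have "... \<le> 4 * ?Ck * (4 * \<rho> * sqrt B + 16 * \<rho>\<^sup>2 * B) + (\<Sum>l<k. 48 / t)"
    using b2 by (intro add_mono b1 sum_mono) auto
  finally have pbad: "PP.prob bad \<le> 4 * ?Ck * (4 * \<rho> * sqrt B + 16 * \<rho>\<^sup>2 * B) + 48 * real k / t" by (simp add: mult.commute)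
  let ?R = "{X \<in> space PP. Phi_IND k d n \<nu> \<alpha> X}"
  have Rm: "?R \<in> sets PP" unfolding Phi_IND_def T_IND_def s2_hat_def by measurable
  have sub: "space PP - bad \<subseteq> ?R"
  proof
    fix X assume X: "X \<in> space PP - bad"
    then have g: "(gamma2_hat k d n \<nu> X - ?\<gamma>)\<^sup>2 < (?\<gamma> / 2)\<^sup>2" and w: "\<And>l. l < k \<Longrightarrow> stat_ABC n \<nu> l X < t * (Kl \<nu> l * m l)"
      by (auto simp: bad_def bad1_def bad2_def not_le)
    have "\<bar>gamma2_hat k d n \<nu> X - ?\<gamma>\<bar> < ?\<gamma> / 2"
      by (rule power_less_imp_less_base[where n=2, OF g[folded power2_abs[of "gamma2_hat k d n \<nu> X - \<gamma>2 \<nu>"]]]) (use \<gamma>0 in simp)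
    then have "?\<gamma> / 2 < gamma2_hat k d n \<nu> X" by linarith
    then have gl: "?K * \<Delta>\<^sup>2 / 8 < gamma2_hat k d n \<nu> X" using signal by linarith
    have "s2_tilde k d n \<nu> X \<le> 9 * (real k)\<^sup>2 * (\<Prod>l<k. t * (Kl \<nu> l * m l))"
    proof (rule s2_tilde_le)
      fix l assume l: "l < k"
      note facts = st(2)[OF l, of X] st(4)[OF l, of X] st(6)[OF l, of X] less_imp_le[OF w[OF l, unfolded stat_ABC_def]]
      show "0 \<le> stat_A d n \<nu> X l \<and> stat_A d n \<nu> X l \<le> t * (Kl \<nu> l * m l)"
        "0 \<le> stat_B d n \<nu> X l \<and> stat_B d n \<nu> X l \<le> t * (Kl \<nu> l * m l)"
        "0 \<le> stat_C d n \<nu> X l \<and> stat_C d n \<nu> X l \<le> t * (Kl \<nu> l * m l)"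
        using facts by linarith+
    qed (use k in simp)
    also have "(\<Prod>l<k. t * (Kl \<nu> l * m l)) = t ^ k * (?K * B)"
      by (simp add: prod.distrib prod_Kl m_prod)
    finally have "s2_tilde k d n \<nu> X \<le> 9 * (real k)\<^sup>2 * (t ^ k * (?K * B))" .
    then have "s2_hat k d n \<nu> X \<le> 9 * (real k)\<^sup>2 * (t ^ k * (?K * B)) + 1 / (real n)\<^sup>2"
    proof -
      assume "s2_tilde k d n \<nu> X \<le> 9 * (real k)\<^sup>2 * (t ^ k * (?K * B))"
      moreover have "0 \<le> 9 * (real k)\<^sup>2 * (t ^ k * (?K * B))" using t K0 B_nonneg by simp
      moreover have "0 \<le> 1 / (real n)\<^sup>2" by simp
      ultimately show ?thesis unfolding s2_hat_def max.bounded_iff by linarith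
    qed
    then have "sqrt (s2_hat k d n \<nu> X) \<le> sqrt (9 * (real k)\<^sup>2 * (t ^ k * (?K * B)) + 1 / (real n)\<^sup>2)" by simp
    also have "... \<le> sqrt (9 * (real k)\<^sup>2 * (t ^ k * (?K * B))) + sqrt (1 / (real n)\<^sup>2)"
      using t K0 B_nonneg by (intro sqrt_add_le_add_sqrt) auto
    also have "... = 3 * real k * sqrt (t ^ k) * (sqrt ?K * sqrt B) + 1 / real n"
    proof -
      have "9 * (real k)\<^sup>2 = (3 * real k)\<^sup>2" by (simp add: power_mult_distrib)
      then show ?thesis using n0 by (simp add: real_sqrt_mult real_sqrt_divide)
    qed
    also have "... = sqrt ?K * (3 * real k * sqrt (t ^ k) * sqrt B + 1 / (real n * sqrt ?K))"
      using K0 n0 by (simp add: field_simps)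
    finally have sl: "sqrt (s2_hat k d n \<nu> X) \<le> sqrt ?K * (3 * real k * sqrt (t ^ k) * sqrt B + 1 / (real n * sqrt ?K))" .
    define Y where "Y = 3 * real k * sqrt (t ^ k) * sqrt B + 1 / (real n * sqrt ?K)"
    have s0: "0 < s2_hat k d n \<nu> X" unfolding s2_hat_def using n0 by (auto simp: less_max_iff_disj)
    have "sqrt 2 * (?z * sqrt (s2_hat k d n \<nu> X)) \<le> sqrt 2 * (\<bar>?z\<bar> * (sqrt ?K * Y))"
      using sl s0 unfolding Y_def[symmetric] by (intro mult_left_mono mult_mono) auto
    also have "... = (8 * sqrt 2 * \<bar>?z\<bar> * \<rho> * Y) * (real n * (?K * \<Delta>\<^sup>2 / 8))"
    proof -
      have "\<rho> * (real n * (sqrt ?K * sqrt ?K * \<Delta>\<^sup>2)) = sqrt ?K"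
        unfolding \<rho>_def using n0 K0 \<Delta> by (simp del: real_sqrt_mult_self)
      then have "\<rho> * (real n * (?K * \<Delta>\<^sup>2)) = sqrt ?K" using K0 by simp
      then show ?thesis by (simp only: mult_ac) simp
    qed
    also have "... < 1 * (real n * (?K * \<Delta>\<^sup>2 / 8))"
      using small n0 K0 \<Delta> unfolding Y_def[symmetric] by (intro mult_strict_right_mono) auto
    also have "... < real n * gamma2_hat k d n \<nu> X" using gl n0 by simp
    finally have "?z * (sqrt 2 * sqrt (s2_hat k d n \<nu> X)) < real n * gamma2_hat k d n \<nu> X" by (simp only: mult_ac)
    then have "?z < T_IND k d n \<nu> X" unfolding T_IND_def using s0 by (simp add: field_simps)
    then show "X \<in> ?R" using X by (simp add: Phi_IND_def)
  qed
  have "1 - PP.prob bad = PP.prob (space PP - bad)" using PP.prob_compl[OF badm] by simp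
  also have "... \<le> PP.prob ?R" using sub Rm by (intro PP.finite_measure_mono)
  also have "... = rejection_prob k d n p (Phi_IND k d n \<nu> \<alpha>)" by (simp add: rejection_prob_def PP_def)
  finally show ?thesis using pbad by linarith
qed

end

section \<open>Consistency above the critical rate\<close>

lemma rejection_prob_le_1:
  assumes "prob_density (coords k d) p"
  shows "0 \<le> rejection_prob k d n p \<phi>" "rejection_prob k d n p \<phi> \<le> 1"
proof -
  interpret P: prob_space "law (coords k d) p" using prob_densityD(3)[OF assms] .
  interpret PP: prob_space "PiM {..<n} (\<lambda>_. law (coords k d) p)" by (rule P.prob_space_PiM_const)
  show "0 \<le> rejection_prob k d n p \<phi>" "rejection_prob k d n p \<phi> \<le> 1"
    by (auto simp: rejection_prob_def)
qed

text \<open>If the bias term \<open>\<nu>\<^sup>-\<^sup>s\<close> is small compared with \<open>\<Delta>\<^sup>2\<close>, every density of the alternative has a signal of order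
\<open>K \<nu> * \<Delta>\<^sup>2\<close>; Plancherel's inequality turns the Sobolev bounds into \<open>L\<^sub>2\<close> bounds.\<close>

lemma H1_rejection_lower_bound:
  fixes M :: "nat \<Rightarrow> real"
  assumes k: "2 \<le> k" and s: "0 < s" and M: "\<And>j. j < k \<Longrightarrow> 0 < M j"
    and p: "p \<in> H1_IND k d s M \<Delta>" and \<Delta>: "0 < \<Delta>" and \<nu>: "0 < \<nu>" and n: "4 * k \<le> n" and t: "0 < t"
  defines "B \<equiv> (\<Prod>j<k. M j)\<^sup>2"
  defines "\<rho> \<equiv> 1 / (real n * sqrt (sqrt (pi / \<nu>) ^ total_dim k d) * \<Delta>\<^sup>2)"
  assumes bias: "8 * B * \<nu> powr (- s) \<le> \<Delta>\<^sup>2"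
    and small: "8 * sqrt 2 * \<bar>z_upper \<alpha>\<bar> * \<rho> * (3 * real k * sqrt (t ^ k) * sqrt B + 4 * B * \<rho>) < 1"
  shows "1 - 4 * (324 * (2 * real k) ^ 6 * 4 ^ k) * (4 * \<rho> * sqrt B + 16 * \<rho>\<^sup>2 * B) - 48 * real k / t
     \<le> rejection_prob k d n p (Phi_IND k d n \<nu> \<alpha>)"
proof -
  let ?C = "coords k d"
  obtain pm where pd: "prob_density ?C p" and pS: "p \<in> sobolev_ball ?C s (\<Prod>j<k. M j)"
    and marg: "marginal_densities k d p pm" and pmS: "\<And>j. j < k \<Longrightarrow> pm j \<in> sobolev_ball (block d j) s (M j)"
    and L2: "\<Delta> \<le> L2_norm ?C (\<lambda>x. p x - tensor k d pm x)"
    using p by (auto simp: H1_IND_def)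
  let ?q = "tensor k d pm" and ?f = "\<lambda>x. p x - tensor k d pm x"
  note p1 = sobolev_ballD[OF pS]
  have q1: "?q \<in> sobolev ?C s" "(sobolev_norm ?C s ?q)\<^sup>2 \<le> B"
    unfolding B_def by (rule tensor_sobolev[OF s], rule pmS, assumption)+
  note GP = genergy_lower_bound[OF finite_coords \<nu> s p1(1)]
  note GQ = genergy_lower_bound[OF finite_coords \<nu> s q1(1)]
  note f1 = sobolev_diff[OF finite_coords p1(1) q1(1)]
  note GF = genergy_lower_bound[OF finite_coords \<nu> s f1(1)]
  have B0: "0 \<le> B" by (simp add: B_def)
  interpret density_with_square_marginals k d p pm B "\<lambda>l. (M l)\<^sup>2"
  proof
    show "2 \<le> k" "prob_density ?C p" "marginal_densities k d p pm" by fact+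
    show "integrable (leb ?C) (\<lambda>x. (p x)\<^sup>2)" "integrable (leb ?C) (\<lambda>x. (?q x)\<^sup>2)" by (rule GP GQ)+
    show "(\<integral>x. (p x)\<^sup>2 \<partial>leb ?C) \<le> B" using GP(2) p1(2) by (simp add: B_def)
    show "(\<integral>x. (?q x)\<^sup>2 \<partial>leb ?C) \<le> B" using GQ(2) q1(2) by linarith
    show "integrable (leb (block d l)) (\<lambda>x. (pm l x)\<^sup>2)" "(\<integral>x. (pm l x)\<^sup>2 \<partial>leb (block d l)) \<le> (M l)\<^sup>2" if "l < k" for l
      using genergy_lower_bound(1,2)[OF finite_block \<nu> s sobolev_ballD(1)[OF pmS[OF that]]] sobolev_ballD(2)[OF pmS[OF that]]
      by auto
    show "0 < (M l)\<^sup>2" if "l < k" for l using M[OF that] by simp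
    show "(\<Prod>l<k. (M l)\<^sup>2) = B" by (simp add: B_def prod_power_distrib)
  qed
  have gap: "gap = ?f" by (simp add: gap_def[abs_def] q_def)
  have fn: "(sobolev_norm ?C s ?f)\<^sup>2 \<le> 4 * B" using f1(2) p1(2) q1(2) unfolding B_def by linarith
  have "\<Delta>\<^sup>2 \<le> (L2_norm ?C ?f)\<^sup>2" using L2 \<Delta> by (intro power_mono) auto
  also have "... = (\<integral>x. (?f x)\<^sup>2 \<partial>leb ?C)" unfolding L2_norm_def by (subst real_sqrt_pow2) auto
  finally have D: "\<Delta>\<^sup>2 \<le> (\<integral>x. (?f x)\<^sup>2 \<partial>leb ?C)" .
  have D4: "\<Delta>\<^sup>2 \<le> 4 * B" using D GF(2) fn by linarith
  have K_eq: "K \<nu> = sqrt (pi / \<nu>) ^ total_dim k d" by (simp add: K_def card_coords)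
  have K0: "0 < K \<nu>" by (rule K_pos[OF \<nu>])
  have n0: "0 < real n" using n k by simp
  have signal: "K \<nu> * \<Delta>\<^sup>2 / 4 \<le> \<gamma>2 \<nu>"
  proof -
    have "\<nu> powr (- s) * (sobolev_norm ?C s ?f)\<^sup>2 \<le> \<nu> powr (- s) * (4 * B)" using fn by (intro mult_left_mono) auto
    with bias D have "\<Delta>\<^sup>2 / 2 \<le> (\<integral>x. (?f x)\<^sup>2 \<partial>leb ?C) - \<nu> powr (- s) * (sobolev_norm ?C s ?f)\<^sup>2" by (simp add: mult_ac)
    moreover have "(1 / 2 :: real) \<le> exp (- 1 / 4)" using exp_ge_add_one_self[of "- 1 / 4 :: real"] by linarith
    ultimately have "1 / 2 * (\<Delta>\<^sup>2 / 2) \<le> exp (- 1 / 4) * ((\<integral>x. (?f x)\<^sup>2 \<partial>leb ?C) - \<nu> powr (- s) * (sobolev_norm ?C s ?f)\<^sup>2)"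
      by (intro mult_mono) auto
    then have "K \<nu> * (1 / 2 * (\<Delta>\<^sup>2 / 2)) \<le> K \<nu> * (exp (- 1 / 4) * ((\<integral>x. (?f x)\<^sup>2 \<partial>leb ?C) - \<nu> powr (- s) * (sobolev_norm ?C s ?f)\<^sup>2))"
      using K0 by (intro mult_left_mono) auto
    also have "... \<le> \<gamma>2 \<nu>" using GF(3) by (simp add: \<gamma>2_def gap K_def mult.assoc)
    finally show ?thesis by simp
  qed
  have \<rho>: "\<rho> = 1 / (real n * sqrt (K \<nu>) * \<Delta>\<^sup>2)" by (simp add: \<rho>_def K_eq)
  have \<rho>0: "0 \<le> \<rho>" unfolding \<rho> using n0 K0 by simp
  have "1 / (real n * sqrt (K \<nu>)) = \<rho> * \<Delta>\<^sup>2" unfolding \<rho> using n0 K0 \<Delta> by simp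
  also have "... \<le> 4 * B * \<rho>" using D4 \<rho>0 by (simp add: mult.commute mult_left_mono)
  finally have "8 * sqrt 2 * \<bar>z_upper \<alpha>\<bar> * \<rho> * (3 * real k * sqrt (t ^ k) * sqrt B + 1 / (real n * sqrt (K \<nu>))) \<le>
    8 * sqrt 2 * \<bar>z_upper \<alpha>\<bar> * \<rho> * (3 * real k * sqrt (t ^ k) * sqrt B + 4 * B * \<rho>)"
    using \<rho>0 by (intro mult_left_mono add_left_mono) auto
  with small have "8 * sqrt 2 * \<bar>z_upper \<alpha>\<bar> * \<rho> * (3 * real k * sqrt (t ^ k) * sqrt B + 1 / (real n * sqrt (K \<nu>))) < 1" by linarith
  then show ?thesis unfolding \<rho> by (rule rejection_lower_bound[OF \<nu> n t \<Delta> signal])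
qed

lemma test_power_ge:
  assumes "\<And>p. p \<in> H \<Longrightarrow> prob_density (coords k d) p" "\<And>p. p \<in> H \<Longrightarrow> c \<le> rejection_prob k d n p \<phi>" "c \<le> 1"
  shows "c \<le> test_power k d n \<phi> H" "test_power k d n \<phi> H \<le> 1"
proof -
  show "c \<le> test_power k d n \<phi> H"
    using assms by (auto simp: test_power_def intro!: cINF_greatest)
  show "test_power k d n \<phi> H \<le> 1"
  proof (cases "H = {}")
    case False
    then obtain p where p: "p \<in> H" by blast
    have "(INF p\<in>H. rejection_prob k d n p \<phi>) \<le> rejection_prob k d n p \<phi>"
      using rejection_prob_le_1(1)[OF assms(1)] p by (intro cINF_lower bdd_belowI2[of _ 0]) auto
    also have "... \<le> 1" by (rule rejection_prob_le_1(2)[OF assms(1)[OF p]])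
    finally show ?thesis using False by (simp add: test_power_def)
  qed (simp add: test_power_def)
qed

text \<open>The two sides of the trade-off. Up to constants both quantities are \<open>u\<^bsup>-2\<^esup>\<close> for \<open>u = n\<^bsup>2s/(D+4s)\<^esup> \<Delta>\<close>: the exponent
of \<open>\<nu>\<close> is chosen such that bias and noise are critical at the same \<open>\<Delta>\<close>.\<close>

lemma adaptive_rates:
  fixes \<Delta> \<nu> :: "nat \<Rightarrow> real" and D :: nat and s :: real
  assumes s: "0 < s" and D: "0 < D" and \<Delta>: "\<And>n. 0 < \<Delta> n" and \<nu>: "\<And>n. 0 < \<nu> n"
    and u: "filterlim (\<lambda>n. real n powr (2 * s / (real D + 4 * s)) * \<Delta> n) at_top sequentially"
    and \<Theta>: "\<nu> \<in> \<Theta>(\<lambda>n. real n powr (4 / (real D + 4 * s)))"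
  shows "(\<lambda>n. 1 / (real n * sqrt (sqrt (pi / \<nu> n) ^ D) * (\<Delta> n)\<^sup>2)) \<longlonglongrightarrow> 0"
    and "(\<lambda>n. \<nu> n powr (- s) / (\<Delta> n)\<^sup>2) \<longlonglongrightarrow> 0"
proof -
  define a where "a = 4 / (real D + 4 * s)"
  define b where "b = 2 * s / (real D + 4 * s)"
  define w where "w n = real n powr b * \<Delta> n" for n
  have ab: "a * s = 2 * b" "1 - a * real D / 4 = 2 * b" "0 < real D + 4 * s"
    using s D by (auto simp: a_def b_def field_simps)
  have w_lim: "filterlim w at_top sequentially" using u by (simp add: w_def[abs_def] b_def)
  have inv: "(\<lambda>n. c / (w n)\<^sup>2) \<longlonglongrightarrow> 0" for c :: real
    by (intro tendsto_divide_0[OF tendsto_const] filterlim_at_top_imp_at_infinity filterlim_pow_at_top w_lim) simp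
  from \<Theta> obtain c2 where c2: "0 < c2" "eventually (\<lambda>n. norm (\<nu> n) \<le> c2 * norm (real n powr a)) sequentially"
    unfolding bigtheta_def a_def by (auto elim!: landau_o.bigE)
  from \<Theta> obtain c1 where c1: "0 < c1" "eventually (\<lambda>n. c1 * norm (real n powr a) \<le> norm (\<nu> n)) sequentially"
    unfolding bigtheta_def a_def by (auto elim!: landau_omega.bigE)
  have w2: "(\<Delta> n)\<^sup>2 = (w n)\<^sup>2 * real n powr (- (2 * b))" if "0 < n" for n
    using that by (simp add: w_def power_mult_distrib power2_eq_square powr_add[symmetric] powr_minus field_simps)
  have wpos: "0 < w n" if "0 < n" for n using that \<Delta>[of n] by (simp add: w_def)
  show "(\<lambda>n. \<nu> n powr (- s) / (\<Delta> n)\<^sup>2) \<longlonglongrightarrow> 0"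
  proof (rule tendsto_sandwich[OF _ _ tendsto_const inv[of "c1 powr (- s)"]])
    show "\<forall>\<^sub>F n in sequentially. 0 \<le> \<nu> n powr (- s) / (\<Delta> n)\<^sup>2" by simp
    show "\<forall>\<^sub>F n in sequentially. \<nu> n powr (- s) / (\<Delta> n)\<^sup>2 \<le> c1 powr (- s) / (w n)\<^sup>2"
      using c1(2) eventually_gt_at_top[of 0]
    proof eventually_elim
      case (elim n)
      have "\<nu> n powr (- s) \<le> (c1 * real n powr a) powr (- s)"
        using elim \<nu>[of n] c1(1) s by (intro powr_mono2') auto
      also have "... = c1 powr (- s) * real n powr (- (2 * b))"
        using c1(1) by (simp add: powr_mult powr_powr ab(1)[symmetric])
      finally have "\<nu> n powr (- s) / (\<Delta> n)\<^sup>2 \<le> c1 powr (- s) * real n powr (- (2 * b)) / (\<Delta> n)\<^sup>2"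
        by (intro divide_right_mono) auto
      also have "... = c1 powr (- s) / (w n)\<^sup>2" unfolding w2[OF elim(2)] using elim(2) by simp
      finally show ?case .
    qed
  qed
  define c where "c = (pi / c2) powr (real D / 4)"
  have c0: "0 < c" using c2(1) by (simp add: c_def)
  show "(\<lambda>n. 1 / (real n * sqrt (sqrt (pi / \<nu> n) ^ D) * (\<Delta> n)\<^sup>2)) \<longlonglongrightarrow> 0"
  proof (rule tendsto_sandwich[OF _ _ tendsto_const inv[of "1 / c"]])
    show "\<forall>\<^sub>F n in sequentially. 0 \<le> 1 / (real n * sqrt (sqrt (pi / \<nu> n) ^ D) * (\<Delta> n)\<^sup>2)"
      using \<nu> by (intro always_eventually allI divide_nonneg_nonneg mult_nonneg_nonneg) (auto simp: less_imp_le)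
    show "\<forall>\<^sub>F n in sequentially. 1 / (real n * sqrt (sqrt (pi / \<nu> n) ^ D) * (\<Delta> n)\<^sup>2) \<le> (1 / c) / (w n)\<^sup>2"
      using c2(2) eventually_gt_at_top[of 0]
    proof eventually_elim
      case (elim n)
      have r: "sqrt (sqrt x ^ D) = x powr (real D / 4)" if "0 < x" for x :: real
        using that by (simp add: powr_half_sqrt[symmetric] powr_realpow[symmetric] powr_powr)
      have "c * real n powr (- (a * real D / 4)) = (pi / (c2 * real n powr a)) powr (real D / 4)"
        using c2(1) elim(2) by (simp add: c_def powr_divide powr_mult powr_powr powr_minus field_simps)
      also have "... \<le> (pi / \<nu> n) powr (real D / 4)"
        using elim \<nu>[of n] c2(1) by (intro powr_mono2 divide_left_mono mult_pos_pos divide_nonneg_nonneg) auto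
      also have "... = sqrt (sqrt (pi / \<nu> n) ^ D)" using \<nu>[of n] by (simp add: r)
      finally have "real n * (c * real n powr (- (a * real D / 4))) * (\<Delta> n)\<^sup>2 \<le> real n * sqrt (sqrt (pi / \<nu> n) ^ D) * (\<Delta> n)\<^sup>2"
        by (intro mult_right_mono mult_left_mono) auto
      moreover have "real n * (c * real n powr (- (a * real D / 4))) * (\<Delta> n)\<^sup>2 = c * (w n)\<^sup>2"
      proof -
        have "real n * real n powr (- (a * real D / 4)) = real n powr (1 + - (a * real D / 4))"
          using elim(2) by (simp only: powr_add) simp
        also have "1 + - (a * real D / 4) = 2 * b" using ab(2) by simp
        finally have E: "real n * real n powr (- (a * real D / 4)) = real n powr (2 * b)" .
        have "real n * (c * real n powr (- (a * real D / 4))) * ((w n)\<^sup>2 * real n powr (- (2 * b))) =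
          c * (w n)\<^sup>2 * ((real n * real n powr (- (a * real D / 4))) * real n powr (- (2 * b)))"
          by (simp only: mult_ac)
        also note E
        also have "real n powr (2 * b) * real n powr (- (2 * b)) = 1"
          using elim(2) by (simp flip: powr_add)
        finally show ?thesis unfolding w2[OF elim(2)] by simp
      qed
      ultimately have "c * (w n)\<^sup>2 \<le> real n * sqrt (sqrt (pi / \<nu> n) ^ D) * (\<Delta> n)\<^sup>2" by simp
      then have "1 / (real n * sqrt (sqrt (pi / \<nu> n) ^ D) * (\<Delta> n)\<^sup>2) \<le> 1 / (c * (w n)\<^sup>2)"
        using c0 wpos[OF elim(2)] by (intro frac_le) simp_all
      then show ?case by simp
    qed
  qed
qed

lemma power_tendsto_1:
  fixes M \<Delta> \<nu> :: "nat \<Rightarrow> real"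
  assumes k: "2 \<le> k" and d: "\<And>j. j < k \<Longrightarrow> 1 \<le> d j" and s: "0 < s" and M: "\<And>j. j < k \<Longrightarrow> 0 < M j"
    and \<Delta>: "\<And>n. 0 < \<Delta> n" and \<nu>: "\<And>n. 0 < \<nu> n"
    and u: "filterlim (\<lambda>n. real n powr (2 * s / (real (total_dim k d) + 4 * s)) * \<Delta> n) at_top sequentially"
    and \<Theta>: "\<nu> \<in> \<Theta>(\<lambda>n. real n powr (4 / (real (total_dim k d) + 4 * s)))"
  shows "(\<lambda>n. test_power k d n (Phi_IND k d n (\<nu> n) \<alpha>) (H1_IND k d s M (\<Delta> n))) \<longlonglongrightarrow> 1"
proof -
  define B where "B = (\<Prod>j<k. M j)\<^sup>2"
  define \<rho> where "\<rho> n = 1 / (real n * sqrt (sqrt (pi / \<nu> n) ^ total_dim k d) * (\<Delta> n)\<^sup>2)" for n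
  have "d 0 \<le> total_dim k d" unfolding total_dim_def using k by (intro member_le_sum) auto
  then have D: "0 < total_dim k d" using d[of 0] k by simp
  note rates = adaptive_rates[OF s D \<Delta> \<nu> u \<Theta>]
  have \<rho>: "\<rho> \<longlonglongrightarrow> 0" unfolding \<rho>_def[abs_def] by (rule rates(1))
  show ?thesis
  proof (rule LIMSEQ_I)
    fix e :: real assume e: "0 < e"
    define t where "t = 96 * real k / e + 1"
    have t: "0 < t" using e by (simp add: t_def add_nonneg_pos)
    have te: "48 * real k / t < e / 2"
    proof -
      have "48 * real k < e / 2 * t" using e by (simp add: t_def field_simps)
      then show ?thesis using t by (simp add: field_simps)
    qed
    have "(\<lambda>n. 8 * sqrt 2 * \<bar>z_upper \<alpha>\<bar> * \<rho> n * (3 * real k * sqrt (t ^ k) * sqrt B + 4 * B * \<rho> n)) \<longlonglongrightarrow>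
       8 * sqrt 2 * \<bar>z_upper \<alpha>\<bar> * 0 * (3 * real k * sqrt (t ^ k) * sqrt B + 4 * B * 0)"
      by (intro tendsto_intros \<rho>)
    then have E1: "\<forall>\<^sub>F n in sequentially. 8 * sqrt 2 * \<bar>z_upper \<alpha>\<bar> * \<rho> n * (3 * real k * sqrt (t ^ k) * sqrt B + 4 * B * \<rho> n) < 1"
      by (intro order_tendstoD(2)) auto
    have "(\<lambda>n. 4 * (324 * (2 * real k) ^ 6 * 4 ^ k) * (4 * \<rho> n * sqrt B + 16 * (\<rho> n)\<^sup>2 * B)) \<longlonglongrightarrow>
       4 * (324 * (2 * real k) ^ 6 * 4 ^ k) * (4 * 0 * sqrt B + 16 * 0\<^sup>2 * B)"
      by (intro tendsto_intros \<rho>)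
    then have E2: "\<forall>\<^sub>F n in sequentially. 4 * (324 * (2 * real k) ^ 6 * 4 ^ k) * (4 * \<rho> n * sqrt B + 16 * (\<rho> n)\<^sup>2 * B) < e / 2"
      using e by (intro order_tendstoD(2)) auto
    have "(\<lambda>n. 8 * B * (\<nu> n powr (- s) / (\<Delta> n)\<^sup>2)) \<longlonglongrightarrow> 8 * B * 0"
      by (intro tendsto_intros rates(2))
    then have E3: "\<forall>\<^sub>F n in sequentially. 8 * B * (\<nu> n powr (- s) / (\<Delta> n)\<^sup>2) < 1"
      by (intro order_tendstoD(2)) auto
    have "\<forall>\<^sub>F n in sequentially. norm (test_power k d n (Phi_IND k d n (\<nu> n) \<alpha>) (H1_IND k d s M (\<Delta> n)) - 1) < e"
      using E1 E2 E3 eventually_ge_at_top[of "4 * k"]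
    proof eventually_elim
      case (elim n)
      let ?T = "test_power k d n (Phi_IND k d n (\<nu> n) \<alpha>) (H1_IND k d s M (\<Delta> n))"
      define c where "c = 1 - 4 * (324 * (2 * real k) ^ 6 * 4 ^ k) * (4 * \<rho> n * sqrt B + 16 * (\<rho> n)\<^sup>2 * B) - 48 * real k / t"
      have bias: "8 * B * \<nu> n powr (- s) \<le> (\<Delta> n)\<^sup>2" using elim(3) \<Delta>[of n] by (simp add: field_simps)
      have \<rho>0: "0 \<le> \<rho> n" unfolding \<rho>_def using \<nu>[of n] by (simp add: less_imp_le)
      have B0: "0 \<le> B" by (simp add: B_def)
      have "0 \<le> 4 * (324 * (2 * real k) ^ 6 * 4 ^ k) * (4 * \<rho> n * sqrt B + 16 * (\<rho> n)\<^sup>2 * B)"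
        using \<rho>0 B0 by (intro mult_nonneg_nonneg add_nonneg_nonneg) auto
      moreover have "0 \<le> 48 * real k / t" using t by simp
      ultimately have c1: "c \<le> 1" unfolding c_def by linarith
      have "prob_density (coords k d) p" "c \<le> rejection_prob k d n p (Phi_IND k d n (\<nu> n) \<alpha>)"
        if p: "p \<in> H1_IND k d s M (\<Delta> n)" for p
        using p H1_rejection_lower_bound[OF k s M p \<Delta> \<nu> elim(4) t bias[unfolded B_def] elim(1)[unfolded \<rho>_def B_def]]
        by (simp_all add: H1_IND_def c_def \<rho>_def B_def)
      from test_power_ge[OF this c1] have "c \<le> ?T \<and> ?T \<le> 1" by blast
      moreover have "1 - e < c" unfolding c_def using elim(2) te by linarith
      ultimately show ?case by auto
    qed
    then show "\<exists>n0. \<forall>n\<ge>n0. norm (test_power k d n (Phi_IND k d n (\<nu> n) \<alpha>) (H1_IND k d s M (\<Delta> n)) - 1) < e"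
      by (simp add: eventually_sequentially)
  qed
qed

section \<open>Product functions and two one-dimensional profiles\<close>

text \<open>The normalising constant of the Fourier transform is omitted; dropping it only increases the norms, see
\<open>fourier_prod_norm_le\<close>.\<close>

definition fourier_1d :: "(real \<Rightarrow> real) \<Rightarrow> real \<Rightarrow> complex" where
  "fourier_1d g t = (\<integral>x. complex_of_real (g x) * cis (- (x * t)) \<partial>lborel)"

definition weight_1d :: "real \<Rightarrow> (real \<Rightarrow> real) \<Rightarrow> real \<Rightarrow> real" where
  "weight_1d s g t = (1 + t\<^sup>2) powr s * (cmod (fourier_1d g t))\<^sup>2"

lemma integrable_fourier_1d:
  assumes "integrable lborel g"
  shows "integrable lborel (\<lambda>x. complex_of_real (g x) * cis (- (x * t)))"
proof (rule Bochner_Integration.integrable_bound[OF assms])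
  have [measurable]: "g \<in> borel_measurable borel" using assms by auto
  note measurable_leb_component [measurable del]
  show "(\<lambda>x. complex_of_real (g x) * cis (- (x * t))) \<in> borel_measurable lborel" by measurable
qed (auto simp: norm_mult)

lemma measurable_fourier_1d:
  assumes "integrable lborel g"
  shows "fourier_1d g \<in> borel_measurable borel"
proof -
  have [measurable]: "g \<in> borel_measurable borel" using assms by auto
  show ?thesis unfolding fourier_1d_def[abs_def] by measurable
qed

lemma weight_1d_nonneg: "0 \<le> weight_1d s g t"
  by (simp add: weight_1d_def)

lemma measurable_weight_1d:
  assumes "integrable lborel g"
  shows "weight_1d s g \<in> borel_measurable borel"
proof -
  note measurable_leb_component [measurable del] measurable_fourier_1d[OF assms, measurable]
  show ?thesis unfolding weight_1d_def[abs_def] by measurable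
qed

text \<open>Repeated integration by parts. Each derivative costs one power of \<open>x (1 - x)\<close>, so as long as one is left the boundary
terms vanish, and the transform decays like \<open>|t|\<^sup>-\<^sup>n\<close>.\<close>

lemma polynomial_bump_oscillation:
  fixes r :: "real poly"
  assumes "[:0, 1, -1:] ^ n dvd r"
  shows "\<exists>A. \<forall>t. \<bar>t\<bar> ^ n * cmod (\<integral>x. indicator {0..1} x *\<^sub>R (complex_of_real (poly r x) * cis (- (x * t))) \<partial>lborel) \<le> A"
  using assms
proof (induction n arbitrary: r)
  case 0
  have c: "continuous_on {0..1::real} (\<lambda>x. norm (poly r x))" by (intro continuous_intros)
  have i: "integrable lborel (\<lambda>x. indicator {0..1::real} x *\<^sub>R norm (poly r x))"
    by (rule borel_integrable_compact[OF _ c]) simp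
  have "cmod (\<integral>x. indicator {0..1} x *\<^sub>R (complex_of_real (poly r x) * cis (- (x * t))) \<partial>lborel) \<le>
    (\<integral>x. indicator {0..1::real} x *\<^sub>R norm (poly r x) \<partial>lborel)" for t
    by (rule Bochner_Integration.integral_norm_bound_integral[OF borel_integrable_compact i])
       (auto simp: norm_mult intro!: continuous_intros)
  then show ?case by auto
next
  case (Suc n)
  define b :: "real poly" where "b = [:0, 1, -1:]"
  from Suc.prems obtain q where q: "r = b ^ Suc n * q" unfolding b_def by (elim dvdE)
  have "b ^ n dvd pderiv r"
    unfolding q pderiv_mult pderiv_power_Suc by (intro dvd_add dvd_mult dvd_mult2 dvd_smult) auto
  from Suc.IH[OF this[unfolded b_def]] obtain A where
    A: "\<And>t. \<bar>t\<bar> ^ n * cmod (\<integral>x. indicator {0..1} x *\<^sub>R (complex_of_real (poly (pderiv r) x) * cis (- (x * t))) \<partial>lborel) \<le> A"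
    by blast
  have z: "poly r 0 = 0" "poly r 1 = 0" by (simp_all add: q b_def)
  have "\<bar>t\<bar> ^ Suc n * cmod (\<integral>x. indicator {0..1} x *\<^sub>R (complex_of_real (poly r x) * cis (- (x * t))) \<partial>lborel) \<le> A" for t
  proof -
    define u where "u x = complex_of_real (poly r x) * cis (- (x * t))" for x
    define v where "v x = complex_of_real (poly (pderiv r) x) * cis (- (x * t))" for x
    have dc: "((\<lambda>x. cis (- (x * t))) has_vector_derivative - (\<i> * complex_of_real t) * cis (- (x * t))) (at x within S)" for x S
    proof -
      have "((\<lambda>z. exp (- \<i> * (z * complex_of_real t))) has_field_derivative
          - (\<i> * complex_of_real t) * exp (- \<i> * (complex_of_real x * complex_of_real t))) (at (complex_of_real x))"
        by (auto intro!: derivative_eq_intros)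
      from has_vector_derivative_real_field[OF this] show ?thesis by (simp add: cis_conv_exp)
    qed
    have dp: "((\<lambda>x. complex_of_real (poly r x)) has_vector_derivative complex_of_real (poly (pderiv r) x)) (at x within S)" for x S
      by (rule has_vector_derivative_of_real) (rule DERIV_subset[OF poly_DERIV], simp)
    have du: "(u has_vector_derivative (complex_of_real (poly r x) * (- (\<i> * complex_of_real t) * cis (- (x * t)))
        + complex_of_real (poly (pderiv r) x) * cis (- (x * t)))) (at x within {0..1})" for x
      unfolding u_def[abs_def] by (rule has_vector_derivative_mult[OF dp dc])
    have int: "integrable lborel (\<lambda>x. indicator {0..1} x *\<^sub>R u x)" "integrable lborel (\<lambda>x. indicator {0..1} x *\<^sub>R v x)"
      unfolding u_def v_def by (auto intro!: borel_integrable_compact continuous_intros)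
    have "(\<integral>x. indicator {0..1} x *\<^sub>R (complex_of_real (poly r x) * (- (\<i> * complex_of_real t) * cis (- (x * t)))
        + complex_of_real (poly (pderiv r) x) * cis (- (x * t))) \<partial>lborel) = u 1 - u 0"
      using du by (intro integral_FTC_Icc) (auto intro!: continuous_intros)
    also have "(\<lambda>x. indicator {0..1} x *\<^sub>R (complex_of_real (poly r x) * (- (\<i> * complex_of_real t) * cis (- (x * t)))
        + complex_of_real (poly (pderiv r) x) * cis (- (x * t)))) =
        (\<lambda>x. - (\<i> * complex_of_real t) * (indicator {0..1} x *\<^sub>R u x) + indicator {0..1} x *\<^sub>R v x)"
      by (rule ext) (simp add: u_def v_def indicator_def)
    also have "(\<integral>x. - (\<i> * complex_of_real t) * (indicator {0..1} x *\<^sub>R u x) + indicator {0..1} x *\<^sub>R v x \<partial>lborel) =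
        - (\<i> * complex_of_real t) * (\<integral>x. indicator {0..1} x *\<^sub>R u x \<partial>lborel) + (\<integral>x. indicator {0..1} x *\<^sub>R v x \<partial>lborel)"
      by (subst Bochner_Integration.integral_add) (use int in \<open>auto simp del: mult_scaleR_right\<close>)
    also have "u 1 - u 0 = 0" by (simp add: u_def z)
    finally have "\<i> * complex_of_real t * (\<integral>x. indicator {0..1} x *\<^sub>R u x \<partial>lborel) = (\<integral>x. indicator {0..1} x *\<^sub>R v x \<partial>lborel)"
      by (simp add: algebra_simps)
    from arg_cong[OF this, of cmod]
    have "\<bar>t\<bar> * cmod (\<integral>x. indicator {0..1} x *\<^sub>R u x \<partial>lborel) = cmod (\<integral>x. indicator {0..1} x *\<^sub>R v x \<partial>lborel)"
      by (simp add: norm_mult)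
    then have "\<bar>t\<bar> ^ Suc n * cmod (\<integral>x. indicator {0..1} x *\<^sub>R u x \<partial>lborel) = \<bar>t\<bar> ^ n * cmod (\<integral>x. indicator {0..1} x *\<^sub>R v x \<partial>lborel)"
      by (simp add: mult_ac)
    also have "... \<le> A" using A unfolding v_def .
    finally show ?thesis unfolding u_def .
  qed
  then show ?case by blast
qed

text \<open>The derivative of a high power of \<open>x (1 - x)\<close>, extended by zero. It has integral zero because it is a derivative, and
its transform decays fast enough for any prescribed Sobolev order. A profile with finite smoothness is enough, and
polynomials make all its properties elementary.\<close>

lemma smooth_bump_exists:
  fixes s :: real
  shows "\<exists>\<psi> :: real \<Rightarrow> real. continuous_on UNIV \<psi> \<and> (\<forall>x. x \<notin> {0<..<1} \<longrightarrow> \<psi> x = 0) \<and> (\<exists>A. \<forall>x. \<bar>\<psi> x\<bar> \<le> A) \<and>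
    integrable lborel \<psi> \<and> (\<integral>x. \<psi> x \<partial>lborel) = 0 \<and> integrable lborel (\<lambda>x. (\<psi> x)\<^sup>2) \<and> 0 < (\<integral>x. (\<psi> x)\<^sup>2 \<partial>lborel) \<and>
    integrable lborel (weight_1d s \<psi>)"
proof -
  (* One power of the weight more than s leaves the integrable majorant 1 / (1 + t\<^sup>2). *)
  define m where "m = nat \<lceil>\<bar>s\<bar> + 1\<rceil>"
  have m: "\<bar>s\<bar> + 1 \<le> real m" "1 \<le> m" unfolding m_def by linarith+
  define b :: "real poly" where "b = [:0, 1, -1:]"
  define r where "r = pderiv (b ^ Suc m)"
  define \<psi> where "\<psi> x = indicator {0..1} x * poly r x" for x
  have dvd: "b ^ m dvd r" unfolding r_def pderiv_power_Suc by (intro dvd_mult2 dvd_smult) simp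
  then obtain q where q: "r = b ^ m * q" by (elim dvdE)
  have z: "poly r 0 = 0" "poly r 1 = 0" using m by (simp_all add: q b_def)
  have out: "\<psi> x = 0" if "x \<notin> {0<..<1}" for x
  proof -
    from that have "x = 0 \<or> x = 1 \<or> x \<notin> {0..1}" by auto
    then show ?thesis using z by (auto simp: \<psi>_def)
  qed
  have "\<psi> = (\<lambda>x. poly r (max 0 (min 1 x)))"
  proof
    fix x :: real
    show "\<psi> x = poly r (max 0 (min 1 x))" using z by (cases "x = 0"; cases "x = 1") (auto simp: \<psi>_def max_def min_def indicator_def)
  qed
  then have cont: "continuous_on UNIV \<psi>" by (auto intro!: continuous_intros)
  have c01: "compact (\<psi> ` {0..1})"
    by (intro compact_continuous_image continuous_on_subset[OF cont]) auto
  from compact_imp_bounded[OF c01] obtain A0 where "\<forall>y\<in>\<psi> ` {0..1}. norm y \<le> A0"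
    unfolding bounded_iff by blast
  then have A0: "\<bar>\<psi> x\<bar> \<le> A0" if "x \<in> {0..1}" for x using that by simp
  have "0 \<le> A0" using A0[of 0] by auto
  then have bd: "\<bar>\<psi> x\<bar> \<le> A0" for x using A0[of x] out[of x] by (cases "x \<in> {0..1}") auto
  have i: "integrable lborel (\<lambda>x. indicator {0..1::real} x *\<^sub>R poly r x)"
    by (rule borel_integrable_compact) (auto intro!: continuous_intros)
  then have int: "integrable lborel \<psi>" by (simp add: \<psi>_def[abs_def])
  have "(\<integral>x. indicator {0..1} x *\<^sub>R poly r x \<partial>lborel) = poly (b ^ Suc m) 1 - poly (b ^ Suc m) 0"
  proof (rule integral_FTC_Icc)
    show "(poly (b ^ Suc m) has_vector_derivative poly r x) (at x within {0..1})" for x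
      unfolding r_def has_real_derivative_iff_has_vector_derivative[symmetric]
      by (rule DERIV_subset[OF poly_DERIV]) simp
  qed (auto intro!: continuous_intros)
  also have "... = 0" by (simp add: b_def)
  finally have zero: "(\<integral>x. \<psi> x \<partial>lborel) = 0" by (simp add: \<psi>_def[abs_def])
  have i2: "integrable lborel (\<lambda>x. indicator {0..1::real} x *\<^sub>R (poly r x)\<^sup>2)"
    by (rule borel_integrable_compact) (auto intro!: continuous_intros)
  have sq: "(\<psi> x)\<^sup>2 = indicator {0..1} x *\<^sub>R (poly r x)\<^sup>2" for x by (simp add: \<psi>_def indicator_def)
  have int2: "integrable lborel (\<lambda>x. (\<psi> x)\<^sup>2)" using i2 by (simp add: sq)
  have r0: "r \<noteq> 0"
  proof
    assume "r = 0"
    then have "degree (b ^ Suc m) = 0" unfolding r_def by (simp add: pderiv_eq_0_iff del: power_Suc)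
    then show False by (simp add: b_def degree_power_eq del: power_Suc)
  qed
  have pos: "0 < (\<integral>x. (\<psi> x)\<^sup>2 \<partial>lborel)"
  proof (rule ccontr)
    assume "\<not> 0 < (\<integral>x. (\<psi> x)\<^sup>2 \<partial>lborel)"
    moreover have "0 \<le> (\<integral>x. (\<psi> x)\<^sup>2 \<partial>lborel)" by (rule Bochner_Integration.integral_nonneg) simp
    ultimately have "(\<integral>x. (\<psi> x)\<^sup>2 \<partial>lborel) = 0" by linarith
    then have ae: "AE x in lborel. \<psi> x = 0" using integral_nonneg_eq_0_iff_AE[OF int2] by simp
    have fin: "finite {x. poly r x = 0}" by (rule poly_roots_finite[OF r0])
    have ae2: "AE x in lborel. x \<notin> {x. poly r x = 0}"
      by (rule AE_not_in) (use fin in \<open>auto intro!: finite_imp_null_set_lborel\<close>)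
    from ae ae2 have "AE x in lborel. x \<notin> {0..1::real}" by eventually_elim (auto simp: \<psi>_def)
    then have "{0..1::real} \<in> null_sets lborel" by (subst AE_iff_null_sets) auto
    then have "emeasure lborel {0..1::real} = 0" by (rule null_setsD1)
    then show False by simp
  qed
  have F: "fourier_1d \<psi> t = (\<integral>x. indicator {0..1} x *\<^sub>R (complex_of_real (poly r x) * cis (- (x * t))) \<partial>lborel)" for t
    unfolding fourier_1d_def by (rule Bochner_Integration.integral_cong) (simp_all add: \<psi>_def indicator_def)
  obtain A where A: "\<And>t. \<bar>t\<bar> ^ m * cmod (fourier_1d \<psi> t) \<le> A"
    using polynomial_bump_oscillation[OF dvd[unfolded b_def]] unfolding F[symmetric] by blast
  obtain B where B: "\<And>t. cmod (fourier_1d \<psi> t) \<le> B"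
    using polynomial_bump_oscillation[of 0 r] unfolding F[symmetric] by auto
  have w: "weight_1d s \<psi> t \<le> 2 ^ m * (B\<^sup>2 + A\<^sup>2) * inverse (1 + t\<^sup>2)" for t
  proof -
    have p: "0 < 1 + t\<^sup>2" by (simp add: add_pos_nonneg)
    have "(1 + t\<^sup>2) powr s * (1 + t\<^sup>2) = (1 + t\<^sup>2) powr (s + 1)" using p by (simp add: powr_add)
    also have "... \<le> (1 + t\<^sup>2) powr real m" using m by (intro powr_mono) auto
    also have "... = (1 + t\<^sup>2) ^ m" using p by (simp add: powr_realpow)
    also have "... \<le> 2 ^ m * (1 + (\<bar>t\<bar> ^ m)\<^sup>2)"
    proof (cases "\<bar>t\<bar> \<le> 1")
      case True
      then have "1 + t\<^sup>2 \<le> 2" by (simp add: abs_square_le_1)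
      then have "(1 + t\<^sup>2) ^ m \<le> 2 ^ m" by (intro power_mono) auto
      also have "... \<le> 2 ^ m * (1 + (\<bar>t\<bar> ^ m)\<^sup>2)" by (simp add: distrib_left)
      finally show ?thesis .
    next
      case False
      then have "1 \<le> t\<^sup>2" by (metis abs_ge_zero linorder_le_cases one_le_power power2_abs)
      then have "(1 + t\<^sup>2) ^ m \<le> (2 * t\<^sup>2) ^ m" by (intro power_mono) auto
      also have "... = 2 ^ m * (\<bar>t\<bar> ^ m)\<^sup>2"
        by (simp add: power_mult_distrib power_mult[symmetric] mult.commute power_even_abs)
      also have "... \<le> 2 ^ m * (1 + (\<bar>t\<bar> ^ m)\<^sup>2)" by simp
      finally show ?thesis .
    qed
    finally have "(1 + t\<^sup>2) powr s * (1 + t\<^sup>2) * (cmod (fourier_1d \<psi> t))\<^sup>2 \<le> 2 ^ m * (1 + (\<bar>t\<bar> ^ m)\<^sup>2) * (cmod (fourier_1d \<psi> t))\<^sup>2"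
      by (rule mult_right_mono) simp
    also have "... = 2 ^ m * ((cmod (fourier_1d \<psi> t))\<^sup>2 + (\<bar>t\<bar> ^ m * cmod (fourier_1d \<psi> t))\<^sup>2)"
      by (simp add: algebra_simps power_mult_distrib)
    also have "... \<le> 2 ^ m * (B\<^sup>2 + A\<^sup>2)"
      by (intro mult_left_mono add_mono power_mono A B) auto
    finally have "weight_1d s \<psi> t * (1 + t\<^sup>2) \<le> 2 ^ m * (B\<^sup>2 + A\<^sup>2)" by (simp add: weight_1d_def mult_ac)
    then show ?thesis using p by (simp add: divide_inverse[symmetric] pos_le_divide_eq)
  qed
  have "integrable lborel (\<lambda>t::real. inverse (1 + t\<^sup>2))"
    using integrable_inverse_1_plus_square by (simp add: set_integrable_def einterval_def)
  then have "integrable lborel (\<lambda>t::real. 2 ^ m * (B\<^sup>2 + A\<^sup>2) * inverse (1 + t\<^sup>2))" by simp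
  then have "integrable lborel (weight_1d s \<psi>)"
  proof (rule Bochner_Integration.integrable_bound)
    show "weight_1d s \<psi> \<in> borel_measurable lborel"
      using measurable_weight_1d[OF int] by simp
    show "AE t in lborel. norm (weight_1d s \<psi> t) \<le> norm (2 ^ m * (B\<^sup>2 + A\<^sup>2) * inverse (1 + t\<^sup>2))"
      using w by (intro AE_I2) (auto simp: weight_1d_nonneg intro: order_trans[OF _ abs_ge_self])
  qed
  then show ?thesis using cont out bd int zero int2 pos by (intro exI[of _ \<psi>]) blast
qed

lemma fourier_prod:
  assumes "finite I" and g: "\<And>i. i \<in> I \<Longrightarrow> integrable lborel (g i)"
  shows "fourier I (\<lambda>x. \<Prod>i\<in>I. g i (x i)) \<omega> =
    complex_of_real ((2 * pi) powr (- real (card I) / 2)) * (\<Prod>i\<in>I. fourier_1d (g i) (\<omega> i))"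
proof -
  have "complex_of_real (\<Prod>i\<in>I. g i (x i)) * cis (- (\<Sum>i\<in>I. x i * \<omega> i)) =
    (\<Prod>i\<in>I. complex_of_real (g i (x i)) * cis (- (x i * \<omega> i)))" for x
    using assms(1) by (simp add: prod.distrib cis_conv_exp exp_sum sum_distrib_left sum_negf[symmetric] del: sum_negf)
  moreover have "integrable lborel (\<lambda>x. complex_of_real (g i x) * cis (- (x * \<omega> i)))" if "i \<in> I" for i
    by (rule integrable_fourier_1d[OF g[OF that]])
  note integral_leb_prod[OF assms(1) this]
  ultimately show ?thesis unfolding fourier_eq_cis fourier_1d_def by simp
qed

lemma sobolev_weight_le_prod:
  assumes "finite I" "0 \<le> (s::real)"
  shows "(1 + (L2_set \<omega> I)\<^sup>2) powr s \<le> (\<Prod>i\<in>I. (1 + (\<omega> i)\<^sup>2) powr s)"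
proof -
  have "(1 + (\<Sum>i\<in>I. (\<omega> i)\<^sup>2)) powr s \<le> (\<Prod>i\<in>I. 1 + (\<omega> i)\<^sup>2) powr s"
    using assms by (intro powr_mono2 one_plus_sum_le_prod add_nonneg_nonneg) (auto intro!: sum_nonneg)
  also have "... = (\<Prod>i\<in>I. (1 + (\<omega> i)\<^sup>2) powr s)" by (rule prod_powr_distrib)
  finally show ?thesis by (simp add: L2_set_def sum_nonneg)
qed

lemma fourier_prod_norm_le:
  assumes "finite I" and g: "\<And>i. i \<in> I \<Longrightarrow> integrable lborel (g i)"
  shows "(cmod (fourier I (\<lambda>x. \<Prod>i\<in>I. g i (x i)) \<omega>))\<^sup>2 \<le> (\<Prod>i\<in>I. (cmod (fourier_1d (g i) (\<omega> i)))\<^sup>2)"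
proof -
  have "(2 * pi) powr (- real (card I) / 2) \<le> (2 * pi) powr 0"
    using pi_ge_two by (intro powr_mono) auto
  then have c: "(2 * pi) powr (- real (card I) / 2) \<le> 1" by simp
  have "cmod (fourier I (\<lambda>x. \<Prod>i\<in>I. g i (x i)) \<omega>) = (2 * pi) powr (- real (card I) / 2) * (\<Prod>i\<in>I. cmod (fourier_1d (g i) (\<omega> i)))"
    by (subst fourier_prod[OF assms]) (simp_all add: norm_mult prod_norm)
  also have "... \<le> 1 * (\<Prod>i\<in>I. cmod (fourier_1d (g i) (\<omega> i)))"
    using c by (intro mult_right_mono prod_nonneg) auto
  finally have "cmod (fourier I (\<lambda>x. \<Prod>i\<in>I. g i (x i)) \<omega>) \<le> (\<Prod>i\<in>I. cmod (fourier_1d (g i) (\<omega> i)))" by simp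
  from power_mono[OF this, of 2] show ?thesis by (simp add: prod_power_distrib)
qed

lemma continuous_product:
  assumes "\<And>i. i \<in> I \<Longrightarrow> continuous_on UNIV (g i)"
  shows "continuous (at x within S) (\<lambda>x::'i::countable \<Rightarrow> real. \<Prod>i\<in>I. g i (x i) :: real)"
proof -
  have "continuous_on UNIV (\<lambda>x::'i \<Rightarrow> real. \<Prod>i\<in>I. g i (x i))"
  proof (rule continuous_on_prod)
    fix i assume "i \<in> I"
    from assms[OF this] show "continuous_on UNIV (\<lambda>x::'i \<Rightarrow> real. g i (x i))"
      by (rule continuous_on_compose2) (auto intro: continuous_on_product_coordinates)
  qed
  then show ?thesis by (metis UNIV_I continuous_on_eq_continuous_within continuous_within_subset subset_UNIV)
qed

lemma product_sobolev:
  fixes g :: "'i::countable \<Rightarrow> real \<Rightarrow> real"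
  assumes I: "finite I" and s: "0 \<le> s" and g: "\<And>i. i \<in> I \<Longrightarrow> integrable lborel (g i)"
    and c: "\<And>i. i \<in> I \<Longrightarrow> continuous_on UNIV (g i)" and w: "\<And>i. i \<in> I \<Longrightarrow> integrable lborel (weight_1d s (g i))"
  shows "(\<lambda>x. \<Prod>i\<in>I. g i (x i)) \<in> sobolev I s"
    and "(sobolev_norm I s (\<lambda>x. \<Prod>i\<in>I. g i (x i)))\<^sup>2 \<le> (\<Prod>i\<in>I. \<integral>t. weight_1d s (g i) t \<partial>lborel)"
proof -
  let ?f = "\<lambda>x. \<Prod>i\<in>I. g i (x i)"
  have fi: "integrable (leb I) ?f" by (rule integrable_leb_prod[OF I g])
  have dom: "sobolev_density I s ?f \<omega> \<le> (\<Prod>i\<in>I. weight_1d s (g i) (\<omega> i))" for \<omega>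
    unfolding sobolev_density_def weight_1d_def prod.distrib
    by (intro mult_mono sobolev_weight_le_prod fourier_prod_norm_le I g s) (auto intro: prod_nonneg)
  note int = integrable_leb_prod[OF I w]
  have Si: "integrable (leb I) (sobolev_density I s ?f)"
  proof (rule Bochner_Integration.integrable_bound[OF int])
    show "sobolev_density I s ?f \<in> borel_measurable (leb I)"
      using fi I by (intro measurable_sobolev_density) auto
    show "AE \<omega> in leb I. norm (sobolev_density I s ?f \<omega>) \<le> norm (\<Prod>i\<in>I. weight_1d s (g i) (\<omega> i))"
      using dom by (intro AE_I2) (simp add: sobolev_density_nonneg prod_nonneg weight_1d_nonneg)
  qed
  have "continuous (at x within space (leb I)) ?f" for x by (rule continuous_product[OF c])
  then show "?f \<in> sobolev I s" using fi Si by (simp add: sobolev_def)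
  have "(sobolev_norm I s ?f)\<^sup>2 \<le> (\<integral>\<omega>. (\<Prod>i\<in>I. weight_1d s (g i) (\<omega> i)) \<partial>leb I)"
    unfolding sobolev_norm_square by (rule integral_mono[OF Si int dom])
  also have "... = (\<Prod>i\<in>I. \<integral>t. weight_1d s (g i) t \<partial>lborel)" by (rule integral_leb_prod[OF I w])
  finally show "(sobolev_norm I s ?f)\<^sup>2 \<le> (\<Prod>i\<in>I. \<integral>t. weight_1d s (g i) t \<partial>lborel)" .
qed

text \<open>Widening a Gaussian density concentrates its transform \<open>exp (- \<nu> t\<^sup>2)\<close> at the origin, so its Sobolev norm tends to
zero while its integral stays one. The weight is dominated through \<open>(1 + t\<^sup>2)\<^sup>s \<le> exp (s t\<^sup>2)\<close>.\<close>

lemma wide_gaussian: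
  fixes s \<eta> :: real
  assumes s: "0 < s" and \<eta>: "0 < \<eta>"
  shows "\<exists>\<rho>. continuous_on UNIV \<rho> \<and> (\<forall>x. 0 < \<rho> x) \<and> (\<forall>x\<in>{0..1}. \<rho> 1 \<le> \<rho> x) \<and> integrable lborel \<rho> \<and> (\<integral>x. \<rho> x \<partial>lborel) = 1
    \<and> integrable lborel (weight_1d s \<rho>) \<and> (\<integral>t. weight_1d s \<rho> t \<partial>lborel) \<le> \<eta>"
proof -
  (* The variance: the dominating integral sqrt (pi / (v - s)) is then exactly eta. *)
  define v where "v = s + pi / \<eta>\<^sup>2"
  define \<nu> where "\<nu> = v / 2"
  have v: "0 < v" "0 < \<nu>" "s < v" using s \<eta> by (auto simp: v_def \<nu>_def add_pos_pos)
  define Z where "Z = sqrt (4 * pi * \<nu>)"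
  have Z: "0 < Z" using v by (simp add: Z_def)
  define \<rho> where "\<rho> x = exp (- (x\<^sup>2 / (4 * \<nu>))) / Z" for x
  have cont: "continuous_on UNIV \<rho>" unfolding \<rho>_def using Z v by (auto intro!: continuous_intros)
  have pos: "0 < \<rho> x" for x using Z by (simp add: \<rho>_def)
  have dec: "\<rho> 1 \<le> \<rho> x" if "x \<in> {0..1}" for x
    using that Z v unfolding \<rho>_def by (intro divide_right_mono) (auto simp: abs_square_le_1 intro!: divide_right_mono)
  have F: "fourier_1d \<rho> u = complex_of_real (exp (- (\<nu> * u\<^sup>2)))" for u
  proof -
    have "fourier_1d \<rho> u = (\<integral>t. complex_of_real (1 / Z) * (complex_of_real (exp (- (t\<^sup>2 / (4 * \<nu>)))) * cis (t * (- u))) \<partial>lborel)"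
      unfolding fourier_1d_def by (intro Bochner_Integration.integral_cong) (simp_all add: \<rho>_def)
    also have "... = complex_of_real (1 / Z) * complex_of_real (Z * exp (- (\<nu> * u\<^sup>2)))"
      by (subst Bochner_Integration.integral_mult_right_zero) (simp only: char_gauss_1d(2)[OF v(2)] Z_def power2_minus)
    finally show ?thesis using Z by simp
  qed
  have "integrable lborel (\<lambda>t. exp (- ((1/(4*\<nu>)) * (0 - t)\<^sup>2)))"
    using v by (intro has_integral_gauss_1d) auto
  then have int: "integrable lborel \<rho>" by (simp add: \<rho>_def[abs_def])
  have "complex_of_real (\<integral>x. \<rho> x \<partial>lborel) = fourier_1d \<rho> 0" by (simp add: fourier_1d_def)
  also have "... = 1" by (simp add: F)
  finally have one: "(\<integral>x. \<rho> x \<partial>lborel) = 1" by (metis of_real_eq_1_iff)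
  have vs: "0 < v - s" using v by simp
  have dom: "weight_1d s \<rho> t \<le> exp (- ((v - s) * (0 - t)\<^sup>2))" for t
  proof -
    have "(1 + t\<^sup>2) powr s \<le> exp (t\<^sup>2) powr s" using s by (intro powr_mono2 exp_ge_add_one_self) auto
    also have "... = exp (s * t\<^sup>2)" by (simp add: exp_powr_real mult.commute)
    finally have "weight_1d s \<rho> t \<le> exp (s * t\<^sup>2) * (exp (- (\<nu> * t\<^sup>2)))\<^sup>2"
      unfolding weight_1d_def F by (intro mult_mono) auto
    also have "... = exp (- ((v - s) * (0 - t)\<^sup>2))"
      by (simp add: exp_add[symmetric] exp_double[symmetric] \<nu>_def algebra_simps)
    finally show ?thesis .
  qed
  have gi: "integrable lborel (\<lambda>t. exp (- ((v - s) * (0 - t)\<^sup>2)))" "(\<integral>t. exp (- ((v - s) * (0 - t)\<^sup>2)) \<partial>lborel) = sqrt (pi / (v - s))"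
    by (rule has_integral_gauss_1d[OF vs])+
  have wi: "integrable lborel (weight_1d s \<rho>)"
  proof (rule Bochner_Integration.integrable_bound[OF gi(1)])
    show "weight_1d s \<rho> \<in> borel_measurable lborel"
      using measurable_weight_1d[OF int] by simp
    show "AE t in lborel. norm (weight_1d s \<rho> t) \<le> norm (exp (- ((v - s) * (0 - t)\<^sup>2)))"
      using dom by (intro AE_I2) (simp add: weight_1d_nonneg)
  qed
  have "(\<integral>t. weight_1d s \<rho> t \<partial>lborel) \<le> sqrt (pi / (v - s))"
    unfolding gi(2)[symmetric] by (rule integral_mono[OF wi gi(1) dom])
  also have "... = \<eta>" using \<eta> by (simp add: v_def)
  finally show ?thesis using cont pos dec int one wi by (intro exI[of _ \<rho>]) blast
qed

section \<open>Perturbations with random signs on a grid\<close>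

lemma fourier_lincomb:
  assumes "finite I" and g: "\<And>v. v \<in> V \<Longrightarrow> integrable (leb I) (g v)"
  shows "fourier I (\<lambda>x. \<Sum>v\<in>V. c v * g v x) \<omega> = (\<Sum>v\<in>V. complex_of_real (c v) * fourier I (g v) \<omega>)"
proof -
  have i: "integrable (leb I) (\<lambda>x. complex_of_real (g v x) * cis (- (\<Sum>i\<in>I. x i * \<omega> i)))" if "v \<in> V" for v
  proof (rule Bochner_Integration.integrable_bound[OF g[OF that]])
    have [measurable]: "g v \<in> borel_measurable (leb I)" using g[OF that] by auto
    show "(\<lambda>x. complex_of_real (g v x) * cis (- (\<Sum>i\<in>I. x i * \<omega> i))) \<in> borel_measurable (leb I)" by measurable
  qed (auto simp: norm_mult)
  have "(\<integral>x. complex_of_real (\<Sum>v\<in>V. c v * g v x) * cis (- (\<Sum>i\<in>I. x i * \<omega> i)) \<partial>leb I) =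
    (\<integral>x. (\<Sum>v\<in>V. complex_of_real (c v) * (complex_of_real (g v x) * cis (- (\<Sum>i\<in>I. x i * \<omega> i)))) \<partial>leb I)"
    by (simp add: sum_distrib_right mult.assoc)
  also have "... = (\<Sum>v\<in>V. \<integral>x. complex_of_real (c v) * (complex_of_real (g v x) * cis (- (\<Sum>i\<in>I. x i * \<omega> i))) \<partial>leb I)"
    by (rule Bochner_Integration.integral_sum) (use i in auto)
  also have "... = (\<Sum>v\<in>V. complex_of_real (c v) * (\<integral>x. complex_of_real (g v x) * cis (- (\<Sum>i\<in>I. x i * \<omega> i)) \<partial>leb I))"
    by simp
  finally show ?thesis unfolding fourier_eq_cis by (simp add: sum_distrib_left mult_ac)
qed

lemma sobolev_lincomb:
  assumes I: "finite I" and V: "finite V" and g: "\<And>v. v \<in> V \<Longrightarrow> g v \<in> sobolev I s"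
  shows "(\<lambda>x. \<Sum>v\<in>V. c v * g v x) \<in> sobolev I s"
proof -
  have gi: "integrable (leb I) (g v)" "integrable (leb I) (sobolev_density I s (g v))"
    "AE x in leb I. continuous (at x within space (leb I)) (g v)" if "v \<in> V" for v
    using g[OF that] by (auto simp: sobolev_def)
  let ?f = "\<lambda>x. \<Sum>v\<in>V. c v * g v x"
  have fi: "integrable (leb I) ?f" using gi by auto
  have dom: "sobolev_density I s ?f \<omega> \<le> real (card V) * (\<Sum>v\<in>V. (c v)\<^sup>2 * sobolev_density I s (g v) \<omega>)" for \<omega>
  proof -
    have F: "fourier I ?f \<omega> = (\<Sum>v\<in>V. complex_of_real (c v) * fourier I (g v) \<omega>)"
      by (rule fourier_lincomb[OF I gi(1)])
    have "(cmod (fourier I ?f \<omega>))\<^sup>2 \<le> (\<Sum>v\<in>V. \<bar>c v\<bar> * cmod (fourier I (g v) \<omega>))\<^sup>2"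
      unfolding F
      by (intro power_mono order_trans[OF norm_sum]) (auto simp: norm_mult)
    also have "... \<le> real (card V) * (\<Sum>v\<in>V. (\<bar>c v\<bar> * cmod (fourier I (g v) \<omega>))\<^sup>2)"
      using sum_squared_le_sum_of_squares[of "\<lambda>v. \<bar>c v\<bar> * cmod (fourier I (g v) \<omega>)" V] by (simp add: mult.commute)
    finally have "sobolev_density I s ?f \<omega> \<le> (1 + (L2_set \<omega> I)\<^sup>2) powr s * (real (card V) * (\<Sum>v\<in>V. (\<bar>c v\<bar> * cmod (fourier I (g v) \<omega>))\<^sup>2))"
      unfolding sobolev_density_def by (rule mult_left_mono) simp
    also have "... = real (card V) * (\<Sum>v\<in>V. (c v)\<^sup>2 * sobolev_density I s (g v) \<omega>)"
      by (simp add: sobolev_density_def power_mult_distrib sum_distrib_left mult_ac)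
    finally show ?thesis .
  qed
  have int: "integrable (leb I) (\<lambda>\<omega>. real (card V) * (\<Sum>v\<in>V. (c v)\<^sup>2 * sobolev_density I s (g v) \<omega>))" using gi by auto
  have Si: "integrable (leb I) (sobolev_density I s ?f)"
  proof (rule Bochner_Integration.integrable_bound[OF int])
    show "sobolev_density I s ?f \<in> borel_measurable (leb I)" using fi I by (intro measurable_sobolev_density) auto
    show "AE \<omega> in leb I. norm (sobolev_density I s ?f \<omega>) \<le> norm (real (card V) * (\<Sum>v\<in>V. (c v)\<^sup>2 * sobolev_density I s (g v) \<omega>))"
      using dom by (intro AE_I2) (simp add: sobolev_density_nonneg sum_nonneg)
  qed
  have "AE x in leb I. \<forall>v\<in>V. continuous (at x within space (leb I)) (g v)"
    by (rule AE_finite_allI[OF V gi(3)])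
  then have "AE x in leb I. continuous (at x within space (leb I)) ?f"
    by eventually_elim (intro continuous_intros, auto)
  then show ?thesis using fi Si by (simp add: sobolev_def)
qed

definition signs :: "'a set \<Rightarrow> ('a \<Rightarrow> real) set" where
  "signs V = (V \<rightarrow>\<^sub>E {-1, 1})"

lemma finite_signs [simp]: "finite V \<Longrightarrow> finite (signs V)"
  by (simp add: signs_def finite_PiE)

lemma card_signs: "finite V \<Longrightarrow> real (card (signs V)) = 2 ^ card V"
  by (simp add: signs_def card_PiE)

lemma signs_square: "\<epsilon> \<in> signs V \<Longrightarrow> v \<in> V \<Longrightarrow> \<epsilon> v * \<epsilon> v = 1"
  by (auto simp: signs_def PiE_iff)

lemma sum_signs_prod:
  fixes h :: "'a \<Rightarrow> real \<Rightarrow> real"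
  assumes "finite V"
  shows "(\<Sum>\<epsilon>\<in>signs V. \<Prod>v\<in>V. h v (\<epsilon> v)) = (\<Prod>v\<in>V. h v (-1) + h v 1)"
proof -
  have "(\<Prod>v\<in>V. \<Sum>e\<in>{-1, 1}. h v e) = (\<Sum>\<epsilon>\<in>signs V. \<Prod>v\<in>V. h v (\<epsilon> v))"
    unfolding signs_def by (rule prod_sum_PiE) (use assms in auto)
  then show ?thesis by simp
qed

text \<open>Two different signs are uncorrelated: in the product form of the sum, flipping the sign at \<open>v\<close> gives a factor zero.\<close>

lemma sum_signs_orthogonal:
  assumes V: "finite V" "v \<in> V" "w \<in> V"
  shows "(\<Sum>\<epsilon>\<in>signs V. \<epsilon> v * \<epsilon> w) = (if v = w then 2 ^ card V else 0)"
proof (cases "v = w")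
  case True
  then show ?thesis using V by (simp add: signs_square card_signs)
next
  case False
  define h where "h u e = (if u = v \<or> u = w then e else 1)" for u and e :: real
  have "(\<Prod>u\<in>V. h u (\<epsilon> u)) = \<epsilon> v * \<epsilon> w" for \<epsilon>
  proof -
    have "(\<Prod>u\<in>V. h u (\<epsilon> u)) = (\<Prod>u\<in>{v, w}. h u (\<epsilon> u))"
      using V by (intro prod.mono_neutral_right) (auto simp: h_def)
    then show ?thesis using False by (simp add: h_def)
  qed
  then have "(\<Sum>\<epsilon>\<in>signs V. \<epsilon> v * \<epsilon> w) = (\<Prod>u\<in>V. h u (-1) + h u 1)"
    using sum_signs_prod[OF V(1), of h] by simp
  also have "... = 0" using V by (intro prod_zero) (auto simp: h_def)
  finally show ?thesis using False by simp
qed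

text \<open>Averaging over the signs removes all cross terms, as for independent variables; real and imaginary parts are treated
separately.\<close>

lemma sum_signs_norm_square:
  fixes F :: "'a \<Rightarrow> complex"
  assumes V: "finite V"
  shows "(\<Sum>\<epsilon>\<in>signs V. (cmod (\<Sum>v\<in>V. complex_of_real (a * \<epsilon> v) * F v))\<^sup>2) = 2 ^ card V * a\<^sup>2 * (\<Sum>v\<in>V. (cmod (F v))\<^sup>2)"
proof -
  have sq: "(\<Sum>\<epsilon>\<in>signs V. (\<Sum>v\<in>V. a * \<epsilon> v * r v)\<^sup>2) = 2 ^ card V * a\<^sup>2 * (\<Sum>v\<in>V. (r v)\<^sup>2)" for r :: "'a \<Rightarrow> real"
  proof -
    have "(\<Sum>v\<in>V. a * \<epsilon> v * r v)\<^sup>2 = (\<Sum>v\<in>V. \<Sum>w\<in>V. a\<^sup>2 * r v * r w * (\<epsilon> v * \<epsilon> w))" for \<epsilon>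
      by (simp add: power2_eq_square sum_product mult_ac)
    then have "(\<Sum>\<epsilon>\<in>signs V. (\<Sum>v\<in>V. a * \<epsilon> v * r v)\<^sup>2) = (\<Sum>\<epsilon>\<in>signs V. \<Sum>v\<in>V. \<Sum>w\<in>V. a\<^sup>2 * r v * r w * (\<epsilon> v * \<epsilon> w))"
      by simp
    also have "... = (\<Sum>v\<in>V. \<Sum>w\<in>V. \<Sum>\<epsilon>\<in>signs V. a\<^sup>2 * r v * r w * (\<epsilon> v * \<epsilon> w))"
      by (subst sum.swap) (intro sum.cong sum.swap refl)
    also have "... = (\<Sum>v\<in>V. \<Sum>w\<in>V. a\<^sup>2 * r v * r w * (if v = w then 2 ^ card V else 0))"
      by (intro sum.cong refl) (simp only: sum_distrib_left[symmetric] sum_signs_orthogonal[OF V])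
    also have "... = (\<Sum>v\<in>V. a\<^sup>2 * r v * r v * 2 ^ card V)"
      by (intro sum.cong refl) (use V in \<open>simp add: if_distrib cong: if_cong\<close>)
    finally show ?thesis by (simp add: sum_distrib_left power2_eq_square mult_ac)
  qed
  have "(cmod (\<Sum>v\<in>V. complex_of_real (a * \<epsilon> v) * F v))\<^sup>2 = (\<Sum>v\<in>V. a * \<epsilon> v * Re (F v))\<^sup>2 + (\<Sum>v\<in>V. a * \<epsilon> v * Im (F v))\<^sup>2" for \<epsilon>
    by (simp add: cmod_power2)
  then have "(\<Sum>\<epsilon>\<in>signs V. (cmod (\<Sum>v\<in>V. complex_of_real (a * \<epsilon> v) * F v))\<^sup>2) =
    2 ^ card V * a\<^sup>2 * (\<Sum>v\<in>V. (Re (F v))\<^sup>2) + 2 ^ card V * a\<^sup>2 * (\<Sum>v\<in>V. (Im (F v))\<^sup>2)"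
    by (simp only: sum.distrib sq)
  also have "... = 2 ^ card V * a\<^sup>2 * (\<Sum>v\<in>V. (cmod (F v))\<^sup>2)"
    by (simp add: cmod_power2 sum.distrib distrib_left)
  finally show ?thesis .
qed

text \<open>The one-dimensional profile of the perturbations.\<close>

locale bump =
  fixes \<psi> :: "real \<Rightarrow> real" and A :: real
  assumes cont: "continuous_on UNIV \<psi>" and out: "\<And>x. x \<notin> {0<..<1} \<Longrightarrow> \<psi> x = 0"
    and bounded: "\<And>x. \<bar>\<psi> x\<bar> \<le> A" and int: "integrable lborel \<psi>" and zero: "(\<integral>x. \<psi> x \<partial>lborel) = 0"
    and int2: "integrable lborel (\<lambda>x. (\<psi> x)\<^sup>2)"
begin

text \<open>The profile moved to the \<open>m\<close>-th of the \<open>N\<close> subintervals of the unit interval. A cell of the grid is given by such a number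
for each coordinate, and \<open>wave\<close> puts a product bump with coefficient \<open>c v\<close> on each cell \<open>v\<close>.\<close>

definition small :: "nat \<Rightarrow> nat \<Rightarrow> real \<Rightarrow> real" where
  "small N m t = \<psi> (real N * t - real m)"

lemma small_outside: "m < N \<Longrightarrow> t \<notin> {0<..<1} \<Longrightarrow> small N m t = 0"
proof -
  assume m: "m < N" and t: "t \<notin> {0<..<1}"
  have "real N * t - real m \<notin> {0<..<1}"
  proof
    assume "real N * t - real m \<in> {0<..<1}"
    then have "real m < real N * t" "real N * t < real m + 1" by auto
    moreover have "real m + 1 \<le> real N" using m by linarith
    ultimately have "0 < real N * t" "real N * t < real N * 1" by linarith+
    then have "0 < t" "t < 1" using m by (auto simp: zero_less_mult_iff)
    then show False using t by auto
  qed
  then show ?thesis by (simp add: small_def out)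
qed

lemma small_disjoint: "m \<noteq> m' \<Longrightarrow> small N m t * small N m' t = 0"
proof (rule ccontr)
  assume "m \<noteq> m'" and "small N m t * small N m' t \<noteq> 0"
  then have "real N * t - real m \<in> {0<..<1}" "real N * t - real m' \<in> {0<..<1}"
    unfolding small_def using out by (metis mult_eq_0_iff)+
  then have "\<bar>real m - real m'\<bar> < 1" by auto
  with \<open>m \<noteq> m'\<close> show False by linarith
qed

lemma affine_integral:
  fixes f :: "real \<Rightarrow> 'b::{banach, second_countable_topology}"
  assumes "0 < N"
  shows "(\<integral>t. f (real N * t - c) \<partial>lborel) = (1 / real N) *\<^sub>R (\<integral>t. f t \<partial>lborel)"
    and "integrable lborel f \<Longrightarrow> integrable lborel (\<lambda>t. f (real N * t - c))"
proof -
  show "(\<integral>t. f (real N * t - c) \<partial>lborel) = (1 / real N) *\<^sub>R (\<integral>t. f t \<partial>lborel)"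
    using lborel_integral_real_affine[of "real N" f "- c"] assms by simp
  show "integrable lborel f \<Longrightarrow> integrable lborel (\<lambda>t. f (real N * t - c))"
    using lborel_integrable_real_affine[of f "real N" "- c"] assms by simp
qed

lemma small_props:
  assumes N: "0 < N"
  shows "continuous_on UNIV (small N m)" "integrable lborel (small N m)" "(\<integral>t. small N m t \<partial>lborel) = 0"
    "integrable lborel (\<lambda>t. (small N m t)\<^sup>2)" "(\<integral>t. (small N m t)\<^sup>2 \<partial>lborel) = (\<integral>t. (\<psi> t)\<^sup>2 \<partial>lborel) / real N"
proof -
  show "continuous_on UNIV (small N m)" unfolding small_def[abs_def]
    by (rule continuous_on_compose2[OF cont]) (auto intro!: continuous_intros)
  show "integrable lborel (small N m)" "(\<integral>t. small N m t \<partial>lborel) = 0"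
    unfolding small_def[abs_def] using affine_integral[of N \<psi> "real m", OF N] int zero by auto
  show "integrable lborel (\<lambda>t. (small N m t)\<^sup>2)" "(\<integral>t. (small N m t)\<^sup>2 \<partial>lborel) = (\<integral>t. (\<psi> t)\<^sup>2 \<partial>lborel) / real N"
    unfolding small_def[abs_def] using affine_integral[of N "\<lambda>t. (\<psi> t)\<^sup>2" "real m", OF N] int2 by auto
qed

lemma fourier_1d_small:
  assumes N: "0 < N"
  shows "cmod (fourier_1d (small N m) t) = cmod (fourier_1d \<psi> (t / real N)) / real N"
proof -
  have "fourier_1d (small N m) t = (\<integral>x. cis (- (real m * t / real N)) *
      (\<lambda>y. complex_of_real (\<psi> y) * cis (- (y * (t / real N)))) (real N * x - real m) \<partial>lborel)"
    unfolding fourier_1d_def small_def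
  proof (intro Bochner_Integration.integral_cong refl)
    fix x
    have "cis (- (x * t)) = cis (- (real m * t / real N)) * cis (- ((real N * x - real m) * (t / real N)))"
      using N by (simp add: cis_mult field_simps)
    then show "complex_of_real (\<psi> (real N * x - real m)) * cis (- (x * t)) = cis (- (real m * t / real N)) *
      (complex_of_real (\<psi> (real N * x - real m)) * cis (- ((real N * x - real m) * (t / real N))))" by simp
  qed
  also have "... = cis (- (real m * t / real N)) * ((1 / real N) *\<^sub>R fourier_1d \<psi> (t / real N))"
    unfolding Bochner_Integration.integral_mult_right_zero
    unfolding affine_integral[of N "\<lambda>y. complex_of_real (\<psi> y) * cis (- (y * (t / real N)))" "real m", OF N] fourier_1d_def ..
  finally show ?thesis by (simp add: norm_mult)
qed

definition cells :: "nat \<Rightarrow> 'i set \<Rightarrow> ('i \<Rightarrow> nat) set" where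
  "cells N I = (I \<rightarrow>\<^sub>E {..<N})"

definition bump_at :: "nat \<Rightarrow> 'i set \<Rightarrow> ('i \<Rightarrow> nat) \<Rightarrow> ('i \<Rightarrow> real) \<Rightarrow> real" where
  "bump_at N I v x = (\<Prod>i\<in>I. small N (v i) (x i))"

definition wave :: "nat \<Rightarrow> 'i set \<Rightarrow> (('i \<Rightarrow> nat) \<Rightarrow> real) \<Rightarrow> ('i \<Rightarrow> real) \<Rightarrow> real" where
  "wave N I c x = (\<Sum>v\<in>cells N I. c v * bump_at N I v x)"

lemma finite_cells [simp]: "finite I \<Longrightarrow> finite (cells N I)"
  by (simp add: cells_def finite_PiE)

lemma card_cells: "finite I \<Longrightarrow> card (cells N I) = N ^ card I"
  by (simp add: cells_def card_PiE)

lemma bump_at_outside: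
  assumes "finite I" "v \<in> cells N I" "i \<in> I" "x i \<notin> {0<..<1}"
  shows "bump_at N I v x = 0"
proof -
  have "small N (v i) (x i) = 0" using assms by (intro small_outside) (auto simp: cells_def)
  then show ?thesis using assms by (auto simp: bump_at_def intro!: prod_zero)
qed

lemma bump_at_disjoint:
  assumes "finite I" "v \<in> cells N I" "w \<in> cells N I" "v \<noteq> w"
  shows "bump_at N I v x * bump_at N I w x = 0"
proof -
  from assms obtain i where i: "i \<in> I" "v i \<noteq> w i" unfolding cells_def by (metis PiE_ext)
  then have "\<exists>i\<in>I. small N (v i) (x i) * small N (w i) (x i) = 0" using small_disjoint by blast
  then show ?thesis unfolding bump_at_def prod.distrib[symmetric] using assms(1) by (rule prod_zero[rotated])
qed

lemma wave_mult:
  assumes I: "finite I"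
  shows "wave N I c x * wave N I c' x = (\<Sum>v\<in>cells N I. c v * c' v * (bump_at N I v x)\<^sup>2)"
proof -
  have "wave N I c x * wave N I c' x = (\<Sum>v\<in>cells N I. \<Sum>w\<in>cells N I. c v * c' w * (bump_at N I v x * bump_at N I w x))"
    by (simp add: wave_def sum_product mult_ac)
  also have "... = (\<Sum>v\<in>cells N I. \<Sum>w\<in>cells N I. if v = w then c v * c' v * (bump_at N I v x)\<^sup>2 else 0)"
    by (intro sum.cong refl) (simp add: bump_at_disjoint[OF I] power2_eq_square)
  also have "... = (\<Sum>v\<in>cells N I. c v * c' v * (bump_at N I v x)\<^sup>2)" using I by simp
  finally show ?thesis .
qed

lemma bump_at_bound: "\<bar>bump_at N I v x\<bar> \<le> A ^ card I"
proof -
  have "\<bar>bump_at N I v x\<bar> = (\<Prod>i\<in>I. \<bar>small N (v i) (x i)\<bar>)" by (simp add: bump_at_def abs_prod)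
  also have "... \<le> (\<Prod>i\<in>I. A)" by (intro prod_mono) (auto simp: small_def bounded)
  finally show ?thesis by simp
qed

lemma wave_bound:
  assumes I: "finite I" and c: "\<And>v. v \<in> cells N I \<Longrightarrow> \<bar>c v\<bar> \<le> a" and a: "0 \<le> a"
  shows "\<bar>wave N I c x\<bar> \<le> a * A ^ card I"
proof (cases "\<exists>v\<in>cells N I. bump_at N I v x \<noteq> 0")
  case True
  then obtain v where v: "v \<in> cells N I" "bump_at N I v x \<noteq> 0" by blast
  have "wave N I c x = (\<Sum>w\<in>{v}. c w * bump_at N I w x)"
    unfolding wave_def
  proof (rule sum.mono_neutral_right)
    show "\<forall>w\<in>cells N I - {v}. c w * bump_at N I w x = 0"
      using bump_at_disjoint[OF I v(1), of _ x] v by auto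
  qed (use I v in auto)
  then have "\<bar>wave N I c x\<bar> = \<bar>c v\<bar> * \<bar>bump_at N I v x\<bar>" by (simp add: abs_mult)
  also have "... \<le> a * A ^ card I" using c[OF v(1)] a by (intro mult_mono bump_at_bound) auto
  finally show ?thesis .
next
  case False
  then have "wave N I c x = 0" by (auto simp: wave_def)
  moreover have "0 \<le> A" using bounded[of 0] by linarith
  ultimately show ?thesis using a by simp
qed

lemma wave_outside:
  assumes "finite I" "i \<in> I" "x i \<notin> {0<..<1}"
  shows "wave N I c x = 0"
  unfolding wave_def using assms by (intro sum.neutral) (simp add: bump_at_outside)

lemma
  assumes I: "finite I" and N: "0 < N"
  shows integrable_bump_at: "integrable (leb I) (bump_at N I v)"
    and integral_bump_at: "I \<noteq> {} \<Longrightarrow> (\<integral>x. bump_at N I v x \<partial>leb I) = 0"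
    and integrable_bump_at_square: "integrable (leb I) (\<lambda>x. (bump_at N I v x)\<^sup>2)"
    and integral_bump_at_square: "(\<integral>x. (bump_at N I v x)\<^sup>2 \<partial>leb I) = ((\<integral>t. (\<psi> t)\<^sup>2 \<partial>lborel) / real N) ^ card I"
proof -
  note S = small_props[OF N]
  show "integrable (leb I) (bump_at N I v)"
    unfolding bump_at_def[abs_def] by (rule integrable_leb_prod[OF I S(2)])
  show "(\<integral>x. bump_at N I v x \<partial>leb I) = 0" if "I \<noteq> {}"
    unfolding bump_at_def using integral_leb_prod[OF I S(2), of v] that I by (simp add: S(3) card_gt_0_iff)
  have sq: "(bump_at N I v x)\<^sup>2 = (\<Prod>i\<in>I. (small N (v i) (x i))\<^sup>2)" for x
    by (simp add: bump_at_def prod_power_distrib)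
  show "integrable (leb I) (\<lambda>x. (bump_at N I v x)\<^sup>2)"
    unfolding sq by (rule integrable_leb_prod[OF I S(4)])
  show "(\<integral>x. (bump_at N I v x)\<^sup>2 \<partial>leb I) = ((\<integral>t. (\<psi> t)\<^sup>2 \<partial>lborel) / real N) ^ card I"
    unfolding sq using integral_leb_prod[OF I S(4), of v] by (simp add: S(5))
qed

text \<open>A bump at scale \<open>1/N\<close> costs a factor \<open>N\<^bsup>2s\<^esup>\<close> in the squared Sobolev norm. The frequency has to be rescaled before
the Sobolev weight is split into one-dimensional weights: splitting first would cost \<open>N\<^bsup>2s\<^esup>\<close> for each coordinate.\<close>

lemma bump_at_sobolev:
  fixes I :: "'i::countable set"
  assumes I: "finite I" and N: "0 < N" and s: "0 \<le> s" and w: "integrable lborel (weight_1d s \<psi>)"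
  shows "bump_at N I v \<in> sobolev I s"
    and "(sobolev_norm I s (bump_at N I v))\<^sup>2 \<le> real N powr (2 * s) * ((\<integral>t. weight_1d s \<psi> t \<partial>lborel) / real N) ^ card I"
proof -
  have N1: "1 \<le> real N" using N by simp
  define W where "W t = weight_1d s \<psi> (real N * 0 + t / real N) / (real N)\<^sup>2" for t
  have Wi: "integrable lborel W" "(\<integral>t. W t \<partial>lborel) = (\<integral>t. weight_1d s \<psi> t \<partial>lborel) / real N"
  proof -
    have i: "integrable lborel (\<lambda>t. weight_1d s \<psi> (0 + (1 / real N) * t))"
      using lborel_integrable_real_affine[of "weight_1d s \<psi>" "1 / real N" 0] w N by simp
    then show "integrable lborel W" by (simp add: W_def[abs_def])
    have "(\<integral>t. weight_1d s \<psi> t \<partial>lborel) = (1 / real N) * (\<integral>t. weight_1d s \<psi> (0 + (1 / real N) * t) \<partial>lborel)"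
      using lborel_integral_real_affine[of "1 / real N" "weight_1d s \<psi>" 0] N by simp
    then show "(\<integral>t. W t \<partial>lborel) = (\<integral>t. weight_1d s \<psi> t \<partial>lborel) / real N"
      using N by (simp add: W_def[abs_def] power2_eq_square field_simps)
  qed
  have W0: "0 \<le> W t" for t by (simp add: W_def weight_1d_nonneg)
  have dom: "sobolev_density I s (bump_at N I v) \<omega> \<le> real N powr (2 * s) * (\<Prod>i\<in>I. W (\<omega> i))" for \<omega>
  proof -
    let ?u = "\<lambda>i. \<omega> i / real N"
    have "(L2_set \<omega> I)\<^sup>2 = (real N)\<^sup>2 * (L2_set ?u I)\<^sup>2"
      using N by (simp add: L2_set_def sum_nonneg power_divide sum_divide_distrib[symmetric])
    then have "1 + (L2_set \<omega> I)\<^sup>2 \<le> (real N)\<^sup>2 * (1 + (L2_set ?u I)\<^sup>2)"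
      using N1 by (simp add: distrib_left)
    then have "(1 + (L2_set \<omega> I)\<^sup>2) powr s \<le> ((real N)\<^sup>2 * (1 + (L2_set ?u I)\<^sup>2)) powr s"
      using s by (intro powr_mono2) auto
    also have "... = real N powr (2 * s) * (1 + (L2_set ?u I)\<^sup>2) powr s"
      using N by (simp add: powr_mult powr_powr[symmetric])
    also have "... \<le> real N powr (2 * s) * (\<Prod>i\<in>I. (1 + (?u i)\<^sup>2) powr s)"
      by (intro mult_left_mono sobolev_weight_le_prod I s) auto
    finally have 1: "(1 + (L2_set \<omega> I)\<^sup>2) powr s \<le> real N powr (2 * s) * (\<Prod>i\<in>I. (1 + (?u i)\<^sup>2) powr s)" .
    have 2: "(cmod (fourier I (bump_at N I v) \<omega>))\<^sup>2 \<le> (\<Prod>i\<in>I. (cmod (fourier_1d \<psi> (?u i)) / real N)\<^sup>2)"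
      using fourier_prod_norm_le[OF I small_props(2)[OF N], of v \<omega>]
      unfolding bump_at_def[abs_def] fourier_1d_small[OF N] .
    have "sobolev_density I s (bump_at N I v) \<omega> \<le>
      (real N powr (2 * s) * (\<Prod>i\<in>I. (1 + (?u i)\<^sup>2) powr s)) * (\<Prod>i\<in>I. (cmod (fourier_1d \<psi> (?u i)) / real N)\<^sup>2)"
      unfolding sobolev_density_def by (intro mult_mono 1 2) (auto intro!: mult_nonneg_nonneg prod_nonneg)
    also have "... = real N powr (2 * s) * (\<Prod>i\<in>I. W (\<omega> i))"
      by (simp add: W_def weight_1d_def prod.distrib[symmetric] mult.assoc power_divide)
    finally show ?thesis .
  qed
  have int: "integrable (leb I) (\<lambda>\<omega>. real N powr (2 * s) * (\<Prod>i\<in>I. W (\<omega> i)))"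
    using integrable_leb_prod[OF I Wi(1)] by simp
  note bi = integrable_bump_at[OF I N, of v]
  have Si: "integrable (leb I) (sobolev_density I s (bump_at N I v))"
  proof (rule Bochner_Integration.integrable_bound[OF int])
    show "sobolev_density I s (bump_at N I v) \<in> borel_measurable (leb I)"
      using bi I by (intro measurable_sobolev_density) auto
    show "AE \<omega> in leb I. norm (sobolev_density I s (bump_at N I v) \<omega>) \<le> norm (real N powr (2 * s) * (\<Prod>i\<in>I. W (\<omega> i)))"
      using dom by (intro AE_I2) (simp add: sobolev_density_nonneg prod_nonneg W0)
  qed
  have "continuous (at x within space (leb I)) (bump_at N I v)" for x
    unfolding bump_at_def[abs_def] by (rule continuous_product[OF small_props(1)[OF N]])
  then show "bump_at N I v \<in> sobolev I s" using bi Si by (simp add: sobolev_def)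
  have "(sobolev_norm I s (bump_at N I v))\<^sup>2 \<le> (\<integral>\<omega>. real N powr (2 * s) * (\<Prod>i\<in>I. W (\<omega> i)) \<partial>leb I)"
    unfolding sobolev_norm_square by (rule integral_mono[OF Si int dom])
  also have "... = real N powr (2 * s) * ((\<integral>t. weight_1d s \<psi> t \<partial>lborel) / real N) ^ card I"
    using integral_leb_prod[OF I Wi(1)] by (simp add: Wi(2))
  finally show "(sobolev_norm I s (bump_at N I v))\<^sup>2 \<le> real N powr (2 * s) * ((\<integral>t. weight_1d s \<psi> t \<partial>lborel) / real N) ^ card I" .
qed

text \<open>On average over the signs the squared norms of the \<open>N\<^sup>d\<close> bumps just add up.\<close>

lemma wave_sobolev:
  fixes I :: "'i::countable set"
  assumes I: "finite I" and N: "0 < N" and s: "0 \<le> s" and w: "integrable lborel (weight_1d s \<psi>)"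
  shows "wave N I c \<in> sobolev I s"
    and "(\<Sum>\<epsilon>\<in>signs (cells N I). (sobolev_norm I s (wave N I (\<lambda>v. a * \<epsilon> v)))\<^sup>2) \<le>
      2 ^ card (cells N I) * (a\<^sup>2 * real N powr (2 * s) * (\<integral>t. weight_1d s \<psi> t \<partial>lborel) ^ card I)"
proof -
  let ?V = "cells N I" and ?S = "\<integral>t. weight_1d s \<psi> t \<partial>lborel"
  have V: "finite ?V" using I by simp
  show ws: "wave N I c \<in> sobolev I s" for c
    unfolding wave_def[abs_def] by (rule sobolev_lincomb[OF I V bump_at_sobolev(1)[OF I N s w]])
  have wi: "integrable (leb I) (sobolev_density I s (wave N I c))" for c using ws by (auto simp: sobolev_def)
  have bi: "integrable (leb I) (sobolev_density I s (bump_at N I v))" for v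
    using bump_at_sobolev(1)[OF I N s w] by (auto simp: sobolev_def)
  have F: "fourier I (wave N I c) \<omega> = (\<Sum>v\<in>?V. complex_of_real (c v) * fourier I (bump_at N I v) \<omega>)" for c \<omega>
    unfolding wave_def[abs_def] by (rule fourier_lincomb[OF I integrable_bump_at[OF I N]])
  have "(\<Sum>\<epsilon>\<in>signs ?V. sobolev_density I s (wave N I (\<lambda>v. a * \<epsilon> v)) \<omega>) =
    2 ^ card ?V * a\<^sup>2 * (\<Sum>v\<in>?V. sobolev_density I s (bump_at N I v) \<omega>)" for \<omega>
    unfolding sobolev_density_def F sum_distrib_left[symmetric] sum_signs_norm_square[OF V] by (simp add: mult_ac)
  then have "(\<Sum>\<epsilon>\<in>signs ?V. (sobolev_norm I s (wave N I (\<lambda>v. a * \<epsilon> v)))\<^sup>2) =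
    2 ^ card ?V * a\<^sup>2 * (\<Sum>v\<in>?V. (sobolev_norm I s (bump_at N I v))\<^sup>2)"
    unfolding sobolev_norm_square using Bochner_Integration.integral_sum[of "signs ?V" "leb I" "\<lambda>\<epsilon>. sobolev_density I s (wave N I (\<lambda>v. a * \<epsilon> v))", OF wi]
    by (simp add: bi)
  also have "... \<le> 2 ^ card ?V * a\<^sup>2 * (\<Sum>v\<in>?V. real N powr (2 * s) * (?S / real N) ^ card I)"
    by (intro mult_left_mono sum_mono bump_at_sobolev(2)[OF I N s w]) auto
  also have "... = 2 ^ card ?V * (a\<^sup>2 * real N powr (2 * s) * ?S ^ card I)"
    using I N by (simp add: card_cells power_divide)
  finally show "(\<Sum>\<epsilon>\<in>signs ?V. (sobolev_norm I s (wave N I (\<lambda>v. a * \<epsilon> v)))\<^sup>2) \<le>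
      2 ^ card ?V * (a\<^sup>2 * real N powr (2 * s) * ?S ^ card I)" .
qed

end

section \<open>Testing against a mixture of alternatives\<close>

lemma cosh_le_exp_square:
  fixes x :: real
  shows "exp x + exp (- x) \<le> 2 * exp (x\<^sup>2 / 2)"
proof -
  have nonneg: "exp y + exp (- y) \<le> 2 * exp (y\<^sup>2 / 2)" if "0 \<le> y" for y :: real
  proof -
    have sinh_le: "sinh z \<le> z * cosh z" if "0 \<le> z" for z :: real
    proof -
      have "(\<lambda>z::real. z * cosh z - sinh z) 0 \<le> (\<lambda>z. z * cosh z - sinh z) z"
      proof (rule DERIV_nonneg_imp_nondecreasing[OF that])
        fix t :: real assume "0 \<le> t" "t \<le> z"
        have "((\<lambda>z. z * cosh z - sinh z) has_real_derivative t * sinh t) (at t)"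
          by (auto intro!: derivative_eq_intros)
        moreover have "0 \<le> t * sinh t" using \<open>0 \<le> t\<close> by simp
        ultimately show "\<exists>D. ((\<lambda>z. z * cosh z - sinh z) has_real_derivative D) (at t) \<and> 0 \<le> D" by blast
      qed
      then show ?thesis by simp
    qed
    have "(\<lambda>z::real. cosh z * exp (- (z\<^sup>2 / 2))) y \<le> (\<lambda>z. cosh z * exp (- (z\<^sup>2 / 2))) 0"
    proof (rule DERIV_nonpos_imp_nonincreasing[OF that])
      fix t :: real assume "0 \<le> t" "t \<le> y"
      have "((\<lambda>z. cosh z * exp (- (z\<^sup>2 / 2))) has_real_derivative (sinh t - t * cosh t) * exp (- (t\<^sup>2 / 2))) (at t)"
        by (auto intro!: derivative_eq_intros simp: algebra_simps)
      moreover have "(sinh t - t * cosh t) * exp (- (t\<^sup>2 / 2)) \<le> 0"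
        using sinh_le[OF \<open>0 \<le> t\<close>] by (simp add: mult_nonpos_nonneg)
      ultimately show "\<exists>D. ((\<lambda>z. cosh z * exp (- (z\<^sup>2 / 2))) has_real_derivative D) (at t) \<and> D \<le> 0" by blast
    qed
    then have "cosh y * exp (- (y\<^sup>2 / 2)) \<le> 1" by simp
    then have "cosh y \<le> exp (y\<^sup>2 / 2)" by (simp add: exp_minus field_simps)
    then show ?thesis by (simp add: cosh_field_def)
  qed
  show ?thesis
  proof (cases "0 \<le> x")
    case False
    then show ?thesis using nonneg[of "- x"] by (simp add: add.commute)
  qed (rule nonneg)
qed

text \<open>For fixed \<open>\<epsilon>\<close> the sum over \<open>\<epsilon>'\<close> factorises over the cells into hyperbolic cosines, each bounded by a Gaussian
exponential. The quadratic dependence on \<open>\<kappa>\<close> is where the mixture is harder to detect than a single alternative.\<close>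

lemma sum_signs_exp_le:
  fixes \<kappa> :: "'a \<Rightarrow> real"
  assumes V: "finite V"
  shows "(\<Sum>\<epsilon>\<in>signs V. \<Sum>\<epsilon>'\<in>signs V. exp (\<Sum>v\<in>V. \<epsilon> v * \<epsilon>' v * \<kappa> v)) \<le> (2 ^ card V)\<^sup>2 * exp ((\<Sum>v\<in>V. (\<kappa> v)\<^sup>2) / 2)"
proof -
  have inner: "(\<Sum>\<epsilon>'\<in>signs V. exp (\<Sum>v\<in>V. \<epsilon> v * \<epsilon>' v * \<kappa> v)) \<le> 2 ^ card V * exp ((\<Sum>v\<in>V. (\<kappa> v)\<^sup>2) / 2)"
    if e: "\<epsilon> \<in> signs V" for \<epsilon>
  proof -
    have "(\<Sum>\<epsilon>'\<in>signs V. exp (\<Sum>v\<in>V. \<epsilon> v * \<epsilon>' v * \<kappa> v)) = (\<Sum>\<epsilon>'\<in>signs V. \<Prod>v\<in>V. exp (\<epsilon> v * \<epsilon>' v * \<kappa> v))"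
      using V by (simp add: exp_sum)
    also have "... = (\<Prod>v\<in>V. exp (\<epsilon> v * (-1) * \<kappa> v) + exp (\<epsilon> v * 1 * \<kappa> v))"
      by (rule sum_signs_prod[OF V, of "\<lambda>v e. exp (\<epsilon> v * e * \<kappa> v)"])
    also have "... \<le> (\<Prod>v\<in>V. 2 * exp ((\<kappa> v)\<^sup>2 / 2))"
    proof (intro prod_mono conjI add_nonneg_nonneg exp_ge_zero)
      fix v assume v: "v \<in> V"
      have "(\<epsilon> v * \<kappa> v)\<^sup>2 = (\<epsilon> v * \<epsilon> v) * (\<kappa> v)\<^sup>2" by (simp add: power2_eq_square)
      then have "(\<epsilon> v * \<kappa> v)\<^sup>2 = (\<kappa> v)\<^sup>2" by (simp add: signs_square[OF e v])
      with cosh_le_exp_square[of "\<epsilon> v * \<kappa> v"]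
      show "exp (\<epsilon> v * (-1) * \<kappa> v) + exp (\<epsilon> v * 1 * \<kappa> v) \<le> 2 * exp ((\<kappa> v)\<^sup>2 / 2)" by (simp add: add.commute)
    qed
    also have "... = 2 ^ card V * exp ((\<Sum>v\<in>V. (\<kappa> v)\<^sup>2) / 2)"
      using V by (simp add: prod.distrib exp_sum[symmetric] sum_divide_distrib)
    finally show ?thesis .
  qed
  have "(\<Sum>\<epsilon>\<in>signs V. \<Sum>\<epsilon>'\<in>signs V. exp (\<Sum>v\<in>V. \<epsilon> v * \<epsilon>' v * \<kappa> v)) \<le> (\<Sum>\<epsilon>\<in>signs V. 2 ^ card V * exp ((\<Sum>v\<in>V. (\<kappa> v)\<^sup>2) / 2))"
    by (rule sum_mono[OF inner])
  also have "... = (2 ^ card V)\<^sup>2 * exp ((\<Sum>v\<in>V. (\<kappa> v)\<^sup>2) / 2)"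
    by (simp add: card_signs[OF V] power2_eq_square)
  finally show ?thesis .
qed

lemma PiM_density:
  fixes h :: "'a \<Rightarrow> ennreal"
  assumes J: "finite J" and P: "prob_space P" and Q: "prob_space (density P h)" and h [measurable]: "h \<in> borel_measurable P"
  shows "PiM J (\<lambda>_. density P h) = density (PiM J (\<lambda>_. P)) (\<lambda>X. \<Prod>j\<in>J. h (X j))"
proof -
  interpret P: product_sigma_finite "\<lambda>_. P"
    using prob_space_imp_sigma_finite[OF P] by (simp add: product_sigma_finite_def)
  interpret Q: product_sigma_finite "\<lambda>_. density P h"
    using prob_space_imp_sigma_finite[OF Q] by (simp add: product_sigma_finite_def)
  have hm: "(\<lambda>X. h (X j)) \<in> borel_measurable (PiM J (\<lambda>_. P))" if "j \<in> J" for j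
    by (rule measurable_compose[OF measurable_component_singleton[of j J "\<lambda>_. P"] h]) (rule that)
  have pm: "(\<lambda>X. \<Prod>j\<in>J. h (X j)) \<in> borel_measurable (PiM J (\<lambda>_. P))"
    by (intro borel_measurable_prod_ennreal hm)
  show ?thesis
  proof (rule Q.PiM_eqI[OF J, symmetric])
    show "sets (density (PiM J (\<lambda>_. P)) (\<lambda>X. \<Prod>j\<in>J. h (X j))) = sets (PiM J (\<lambda>_. density P h))"
      by (simp cong: sets_PiM_cong)
    fix B assume "\<And>i. i \<in> J \<Longrightarrow> B i \<in> sets (density P h)"
    then have B: "B i \<in> sets P" if "i \<in> J" for i using that by simp
    then have PB: "PiE J B \<in> sets (PiM J (\<lambda>_. P))" using J by (intro sets_PiM_I_finite)
    have "emeasure (density (PiM J (\<lambda>_. P)) (\<lambda>X. \<Prod>j\<in>J. h (X j))) (PiE J B) =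
      (\<integral>\<^sup>+X. (\<Prod>j\<in>J. h (X j)) * indicator (PiE J B) X \<partial>PiM J (\<lambda>_. P))"
      by (rule emeasure_density[OF pm PB])
    also have "... = (\<integral>\<^sup>+X. (\<Prod>j\<in>J. h (X j) * indicator (B j) (X j)) \<partial>PiM J (\<lambda>_. P))"
    proof (rule nn_integral_cong)
      fix X assume X: "X \<in> space (PiM J (\<lambda>_. P))"
      have "(indicator (PiE J B) X :: ennreal) = (\<Prod>j\<in>J. indicator (B j) (X j))"
      proof (cases "\<forall>j\<in>J. X j \<in> B j")
        case True
        then have "X \<in> PiE J B" using X by (auto simp: space_PiM PiE_iff)
        then show ?thesis using True by (simp add: prod.neutral)
      next
        case False
        then obtain j where j: "j \<in> J" "X j \<notin> B j" by blast
        then have "X \<notin> PiE J B" by (auto simp: PiE_iff)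
        moreover have "(\<Prod>j\<in>J. indicator (B j) (X j) :: ennreal) = 0"
          using j J by (intro prod_zero) (auto intro!: bexI[of _ j])
        ultimately show ?thesis by simp
      qed
      then show "(\<Prod>j\<in>J. h (X j)) * indicator (PiE J B) X = (\<Prod>j\<in>J. h (X j) * indicator (B j) (X j))"
        by (simp add: prod.distrib)
    qed
    also have "... = (\<Prod>j\<in>J. \<integral>\<^sup>+x. h x * indicator (B j) x \<partial>P)"
      by (rule P.product_nn_integral_prod[OF J]) (use B in measurable)
    also have "... = (\<Prod>j\<in>J. emeasure (density P h) (B j))"
      by (intro prod.cong refl) (simp add: emeasure_density B)
    finally show "emeasure (density (PiM J (\<lambda>_. P)) (\<lambda>X. \<Prod>j\<in>J. h (X j))) (PiE J B) = (\<Prod>j\<in>J. emeasure (density P h) (B j))" .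
  qed
qed

text \<open>Le Cam's second moment method. If \<open>H\<close> is the average likelihood ratio, the arithmetic-geometric inequality gives
\<open>H \<le> \<theta>/2 + H\<^sup>2/(2\<theta>)\<close>; using it on the rejection region bounds the average power by the level times \<open>\<theta>/2\<close> plus the second
moment of \<open>H\<close> divided by \<open>2\<theta>\<close>, and likelihood ratios of samples are products.\<close>

lemma second_moment_testing_bound:
  fixes P :: "'a measure" and h :: "'e \<Rightarrow> 'a \<Rightarrow> real"
  assumes P: "prob_space P" and G: "finite G" "G \<noteq> {}"
    and h: "\<And>e. e \<in> G \<Longrightarrow> h e \<in> borel_measurable P" and h0: "\<And>e x. e \<in> G \<Longrightarrow> x \<in> space P \<Longrightarrow> 0 \<le> h e x"
    and Q: "\<And>e. e \<in> G \<Longrightarrow> prob_space (density P (\<lambda>x. ennreal (h e x)))"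
    and hh: "\<And>e e'. e \<in> G \<Longrightarrow> e' \<in> G \<Longrightarrow> integrable P (\<lambda>x. h e x * h e' x)"
    and S: "S \<in> sets (PiM {..<n} (\<lambda>_. P))" and \<theta>: "0 < \<theta>"
  shows "(\<Sum>e\<in>G. measure (PiM {..<n} (\<lambda>_. density P (\<lambda>x. ennreal (h e x)))) S) \<le>
    real (card G) * (\<theta> / 2 * measure (PiM {..<n} (\<lambda>_. P)) S) +
    1 / (2 * \<theta> * real (card G)) * (\<Sum>e\<in>G. \<Sum>e'\<in>G. (\<integral>x. h e x * h e' x \<partial>P) ^ n)"
proof -
  let ?PP = "PiM {..<n} (\<lambda>_. P)"
  interpret P: prob_space P by fact
  interpret PP: prob_space ?PP by (rule P.prob_space_PiM_const)
  interpret PS: product_sigma_finite "\<lambda>_::nat. P"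
    using P.sigma_finite_measure_axioms by (simp add: product_sigma_finite_def)
  define L where "L e X = (\<Prod>i<n. h e (X i))" for e X
  define c where "c = real (card G)"
  have c: "0 < c" using G by (simp add: c_def card_gt_0_iff)
  have hi: "integrable P (h e)" if "e \<in> G" for e
  proof -
    have "(\<integral>\<^sup>+x. ennreal (h e x) \<partial>P) = 1"
      using prob_space.emeasure_space_1[OF Q[OF that]] h[OF that] by (simp add: emeasure_density cong: nn_integral_cong)
    then show ?thesis using h[OF that] h0[OF that] by (intro integrableI_nonneg) (auto intro!: AE_I2)
  qed
  have Li: "integrable ?PP (L e)" if "e \<in> G" for e
    unfolding L_def by (rule PS.product_integrable_prod) (use hi[OF that] in auto)
  have LLi: "integrable ?PP (\<lambda>X. L e X * L e' X)" "(\<integral>X. L e X * L e' X \<partial>?PP) = (\<integral>x. h e x * h e' x \<partial>P) ^ n"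
    if "e \<in> G" "e' \<in> G" for e e'
  proof -
    have eq: "L e X * L e' X = (\<Prod>i<n. h e (X i) * h e' (X i))" for X by (simp add: L_def prod.distrib)
    show "integrable ?PP (\<lambda>X. L e X * L e' X)"
      unfolding eq by (rule PS.product_integrable_prod) (use hh[OF that] in auto)
    show "(\<integral>X. L e X * L e' X \<partial>?PP) = (\<integral>x. h e x * h e' x \<partial>P) ^ n"
      unfolding eq by (subst PS.product_integral_prod) (use hh[OF that] in auto)
  qed
  have comp: "X i \<in> space P" if "X \<in> space ?PP" "i < n" for X i
    using that by (auto simp: space_PiM PiE_iff)
  have L0: "0 \<le> L e X" if "e \<in> G" "X \<in> space ?PP" for e X
    unfolding L_def using h0[OF that(1)] comp[OF that(2)] by (intro prod_nonneg) auto
  have meas: "measure (PiM {..<n} (\<lambda>_. density P (\<lambda>x. ennreal (h e x)))) S = (\<integral>X. L e X * indicator S X \<partial>?PP)" if e: "e \<in> G" for e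
  proof -
    have "PiM {..<n} (\<lambda>_. density P (\<lambda>x. ennreal (h e x))) = density ?PP (\<lambda>X. \<Prod>i<n. ennreal (h e (X i)))"
      by (rule PiM_density[OF _ P Q[OF e]]) (use h[OF e] in auto)
    also have "... = density ?PP (\<lambda>X. ennreal (L e X))"
    proof (rule density_cong)
      show "AE X in ?PP. (\<Prod>i<n. ennreal (h e (X i))) = ennreal (L e X)"
        unfolding L_def using h0[OF e] comp by (intro AE_I2 prod_ennreal) auto
      have hm: "(\<lambda>X. h e (X i)) \<in> borel_measurable ?PP" if "i \<in> {..<n}" for i
        by (rule measurable_compose[OF measurable_component_singleton[of i "{..<n}" "\<lambda>_. P"] h[OF e]]) (rule that)
      then show "(\<lambda>X. \<Prod>i<n. ennreal (h e (X i))) \<in> borel_measurable ?PP"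
        by (intro borel_measurable_prod_ennreal measurable_compose[OF _ measurable_ennreal]) auto
      show "(\<lambda>X. ennreal (L e X)) \<in> borel_measurable ?PP" using Li[OF e] by simp
    qed
    finally have eq: "PiM {..<n} (\<lambda>_. density P (\<lambda>x. ennreal (h e x))) = density ?PP (\<lambda>X. ennreal (L e X))" .
    have "measure (density ?PP (\<lambda>X. ennreal (L e X))) S = (\<integral>X. indicator S X \<partial>density ?PP (\<lambda>X. ennreal (L e X)))"
      using S sets.sets_into_space[OF S] by (simp add: Int_absorb2)
    also have "... = (\<integral>X. L e X * indicator S X \<partial>?PP)"
      using S Li[OF e] L0[OF e] by (subst integral_density) (auto intro!: AE_I2)
    finally show ?thesis unfolding eq .
  qed
  have Lii: "integrable ?PP (\<lambda>X. L e X * indicator S X)" if "e \<in> G" for e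
    by (rule integrable_real_mult_indicator[OF S Li[OF that]])
  have si: "integrable ?PP (indicator S :: _ \<Rightarrow> real)" using S by (simp add: PP.emeasure_eq_measure)
  have "(\<Sum>e\<in>G. measure (PiM {..<n} (\<lambda>_. density P (\<lambda>x. ennreal (h e x)))) S) = (\<integral>X. (\<Sum>e\<in>G. L e X * indicator S X) \<partial>?PP)"
    using Lii by (simp add: meas)
  also have "... \<le> (\<integral>X. c * (\<theta> / 2 * indicator S X) + 1 / (2 * \<theta> * c) * (\<Sum>e\<in>G. \<Sum>e'\<in>G. L e X * L e' X) \<partial>?PP)"
  proof (rule integral_mono)
    show "integrable ?PP (\<lambda>X. \<Sum>e\<in>G. L e X * indicator S X)" using Lii by auto
    show "integrable ?PP (\<lambda>X. c * (\<theta> / 2 * indicator S X) + 1 / (2 * \<theta> * c) * (\<Sum>e\<in>G. \<Sum>e'\<in>G. L e X * L e' X))"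
      using si LLi(1) by auto
    fix X assume X: "X \<in> space ?PP"
    let ?H = "\<Sum>e\<in>G. L e X"
    have H2: "(\<Sum>e\<in>G. \<Sum>e'\<in>G. L e X * L e' X) = ?H\<^sup>2" by (simp add: power2_eq_square sum_product)
    have "2 * (c * \<theta>) * ?H \<le> (c * \<theta>)\<^sup>2 + ?H\<^sup>2" by (rule sum_squares_bound)
    then have "?H \<le> ((c * \<theta>)\<^sup>2 + ?H\<^sup>2) / (2 * (c * \<theta>))" using c \<theta> by (simp add: pos_le_divide_eq mult.commute)
    also have "... = c * (\<theta> / 2) + 1 / (2 * \<theta> * c) * ?H\<^sup>2" using c \<theta> by (simp add: field_simps power2_eq_square)
    finally have le: "?H \<le> c * (\<theta> / 2) + 1 / (2 * \<theta> * c) * ?H\<^sup>2" .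
    show "(\<Sum>e\<in>G. L e X * indicator S X) \<le> c * (\<theta> / 2 * indicator S X) + 1 / (2 * \<theta> * c) * (\<Sum>e\<in>G. \<Sum>e'\<in>G. L e X * L e' X)"
    proof (cases "X \<in> S")
      case True
      then show ?thesis using le unfolding H2 by simp
    next
      case False
      then show ?thesis unfolding H2 using c \<theta> by simp
    qed
  qed
  also have "... = c * (\<theta> / 2 * measure ?PP S) + 1 / (2 * \<theta> * c) * (\<Sum>e\<in>G. \<Sum>e'\<in>G. (\<integral>x. h e x * h e' x \<partial>P) ^ n)"
  proof -
    have "(\<integral>X. (\<Sum>e\<in>G. \<Sum>e'\<in>G. L e X * L e' X) \<partial>?PP) = (\<Sum>e\<in>G. \<Sum>e'\<in>G. (\<integral>x. h e x * h e' x \<partial>P) ^ n)"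
      using LLi by simp
    moreover have "integrable ?PP (\<lambda>X. \<Sum>e\<in>G. \<Sum>e'\<in>G. L e X * L e' X)" using LLi(1) by auto
    moreover have "(\<integral>X. indicator S X \<partial>?PP) = measure ?PP S"
      using S sets.sets_into_space[OF S] by (simp add: Int_absorb2)
    ultimately show ?thesis using si by simp
  qed
  finally show ?thesis unfolding c_def .
qed

section \<open>The least favourable densities\<close>

lemma prod_coords: "(\<Prod>i\<in>coords k d. f i) = (\<Prod>j<k. \<Prod>i\<in>block d j. f i)"
proof (induction k)
  case (Suc k)
  then show ?case by (simp add: coords_Suc prod.union_disjoint coords_block_disjoint)
qed (simp add: coords_def)

lemma
  fixes g :: "nat \<Rightarrow> (nat \<times> nat \<Rightarrow> real) \<Rightarrow> real"
  assumes j: "j < k" and B: "B \<in> sets (leb (block d j))" and g: "\<And>l. l < k \<Longrightarrow> integrable (leb (block d l)) (g l)"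
  shows integrable_blocks_restrict: "integrable (leb (coords k d)) (\<lambda>x. (\<Prod>l<k. g l (subvec d l x)) * indicator B (subvec d j x))"
    and integral_blocks_restrict: "(\<integral>x. (\<Prod>l<k. g l (subvec d l x)) * indicator B (subvec d j x) \<partial>leb (coords k d)) =
      (\<integral>y. g j y * indicator B y \<partial>leb (block d j)) * (\<Prod>l\<in>{..<k} - {j}. \<integral>y. g l y \<partial>leb (block d l))"
proof -
  define G where "G l y = g l y * (if l = j then indicator B y else 1)" for l y
  have Gi: "integrable (leb (block d l)) (G l)" if "l < k" for l
    using g[OF that] integrable_real_mult_indicator[OF B g[OF j]] by (cases "l = j") (simp_all add: G_def[abs_def])
  have eq: "(\<Prod>l<k. g l (subvec d l x)) * indicator B (subvec d j x) = (\<Prod>l<k. G l (subvec d l x))" for x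
    unfolding G_def prod.distrib using j by (simp add: prod.delta)
  show "integrable (leb (coords k d)) (\<lambda>x. (\<Prod>l<k. g l (subvec d l x)) * indicator B (subvec d j x))"
    unfolding eq by (rule integrable_blocks[OF Gi])
  have "(\<integral>x. (\<Prod>l<k. g l (subvec d l x)) * indicator B (subvec d j x) \<partial>leb (coords k d)) = (\<Prod>l<k. \<integral>y. G l y \<partial>leb (block d l))"
    unfolding eq by (rule integral_blocks[OF Gi])
  also have "... = (\<integral>y. G j y \<partial>leb (block d j)) * (\<Prod>l\<in>{..<k} - {j}. \<integral>y. G l y \<partial>leb (block d l))"
    using j by (intro prod.remove) auto
  also have "(\<Prod>l\<in>{..<k} - {j}. \<integral>y. G l y \<partial>leb (block d l)) = (\<Prod>l\<in>{..<k} - {j}. \<integral>y. g l y \<partial>leb (block d l))"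
    by (intro prod.cong refl) (simp add: G_def)
  finally show "(\<integral>x. (\<Prod>l<k. g l (subvec d l x)) * indicator B (subvec d j x) \<partial>leb (coords k d)) =
      (\<integral>y. g j y * indicator B y \<partial>leb (block d j)) * (\<Prod>l\<in>{..<k} - {j}. \<integral>y. g l y \<partial>leb (block d l))"
    by (simp add: G_def)
qed

text \<open>A fixed Gaussian profile \<open>\<rho>\<close> whose Sobolev integral is small: at most one, so that powers of it can be bounded by the
first power, and small enough that the base density uses only half of the Sobolev radius and leaves the other half to
the perturbation.\<close>

locale perturbed_gaussian = bump \<psi> A for \<psi> A +
  fixes k :: nat and d :: "nat \<Rightarrow> nat" and s :: real and M :: "nat \<Rightarrow> real" and \<rho> :: "real \<Rightarrow> real"
  assumes k: "2 \<le> k" and d: "\<And>j. j < k \<Longrightarrow> 1 \<le> d j" and s: "0 < s" and M: "\<And>j. j < k \<Longrightarrow> 0 < M j"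
    and weight_\<psi>: "integrable lborel (weight_1d s \<psi>)"
    and cont_\<rho>: "continuous_on UNIV \<rho>" and \<rho>_pos: "\<And>t. 0 < \<rho> t" and \<rho>_1: "\<And>t. t \<in> {0..1} \<Longrightarrow> \<rho> 1 \<le> \<rho> t"
    and int_\<rho>: "integrable lborel \<rho>" and one_\<rho>: "(\<integral>t. \<rho> t \<partial>lborel) = 1"
    and weight_\<rho>: "integrable lborel (weight_1d s \<rho>)"
    and small_\<rho>: "(\<integral>t. weight_1d s \<rho> t \<partial>lborel) \<le> 1" "\<And>j. j < k \<Longrightarrow> (\<integral>t. weight_1d s \<rho> t \<partial>lborel) \<le> (M j)\<^sup>2"
      "(\<integral>t. weight_1d s \<rho> t \<partial>lborel) \<le> (\<Prod>j<k. M j)\<^sup>2 / 4"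
begin

abbreviation "C \<equiv> coords k d"
abbreviation "D \<equiv> total_dim k d"

definition base :: "(nat \<times> nat) set \<Rightarrow> (nat \<times> nat \<Rightarrow> real) \<Rightarrow> real" where
  "base I x = (\<Prod>i\<in>I. \<rho> (x i))"

definition perturbed :: "nat \<Rightarrow> ((nat \<times> nat \<Rightarrow> nat) \<Rightarrow> real) \<Rightarrow> (nat \<times> nat \<Rightarrow> real) \<Rightarrow> real" where
  "perturbed N c x = base C x + wave N C c x"

lemma base_pos: "0 < base I x"
  by (simp add: base_def prod_pos \<rho>_pos)

lemma base_props:
  assumes "finite I"
  shows "integrable (leb I) (base I)" "(\<integral>x. base I x \<partial>leb I) = 1" "base I \<in> sobolev I s"
    "(sobolev_norm I s (base I))\<^sup>2 \<le> (\<integral>t. weight_1d s \<rho> t \<partial>lborel) ^ card I"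
proof -
  show "integrable (leb I) (base I)" unfolding base_def[abs_def] by (rule integrable_leb_prod[OF assms int_\<rho>])
  show "(\<integral>x. base I x \<partial>leb I) = 1" unfolding base_def by (subst integral_leb_prod[OF assms int_\<rho>]) (simp add: one_\<rho>)
  show "base I \<in> sobolev I s"
    unfolding base_def[abs_def] by (rule product_sobolev(1)) (use assms s int_\<rho> cont_\<rho> weight_\<rho> in auto)
  have "(sobolev_norm I s (\<lambda>x. \<Prod>i\<in>I. \<rho> (x i)))\<^sup>2 \<le> (\<Prod>i\<in>I. \<integral>t. weight_1d s \<rho> t \<partial>lborel)"
    by (rule product_sobolev(2)) (use assms s int_\<rho> cont_\<rho> weight_\<rho> in auto)
  then show "(sobolev_norm I s (base I))\<^sup>2 \<le> (\<integral>t. weight_1d s \<rho> t \<partial>lborel) ^ card I"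
    by (simp add: base_def[abs_def])
qed

lemma weight_power_le:
  assumes "1 \<le> n" "(\<integral>t. weight_1d s \<rho> t \<partial>lborel) \<le> b"
  shows "(\<integral>t. weight_1d s \<rho> t \<partial>lborel) ^ n \<le> b"
proof -
  have "0 \<le> (\<integral>t. weight_1d s \<rho> t \<partial>lborel)" by (intro Bochner_Integration.integral_nonneg weight_1d_nonneg)
  then have "(\<integral>t. weight_1d s \<rho> t \<partial>lborel) ^ n \<le> (\<integral>t. weight_1d s \<rho> t \<partial>lborel) ^ 1"
    using assms(1) small_\<rho>(1) by (intro power_decreasing) auto
  then show ?thesis using assms(2) by simp
qed

lemma base_block:
  assumes j: "j < k"
  shows "prob_density (block d j) (base (block d j))" "base (block d j) \<in> sobolev_ball (block d j) s (M j)"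
proof -
  note B = base_props[OF finite_block, of d j]
  show "prob_density (block d j) (base (block d j))"
  proof (rule prob_densityI)
    show "base (block d j) \<in> borel_measurable (leb (block d j))" using B(1) by auto
    show "0 \<le> base (block d j) x" for x using base_pos[of "block d j" x] by simp
    then show "(\<integral>\<^sup>+x. ennreal (base (block d j) x) \<partial>leb (block d j)) = 1"
      using B(1,2) by (subst nn_integral_eq_integral) auto
  qed
  have "(sobolev_norm (block d j) s (base (block d j)))\<^sup>2 \<le> (M j)\<^sup>2"
    by (rule order_trans[OF B(4) weight_power_le]) (use d[OF j] small_\<rho>(2)[OF j] in \<open>auto simp: block_def\<close>)
  then have "sobolev_norm (block d j) s (base (block d j)) \<le> M j"
    using M[OF j] by (rule power2_le_imp_le[OF _ less_imp_le])
  then show "base (block d j) \<in> sobolev_ball (block d j) s (M j)" using B(3) by (simp add: sobolev_ball_def)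
qed

lemma D_pos: "1 \<le> D"
proof -
  have "d 0 \<le> (\<Sum>j<k. d j)" using k by (intro member_le_sum) auto
  then show ?thesis using d[of 0] k by (simp add: total_dim_def)
qed

lemma base_C_norm: "(sobolev_norm C s (base C))\<^sup>2 \<le> (\<Prod>j<k. M j)\<^sup>2 / 4"
  by (rule order_trans[OF base_props(4)[OF finite_coords] weight_power_le]) (use D_pos small_\<rho>(3) in \<open>auto simp: card_coords\<close>)

lemma base_tensor: "tensor k d (\<lambda>j. base (block d j)) x = base C x"
  by (simp add: tensor_def base_def prod_coords subvec_def)

lemma base_cube:
  assumes "\<And>i. i \<in> C \<Longrightarrow> x i \<in> {0<..<1}"
  shows "\<rho> 1 ^ D \<le> base C x"
proof -
  have "(\<Prod>i\<in>C. \<rho> 1) \<le> base C x"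
    unfolding base_def using assms less_imp_le[OF \<rho>_pos] by (intro prod_mono conjI \<rho>_1) force+
  then show ?thesis by (simp add: card_coords)
qed

text \<open>On the unit cube the base density is at least \<open>\<rho> 1 ^ D\<close>, off the cube there is no perturbation.\<close>

lemma perturbed_nonneg:
  assumes c: "\<And>v. v \<in> cells N C \<Longrightarrow> \<bar>c v\<bar> \<le> a" and a: "0 \<le> a" "a * A ^ D \<le> \<rho> 1 ^ D"
  shows "0 \<le> perturbed N c x"
proof (cases "\<forall>i\<in>C. x i \<in> {0<..<1}")
  case True
  have "\<bar>wave N C c x\<bar> \<le> a * A ^ D" using wave_bound[OF finite_coords c a(1)] by (simp add: card_coords)
  moreover have "\<rho> 1 ^ D \<le> base C x" using True by (intro base_cube) auto
  ultimately show ?thesis unfolding perturbed_def using a(2) by linarith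
next
  case False
  then obtain i where "i \<in> C" "x i \<notin> {0<..<1}" by blast
  then have "wave N C c x = 0" by (intro wave_outside) auto
  then show ?thesis unfolding perturbed_def using base_pos[of C x] by simp
qed

lemma integral_wave:
  assumes N: "0 < N"
  shows "integrable (leb C) (wave N C c)" "(\<integral>x. wave N C c x \<partial>leb C) = 0"
proof -
  have "C \<noteq> {}" using card_coords[of k d] D_pos by auto
  then show "integrable (leb C) (wave N C c)" "(\<integral>x. wave N C c x \<partial>leb C) = 0"
    unfolding wave_def[abs_def] by (simp_all add: integrable_bump_at N integral_bump_at)
qed

lemma perturbed_density:
  assumes N: "0 < N" and c: "\<And>v. v \<in> cells N C \<Longrightarrow> \<bar>c v\<bar> \<le> a" and a: "0 \<le> a" "a * A ^ D \<le> \<rho> 1 ^ D"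
  shows "prob_density C (perturbed N c)" "integrable (leb C) (perturbed N c)"
proof -
  note B = base_props[OF finite_coords, of k d] and W = integral_wave[OF N, of c]
  show i: "integrable (leb C) (perturbed N c)" unfolding perturbed_def[abs_def] using B(1) W(1) by simp
  have one: "(\<integral>x. perturbed N c x \<partial>leb C) = 1" unfolding perturbed_def[abs_def] using B(1,2) W by simp
  show "prob_density C (perturbed N c)"
  proof (rule prob_densityI)
    show "perturbed N c \<in> borel_measurable (leb C)" using i by auto
    show "0 \<le> perturbed N c x" for x by (rule perturbed_nonneg[OF c a])
    then show "(\<integral>\<^sup>+x. ennreal (perturbed N c x) \<partial>leb C) = 1"
      using i one by (subst nn_integral_eq_integral) auto
  qed
qed

text \<open>A condition on one subvector leaves the integral over another one unrestricted, and this integral of a bump vanishes.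
Here at least two nonempty subvectors are required.\<close>

lemma integral_wave_restrict:
  assumes N: "0 < N" and j: "j < k" and B: "B \<in> sets (leb (block d j))"
  shows "integrable (leb C) (\<lambda>x. wave N C c x * indicator B (subvec d j x))"
    and "(\<integral>x. wave N C c x * indicator B (subvec d j x) \<partial>leb C) = 0"
proof -
  have bl: "bump_at N C v x = (\<Prod>l<k. bump_at N (block d l) v (subvec d l x))" for v x
    by (simp add: bump_at_def prod_coords subvec_def)
  have i: "integrable (leb C) (\<lambda>x. bump_at N C v x * indicator B (subvec d j x))" for v
    unfolding bl by (rule integrable_blocks_restrict[OF j B]) (simp add: integrable_bump_at N)
  have z: "(\<integral>x. bump_at N C v x * indicator B (subvec d j x) \<partial>leb C) = 0" for v
  proof -
    define l where "l = (if j = 0 then 1 else 0 :: nat)"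
    have l: "l \<in> {..<k} - {j}" using k by (auto simp: l_def)
    then have "(l, 0) \<in> block d l" using d[of l] by (auto simp: block_def)
    then have "block d l \<noteq> {}" by blast
    then have "(\<integral>y. bump_at N (block d l) v y \<partial>leb (block d l)) = 0" by (intro integral_bump_at N) auto
    then have "(\<Prod>l\<in>{..<k} - {j}. \<integral>y. bump_at N (block d l) v y \<partial>leb (block d l)) = 0"
      using l by (intro prod_zero) auto
    then show ?thesis
      unfolding bl by (subst integral_blocks_restrict[OF j B]) (simp_all add: integrable_bump_at N)
  qed
  have eq: "wave N C c x * indicator B (subvec d j x) = (\<Sum>v\<in>cells N C. c v * (bump_at N C v x * indicator B (subvec d j x)))" for x
    by (simp add: wave_def sum_distrib_right mult.assoc)
  show "integrable (leb C) (\<lambda>x. wave N C c x * indicator B (subvec d j x))"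
    unfolding eq by (intro Bochner_Integration.integrable_sum integrable_mult_right i)
  have "(\<integral>x. (\<Sum>v\<in>cells N C. c v * (bump_at N C v x * indicator B (subvec d j x))) \<partial>leb C) =
    (\<Sum>v\<in>cells N C. \<integral>x. c v * (bump_at N C v x * indicator B (subvec d j x)) \<partial>leb C)"
    by (intro Bochner_Integration.integral_sum integrable_mult_right i)
  then show "(\<integral>x. wave N C c x * indicator B (subvec d j x) \<partial>leb C) = 0"
    unfolding eq by (simp add: z)
qed

lemma perturbed_marginals:
  assumes N: "0 < N" and c: "\<And>v. v \<in> cells N C \<Longrightarrow> \<bar>c v\<bar> \<le> a" and a: "0 \<le> a" "a * A ^ D \<le> \<rho> 1 ^ D"
  shows "marginal_densities k d (perturbed N c) (\<lambda>j. base (block d j))"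
  unfolding marginal_densities_def
proof (intro allI impI conjI)
  fix j assume j: "j < k"
  let ?b = "\<lambda>y. base (block d j) y"
  show pd: "prob_density (block d j) ?b" by (rule base_block(1)[OF j])
  note P = perturbed_density[OF N c a]
  note pm = prob_densityD(1)[OF P(1)] and bm = prob_densityD(1)[OF pd]
  have bb: "integrable (leb (block d l)) (base (block d l))" "(\<integral>y. base (block d l) y \<partial>leb (block d l)) = 1" for l
    by (rule base_props[OF finite_block])+
  have "distr (law C (perturbed N c)) (leb (block d j)) (subvec d j) = density (leb (block d j)) (\<lambda>y. ennreal (?b y))"
  proof (rule measure_eqI)
    fix B assume "B \<in> sets (distr (law C (perturbed N c)) (leb (block d j)) (subvec d j))"
    then have B: "B \<in> sets (leb (block d j))" by simp
    have base_B: "integrable (leb C) (\<lambda>x. base C x * indicator B (subvec d j x))"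
      "(\<integral>x. base C x * indicator B (subvec d j x) \<partial>leb C) = (\<integral>y. ?b y * indicator B y \<partial>leb (block d j))"
      unfolding base_tensor[symmetric] tensor_def
      using integrable_blocks_restrict[OF j B bb(1)] integral_blocks_restrict[OF j B bb(1)] by (simp_all add: bb(2))
    note W = integral_wave_restrict[OF N j B, of c]
    have sv: "subvec d j -` B \<inter> space (law C (perturbed N c)) \<in> sets (leb C)"
      using measurable_sets[OF measurable_subvec[OF j, of d] B] by simp
    have "emeasure (distr (law C (perturbed N c)) (leb (block d j)) (subvec d j)) B =
      emeasure (law C (perturbed N c)) (subvec d j -` B \<inter> space (law C (perturbed N c)))"
      using measurable_subvec[OF j, of d] B by (intro emeasure_distr) (simp_all add: law_def)
    also have "... = (\<integral>\<^sup>+x. ennreal (perturbed N c x) * indicator (subvec d j -` B \<inter> space (law C (perturbed N c))) x \<partial>leb C)"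
      unfolding law_def using sv pm by (intro emeasure_density) (simp_all add: law_def)
    also have "... = (\<integral>\<^sup>+x. ennreal (perturbed N c x * indicator B (subvec d j x)) \<partial>leb C)"
      by (intro nn_integral_cong) (auto simp: indicator_def)
    also have "... = ennreal (\<integral>x. base C x * indicator B (subvec d j x) + wave N C c x * indicator B (subvec d j x) \<partial>leb C)"
      unfolding distrib_right[symmetric] perturbed_def[symmetric]
    proof (rule nn_integral_eq_integral)
      show "integrable (leb C) (\<lambda>x. perturbed N c x * indicator B (subvec d j x))"
        unfolding perturbed_def distrib_right using base_B(1) W(1) by simp
      show "AE x in leb C. 0 \<le> perturbed N c x * indicator B (subvec d j x)"
        using perturbed_nonneg[OF c a] by (intro AE_I2 mult_nonneg_nonneg) auto
    qed
    also have "... = ennreal (\<integral>y. ?b y * indicator B y \<partial>leb (block d j))"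
      using base_B W by simp
    also have "... = (\<integral>\<^sup>+y. ennreal (?b y * indicator B y) \<partial>leb (block d j))"
      using integrable_real_mult_indicator[OF B bb(1)] base_pos[THEN less_imp_le]
      by (intro nn_integral_eq_integral[symmetric] AE_I2 mult_nonneg_nonneg) auto
    also have "... = (\<integral>\<^sup>+y. ennreal (?b y) * indicator B y \<partial>leb (block d j))"
      by (intro nn_integral_cong) (auto simp: indicator_def)
    also have "... = emeasure (density (leb (block d j)) (\<lambda>y. ennreal (?b y))) B"
      using bm B by (intro emeasure_density[symmetric]) auto
    finally show "emeasure (distr (law C (perturbed N c)) (leb (block d j)) (subvec d j)) B =
      emeasure (density (leb (block d j)) (\<lambda>y. ennreal (?b y))) B" .
  qed simp
  then show "distributed (law C (perturbed N c)) (leb (block d j)) (subvec d j) (\<lambda>y. ennreal (?b y))"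
    unfolding distributed_def using bm measurable_subvec[OF j, of d] by (simp add: law_def)
qed

text \<open>The base density is the perturbation with all coefficients zero.\<close>

lemma base_in_H0: "base C \<in> H0_IND k d s M"
proof -
  have z: "perturbed (Suc 0) (\<lambda>_. 0) = base C" by (rule ext) (simp add: perturbed_def wave_def)
  have r: "0 \<le> \<rho> 1 ^ D" using \<rho>_pos[of 1] by simp
  have "prob_density C (base C)" "marginal_densities k d (base C) (\<lambda>j. base (block d j))"
    using perturbed_density(1)[of "Suc 0" "\<lambda>_. 0" 0] perturbed_marginals[of "Suc 0" "\<lambda>_. 0" 0] r by (simp_all add: z)
  then show ?thesis unfolding H0_IND_def
    by (intro CollectI conjI exI[of _ "\<lambda>j. base (block d j)"] ballI allI impI base_block(2) base_tensor[symmetric])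
qed

text \<open>The bumps have disjoint supports and the signs square to one, so the separation from the null density is the same for
all choices of signs.\<close>

lemma wave_signs_square:
  assumes N: "0 < N" and e: "\<epsilon> \<in> signs (cells N C)"
  shows "(\<integral>x. (wave N C (\<lambda>v. a * \<epsilon> v) x)\<^sup>2 \<partial>leb C) = a\<^sup>2 * (\<integral>t. (\<psi> t)\<^sup>2 \<partial>lborel) ^ D"
proof -
  have eq: "(wave N C (\<lambda>v. a * \<epsilon> v) x)\<^sup>2 = a\<^sup>2 * (\<Sum>v\<in>cells N C. (bump_at N C v x)\<^sup>2)" for x
  proof -
    have "(wave N C (\<lambda>v. a * \<epsilon> v) x)\<^sup>2 = (\<Sum>v\<in>cells N C. a\<^sup>2 * (\<epsilon> v * \<epsilon> v) * (bump_at N C v x)\<^sup>2)"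
      by (simp add: power2_eq_square[of "wave N C (\<lambda>v. a * \<epsilon> v) x"] wave_mult[OF finite_coords] power2_eq_square[of a] mult_ac)
    also have "... = (\<Sum>v\<in>cells N C. a\<^sup>2 * (bump_at N C v x)\<^sup>2)"
      by (intro sum.cong refl) (simp add: signs_square[OF e])
    finally show ?thesis by (simp add: sum_distrib_left)
  qed
  show ?thesis unfolding eq
    using N by (simp add: integrable_bump_at_square integral_bump_at_square card_cells card_coords power_divide)
qed

lemma perturbed_in_H1:
  assumes N: "0 < N" and e: "\<epsilon> \<in> signs (cells N C)" and a: "0 \<le> a" "a * A ^ D \<le> \<rho> 1 ^ D"
    and sob: "(sobolev_norm C s (wave N C (\<lambda>v. a * \<epsilon> v)))\<^sup>2 \<le> (\<Prod>j<k. M j)\<^sup>2 / 4"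
    and \<delta>: "\<delta>\<^sup>2 \<le> a\<^sup>2 * (\<integral>t. (\<psi> t)\<^sup>2 \<partial>lborel) ^ D"
  shows "perturbed N (\<lambda>v. a * \<epsilon> v) \<in> H1_IND k d s M \<delta>"
proof -
  let ?c = "\<lambda>v. a * \<epsilon> v"
  have c: "\<bar>?c v\<bar> \<le> a" if "v \<in> cells N C" for v
  proof -
    have "\<epsilon> v = -1 \<or> \<epsilon> v = 1" using e that by (auto simp: signs_def PiE_iff)
    then show ?thesis using a by auto
  qed
  have M0: "0 < (\<Prod>j<k. M j)" using M by (intro prod_pos) auto
  have ws: "wave N C ?c \<in> sobolev C s" "(\<lambda>x. - wave N C ?c x) \<in> sobolev C s"
  proof -
    show "wave N C ?c \<in> sobolev C s" by (rule wave_sobolev(1)) (use N s weight_\<psi> in auto)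
    have "wave N C (\<lambda>v. - ?c v) \<in> sobolev C s" by (rule wave_sobolev(1)) (use N s weight_\<psi> in auto)
    then show "(\<lambda>x. - wave N C ?c x) \<in> sobolev C s" by (simp add: wave_def[abs_def] sum_negf)
  qed
  have neg: "sobolev_norm C s (\<lambda>x. - wave N C ?c x) = sobolev_norm C s (wave N C ?c)"
  proof -
    have "fourier C (\<lambda>x. - wave N C ?c x) \<omega> = - fourier C (wave N C ?c) \<omega>" for \<omega>
      using integral_wave(1)[OF N, of ?c] by (simp add: fourier_eq_cis)
    then show ?thesis by (simp add: sobolev_norm_def sobolev_density_def)
  qed
  have p: "perturbed N ?c = (\<lambda>x. base C x - (- wave N C ?c x))" by (rule ext) (simp add: perturbed_def)
  note SD = sobolev_diff[OF finite_coords base_props(3)[OF finite_coords] ws(2)]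
  have "(sobolev_norm C s (perturbed N ?c))\<^sup>2 \<le> 2 * (sobolev_norm C s (base C))\<^sup>2 + 2 * (sobolev_norm C s (wave N C ?c))\<^sup>2"
    unfolding p using SD(2) by (simp add: neg)
  also have "... \<le> (\<Prod>j<k. M j)\<^sup>2" using base_C_norm sob by simp
  finally have "sobolev_norm C s (perturbed N ?c) \<le> (\<Prod>j<k. M j)" using M0 by (rule power2_le_imp_le[OF _ less_imp_le])
  then have ball: "perturbed N ?c \<in> sobolev_ball C s (\<Prod>j<k. M j)"
    using SD(1) unfolding p sobolev_ball_def by simp
  have "\<delta> \<le> \<bar>\<delta>\<bar>" by simp
  also have "... \<le> sqrt (a\<^sup>2 * (\<integral>t. (\<psi> t)\<^sup>2 \<partial>lborel) ^ D)" using \<delta> by (intro real_le_rsqrt) simp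
  also have "... = L2_norm C (\<lambda>x. perturbed N ?c x - tensor k d (\<lambda>j. base (block d j)) x)"
    by (simp add: L2_norm_def base_tensor perturbed_def wave_signs_square[OF N e])
  finally have \<delta>': "\<delta> \<le> L2_norm C (\<lambda>x. perturbed N ?c x - tensor k d (\<lambda>j. base (block d j)) x)" .
  show ?thesis unfolding H1_IND_def
    by (intro CollectI conjI exI[of _ "\<lambda>j. base (block d j)"] allI impI base_block(2) \<delta>' ball
        perturbed_density(1)[OF N c a] perturbed_marginals[OF N c a])
qed

end

context perturbed_gaussian
begin

lemma
  assumes N: "0 < N" and v: "v \<in> cells N C"
  shows integrable_bump_at_over_base: "integrable (leb C) (\<lambda>x. (bump_at N C v x)\<^sup>2 / base C x)"
    and bump_at_over_base_bound: "\<bar>\<integral>x. (bump_at N C v x)\<^sup>2 / base C x \<partial>leb C\<bar> \<le> ((\<integral>t. (\<psi> t)\<^sup>2 \<partial>lborel) / real N) ^ D / \<rho> 1 ^ D"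
proof -
  have r: "0 < \<rho> 1 ^ D" using \<rho>_pos by simp
  have dom: "(bump_at N C v x)\<^sup>2 / base C x \<le> (bump_at N C v x)\<^sup>2 / \<rho> 1 ^ D" for x
  proof (cases "\<forall>i\<in>C. x i \<in> {0<..<1}")
    case True
    then have "\<rho> 1 ^ D \<le> base C x" by (intro base_cube) blast
    then show ?thesis using r by (intro divide_left_mono) (auto intro: mult_pos_pos base_pos)
  next
    case False
    then obtain i where "i \<in> C" "x i \<notin> {0<..<1}" by blast
    then have "bump_at N C v x = 0" by (rule bump_at_outside[OF finite_coords v])
    then show ?thesis by simp
  qed
  have nn: "0 \<le> (bump_at N C v x)\<^sup>2 / base C x" for x using base_pos[of C x] by simp
  have bi: "integrable (leb C) (\<lambda>x. (bump_at N C v x)\<^sup>2 / \<rho> 1 ^ D)"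
    by (intro integrable_divide integrable_bump_at_square finite_coords N)
  show i: "integrable (leb C) (\<lambda>x. (bump_at N C v x)\<^sup>2 / base C x)"
  proof (rule Bochner_Integration.integrable_bound[OF bi])
    have "bump_at N C v \<in> borel_measurable (leb C)" "base C \<in> borel_measurable (leb C)"
      using integrable_bump_at[OF finite_coords N, of k d v] base_props(1)[OF finite_coords, of k d] by auto
    then show "(\<lambda>x. (bump_at N C v x)\<^sup>2 / base C x) \<in> borel_measurable (leb C)"
      by (intro borel_measurable_divide borel_measurable_power)
    show "AE x in leb C. norm ((bump_at N C v x)\<^sup>2 / base C x) \<le> norm ((bump_at N C v x)\<^sup>2 / \<rho> 1 ^ D)"
      unfolding real_norm_def abs_of_nonneg[OF nn] by (intro AE_I2 order_trans[OF dom abs_ge_self])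
  qed
  have "\<bar>\<integral>x. (bump_at N C v x)\<^sup>2 / base C x \<partial>leb C\<bar> = (\<integral>x. (bump_at N C v x)\<^sup>2 / base C x \<partial>leb C)"
    by (intro abs_of_nonneg Bochner_Integration.integral_nonneg nn)
  also have "... \<le> (\<integral>x. (bump_at N C v x)\<^sup>2 / \<rho> 1 ^ D \<partial>leb C)" by (rule integral_mono[OF i bi dom])
  also have "... = ((\<integral>t. (\<psi> t)\<^sup>2 \<partial>lborel) / real N) ^ D / \<rho> 1 ^ D"
    by (simp add: integral_bump_at_square N card_coords)
  finally show "\<bar>\<integral>x. (bump_at N C v x)\<^sup>2 / base C x \<partial>leb C\<bar> \<le> ((\<integral>t. (\<psi> t)\<^sup>2 \<partial>lborel) / real N) ^ D / \<rho> 1 ^ D" .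
qed

text \<open>The likelihood ratio of a perturbed density with respect to the base density.\<close>

definition likelihood :: "nat \<Rightarrow> ((nat \<times> nat \<Rightarrow> nat) \<Rightarrow> real) \<Rightarrow> (nat \<times> nat \<Rightarrow> real) \<Rightarrow> real" where
  "likelihood N c x = perturbed N c x / base C x"

lemma base_law: "prob_density C (base C)"
  using base_in_H0 by (simp add: H0_IND_def)

lemma measurable_likelihood: "0 < N \<Longrightarrow> likelihood N c \<in> borel_measurable (leb C)"
  using integral_wave(1)[of N c] base_props(1)[OF finite_coords, of k d]
  unfolding likelihood_def[abs_def] perturbed_def by (intro borel_measurable_divide borel_measurable_add) auto

lemma law_perturbed:
  assumes N: "0 < N"
  shows "density (law C (base C)) (\<lambda>x. ennreal (likelihood N c x)) = law C (perturbed N c)"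
proof -
  have m: "base C \<in> borel_measurable (leb C)" using base_props(1)[OF finite_coords, of k d] by auto
  have "ennreal (base C x) * ennreal (likelihood N c x) = ennreal (perturbed N c x)" for x
    using base_pos[of C x] by (simp add: likelihood_def ennreal_mult'[symmetric])
  then show ?thesis unfolding law_def
    using m measurable_likelihood[OF N, of c] by (subst density_density_eq) auto
qed

lemma
  assumes N: "0 < N"
  shows integrable_likelihood_mult: "integrable (law C (base C)) (\<lambda>x. likelihood N c x * likelihood N c' x)"
    and integral_likelihood_mult: "(\<integral>x. likelihood N c x * likelihood N c' x \<partial>law C (base C)) =
      1 + (\<Sum>v\<in>cells N C. c v * c' v * (\<integral>x. (bump_at N C v x)\<^sup>2 / base C x \<partial>leb C))"
proof -
  have m: "base C \<in> borel_measurable (leb C)" using base_props(1)[OF finite_coords, of k d] by auto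
  have m2: "(\<lambda>x. likelihood N c x * likelihood N c' x) \<in> borel_measurable (leb C)"
    by (intro borel_measurable_times measurable_likelihood N)
  have b0: "AE x in leb C. 0 \<le> base C x" using base_pos by (intro AE_I2 less_imp_le)
  have eq: "base C x *\<^sub>R (likelihood N c x * likelihood N c' x) =
    base C x + wave N C c x + wave N C c' x + (\<Sum>v\<in>cells N C. c v * c' v * ((bump_at N C v x)\<^sup>2 / base C x))" for x
  proof -
    have "base C x *\<^sub>R (likelihood N c x * likelihood N c' x) =
      base C x + wave N C c x + wave N C c' x + wave N C c x * wave N C c' x / base C x"
      using base_pos[of C x] by (simp add: likelihood_def perturbed_def field_simps)
    then show ?thesis by (simp add: wave_mult sum_divide_distrib)
  qed
  have ci: "integrable (leb C) (\<lambda>x. c v * c' v * ((bump_at N C v x)\<^sup>2 / base C x))" if "v \<in> cells N C" for v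
    by (rule integrable_mult_right[OF integrable_bump_at_over_base[OF N that]])
  have si: "integrable (leb C) (\<lambda>x. \<Sum>v\<in>cells N C. c v * c' v * ((bump_at N C v x)\<^sup>2 / base C x))"
    by (rule Bochner_Integration.integrable_sum[OF ci])
  note W = integral_wave[OF N] and B = base_props[OF finite_coords, of k d]
  show "integrable (law C (base C)) (\<lambda>x. likelihood N c x * likelihood N c' x)"
    unfolding law_def integrable_density[OF m2 m b0] eq
    by (intro Bochner_Integration.integrable_add si W(1) B(1))
  have "(\<integral>x. likelihood N c x * likelihood N c' x \<partial>law C (base C)) =
    (\<integral>x. base C x + wave N C c x + wave N C c' x + (\<Sum>v\<in>cells N C. c v * c' v * ((bump_at N C v x)\<^sup>2 / base C x)) \<partial>leb C)"
    unfolding law_def integral_density[OF m2 m b0] eq ..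
  also have "... = 1 + (\<integral>x. (\<Sum>v\<in>cells N C. c v * c' v * ((bump_at N C v x)\<^sup>2 / base C x)) \<partial>leb C)"
    using si W B(1,2) by simp
  also have "(\<integral>x. (\<Sum>v\<in>cells N C. c v * c' v * ((bump_at N C v x)\<^sup>2 / base C x)) \<partial>leb C) =
    (\<Sum>v\<in>cells N C. \<integral>x. c v * c' v * ((bump_at N C v x)\<^sup>2 / base C x) \<partial>leb C)"
    by (rule Bochner_Integration.integral_sum[OF ci])
  finally show "(\<integral>x. likelihood N c x * likelihood N c' x \<partial>law C (base C)) =
      1 + (\<Sum>v\<in>cells N C. c v * c' v * (\<integral>x. (bump_at N C v x)\<^sup>2 / base C x \<partial>leb C))"
    by (simp only: Bochner_Integration.integral_mult_right_zero)
qed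

text \<open>Markov's inequality for the average over the signs.\<close>

lemma many_signs_in_ball:
  assumes N: "0 < N" and a: "2 * (a\<^sup>2 * real N powr (2 * s) * (\<integral>t. weight_1d s \<psi> t \<partial>lborel) ^ D) \<le> (\<Prod>j<k. M j)\<^sup>2 / 4"
  shows "2 ^ card (cells N C) / 2 \<le>
    real (card {\<epsilon> \<in> signs (cells N C). (sobolev_norm C s (wave N C (\<lambda>v. a * \<epsilon> v)))\<^sup>2 \<le> (\<Prod>j<k. M j)\<^sup>2 / 4})"
proof -
  let ?V = "cells N C" and ?T = "(\<Prod>j<k. M j)\<^sup>2 / 4"
  let ?q = "\<lambda>\<epsilon>. (sobolev_norm C s (wave N C (\<lambda>v. a * \<epsilon> v)))\<^sup>2"
  let ?good = "{\<epsilon> \<in> signs ?V. ?q \<epsilon> \<le> ?T}" and ?bad = "{\<epsilon> \<in> signs ?V. \<not> ?q \<epsilon> \<le> ?T}"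
  have "0 < (\<Prod>j<k. M j)" using M by (intro prod_pos) auto
  then have T: "0 < ?T" by (rule divide_pos_pos[OF zero_less_power]) simp
  have fin: "finite (signs ?V)" by simp
  have "real (card ?bad) * ?T = (\<Sum>\<epsilon>\<in>?bad. ?T)" by simp
  also have "... \<le> (\<Sum>\<epsilon>\<in>?bad. ?q \<epsilon>)" by (intro sum_mono) auto
  also have "... \<le> (\<Sum>\<epsilon>\<in>signs ?V. ?q \<epsilon>)" using fin by (intro sum_mono2) auto
  also have "... \<le> 2 ^ card ?V * (a\<^sup>2 * real N powr (2 * s) * (\<integral>t. weight_1d s \<psi> t \<partial>lborel) ^ card C)"
    by (rule wave_sobolev(2)) (use N s weight_\<psi> in auto)
  also have "... \<le> 2 ^ card ?V * (?T / 2)" using a by (intro mult_left_mono) (auto simp: card_coords)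
  finally have bad: "real (card ?bad) * ?T \<le> (2 ^ card ?V / 2) * ?T" by simp
  have bad': "real (card ?bad) \<le> 2 ^ card ?V / 2" by (rule mult_right_le_imp_le[OF bad T])
  have "card (signs ?V) = card (?good \<union> ?bad)" by (rule arg_cong[of _ _ card]) blast
  also have "... = card ?good + card ?bad" using fin by (intro card_Un_disjoint) auto
  finally have "real (card ?good) + real (card ?bad) = 2 ^ card ?V" using card_signs[of ?V] by simp
  then show ?thesis using bad' by linarith
qed

text \<open>The power is at most the average rejection probability over the admissible signs. Passing from them to all signs in
the second moment costs a factor four, since they are at least half.\<close>

lemma test_power_le:
  assumes t: "is_test k d n \<phi>" and N: "0 < N" and a: "0 \<le> a" "a * A ^ D \<le> \<rho> 1 ^ D"
    and sob: "2 * (a\<^sup>2 * real N powr (2 * s) * (\<integral>t. weight_1d s \<psi> t \<partial>lborel) ^ D) \<le> (\<Prod>j<k. M j)\<^sup>2 / 4"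
    and \<delta>: "\<delta>\<^sup>2 \<le> a\<^sup>2 * (\<integral>t. (\<psi> t)\<^sup>2 \<partial>lborel) ^ D"
    and \<kappa>: "real N ^ D * (real n * a\<^sup>2 * (((\<integral>t. (\<psi> t)\<^sup>2 \<partial>lborel) / real N) ^ D / \<rho> 1 ^ D))\<^sup>2 / 2 \<le> \<kappa>"
    and \<theta>: "0 < \<theta>"
  shows "test_power k d n \<phi> (H1_IND k d s M \<delta>) \<le> \<theta> / 2 * rejection_prob k d n (base C) \<phi> + 2 / \<theta> * exp \<kappa>"
proof -
  let ?V = "cells N C"
  let ?b = "((\<integral>t. (\<psi> t)\<^sup>2 \<partial>lborel) / real N) ^ D / \<rho> 1 ^ D"
  define G where "G = {\<epsilon> \<in> signs ?V. (sobolev_norm C s (wave N C (\<lambda>v. a * \<epsilon> v)))\<^sup>2 \<le> (\<Prod>j<k. M j)\<^sup>2 / 4}"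
  define w where "w v = (\<integral>x. (bump_at N C v x)\<^sup>2 / base C x \<partial>leb C)" for v
  define h where "h e = likelihood N (\<lambda>v. a * e v)" for e
  define S where "S = {X \<in> space (PiM {..<n} (\<lambda>_. leb C)). \<phi> X}"
  define tp where "tp = test_power k d n \<phi> (H1_IND k d s M \<delta>)"
  let ?P = "law C (base C)"
  have Gs: "\<epsilon> \<in> signs ?V" if "\<epsilon> \<in> G" for \<epsilon> using that by (simp add: G_def)
  have fin: "finite G" "finite (signs ?V)" by (simp_all add: G_def)
  have cG: "2 ^ card ?V / 2 \<le> real (card G)" unfolding G_def by (rule many_signs_in_ball[OF N sob])
  have pos2: "(0::real) < 2 ^ card ?V / 2" by simp
  have cG0: "0 < real (card G)" using cG pos2 by linarith
  then have Gne: "G \<noteq> {}" by auto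
  have c: "\<bar>a * \<epsilon> v\<bar> \<le> a" if "\<epsilon> \<in> G" "v \<in> ?V" for \<epsilon> v
  proof -
    have "\<epsilon> v = -1 \<or> \<epsilon> v = 1" using Gs[OF that(1)] that(2) by (auto simp: signs_def PiE_iff)
    then show ?thesis using a by auto
  qed
  have H1: "perturbed N (\<lambda>v. a * \<epsilon> v) \<in> H1_IND k d s M \<delta>" if "\<epsilon> \<in> G" for \<epsilon>
    by (rule perturbed_in_H1[OF N Gs[OF that] a _ \<delta>]) (use that in \<open>simp add: G_def\<close>)
  have rej: "rejection_prob k d n p \<phi> = measure (PiM {..<n} (\<lambda>_. law C p)) S" for p
    by (simp add: rejection_prob_def S_def space_PiM)
  have le: "tp \<le> measure (PiM {..<n} (\<lambda>_. density ?P (\<lambda>x. ennreal (h \<epsilon> x)))) S" if "\<epsilon> \<in> G" for \<epsilon>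
  proof -
    have "bdd_below ((\<lambda>p. rejection_prob k d n p \<phi>) ` H1_IND k d s M \<delta>)"
      by (rule bdd_belowI2[of _ 0]) (simp add: rej)
    then have "(INF p\<in>H1_IND k d s M \<delta>. rejection_prob k d n p \<phi>) \<le> rejection_prob k d n (perturbed N (\<lambda>v. a * \<epsilon> v)) \<phi>"
      using H1[OF that] by (rule cINF_lower)
    moreover have "H1_IND k d s M \<delta> \<noteq> {}" using H1[OF that] by blast
    ultimately have "tp \<le> rejection_prob k d n (perturbed N (\<lambda>v. a * \<epsilon> v)) \<phi>" by (simp add: tp_def test_power_def)
    then show ?thesis unfolding h_def law_perturbed[OF N] rej .
  qed
  have hm: "h \<epsilon> \<in> borel_measurable ?P" for \<epsilon>
    using measurable_likelihood[OF N] by (simp add: h_def law_def)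
  have h0: "0 \<le> h \<epsilon> x" if "\<epsilon> \<in> G" for \<epsilon> x
    unfolding h_def likelihood_def using perturbed_nonneg[OF c[OF that] a] base_pos[of C x] by simp
  have hQ: "prob_space (density ?P (\<lambda>x. ennreal (h \<epsilon> x)))" if "\<epsilon> \<in> G" for \<epsilon>
    unfolding h_def law_perturbed[OF N] by (rule prob_densityD(3)[OF perturbed_density(1)[OF N c[OF that] a]])
  have hh: "integrable ?P (\<lambda>x. h \<epsilon> x * h \<epsilon>' x)" for \<epsilon> \<epsilon>'
    unfolding h_def by (rule integrable_likelihood_mult[OF N])
  have SS: "S \<in> sets (PiM {..<n} (\<lambda>_. ?P))"
  proof -
    have "S \<in> sets (PiM {..<n} (\<lambda>_. leb C))" using t unfolding S_def is_test_def by (simp add: pred_def)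
    also have "sets (PiM {..<n} (\<lambda>_. leb C)) = sets (PiM {..<n} (\<lambda>_. ?P))" by (intro sets_PiM_cong) auto
    finally show ?thesis .
  qed
  have "real (card G) * tp = (\<Sum>\<epsilon>\<in>G. tp)" by simp
  also have "... \<le> (\<Sum>\<epsilon>\<in>G. measure (PiM {..<n} (\<lambda>_. density ?P (\<lambda>x. ennreal (h \<epsilon> x)))) S)"
    by (rule sum_mono[OF le])
  also have "... \<le> real (card G) * (\<theta> / 2 * measure (PiM {..<n} (\<lambda>_. ?P)) S) +
    1 / (2 * \<theta> * real (card G)) * (\<Sum>\<epsilon>\<in>G. \<Sum>\<epsilon>'\<in>G. (\<integral>x. h \<epsilon> x * h \<epsilon>' x \<partial>?P) ^ n)"
    by (rule second_moment_testing_bound[OF prob_densityD(3)[OF base_law] fin(1) Gne hm h0 hQ hh SS \<theta>])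
  also have "(\<Sum>\<epsilon>\<in>G. \<Sum>\<epsilon>'\<in>G. (\<integral>x. h \<epsilon> x * h \<epsilon>' x \<partial>?P) ^ n) \<le> (2 ^ card ?V)\<^sup>2 * exp \<kappa>"
  proof -
    have "(\<integral>x. h \<epsilon> x * h \<epsilon>' x \<partial>?P) ^ n \<le> exp (\<Sum>v\<in>?V. \<epsilon> v * \<epsilon>' v * (real n * a\<^sup>2 * w v))" if e: "\<epsilon> \<in> G" "\<epsilon>' \<in> G" for \<epsilon> \<epsilon>'
    proof -
      have "0 \<le> (\<integral>x. h \<epsilon> x * h \<epsilon>' x \<partial>?P)"
        using h0[OF e(1)] h0[OF e(2)] by (intro Bochner_Integration.integral_nonneg mult_nonneg_nonneg)
      moreover have "(\<integral>x. h \<epsilon> x * h \<epsilon>' x \<partial>?P) \<le> exp (\<Sum>v\<in>?V. a * \<epsilon> v * (a * \<epsilon>' v) * w v)"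
        unfolding h_def integral_likelihood_mult[OF N] w_def by (rule exp_ge_add_one_self)
      ultimately have "(\<integral>x. h \<epsilon> x * h \<epsilon>' x \<partial>?P) ^ n \<le> exp (\<Sum>v\<in>?V. a * \<epsilon> v * (a * \<epsilon>' v) * w v) ^ n"
        by (intro power_mono)
      also have "... = exp (\<Sum>v\<in>?V. \<epsilon> v * \<epsilon>' v * (real n * a\<^sup>2 * w v))"
        unfolding exp_of_nat_mult[symmetric] by (simp add: sum_distrib_left power2_eq_square mult_ac)
      finally show ?thesis .
    qed
    then have "(\<Sum>\<epsilon>\<in>G. \<Sum>\<epsilon>'\<in>G. (\<integral>x. h \<epsilon> x * h \<epsilon>' x \<partial>?P) ^ n) \<le> (\<Sum>\<epsilon>\<in>G. \<Sum>\<epsilon>'\<in>G. exp (\<Sum>v\<in>?V. \<epsilon> v * \<epsilon>' v * (real n * a\<^sup>2 * w v)))"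
      by (intro sum_mono)
    also have "... \<le> (\<Sum>\<epsilon>\<in>G. \<Sum>\<epsilon>'\<in>signs ?V. exp (\<Sum>v\<in>?V. \<epsilon> v * \<epsilon>' v * (real n * a\<^sup>2 * w v)))"
      using fin Gs by (intro sum_mono sum_mono2) auto
    also have "... \<le> (\<Sum>\<epsilon>\<in>signs ?V. \<Sum>\<epsilon>'\<in>signs ?V. exp (\<Sum>v\<in>?V. \<epsilon> v * \<epsilon>' v * (real n * a\<^sup>2 * w v)))"
      using fin Gs by (intro sum_mono2) (auto intro: sum_nonneg)
    also have "... \<le> (2 ^ card ?V)\<^sup>2 * exp ((\<Sum>v\<in>?V. (real n * a\<^sup>2 * w v)\<^sup>2) / 2)"
      by (rule sum_signs_exp_le) simp
    also have "... \<le> (2 ^ card ?V)\<^sup>2 * exp \<kappa>"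
    proof -
      have "(real n * a\<^sup>2 * w v)\<^sup>2 \<le> (real n * a\<^sup>2 * ?b)\<^sup>2" if "v \<in> ?V" for v
      proof -
        have "\<bar>real n * a\<^sup>2 * w v\<bar> = real n * a\<^sup>2 * \<bar>w v\<bar>" by (simp add: abs_mult)
        also have "... \<le> real n * a\<^sup>2 * ?b"
          unfolding w_def by (intro mult_left_mono bump_at_over_base_bound[OF N that]) auto
        finally have "\<bar>real n * a\<^sup>2 * w v\<bar> \<le> real n * a\<^sup>2 * ?b" .
        from power_mono[OF this abs_ge_zero, of 2] show ?thesis by (simp only: power2_abs)
      qed
      then have "(\<Sum>v\<in>?V. (real n * a\<^sup>2 * w v)\<^sup>2) \<le> (\<Sum>v\<in>?V. (real n * a\<^sup>2 * ?b)\<^sup>2)" by (rule sum_mono)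
      also have "... = real N ^ D * (real n * a\<^sup>2 * ?b)\<^sup>2" by (simp add: card_cells card_coords)
      finally have "(\<Sum>v\<in>?V. (real n * a\<^sup>2 * w v)\<^sup>2) / 2 \<le> real N ^ D * (real n * a\<^sup>2 * ?b)\<^sup>2 / 2"
        by (rule divide_right_mono) simp
      also have "... \<le> \<kappa>" by (rule \<kappa>)
      finally show ?thesis by (intro mult_left_mono) auto
    qed
    finally show ?thesis .
  qed
  finally have main: "real (card G) * tp \<le> real (card G) * (\<theta> / 2 * measure (PiM {..<n} (\<lambda>_. ?P)) S) +
    1 / (2 * \<theta> * real (card G)) * ((2 ^ card ?V)\<^sup>2 * exp \<kappa>)"
    using cG0 \<theta> by (simp add: divide_right_mono)
  have "(2 ^ card ?V)\<^sup>2 \<le> (2 * real (card G))\<^sup>2" using cG by (intro power_mono) auto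
  then have "1 / (2 * \<theta> * real (card G)) * ((2 ^ card ?V)\<^sup>2 * exp \<kappa>) \<le> 1 / (2 * \<theta> * real (card G)) * ((2 * real (card G))\<^sup>2 * exp \<kappa>)"
    using \<theta> cG0 by (intro mult_left_mono mult_right_mono) auto
  also have "... = real (card G) * (2 / \<theta> * exp \<kappa>)"
    using \<theta> cG0 by (simp add: field_simps power2_eq_square)
  finally have "real (card G) * tp \<le> real (card G) * (\<theta> / 2 * measure (PiM {..<n} (\<lambda>_. ?P)) S + 2 / \<theta> * exp \<kappa>)"
    using main by (simp add: distrib_left)
  then have "tp \<le> \<theta> / 2 * measure (PiM {..<n} (\<lambda>_. ?P)) S + 2 / \<theta> * exp \<kappa>"
    using cG0 by (simp only: mult_le_cancel_left_pos)
  then show ?thesis by (simp add: tp_def rej)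
qed

end

section \<open>Impossibility below the critical rate\<close>

lemma liminf_finite_frequently_le:
  fixes X :: "nat \<Rightarrow> real"
  assumes "liminf (\<lambda>n. ereal (X n)) < \<infinity>"
  shows "\<exists>c>0. \<exists>\<^sub>F n in sequentially. X n \<le> c"
proof -
  obtain m :: nat where m: "liminf (\<lambda>n. ereal (X n)) < ereal (real m)"
    using assms less_PInf_Ex_of_nat[of "liminf (\<lambda>n. ereal (X n))"] by auto
  have "\<exists>\<^sub>F n in sequentially. X n \<le> real m + 1"
  proof (rule ccontr)
    assume "\<not> (\<exists>\<^sub>F n in sequentially. X n \<le> real m + 1)"
    then have "\<forall>\<^sub>F n in sequentially. \<not> X n \<le> real m + 1" by (simp add: frequently_def)
    then have "\<forall>\<^sub>F n in sequentially. ereal (real m) \<le> ereal (X n)" by eventually_elim auto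
    then have "ereal (real m) \<le> liminf (\<lambda>n. ereal (X n))" by (rule Liminf_bounded)
    with m show False by simp
  qed
  moreover have "0 < real m + 1" by simp
  ultimately show ?thesis by blast
qed

context perturbed_gaussian
begin

text \<open>With amplitude \<open>a \<sim> x\<^sup>-\<^sup>r\<close> and \<open>N \<sim> x\<^sup>q\<close> cells per axis, \<open>x\<close> the sample size, all powers of \<open>x\<close> cancel: in the
Sobolev norm because \<open>r = s q\<close>, and in the second moment because \<open>2 - 4 r = q D\<close>. The constant \<open>\<beta>\<close> is left free to meet
the Sobolev bound.\<close>

lemma critical_scaling:
  fixes x c \<beta> P S R q r :: real
  assumes x: "0 < x" and c: "0 < c" and P: "0 < P" and S: "0 \<le> S" and R: "0 < R" and \<beta>: "0 < \<beta>"
    and q: "q = 2 / (real D + 4 * s)" and r: "r = s * q"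
    and N: "0 < N" "real N \<le> \<beta> * x powr q" "\<beta> * x powr q / 2 \<le> real N"
    and a: "a = c * x powr (- r) / sqrt P"
  shows "2 * (a\<^sup>2 * real N powr (2 * s) * S) \<le> 2 * c\<^sup>2 * \<beta> powr (2 * s) * S / P"
    and "a\<^sup>2 * P = (c * x powr (- r))\<^sup>2"
    and "real N ^ D * (x * a\<^sup>2 * (P / real N ^ D / R))\<^sup>2 / 2 \<le> c ^ 4 * (2 / \<beta>) ^ D / (2 * R\<^sup>2)"
proof -
  define u where "u = x powr (- r)"
  define y where "y = x powr q"
  have uy: "0 < u" "0 < y" using x by (simp_all add: u_def y_def)
  have a2: "a\<^sup>2 = c\<^sup>2 * u\<^sup>2 / P" using P by (simp add: a u_def power_divide power_mult_distrib)
  have e1: "u\<^sup>2 * y powr (2 * s) = 1"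
  proof -
    have "u\<^sup>2 = x powr (- (2 * r))" unfolding u_def using x by (simp add: powr_power)
    moreover have "y powr (2 * s) = x powr (2 * r)" by (simp add: y_def powr_powr r mult_ac)
    ultimately show ?thesis using x by (simp add: powr_add[symmetric])
  qed
  have e2: "x\<^sup>2 * u ^ 4 = y ^ D"
  proof -
    have "real D + 4 * s \<noteq> 0" using s by (intro less_imp_neq[symmetric] add_nonneg_pos) auto
    then have ex: "2 - 4 * r = q * real D" by (simp add: r q field_simps)
    have "x\<^sup>2 = x powr 2" using x by (simp add: powr_numeral)
    moreover have "u ^ 4 = x powr (- (4 * r))" unfolding u_def using x by (simp add: powr_power)
    moreover have "y ^ D = x powr (q * real D)" unfolding y_def using x by (simp add: powr_power mult.commute)
    ultimately show ?thesis using ex by (simp add: powr_add[symmetric])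
  qed
  have "real N powr (2 * s) \<le> (\<beta> * y) powr (2 * s)"
    using N(2) s unfolding y_def by (intro powr_mono2) auto
  also have "... = \<beta> powr (2 * s) * y powr (2 * s)" using \<beta> uy by (simp add: powr_mult)
  finally have "2 * (a\<^sup>2 * real N powr (2 * s) * S) \<le> 2 * (c\<^sup>2 * u\<^sup>2 / P * (\<beta> powr (2 * s) * y powr (2 * s)) * S)"
    unfolding a2 using S P by (intro mult_left_mono mult_right_mono) auto
  also have "... = 2 * c\<^sup>2 * \<beta> powr (2 * s) * S / P * (u\<^sup>2 * y powr (2 * s))" by simp
  finally show "2 * (a\<^sup>2 * real N powr (2 * s) * S) \<le> 2 * c\<^sup>2 * \<beta> powr (2 * s) * S / P" unfolding e1 by simp
  show "a\<^sup>2 * P = (c * x powr (- r))\<^sup>2" using P by (simp add: a2 u_def power_mult_distrib)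
  have N0: "0 < real N ^ D" using N by simp
  have "real N ^ D * (x * a\<^sup>2 * (P / real N ^ D / R))\<^sup>2 / 2 = (x\<^sup>2 * u ^ 4) * (c ^ 4 / (2 * R\<^sup>2)) / real N ^ D"
    unfolding a2 using P R N(1) by (simp add: field_simps power2_eq_square power4_eq_xxxx)
  also have "... = y ^ D * (c ^ 4 / (2 * R\<^sup>2)) / real N ^ D" unfolding e2 ..
  also have "... \<le> y ^ D * (c ^ 4 / (2 * R\<^sup>2)) / (\<beta> * y / 2) ^ D"
    using N(3) N0 \<beta> uy c R unfolding y_def[symmetric] by (intro divide_left_mono power_mono mult_pos_pos) auto
  also have "... = c ^ 4 * (2 / \<beta>) ^ D / (2 * R\<^sup>2)" using \<beta> uy by (simp add: power_divide power_mult_distrib field_simps)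
  finally show "real N ^ D * (x * a\<^sup>2 * (P / real N ^ D / R))\<^sup>2 / 2 \<le> c ^ 4 * (2 / \<beta>) ^ D / (2 * R\<^sup>2)" .
qed

text \<open>The second moment contributes a constant \<open>exp \<kappa>\<close> that depends on the bound for \<open>n\<^sup>r \<Delta>\<^sub>n\<close>. First \<open>\<theta>\<close> is taken large
enough to make the second moment term at most a quarter, then the level \<open>\<alpha>\<close> small enough to make the level term at most a
quarter, so that the power is infinitely often at most a half.\<close>

lemma liminf_power_less_1:
  assumes \<psi>2: "0 < (\<integral>t. (\<psi> t)\<^sup>2 \<partial>lborel)" and \<Delta>: "\<And>n. 0 < \<Delta> n"
    and lim: "liminf (\<lambda>n. ereal (real n powr (2 * s / (real D + 4 * s)) * \<Delta> n)) < \<infinity>"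
  shows "\<exists>\<alpha>. 0 < \<alpha> \<and> \<alpha> < 1 \<and>
    (\<forall>\<Phi>. (\<forall>n. is_test k d n (\<Phi> n)) \<and> asymp_level k d (H0_IND k d s M) \<Phi> \<alpha> \<longrightarrow>
      liminf (\<lambda>n. ereal (test_power k d n (\<Phi> n) (H1_IND k d s M (\<Delta> n)))) < 1)"
proof -
  define q where "q = 2 / (real D + 4 * s)"
  define r where "r = s * q"
  have Dpos: "0 < real D + 4 * s" using s by (intro add_nonneg_pos) auto
  have qr: "0 < q" "0 < r" "2 * s / (real D + 4 * s) = r" using s Dpos by (auto simp: q_def r_def)
  from liminf_finite_frequently_le[OF lim[unfolded qr(3)]] obtain c where
    c: "0 < c" and freq: "\<exists>\<^sub>F n in sequentially. real n powr r * \<Delta> n \<le> c" by blast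
  define P where "P = (\<integral>t. (\<psi> t)\<^sup>2 \<partial>lborel) ^ D"
  define S where "S = (\<integral>t. weight_1d s \<psi> t \<partial>lborel) ^ D"
  define T where "T = (\<Prod>j<k. M j)\<^sup>2 / 4"
  define R where "R = \<rho> 1 ^ D"
  have "0 < (\<Prod>j<k. M j)" using M by (intro prod_pos) auto
  then have T: "0 < T" unfolding T_def by (rule divide_pos_pos[OF zero_less_power]) simp
  have P: "0 < P" using \<psi>2 by (simp add: P_def)
  have S: "0 \<le> S" unfolding S_def by (intro zero_le_power Bochner_Integration.integral_nonneg weight_1d_nonneg)
  have R: "0 < R" using \<rho>_pos by (simp add: R_def)
  (* Chosen such that the bound for the Sobolev norm in critical_scaling becomes T * (S / (1 + S)). *)
  define B where "B = T * P / (2 * c\<^sup>2 * (1 + S))"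
  define \<beta> where "\<beta> = B powr (1 / (2 * s))"
  have B: "0 < B" using T P c S by (auto simp: B_def intro!: divide_pos_pos mult_pos_pos)
  have \<beta>: "0 < \<beta>" "\<beta> powr (2 * s) = B" using B s by (auto simp: \<beta>_def powr_powr)
  define \<kappa> where "\<kappa> = c ^ 4 * (2 / \<beta>) ^ D / (2 * R\<^sup>2)"
  have \<kappa>: "0 \<le> \<kappa>" using c \<beta> by (simp add: \<kappa>_def)
  define \<theta> where "\<theta> = 8 * exp \<kappa>"
  define \<alpha> where "\<alpha> = 1 / (4 * \<theta>)"
  have \<theta>: "8 \<le> \<theta>" using \<kappa> by (simp add: \<theta>_def)
  then have \<alpha>: "0 < \<alpha>" "\<alpha> < 1" by (simp_all add: \<alpha>_def)
  define a where "a n = c * real n powr (- r) / sqrt P" for n :: nat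
  define N where "N n = nat \<lfloor>\<beta> * real n powr q\<rfloor>" for n :: nat
  have "filterlim (\<lambda>n. \<beta> * real n powr q) at_top sequentially" using \<beta>(1) qr(1) by real_asymp
  then have ev2: "\<forall>\<^sub>F n in sequentially. 2 \<le> \<beta> * real n powr q" by (simp add: filterlim_at_top)
  have "(\<lambda>n. real n powr (- r)) \<longlonglongrightarrow> 0" using qr(2) by real_asymp
  from tendsto_mult_right[OF this, of "c / sqrt P * A ^ D"]
  have "(\<lambda>n. c * real n powr (- r) / sqrt P * A ^ D) \<longlonglongrightarrow> 0" by (simp add: mult_ac)
  from order_tendstoD(2)[OF this R] have ev3: "\<forall>\<^sub>F n in sequentially. a n * A ^ D < R" by (simp add: a_def)
  have "liminf (\<lambda>n. ereal (test_power k d n (\<Phi> n) (H1_IND k d s M (\<Delta> n)))) < 1"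
    if test: "\<And>n. is_test k d n (\<Phi> n)" and level: "asymp_level k d (H0_IND k d s M) \<Phi> \<alpha>" for \<Phi>
  proof -
    have "limsup (\<lambda>n. ereal (rejection_prob k d n (base C) (\<Phi> n))) \<le> ereal \<alpha>"
      using level base_in_H0 by (auto simp: asymp_level_def)
    also have "... < ereal (2 * \<alpha>)" using \<alpha> by simp
    finally have "\<forall>\<^sub>F n in sequentially. ereal (rejection_prob k d n (base C) (\<Phi> n)) < ereal (2 * \<alpha>)"
      by (rule Limsup_lessD)
    then have ev4: "\<forall>\<^sub>F n in sequentially. rejection_prob k d n (base C) (\<Phi> n) < 2 * \<alpha>" by simp
    have ev: "\<forall>\<^sub>F n in sequentially. real n powr r * \<Delta> n \<le> c \<longrightarrow> test_power k d n (\<Phi> n) (H1_IND k d s M (\<Delta> n)) \<le> 1 / 2"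
      using eventually_gt_at_top[of 0] ev2 ev3 ev4
    proof eventually_elim
      case (elim n)
      show ?case
      proof
        assume le: "real n powr r * \<Delta> n \<le> c"
        have n: "0 < real n" using elim(1) by simp
        have Nn: "0 < N n" "real (N n) \<le> \<beta> * real n powr q" "\<beta> * real n powr q / 2 \<le> real (N n)"
          using elim(2) unfolding N_def by linarith+
        note CS = critical_scaling[OF n c P S R \<beta>(1) q_def r_def Nn a_def]
        have "\<Delta> n \<le> c * real n powr (- r)" using le n by (simp add: powr_minus field_simps)
        then have \<delta>: "(\<Delta> n)\<^sup>2 \<le> (a n)\<^sup>2 * P" unfolding CS(2) using \<Delta>[of n] by (intro power_mono) auto
        define z where "z = 1 + S"
        have z: "0 < z" using S by (simp add: z_def)
        have "2 * c\<^sup>2 * \<beta> powr (2 * s) * S / P = T * (S / (1 + S))"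
          unfolding \<beta>(2) B_def z_def[symmetric] using c P z by (simp add: field_simps)
        also have "... \<le> T * 1" using T S by (intro mult_left_mono) auto
        finally have sob: "2 * ((a n)\<^sup>2 * real (N n) powr (2 * s) * S) \<le> T" using CS(1) by simp
        have "test_power k d n (\<Phi> n) (H1_IND k d s M (\<Delta> n)) \<le> \<theta> / 2 * rejection_prob k d n (base C) (\<Phi> n) + 2 / \<theta> * exp \<kappa>"
        proof (rule test_power_le[OF test Nn(1)])
          show "0 \<le> a n" using c P by (simp add: a_def)
          show "a n * A ^ D \<le> \<rho> 1 ^ D" using elim(3) by (simp add: R_def)
          show "2 * ((a n)\<^sup>2 * real (N n) powr (2 * s) * (\<integral>t. weight_1d s \<psi> t \<partial>lborel) ^ D) \<le> (\<Prod>j<k. M j)\<^sup>2 / 4"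
            using sob unfolding S_def T_def .
          show "(\<Delta> n)\<^sup>2 \<le> (a n)\<^sup>2 * (\<integral>t. (\<psi> t)\<^sup>2 \<partial>lborel) ^ D" using \<delta> unfolding P_def .
          show "real (N n) ^ D * (real n * (a n)\<^sup>2 * (((\<integral>t. (\<psi> t)\<^sup>2 \<partial>lborel) / real (N n)) ^ D / \<rho> 1 ^ D))\<^sup>2 / 2 \<le> \<kappa>"
            using CS(3) unfolding power_divide[of "\<integral>t. (\<psi> t)\<^sup>2 \<partial>lborel"] P_def[symmetric] R_def[symmetric] \<kappa>_def .
          show "0 < \<theta>" using \<theta> by simp
        qed
        also have "... \<le> \<theta> / 2 * (2 * \<alpha>) + 1 / 4"
          using elim(4) \<theta> by (intro add_mono mult_left_mono) (auto simp: \<theta>_def)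
        also have "... = 1 / 2" using \<theta> by (simp add: \<alpha>_def)
        finally show "test_power k d n (\<Phi> n) (H1_IND k d s M (\<Delta> n)) \<le> 1 / 2" .
      qed
    qed
    show ?thesis
    proof (rule ccontr)
      assume "\<not> ?thesis"
      then have "1 \<le> liminf (\<lambda>n. ereal (test_power k d n (\<Phi> n) (H1_IND k d s M (\<Delta> n))))" by simp
      moreover have "ereal (1 / 2) < 1" by simp
      ultimately have "ereal (1 / 2) < liminf (\<lambda>n. ereal (test_power k d n (\<Phi> n) (H1_IND k d s M (\<Delta> n))))"
        by (rule less_le_trans[rotated])
      from less_LiminfD[OF this] ev
      have "\<forall>\<^sub>F n in sequentially. \<not> real n powr r * \<Delta> n \<le> c" by eventually_elim auto
      with freq show False by (simp add: frequently_def)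
    qed
  qed
  then show ?thesis using \<alpha> by (intro exI[of _ \<alpha>]) blast
qed

end

lemma no_consistent_test_below_rate:
  fixes k :: nat and d :: "nat \<Rightarrow> nat" and s :: real and M :: "nat \<Rightarrow> real" and \<Delta> :: "nat \<Rightarrow> real"
  assumes k: "2 \<le> k" and d: "\<And>j. j < k \<Longrightarrow> 1 \<le> d j" and s: "0 < s" and M: "\<And>j. j < k \<Longrightarrow> 0 < M j"
    and \<Delta>: "\<And>n. 0 < \<Delta> n"
    and lim: "liminf (\<lambda>n. ereal (real n powr (2 * s / (real (total_dim k d) + 4 * s)) * \<Delta> n)) < \<infinity>"
  shows "\<exists>\<alpha>. 0 < \<alpha> \<and> \<alpha> < 1 \<and>
    (\<forall>\<Phi>. (\<forall>n. is_test k d n (\<Phi> n)) \<and> asymp_level k d (H0_IND k d s M) \<Phi> \<alpha> \<longrightarrow>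
      liminf (\<lambda>n. ereal (test_power k d n (\<Phi> n) (H1_IND k d s M (\<Delta> n)))) < 1)"
proof -
  obtain \<psi> A where \<psi>: "continuous_on UNIV \<psi>" "\<And>x. x \<notin> {0<..<1} \<Longrightarrow> \<psi> x = 0" "\<And>x. \<bar>\<psi> x\<bar> \<le> A"
    "integrable lborel \<psi>" "(\<integral>x. \<psi> x \<partial>lborel) = 0" "integrable lborel (\<lambda>x. (\<psi> x)\<^sup>2)" "0 < (\<integral>x. (\<psi> x)\<^sup>2 \<partial>lborel)"
    "integrable lborel (weight_1d s \<psi>)"
    using smooth_bump_exists[of s] by blast
  define w where "w = (\<Prod>j<k. M j)\<^sup>2 / 4"
  define F where "F = insert 1 (insert w ((\<lambda>j. (M j)\<^sup>2) ` {..<k}))"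
  define \<eta> where "\<eta> = Min F"
  have F: "finite F" by (simp add: F_def)
  have "0 < (\<Prod>j<k. M j)" using M by (intro prod_pos) auto
  then have "0 < w" unfolding w_def by (rule divide_pos_pos[OF zero_less_power]) simp
  have "0 < x" if "x \<in> F" for x
  proof -
    from that consider "x = 1" | "x = w" | j where "j < k" "x = (M j)\<^sup>2" unfolding F_def by blast
    then show ?thesis
    proof cases
      case 3
      show ?thesis unfolding 3(2) by (rule zero_less_power[OF M[OF 3(1)]])
    qed (use \<open>0 < w\<close> in simp_all)
  qed
  then have "0 < \<eta>" unfolding \<eta>_def using F by (subst Min_gr_iff) (auto simp: F_def)
  have \<eta>: "\<eta> \<le> x" if "x \<in> F" for x using F that by (simp add: \<eta>_def)
  obtain \<rho> where \<rho>: "continuous_on UNIV \<rho>" "\<And>x. 0 < \<rho> x" "\<And>x. x \<in> {0..1} \<Longrightarrow> \<rho> 1 \<le> \<rho> x" "integrable lborel \<rho>"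
    "(\<integral>x. \<rho> x \<partial>lborel) = 1" "integrable lborel (weight_1d s \<rho>)" "(\<integral>t. weight_1d s \<rho> t \<partial>lborel) \<le> \<eta>"
    using wide_gaussian[OF s \<open>0 < \<eta>\<close>] by blast
  interpret perturbed_gaussian \<psi> A k d s M \<rho>
  proof
    show "(\<integral>t. weight_1d s \<rho> t \<partial>lborel) \<le> 1" using \<rho>(7) \<eta>[of 1] by (simp add: F_def)
    show "(\<integral>t. weight_1d s \<rho> t \<partial>lborel) \<le> (M j)\<^sup>2" if "j < k" for j
      by (rule order_trans[OF \<rho>(7) \<eta>]) (use that in \<open>simp add: F_def\<close>)
    show "(\<integral>t. weight_1d s \<rho> t \<partial>lborel) \<le> (\<Prod>j<k. M j)\<^sup>2 / 4"
      unfolding w_def[symmetric]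
      by (rule order_trans[OF \<rho>(7) \<eta>]) (simp add: F_def)
  qed (fact k d s M \<psi> \<rho>)+
  show ?thesis by (rule liminf_power_less_1[OF \<psi>(7) \<Delta> lim])
qed

theorem theorem7:
  fixes k :: nat and d :: "nat \<Rightarrow> nat" and s :: real and M :: "nat \<Rightarrow> real" and \<Delta> :: "nat \<Rightarrow> real"
  assumes "2 \<le> k" and "\<And>j. j < k \<Longrightarrow> 1 \<le> d j"
    and "0 < s" and "\<And>j. j < k \<Longrightarrow> 0 < M j"
    and "\<And>n. 0 < \<Delta> n"
  shows
    "(filterlim (\<lambda>n. real n powr (2 * s / (real (total_dim k d) + 4 * s)) * \<Delta> n) at_top sequentially \<longrightarrow>
       (\<forall>\<alpha> \<nu>. 0 < \<alpha> \<and> \<alpha> < 1 \<and> (\<forall>n. 0 < \<nu> n) \<and>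
           \<nu> \<in> \<Theta>(\<lambda>n. real n powr (4 / (real (total_dim k d) + 4 * s))) \<longrightarrow>
         (\<lambda>n. test_power k d n (Phi_IND k d n (\<nu> n) \<alpha>) (H1_IND k d s M (\<Delta> n))) \<longlonglongrightarrow> 1))
     \<and>
     (liminf (\<lambda>n. ereal (real n powr (2 * s / (real (total_dim k d) + 4 * s)) * \<Delta> n)) < \<infinity> \<longrightarrow>
       (\<exists>\<alpha>. 0 < \<alpha> \<and> \<alpha> < 1 \<and>
         (\<forall>\<Phi>. (\<forall>n. is_test k d n (\<Phi> n)) \<and> asymp_level k d (H0_IND k d s M) \<Phi> \<alpha> \<longrightarrow>
           liminf (\<lambda>n. ereal (test_power k d n (\<Phi> n) (H1_IND k d s M (\<Delta> n)))) < 1)))"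
  using power_tendsto_1[of k d s M \<Delta>] no_consistent_test_below_rate[of k d s M \<Delta>] assms by blast

end
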